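(* Let $\Omega\subset\mathbf{R}^N$ be a bounded smooth domain. Let $\phi:(0,\infty)\to(0,\infty)$ be continuous with $\lim_{s\to0}s\phi(s)=0$, $\lim_{s\to\infty}s\phi(s)=\infty$ and $s\mapsto s\phi(s)$ nondecreasing on $(0,\infty)$; put $\Phi(t)=\int_0^t s\phi(s)\,ds$ and assume there are $\ell,m$ with $1<\ell,m<N$ such that $\ell\le \frac{t^2\phi(t)}{\Phi(t)}\le m$ for all $t>0$. Let $f:\Omega\times\mathbf{R}\to\mathbf{R}$ be a Carath\'eodory function, $F(x,t)=\int_0^t f(x,s)\,ds$ and $A_\infty(x)=\limsup_{|s|\to\infty}\frac{F(x,s)}{|s|^\ell}$. Suppose: (i) there are a number $a\ge0$ and a nonnegative $b\in L_{\Phi_*}(\Omega)'$ such that $|f(x,s)s|\le a\Phi_*(s)+b(x)|s|$ for all $s\in\mathbf{R}$ and a.e. $x\in\Omega$; (ii) there are a number $A\ge0$ and a nonnegative $B\in L^1(\Omega)$ such that $F(x,s)\le A|s|^\ell+B(x)$ for all $s\in\mathbf{R}$ and a.e. $x\in\Omega$; (iii) $$\inf_{v\in W_0^{1,\Phi}(\Omega),\ \|v\|_\Phi=1}\left\{\int_\Omega\Phi(|\nabla v|)\,dx-\int_{\{v\ne0\}}A_\infty(x)|v(x)|^\ell\,dx\right\}>0.$$ Then for every $h\in L_\Phi(\Omega)'$ there is a weak solution $u\in W_0^{1,\Phi}(\Omega)$ of $$-\mathrm{div}(\phi(|\nabla u|)\nabla u)=f(x,u)+h\ \text{ in }\Omega,\qquad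 u=0\ \text{ on }\partial\Omega.$$
   Context: The function $s\mapsto s\phi(s)$ is extended to $\mathbf{R}$ as an odd function (value $0$ at $0$; so $\phi(|\nabla u|)\nabla u:=0$ where $\nabla u=0$), and $\Phi$ is even on $\mathbf{R}$. Orlicz space: for an even convex function $\Psi$ of this type, $L_\Psi(\Omega)$ is the set of measurable $u:\Omega\to\mathbf{R}$ with $\int_\Omega\Psi(u/\lambda)\,dx<\infty$ for some $\lambda>0$, with the Luxemburg norm $\|u\|_\Psi=\inf\{\lambda>0:\int_\Omega\Psi(u/\lambda)\,dx\le1\}$. $W^{1,\Phi}(\Omega)=\{u\in L_\Phi(\Omega):\partial u/\partial x_i\in L_\Phi(\Omega),\ i=1,\dots,N\}$ with norm $\|u\|_{1,\Phi}=\|u\|_\Phi+\sum_i\|\partial u/\partial x_i\|_\Phi$, and $W_0^{1,\Phi}(\Omega)$ is the closure of $C_0^\infty(\Omega)$ in it ($u\in W_0^{1,\Phi}(\Omega)$ encodes $u=0$ on $\partial\Omega$). $L_\Psi(\Omega)'$ is the dual space, identified with the function space $L_{\widetilde\Psi}(\Omega)$, $\widetilde\Psi(t)=\max_{s\ge0}\{st-\Psi(s)\}$, via $\langle h,u\rangle=\int_\Omega hu\,dx$ (used with $\Psi=\Phi$ and $\Psi=\Phi_*$). Critical function: $\Phi_*$ is the inverse of $\Phi_*^{-1}(t)=\int_0^t\frac{\Phi^{-1}(s)}{s^{(N+1)/N}}\,ds$, $t>0$, extended to $\mathbf{R}$ as an even function with $\Phi_*(0)=0$. By (ii), $A_\infty\le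 A$ a.e., so the integral of $A_\infty|v|^\ell$ is well defined in $[-\infty,\infty)$. $u\in W_0^{1,\Phi}(\Omega)$ is a weak solution if $\int_\Omega\phi(|\nabla u|)\nabla u\cdot\nabla v\,dx=\int_\Omega f(x,u)v\,dx+\int_\Omega hv\,dx$ for all $v\in W_0^{1,\Phi}(\Omega)$. *)

theory Defs
  imports "HOL-Analysis.Analysis"
begin

definition partial_deriv :: "'n::finite \<Rightarrow> (real^'n \<Rightarrow> 'b::real_normed_vector) \<Rightarrow> real^'n \<Rightarrow> 'b"
  where "partial_deriv i f x = frechet_derivative f (at x) (axis i 1)"

text \<open>The next two notions are meant for open \<open>S\<close>.\<close>

primrec Ck_on :: "nat \<Rightarrow> (real^'n::finite) set \<Rightarrow> (real^'n \<Rightarrow> 'b::real_normed_vector) \<Rightarrow> bool"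
  where
    "Ck_on 0 S f \<longleftrightarrow> continuous_on S f"
  | "Ck_on (Suc k) S f \<longleftrightarrow>
       (\<forall>x\<in>S. f differentiable (at x)) \<and> (\<forall>i. Ck_on k S (partial_deriv i f))"

definition smooth_on :: "(real^'n::finite) set \<Rightarrow> (real^'n \<Rightarrow> 'b::real_normed_vector) \<Rightarrow> bool"
  where "smooth_on S f \<longleftrightarrow> (\<forall>k. Ck_on k S f)"

text \<open>The boundary is \<open>C\<^sup>\<infinity>\<close>: near each of its points a smooth diffeomorphism straightens it,
  with the domain on one side.\<close>

definition smooth_boundary :: "(real^'n::finite) set \<Rightarrow> bool"
  where "smooth_boundary \<Omega> \<longleftrightarrow>
    (\<forall>p\<in>frontier \<Omega>. \<exists>U V \<psi> \<psi>' i.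
       open U \<and> p \<in> U \<and> open V \<and> homeomorphism U V \<psi> \<psi>' \<and>
       smooth_on U \<psi> \<and> smooth_on V (\<psi>' :: real^'n \<Rightarrow> real^'n) \<and>
       \<psi> ` (U \<inter> \<Omega>) = {y \<in> V. y $ i > 0} \<and>
       \<psi> ` (U \<inter> frontier \<Omega>) = {y \<in> V. y $ i = 0})"

definition bounded_smooth_domain :: "(real^'n::finite) set \<Rightarrow> bool"
  where "bounded_smooth_domain \<Omega> \<longleftrightarrow>
    open \<Omega> \<and> connected \<Omega> \<and> \<Omega> \<noteq> {} \<and> bounded \<Omega> \<and> smooth_boundary \<Omega>"

text \<open>Functions on \<open>\<Omega>\<close> are total functions of which only the values on \<open>\<Omega>\<close> matter, and only up to
  null sets; no quotient is taken. An element of \<open>C\<^sub>0\<^sup>\<infinity>(\<Omega>)\<close> is given by its extension by zero.\<close>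

definition test_functions :: "(real^'n::finite) set \<Rightarrow> (real^'n \<Rightarrow> real) set"
  where "test_functions \<Omega> =
    {\<psi>. smooth_on UNIV \<psi> \<and> compact (closure {x. \<psi> x \<noteq> 0}) \<and> closure {x. \<psi> x \<noteq> 0} \<subseteq> \<Omega>}"

definition locally_integrable :: "(real^'n::finite) set \<Rightarrow> (real^'n \<Rightarrow> real) \<Rightarrow> bool"
  where "locally_integrable \<Omega> u \<longleftrightarrow> (\<forall>K. compact K \<and> K \<subseteq> \<Omega> \<longrightarrow> set_integrable lebesgue K u)"

definition has_weak_partial ::
    "(real^'n::finite) set \<Rightarrow> 'n \<Rightarrow> (real^'n \<Rightarrow> real) \<Rightarrow> (real^'n \<Rightarrow> real) \<Rightarrow> bool"
  where "has_weak_partial \<Omega> i u g \<longleftrightarrow>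
    locally_integrable \<Omega> u \<and> locally_integrable \<Omega> g \<and>
    (\<forall>\<psi>\<in>test_functions \<Omega>.
       (\<integral>x. u x * partial_deriv i \<psi> x \<partial>lebesgue_on \<Omega>) = - (\<integral>x. g x * \<psi> x \<partial>lebesgue_on \<Omega>))"

text \<open>Weak derivatives are determined only up to null sets; a representative is chosen.\<close>

definition weak_partial :: "(real^'n::finite) set \<Rightarrow> 'n \<Rightarrow> (real^'n \<Rightarrow> real) \<Rightarrow> real^'n \<Rightarrow> real"
  where "weak_partial \<Omega> i u = (SOME g. has_weak_partial \<Omega> i u g)"

definition weak_grad :: "(real^'n::finite) set \<Rightarrow> (real^'n \<Rightarrow> real) \<Rightarrow> real^'n \<Rightarrow> real^'n"
  where "weak_grad \<Omega> u x = (\<chi> i. weak_partial \<Omega> i u x)"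

definition orlicz_space ::
    "(real^'n::finite) set \<Rightarrow> (real \<Rightarrow> real) \<Rightarrow> (real^'n \<Rightarrow> real) set"
  where "orlicz_space \<Omega> \<Psi> =
    {u \<in> borel_measurable (lebesgue_on \<Omega>).
       \<exists>c>0. (\<integral>\<^sup>+x. ennreal (\<Psi> (u x / c)) \<partial>lebesgue_on \<Omega>) < \<infinity>}"

definition luxemburg_norm ::
    "(real^'n::finite) set \<Rightarrow> (real \<Rightarrow> real) \<Rightarrow> (real^'n \<Rightarrow> real) \<Rightarrow> real"
  where "luxemburg_norm \<Omega> \<Psi> u =
    Inf {c. c > 0 \<and> (\<integral>\<^sup>+x. ennreal (\<Psi> (u x / c)) \<partial>lebesgue_on \<Omega>) \<le> 1}"

text \<open>The conjugate \<open>max\<^bsub>s \<ge> 0\<^esub> (s t - \<Psi> s)\<close> for \<open>t \<ge> 0\<close>, extended as an even function. The real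
  supremum is meaningful for superlinear \<open>\<Psi>\<close> only.\<close>

definition orlicz_conjugate :: "(real \<Rightarrow> real) \<Rightarrow> real \<Rightarrow> real"
  where "orlicz_conjugate \<Psi> t = (SUP s\<in>{0..}. s * \<bar>t\<bar> - \<Psi> s)"

text \<open>The dual of \<open>L\<^sub>\<Psi>(\<Omega>)\<close>, identified with a function space via the pairing \<open>\<integral> h u dx\<close>.\<close>

definition orlicz_dual ::
    "(real^'n::finite) set \<Rightarrow> (real \<Rightarrow> real) \<Rightarrow> (real^'n \<Rightarrow> real) set"
  where "orlicz_dual \<Omega> \<Psi> = orlicz_space \<Omega> (orlicz_conjugate \<Psi>)"

definition sobolev_orlicz ::
    "(real^'n::finite) set \<Rightarrow> (real \<Rightarrow> real) \<Rightarrow> (real^'n \<Rightarrow> real) set"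
  where "sobolev_orlicz \<Omega> \<Phi> =
    {u \<in> orlicz_space \<Omega> \<Phi>. \<forall>i. \<exists>g\<in>orlicz_space \<Omega> \<Phi>. has_weak_partial \<Omega> i u g}"

definition sobolev_orlicz_norm ::
    "(real^'n::finite) set \<Rightarrow> (real \<Rightarrow> real) \<Rightarrow> (real^'n \<Rightarrow> real) \<Rightarrow> real"
  where "sobolev_orlicz_norm \<Omega> \<Phi> u =
    luxemburg_norm \<Omega> \<Phi> u + (\<Sum>i\<in>UNIV. luxemburg_norm \<Omega> \<Phi> (weak_partial \<Omega> i u))"

definition sobolev_orlicz0 ::
    "(real^'n::finite) set \<Rightarrow> (real \<Rightarrow> real) \<Rightarrow> (real^'n \<Rightarrow> real) set"
  where "sobolev_orlicz0 \<Omega> \<Phi> =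
    {u \<in> sobolev_orlicz \<Omega> \<Phi>.
       \<forall>\<epsilon>>0. \<exists>\<psi>\<in>test_functions \<Omega>. sobolev_orlicz_norm \<Omega> \<Phi> (\<lambda>x. u x - \<psi> x) < \<epsilon>}"

text \<open>The critical function \<open>\<Phi>\<^sub>*\<close> in dimension \<open>N\<close>: first its inverse on \<open>[0,\<infinity>)\<close>, in which \<open>\<Phi>\<close> is
  inverted on \<open>[0,\<infinity>)\<close>; then the even function itself.\<close>

definition critical_inv :: "nat \<Rightarrow> (real \<Rightarrow> real) \<Rightarrow> real \<Rightarrow> real"
  where "critical_inv N \<Phi> t =
    (LBINT s=0..t. inv_into {0..} \<Phi> s / s powr ((real N + 1) / real N))"

definition critical_fun :: "nat \<Rightarrow> (real \<Rightarrow> real) \<Rightarrow> real \<Rightarrow> real"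
  where "critical_fun N \<Phi> t = inv_into {0..} (critical_inv N \<Phi>) \<bar>t\<bar>"

definition caratheodory :: "(real^'n::finite) set \<Rightarrow> (real^'n \<Rightarrow> real \<Rightarrow> real) \<Rightarrow> bool"
  where "caratheodory \<Omega> f \<longleftrightarrow>
    (\<forall>s. (\<lambda>x. f x s) \<in> borel_measurable (lebesgue_on \<Omega>)) \<and>
    (AE x in lebesgue_on \<Omega>. continuous_on UNIV (f x))"

text \<open>Integral with values in \<open>[-\<infinity>,\<infinity>]\<close>, as the positive minus the negative part (\<open>e2ennreal\<close> sends
  negative numbers to \<open>0\<close>); meaningful unless both parts are infinite.\<close>

definition ereal_integral :: "'a measure \<Rightarrow> ('a \<Rightarrow> ereal) \<Rightarrow> ereal"
  where "ereal_integral M g =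
    enn2ereal (\<integral>\<^sup>+x. e2ennreal (g x) \<partial>M) - enn2ereal (\<integral>\<^sup>+x. e2ennreal (- g x) \<partial>M)"

text \<open>Integrability is demanded explicitly, since the Bochner integral of a non-integrable function
  is \<open>0\<close>. Where \<open>\<nabla>u\<close> vanishes, so does \<open>\<phi>(|\<nabla>u|) \<nabla>u\<close>, whatever the value of \<open>\<phi>\<close> at \<open>0\<close>.\<close>

definition weak_solution ::
    "(real^'n::finite) set \<Rightarrow> (real \<Rightarrow> real) \<Rightarrow> (real \<Rightarrow> real) \<Rightarrow> (real^'n \<Rightarrow> real \<Rightarrow> real) \<Rightarrow>
     (real^'n \<Rightarrow> real) \<Rightarrow> (real^'n \<Rightarrow> real) \<Rightarrow> bool"
  where "weak_solution \<Omega> \<phi> \<Phi> f h u \<longleftrightarrow>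
    u \<in> sobolev_orlicz0 \<Omega> \<Phi> \<and>
    (\<forall>v\<in>sobolev_orlicz0 \<Omega> \<Phi>.
       integrable (lebesgue_on \<Omega>)
         (\<lambda>x. (\<phi> (norm (weak_grad \<Omega> u x)) *\<^sub>R weak_grad \<Omega> u x) \<bullet> weak_grad \<Omega> v x) \<and>
       integrable (lebesgue_on \<Omega>) (\<lambda>x. f x (u x) * v x) \<and>
       integrable (lebesgue_on \<Omega>) (\<lambda>x. h x * v x) \<and>
       (\<integral>x. (\<phi> (norm (weak_grad \<Omega> u x)) *\<^sub>R weak_grad \<Omega> u x) \<bullet> weak_grad \<Omega> v x \<partial>lebesgue_on \<Omega>) =
       (\<integral>x. f x (u x) * v x \<partial>lebesgue_on \<Omega>) + (\<integral>x. h x * v x \<partial>lebesgue_on \<Omega>))"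

end

theory Submission
  imports Defs "HOL-Complex_Analysis.Great_Picard"
begin

text \<open>
  A weak solution is obtained as a minimiser of the energy
  \<open>E u = \<integral> \<Phi>(|\<nabla>u|) - \<integral> F(x, u) - \<integral> h u\<close>.

  It is convenient to work with the modular \<open>\<rho> u = \<integral> \<Phi>(u)\<close> instead of the Luxemburg norm: because
  \<open>r\<^sup>l \<Phi>(t) \<le> \<Phi>(r t) \<le> r\<^sup>m \<Phi>(t)\<close> for \<open>r \<ge> 1\<close>, both give the same convergence. \<open>W0 u g\<close> says that the
  pair \<open>(u, g)\<close> is a modular limit of pairs \<open>(\<psi>, \<nabla>\<psi>)\<close> of test functions; the theorems
  \<open>W0_imp_sobolev_orlicz0\<close> and \<open>sobolev_orlicz0_imp_W0\<close> identify this with membership in the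
  Orlicz--Sobolev space with zero boundary values. The argument rests on four facts.

  \<^item> The Sobolev inequality \<open>W0_sobolev\<close>: a bound on \<open>\<integral> \<Phi>(|\<nabla>u|)\<close> controls \<open>\<integral> \<Phi>\<^sub>*(u / c)\<close>. It makes \<open>F(x, u)\<close>
    integrable. For test functions it follows from the Gagliardo--Nirenberg inequality for
    \<open>\<Phi>\<^sub>*(u)\<close> raised to the power \<open>(N - 1) / N\<close>.

  \<^item> Compactness, \<open>W0_compact\<close>: if \<open>\<integral> \<Phi>(|\<nabla>u\<^sub>n|)\<close> is bounded, then a subsequence converges in
    modular to some \<open>v\<close>, and \<open>v\<close> has a gradient whose modular is at most the lower limit. Convergence
    combines Rellich's theorem in \<open>L\<^sup>1\<close> with the fact that \<open>\<Phi>\<close> grows essentially more slowly than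
    \<open>\<Phi>\<^sub>*\<close>. Weak convergence of the gradients is replaced by strong convergence of iterated midpoints:
    midpoints that nearly minimise a uniformly convex functional equivalent to the modular form a
    Cauchy sequence.

  \<^item> Coercivity, \<open>coercive\<close>: suppose that \<open>\<rho> u\<^sub>n \<rightarrow> \<infinity>\<close> while \<open>E u\<^sub>n\<close> stays bounded, and write
    \<open>u\<^sub>n = r\<^sub>n v\<^sub>n\<close> with \<open>\<rho> v\<^sub>n = 1\<close>. Divide the energy by \<open>r\<^sub>n\<^sup>l\<close> and let \<open>v\<^sub>n \<rightarrow> w\<close>. Since
    \<open>r\<^sub>n\<^sup>l \<Phi>(|\<nabla>v\<^sub>n|) \<le> \<Phi>(|\<nabla>u\<^sub>n|)\<close>, the reverse Fatou lemma gives
    \<open>\<integral> \<Phi>(|\<nabla>w|) \<le> \<integral> A\<^sub>\<infinity> |w|\<^sup>l\<close> with \<open>\<rho> w = 1\<close>, against the hypothesis on the infimum.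

  \<^item> The direct method, \<open>minimiser_exists\<close>: along a minimising sequence the first term of \<open>E\<close> is lower
    semicontinuous by compactness and \<open>\<integral> F(x, u) + \<integral> h u\<close> is upper semicontinuous by the
    reverse Fatou lemma, whose majorant is supplied by the upper bound on \<open>F\<close>.

  Finally \<open>minimiser_is_weak_solution\<close> differentiates \<open>E\<close> along lines in the space; the growth
  condition on \<open>f\<close> and the Sobolev inequality provide the dominating functions.
\<close>

section \<open>Smooth bump functions\<close>

text \<open>The factor \<open>p / (1 - t\<^sup>2)\<^sup>k\<close> is there to make the family
  closed under differentiation.\<close>

definition bump :: "real \<Rightarrow> real poly \<Rightarrow> nat \<Rightarrow> real \<Rightarrow> real" where
  "bump c p k t = (if \<bar>t\<bar> < 1 then poly p t / (1 - t\<^sup>2) ^ k * exp (- c / (1 - t\<^sup>2)) else 0)"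

lemma one_minus_square_pos: "\<bar>t\<bar> < 1 \<Longrightarrow> 0 < 1 - t\<^sup>2" for t :: real
  by (simp add: abs_square_less_1)

lemma power_times_exp_bounded:
  fixes c y :: real
  assumes "c > 0" "y \<ge> 0" "n > 0"
  shows "y ^ n * exp (- c * y) \<le> (n / c) ^ n"
proof -
  define z where "z = c * y / n"
  have "z \<le> exp z" using exp_ge_add_one_self[of z] by linarith
  then have "z * exp (- z) \<le> 1"
    by (simp add: exp_minus field_simps)
  then have "y * exp (- z) \<le> n / c"
    using assms by (simp add: z_def field_simps)
  then have "(y * exp (- z)) ^ n \<le> (n / c) ^ n"
    using assms by (intro power_mono) auto
  moreover have "(y * exp (- z)) ^ n = y ^ n * exp (- c * y)"
    using assms by (simp add: power_mult_distrib exp_of_nat_mult[symmetric] z_def)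
  ultimately show ?thesis by simp
qed

text \<open>Near \<open>\<plusminus>1\<close> the exponential beats every power of
  \<open>1 / (1 - t\<^sup>2)\<close>; two powers are kept, so that the derivative vanishes
  there.\<close>

lemma bump_quadratic_bound:
  assumes c: "c > 0"
  obtains C where "C \<ge> 0" "\<And>s t. \<bar>t\<bar> \<ge> 1 \<Longrightarrow> \<bar>bump c p k s\<bar> \<le> C * \<bar>s - t\<bar>\<^sup>2"
proof -
  have "compact ((\<lambda>t. poly p t) ` {-1..1})"
    by (intro compact_continuous_image continuous_intros) auto
  then obtain P where P: "\<And>t. t \<in> {-1..1} \<Longrightarrow> \<bar>poly p t\<bar> \<le> P"
    by (force dest!: compact_imp_bounded simp: bounded_iff)
  have P0: "P \<ge> 0" using P[of 0] by (simp add: abs_ge_zero order.trans[OF abs_ge_zero])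
  define D where "D = (real (k + 2) / c) ^ (k + 2)"
  have D0: "D \<ge> 0" using c by (simp add: D_def)
  show thesis
  proof (rule that[of "4 * P * D"])
    show "4 * P * D \<ge> 0" using P0 D0 by simp
    fix s t :: real assume t: "\<bar>t\<bar> \<ge> 1"
    show "\<bar>bump c p k s\<bar> \<le> 4 * P * D * \<bar>s - t\<bar>\<^sup>2"
    proof (cases "\<bar>s\<bar> < 1")
      case True
      define q where "q = 1 - s\<^sup>2"
      have q: "q > 0" using one_minus_square_pos[OF True] by (simp add: q_def)
      have "(1 / q) ^ (k + 2) * exp (- c * (1 / q)) \<le> D"
        unfolding D_def using c q by (intro power_times_exp_bounded) auto
      then have e: "exp (- c / q) / q ^ k \<le> D * q\<^sup>2"
        using q by (simp add: field_simps power_add power2_eq_square)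
      have "q = (1 - \<bar>s\<bar>) * (1 + \<bar>s\<bar>)" by (simp add: q_def algebra_simps power2_eq_square abs_mult_self_eq)
      also have "\<dots> \<le> \<bar>s - t\<bar> * 2" using True t by (intro mult_mono) auto
      finally have "q\<^sup>2 \<le> (\<bar>s - t\<bar> * 2)\<^sup>2" using q by (intro power_mono) auto
      then have q2: "q\<^sup>2 \<le> 4 * \<bar>s - t\<bar>\<^sup>2" by (simp add: power_mult_distrib)
      have "\<bar>bump c p k s\<bar> = \<bar>poly p s\<bar> * (exp (- c / q) / q ^ k)"
        using True q by (simp add: bump_def q_def abs_mult)
      also have "\<dots> \<le> P * (D * q\<^sup>2)"
      proof (rule mult_mono)
        show "\<bar>poly p s\<bar> \<le> P" using True by (intro P) auto
      qed (use e q P0 in auto)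
      also have "\<dots> \<le> P * (D * (4 * \<bar>s - t\<bar>\<^sup>2))"
        using P0 D0 q2 by (intro mult_left_mono)
      finally show ?thesis by (simp add: mult_ac)
    qed (use P0 D0 in \<open>simp add: bump_def\<close>)
  qed
qed

lemma quadratic_bound_imp_DERIV_0:
  fixes f :: "real \<Rightarrow> real"
  assumes "\<And>s. \<bar>f s\<bar> \<le> C * \<bar>s - t\<bar>\<^sup>2"
  shows "(f has_real_derivative 0) (at t)"
proof -
  have f0: "f t = 0" using assms[of t] by simp
  have "((\<lambda>h. (f (t + h) - f t) / h) \<longlongrightarrow> 0) (at 0)"
  proof (rule Lim_null_comparison)
    show "\<forall>\<^sub>F h in at 0. norm ((f (t + h) - f t) / h) \<le> C * \<bar>h\<bar>"
    proof (rule eventually_at_filter[THEN iffD2], rule always_eventually, intro allI impI)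
      fix h :: real assume "h \<noteq> 0"
      then show "norm ((f (t + h) - f t) / h) \<le> C * \<bar>h\<bar>"
        using assms[of "t + h"] f0 by (simp add: divide_simps power2_eq_square abs_mult mult_ac)
    qed
    show "((\<lambda>h. C * \<bar>h\<bar>) \<longlongrightarrow> 0) (at 0)"
      by (auto intro!: tendsto_eq_intros)
  qed
  then show ?thesis by (simp add: DERIV_def)
qed

definition bump_deriv_poly :: "real \<Rightarrow> real poly \<Rightarrow> nat \<Rightarrow> real poly" where
  "bump_deriv_poly c p k =
     pderiv p * [:1, 0, -1:]\<^sup>2 + smult (2 * real k) ([:0, 1:] * p * [:1, 0, -1:]) - smult (2 * c) ([:0, 1:] * p)"

lemma DERIV_bump:
  assumes c: "c > 0"
  shows "(bump c p k has_real_derivative bump c (bump_deriv_poly c p k) (k + 2) t) (at t)"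
proof (cases "\<bar>t\<bar> < 1")
  case True
  define y where "y t = 1 / (1 - t\<^sup>2)" for t :: real
  have q: "1 - t\<^sup>2 > 0" by (rule one_minus_square_pos[OF True])
  have y: "(y has_real_derivative 2 * t * (y t)\<^sup>2) (at t)"
    unfolding y_def[abs_def] using q
    by (auto intro!: derivative_eq_intros simp: field_simps power2_eq_square)
  have "((\<lambda>t. y t ^ k) has_real_derivative 2 * k * t * (y t ^ k * y t)) (at t)"
    using DERIV_power[OF y, of k] by (cases k) (simp_all add: power2_eq_square algebra_simps)
  moreover have "((\<lambda>t. exp (- c * y t)) has_real_derivative exp (- c * y t) * (- c * (2 * t * (y t)\<^sup>2))) (at t)"
    by (intro DERIV_fun_exp DERIV_cmult y)
  ultimately have "((\<lambda>t. poly p t * y t ^ k * exp (- c * y t)) has_real_derivative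
      (poly (pderiv p) t * y t ^ k + 2 * k * t * (y t ^ k * y t) * poly p t) * exp (- c * y t)
        + exp (- c * y t) * (- c * (2 * t * (y t)\<^sup>2)) * (poly p t * y t ^ k)) (at t)"
    by (intro DERIV_mult poly_DERIV)
  moreover have "(poly (pderiv p) t * y t ^ k + 2 * k * t * (y t ^ k * y t) * poly p t) * exp (- c * y t)
        + exp (- c * y t) * (- c * (2 * t * (y t)\<^sup>2)) * (poly p t * y t ^ k)
      = bump c (bump_deriv_poly c p k) (k + 2) t"
  proof -
    define z where "z = 1 - t\<^sup>2"
    have z: "y t * z = 1" "y t = 1 / z" using q by (simp_all add: y_def z_def)
    have "poly (bump_deriv_poly c p k) t = poly (pderiv p) t * z\<^sup>2 + 2 * k * (t * poly p t * z) - 2 * c * (t * poly p t)"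
      by (simp add: bump_deriv_poly_def z_def algebra_simps power2_eq_square)
    then have "bump c (bump_deriv_poly c p k) (k + 2) t =
        (poly (pderiv p) t * z\<^sup>2 + 2 * k * (t * poly p t * z) - 2 * c * (t * poly p t)) * y t ^ (k + 2) * exp (- c * y t)"
      using True unfolding bump_def z_def[symmetric] z(2) by (simp add: power_divide)
    also have "\<dots> = (poly (pderiv p) t * (y t * z)\<^sup>2 + 2 * k * (t * poly p t * (y t * z) * y t)
        - 2 * c * (t * poly p t) * (y t)\<^sup>2) * y t ^ k * exp (- c * y t)"
      by (simp add: algebra_simps power2_eq_square)
    also have "\<dots> = (poly (pderiv p) t * y t ^ k + 2 * k * t * (y t ^ k * y t) * poly p t) * exp (- c * y t)
        + exp (- c * y t) * (- c * (2 * t * (y t)\<^sup>2)) * (poly p t * y t ^ k)"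
      unfolding z(1) by (simp add: algebra_simps)
    finally show ?thesis by simp
  qed
  ultimately have "((\<lambda>t. poly p t * y t ^ k * exp (- c * y t)) has_real_derivative
       bump c (bump_deriv_poly c p k) (k + 2) t) (at t)" by simp
  then show ?thesis
  proof (rule has_field_derivative_transform_within_open)
    show "open {-1<..<1::real}" "t \<in> {-1<..<1}" using True by auto
    show "\<And>x. x \<in> {-1<..<1} \<Longrightarrow> poly p x * y x ^ k * exp (- c * y x) = bump c p k x"
      by (auto simp: bump_def y_def power_divide)
  qed
next
  case False
  obtain C where "\<And>s t. \<bar>t\<bar> \<ge> 1 \<Longrightarrow> \<bar>bump c p k s\<bar> \<le> C * \<bar>s - t\<bar>\<^sup>2"
    using bump_quadratic_bound[OF c] by metis
  then have "(bump c p k has_real_derivative 0) (at t)"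
    using False by (intro quadratic_bound_imp_DERIV_0[of _ C]) auto
  then show ?thesis using False by (simp add: bump_def)
qed

section \<open>Products of one-dimensional functions\<close>

definition tensor :: "('n::finite \<Rightarrow> real \<Rightarrow> real) \<Rightarrow> real^'n \<Rightarrow> real" where
  "tensor g x = (\<Prod>i\<in>UNIV. g i (x $ i))"

lemma has_derivative_tensor:
  assumes "\<And>i t. (g i has_real_derivative d i t) (at t)"
  shows "(tensor g has_derivative (\<lambda>h. \<Sum>i\<in>UNIV. h $ i * tensor (g(i := d i)) x)) (at x)"
proof -
  have "((\<lambda>x. \<Prod>i\<in>UNIV. g i (x $ i)) has_derivative
      (\<lambda>h. \<Sum>i\<in>UNIV. (d i (x $ i) * h $ i) * (\<Prod>j\<in>UNIV - {i}. g j (x $ j)))) (at x)"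
  proof (rule has_derivative_prod)
    fix i
    have "((\<lambda>x. x $ i) has_derivative (\<lambda>h. h $ i)) (at x)"
      by (intro bounded_linear_imp_has_derivative bounded_linear_vec_nth)
    from has_derivative_compose[OF this, of "g i" "\<lambda>h. d i (x $ i) * h"]
    show "((\<lambda>x. g i (x $ i)) has_derivative (\<lambda>h. d i (x $ i) * h $ i)) (at x)"
      using assms[of i "x $ i"] by (simp add: has_field_derivative_def)
  qed
  moreover have "d i (x $ i) * (\<Prod>j\<in>UNIV - {i}. g j (x $ j)) = tensor (g(i := d i)) x" for i
    unfolding tensor_def by (subst prod.remove[of UNIV i]) (auto intro!: prod.cong)
  ultimately show ?thesis
    by (simp add: tensor_def[abs_def] mult_ac)
qed

lemma partial_deriv_eqI:
  assumes "(f has_derivative D) (at x)"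
  shows "partial_deriv i f x = D (axis i 1)"
  unfolding partial_deriv_def using frechet_derivative_at[OF assms] by simp

text \<open>All partial derivatives of a product of functions of one variable are again such
  products, so smoothness only needs a set of one-variable functions that is closed under
  differentiation.\<close>

lemma smooth_tensor:
  assumes S: "\<And>f. f \<in> S \<Longrightarrow> \<exists>f'\<in>S. \<forall>t. (f has_real_derivative f' t) (at t)"
    and g: "\<And>i. g i \<in> S"
  shows "smooth_on UNIV (tensor g)"
proof -
  have "Ck_on k UNIV (tensor g)" if "\<And>i. g i \<in> S" for k and g :: "'a \<Rightarrow> real \<Rightarrow> real"
    using that
  proof (induction k arbitrary: g)
    case 0
    have "\<forall>i. \<exists>f'. f' \<in> S \<and> (\<forall>t. (g i has_real_derivative f' t) (at t))"
      using S[OF 0] by blast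
    then obtain d where d: "\<And>i. d i \<in> S" "\<And>i t. (g i has_real_derivative d i t) (at t)"
      by metis
    show ?case
      using has_derivative_tensor[of g d] d(2)
      by (auto intro!: continuous_at_imp_continuous_on dest: has_derivative_continuous)
  next
    case (Suc k)
    have "\<forall>i. \<exists>f'. f' \<in> S \<and> (\<forall>t. (g i has_real_derivative f' t) (at t))"
      using S[OF Suc.prems] by blast
    then obtain d where d: "\<And>i. d i \<in> S" "\<And>i t. (g i has_real_derivative d i t) (at t)"
      by metis
    have "partial_deriv i (tensor g) = tensor (g(i := d i))" for i
      using partial_deriv_eqI[OF has_derivative_tensor[OF d(2)], of i]
      by (auto simp: fun_eq_iff axis_def if_distrib if_distribR cong: if_cong)
    moreover have "Ck_on k UNIV (tensor (g(i := d i)))" for i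
      using Suc.prems d by (intro Suc.IH) auto
    ultimately show ?case
      using has_derivative_tensor[of g d, OF d(2)] by (auto simp: differentiable_def)
  qed
  then show ?thesis using g by (auto simp: smooth_on_def)
qed

text \<open>As \<open>c\<close> tends to \<open>0\<close>, these functions increase to the
  indicator of the box.\<close>

definition box_bump :: "real \<Rightarrow> real^'n \<Rightarrow> real^'n \<Rightarrow> real^'n::finite \<Rightarrow> real" where
  "box_bump c a b = tensor (\<lambda>i t. bump c 1 0 ((t - (a $ i + b $ i) / 2) / ((b $ i - a $ i) / 2)))"

lemma rescale_interval:
  fixes a b t :: real assumes "a < b"
  shows "\<bar>(t - (a + b) / 2) / ((b - a) / 2)\<bar> < 1 \<longleftrightarrow> a < t \<and> t < b"
proof -
  have "\<bar>(b - a) / 2\<bar> = (b - a) / 2" using assms by simp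
  then have "\<bar>(t - (a + b) / 2) / ((b - a) / 2)\<bar> = \<bar>t - (a + b) / 2\<bar> / ((b - a) / 2)"
    by (metis abs_divide)
  also have "\<dots> < 1 \<longleftrightarrow> \<bar>t - (a + b) / 2\<bar> < (b - a) / 2" using assms by (subst divide_less_eq_1_pos) auto
  also have "\<dots> \<longleftrightarrow> a < t \<and> t < b" by (auto simp: abs_less_iff field_simps)
  finally show ?thesis .
qed

lemma smooth_box_bump:
  assumes "c > 0"
  shows "smooth_on UNIV (box_bump c a b)"
  unfolding box_bump_def
proof (rule smooth_tensor)
  let ?S = "{\<lambda>t. s * bump c p k ((t - m) / r) | s p k m r. True}"
  show "(\<lambda>t. bump c 1 0 ((t - (a $ i + b $ i) / 2) / ((b $ i - a $ i) / 2))) \<in> ?S" for i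
    by (rule CollectI, rule exI[of _ 1], rule exI[of _ 1], rule exI[of _ 0],
        rule exI[of _ "(a $ i + b $ i) / 2"], rule exI[of _ "(b $ i - a $ i) / 2"]) simp
  fix f assume "f \<in> ?S"
  then obtain s p k m r where f: "f = (\<lambda>t. s * bump c p k ((t - m) / r))" by auto
  have "(f has_real_derivative (s * inverse r) * bump c (bump_deriv_poly c p k) (k + 2) ((t - m) / r)) (at t)" for t
  proof -
    have "((\<lambda>t. (t - m) / r) has_real_derivative inverse r) (at t)"
      by (cases "r = 0") (auto intro!: derivative_eq_intros simp: field_simps)
    from DERIV_chain2[OF DERIV_bump[OF assms] this, of p k]
    show ?thesis unfolding f by (auto intro!: derivative_eq_intros)
  qed
  then show "\<exists>f'\<in>?S. \<forall>t. (f has_real_derivative f' t) (at t)"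
    by (intro bexI[of _ "\<lambda>t. (s * inverse r) * bump c (bump_deriv_poly c p k) (k + 2) ((t - m) / r)"]) blast+
qed

lemma box_bump_values:
  fixes a b :: "real^'n::finite"
  assumes ab: "\<And>i. a $ i < b $ i" and c: "c > 0"
  shows "0 \<le> box_bump c a b x" "box_bump c a b x \<le> 1" "box_bump c a b x \<noteq> 0 \<longleftrightarrow> x \<in> box a b"
proof -
  have b: "0 \<le> bump c 1 0 t" "bump c 1 0 t \<le> 1" "bump c 1 0 t \<noteq> 0 \<longleftrightarrow> \<bar>t\<bar> < 1" for t
    using one_minus_square_pos[of t] c by (auto simp: bump_def)
  show "0 \<le> box_bump c a b x" "box_bump c a b x \<le> 1"
    unfolding box_bump_def tensor_def using b by (auto intro!: prod_nonneg prod_le_1)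
  show "box_bump c a b x \<noteq> 0 \<longleftrightarrow> x \<in> box a b"
    unfolding box_bump_def tensor_def using b(3) rescale_interval[OF ab]
    by (simp add: mem_box_cart)
qed

lemma box_bump_tendsto:
  fixes a b :: "real^'n::finite"
  assumes ab: "\<And>i. a $ i < b $ i"
  shows "(\<lambda>n. box_bump (1 / real (Suc n)) a b x) \<longlonglongrightarrow> indicator (box a b) x"
proof (cases "x \<in> box a b")
  case True
  define z where "z i = (x $ i - (a $ i + b $ i) / 2) / ((b $ i - a $ i) / 2)" for i
  have z: "\<bar>z i\<bar> < 1" for i
    unfolding z_def using True rescale_interval[OF ab] by (simp add: mem_box_cart)
  have "(\<lambda>n. bump (1 / real (Suc n)) 1 0 (z i)) \<longlonglongrightarrow> 1" for i
  proof -
    have "(\<lambda>n. exp (- (1 / real (Suc n)) / (1 - (z i)\<^sup>2))) \<longlonglongrightarrow> exp (- 0 / (1 - (z i)\<^sup>2))"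
      using one_minus_square_pos[OF z[of i]] by (intro tendsto_intros LIMSEQ_Suc[OF lim_1_over_n]) auto
    then show ?thesis using z[of i] by (simp add: bump_def)
  qed
  then have "(\<lambda>n. \<Prod>i\<in>UNIV. bump (1 / real (Suc n)) 1 0 (z i)) \<longlonglongrightarrow> (\<Prod>i\<in>(UNIV::'n set). 1)"
    by (intro tendsto_prod)
  then show ?thesis using True by (simp add: box_bump_def tensor_def z_def)
next
  case False
  then have "box_bump (1 / real (Suc n)) a b x = 0" for n
    using box_bump_values(3)[OF ab, of "1 / real (Suc n)" x] by simp
  then show ?thesis using False by simp
qed

lemma box_bump_test_function:
  fixes a b :: "real^'n::finite"
  assumes "\<And>i. a $ i < b $ i" "cbox a b \<subseteq> \<Omega>" "c > 0"
  shows "box_bump c a b \<in> test_functions \<Omega>"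
proof -
  have "{x. box_bump c a b x \<noteq> 0} = box a b" using box_bump_values(3)[OF assms(1,3)] by auto
  moreover have "closure (box a b) \<subseteq> cbox a b" by (intro closure_minimal box_subset_cbox closed_cbox)
  moreover have "compact (closure (box a b))" by (simp add: compact_closure bounded_box)
  ultimately show ?thesis
    using assms smooth_box_bump[OF assms(3)] by (auto simp: test_functions_def)
qed

section \<open>Linear combinations of test functions\<close>

lemma partial_deriv_linear:
  fixes f g :: "real^'n::finite \<Rightarrow> real"
  assumes "f differentiable (at x)" "g differentiable (at x)"
  shows "partial_deriv i (\<lambda>x. r * f x + s * g x) x = r * partial_deriv i f x + s * partial_deriv i g x"
proof -
  obtain F G where FG: "(f has_derivative F) (at x)" "(g has_derivative G) (at x)"
    using assms by (auto simp: differentiable_def)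
  have "((\<lambda>x. r * f x + s * g x) has_derivative (\<lambda>h. r * F h + s * G h)) (at x)"
    using FG by (auto intro!: derivative_eq_intros)
  then show ?thesis using FG by (simp add: partial_deriv_eqI)
qed

lemma Ck_on_linear:
  assumes "Ck_on k UNIV f" "Ck_on k UNIV g"
  shows "Ck_on k UNIV (\<lambda>x. r * f x + s * g x :: real)"
  using assms
proof (induction k arbitrary: f g)
  case 0
  then show ?case by (auto intro!: continuous_intros)
next
  case (Suc k)
  have "partial_deriv i (\<lambda>x. r * f x + s * g x) = (\<lambda>x. r * partial_deriv i f x + s * partial_deriv i g x)" for i
    using Suc.prems by (auto simp: fun_eq_iff partial_deriv_linear)
  then show ?case using Suc by (auto intro!: differentiable_add differentiable_mult)
qed

lemma test_functions_linear:
  assumes "\<psi>1 \<in> test_functions \<Omega>" "\<psi>2 \<in> test_functions \<Omega>"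
  shows "(\<lambda>x. r * \<psi>1 x + s * \<psi>2 x) \<in> test_functions \<Omega>"
proof -
  let ?T = "{x. r * \<psi>1 x + s * \<psi>2 x \<noteq> 0}"
  have "?T \<subseteq> {x. \<psi>1 x \<noteq> 0} \<union> {x. \<psi>2 x \<noteq> 0}" by auto
  also have "\<dots> \<subseteq> closure {x. \<psi>1 x \<noteq> 0} \<union> closure {x. \<psi>2 x \<noteq> 0}"
    by (intro Un_mono closure_subset)
  finally have "?T \<subseteq> closure {x. \<psi>1 x \<noteq> 0} \<union> closure {x. \<psi>2 x \<noteq> 0}" .
  then have *: "closure ?T \<subseteq> closure {x. \<psi>1 x \<noteq> 0} \<union> closure {x. \<psi>2 x \<noteq> 0}"
    by (intro closure_minimal) auto
  have "compact (closure {x. \<psi>1 x \<noteq> 0} \<union> closure {x. \<psi>2 x \<noteq> 0})"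
    using assms by (auto simp: test_functions_def)
  with * have "compact (closure ?T)"
    by (meson bounded_subset closed_closure compact_eq_bounded_closed)
  then show ?thesis using assms * by (auto simp: test_functions_def smooth_on_def Ck_on_linear)
qed

lemma zero_test_function: "(\<lambda>x. 0) \<in> test_functions \<Omega>"
proof -
  have "Ck_on k UNIV (\<lambda>x::real^'a. 0 :: real)" for k
  proof (induction k)
    case (Suc k)
    have "partial_deriv i (\<lambda>x::real^'a. 0 :: real) = (\<lambda>x. 0)" for i
      by (auto simp: fun_eq_iff intro!: partial_deriv_eqI[where D="\<lambda>_. 0", simplified])
    then show ?case using Suc by simp
  qed simp
  then show ?thesis by (simp add: test_functions_def smooth_on_def)
qed

section \<open>Compactly supported functions of class C1\<close>

text \<open>Continuously differentiable functions with compact support, with their gradient.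
  Unlike test functions they are stable under composition with a \<open>C\<^sup>1\<close> function
  that vanishes at \<open>0\<close>, which the proof of the Sobolev inequality requires.\<close>

definition C1c :: "('a::euclidean_space \<Rightarrow> real) \<Rightarrow> ('a \<Rightarrow> 'a) \<Rightarrow> bool" where
  "C1c w g \<longleftrightarrow> (\<forall>x. (w has_derivative (\<lambda>h. h \<bullet> g x)) (at x)) \<and> continuous_on UNIV g \<and>
     (\<exists>R>0. \<forall>x. norm x > R \<longrightarrow> w x = 0 \<and> g x = 0)"

definition grad :: "(real^'n::finite \<Rightarrow> real) \<Rightarrow> real^'n \<Rightarrow> real^'n" where
  "grad w x = (\<chi> i. partial_deriv i w x)"

lemma has_derivative_grad:
  fixes w :: "real^'n::finite \<Rightarrow> real"
  assumes "w differentiable (at x)"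
  shows "(w has_derivative (\<lambda>h. h \<bullet> grad w x)) (at x)"
proof -
  define D where "D = frechet_derivative w (at x)"
  have D: "(w has_derivative D) (at x)"
    using assms by (simp add: D_def frechet_derivative_works)
  then have "linear D" by (rule has_derivative_linear)
  have "D h = h \<bullet> grad w x" for h
  proof -
    have "D h = D (\<Sum>i\<in>UNIV. h $ i *\<^sub>R axis i 1)"
      using basis_expansion[of h] by (simp add: scalar_mult_eq_scaleR)
    also have "\<dots> = (\<Sum>i\<in>UNIV. h $ i * D (axis i 1))"
      using \<open>linear D\<close> by (simp add: linear_sum linear_scale)
    also have "\<dots> = h \<bullet> grad w x"
      by (simp add: inner_vec_def grad_def partial_deriv_def D_def)
    finally show ?thesis .
  qed
  then have "D = (\<lambda>h. h \<bullet> grad w x)" by (simp add: fun_eq_iff)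
  with D show ?thesis by simp
qed

lemma test_function_C1c:
  assumes "\<psi> \<in> test_functions \<Omega>"
  shows "C1c \<psi> (grad \<psi>)"
proof -
  have C: "Ck_on k UNIV \<psi>" for k using assms by (auto simp: test_functions_def smooth_on_def)
  have diff: "\<psi> differentiable (at x)" for x using C[of 1] by simp
  have cont: "continuous_on UNIV (grad \<psi>)"
    unfolding grad_def[abs_def] using C[of 1] by (auto intro!: continuous_intros)
  have "bounded (closure {x. \<psi> x \<noteq> 0})" using assms by (auto simp: test_functions_def compact_imp_bounded)
  then obtain R where R: "R > 0" "\<And>x. x \<in> closure {x. \<psi> x \<noteq> 0} \<Longrightarrow> norm x \<le> R"
    by (auto simp: bounded_pos)
  have z: "\<psi> x = 0" if "norm x > R" for x
    using R(2)[of x] that closure_subset[of "{x. \<psi> x \<noteq> 0}"] by fastforce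
  have "grad \<psi> x = 0" if "norm x > R" for x
  proof -
    have "(\<psi> has_derivative (\<lambda>h. 0)) (at x)"
    proof (rule has_derivative_transform_within_open[of "\<lambda>x. 0" _ _ _ "- cball 0 R"])
      show "x \<in> - cball 0 R" "open (- cball (0::real^'a) R)" using that by auto
    qed (use z in auto)
    then show ?thesis by (simp add: grad_def vec_eq_iff partial_deriv_eqI)
  qed
  then show ?thesis unfolding C1c_def
    using has_derivative_grad[OF diff] cont R z by auto
qed

lemma grad_linear:
  assumes "\<psi>1 \<in> test_functions \<Omega>" "\<psi>2 \<in> test_functions \<Omega>"
  shows "grad (\<lambda>x. r * \<psi>1 x + s * \<psi>2 x) x = r *\<^sub>R grad \<psi>1 x + s *\<^sub>R grad \<psi>2 x"
proof -
  have "\<psi>1 differentiable (at x)" "\<psi>2 differentiable (at x)"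
    using assms test_function_C1c[OF assms(1)] test_function_C1c[OF assms(2)]
    by (auto simp: C1c_def differentiable_def)
  then show ?thesis by (simp add: grad_def vec_eq_iff partial_deriv_linear)
qed

lemma test_function_support:
  assumes "\<psi> \<in> test_functions \<Omega>" "x \<notin> \<Omega>"
  shows "\<psi> x = 0" "grad \<psi> x = 0"
proof -
  let ?T = "closure {x. \<psi> x \<noteq> 0}"
  have x: "x \<notin> ?T" using assms by (auto simp: test_functions_def)
  then show "\<psi> x = 0" using closure_subset by force
  have "(\<psi> has_derivative (\<lambda>h. 0)) (at x)"
  proof (rule has_derivative_transform_within_open[of "\<lambda>x. 0" _ _ _ "- ?T"])
    show "x \<in> - ?T" "open (- ?T)" using x by auto
    show "\<And>x. x \<in> - ?T \<Longrightarrow> 0 = \<psi> x" using closure_subset by force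
  qed auto
  then show "grad \<psi> x = 0" by (simp add: grad_def vec_eq_iff partial_deriv_eqI)
qed

lemma C1c_continuous: "C1c w g \<Longrightarrow> continuous_on UNIV w"
  by (auto simp: C1c_def intro!: continuous_at_imp_continuous_on has_derivative_continuous)

lemma C1c_mult:
  assumes "C1c u g" "C1c v k"
  shows "C1c (\<lambda>x. u x * v x) (\<lambda>x. u x *\<^sub>R k x + v x *\<^sub>R g x)"
proof -
  obtain R where R: "R > 0" "\<And>x. norm x > R \<Longrightarrow> u x = 0 \<and> g x = 0"
    using assms(1) by (auto simp: C1c_def)
  have "((\<lambda>x. u x * v x) has_derivative (\<lambda>h. h \<bullet> (u x *\<^sub>R k x + v x *\<^sub>R g x))) (at x)" for x
    using assms unfolding C1c_def
    by (auto intro!: derivative_eq_intros simp: inner_add_right mult_ac)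
  moreover have "continuous_on UNIV (\<lambda>x. u x *\<^sub>R k x + v x *\<^sub>R g x)"
    using assms C1c_continuous[OF assms(1)] C1c_continuous[OF assms(2)]
    by (auto simp: C1c_def intro!: continuous_intros)
  ultimately show ?thesis using R unfolding C1c_def by auto
qed

lemma C1c_bounded:
  assumes "C1c w g"
  obtains C where "C > 0" "\<And>x. \<bar>w x\<bar> \<le> C" "\<And>x. norm (g x) \<le> C"
proof -
  obtain R where R: "R > 0" "\<And>x. norm x > R \<Longrightarrow> w x = 0 \<and> g x = 0"
    using assms by (auto simp: C1c_def)
  have "bounded (w ` cball 0 R)" "bounded (g ` cball 0 R)"
    using assms C1c_continuous[OF assms]
    by (auto simp: C1c_def intro!: compact_imp_bounded compact_continuous_image intro: continuous_on_subset)
  then obtain A B where A: "A > 0" "\<And>x. norm x \<le> R \<Longrightarrow> \<bar>w x\<bar> \<le> A"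
    and B: "B > 0" "\<And>x. norm x \<le> R \<Longrightarrow> norm (g x) \<le> B"
    by (auto simp: bounded_pos)
  show thesis
  proof (rule that[of "A + B"])
    show "A + B > 0" using A B by simp
    show "\<bar>w x\<bar> \<le> A + B" "norm (g x) \<le> A + B" for x
      using A B R(2)[of x] by (cases "norm x \<le> R"; force)+
  qed
qed

lemma C1c_line_derivative:
  assumes "C1c w g"
  shows "((\<lambda>t. w (x + t *\<^sub>R e)) has_real_derivative e \<bullet> g (x + t *\<^sub>R e)) (at t within T)"
proof -
  have "((\<lambda>t. x + t *\<^sub>R e) has_derivative (\<lambda>h. h *\<^sub>R e)) (at t within T)"
    by (auto intro!: derivative_eq_intros)
  from has_derivative_compose[OF this, of w "\<lambda>h. h \<bullet> g (x + t *\<^sub>R e)"]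
  show ?thesis using assms unfolding C1c_def has_field_derivative_def by (simp add: mult_commute_abs)
qed

lemma integrable_compact_support:
  fixes f :: "'a::euclidean_space \<Rightarrow> 'b::{banach, second_countable_topology}"
  assumes "continuous_on UNIV f" "\<And>x. norm x > R \<Longrightarrow> f x = 0"
  shows "integrable lborel f"
proof -
  have "integrable lborel (\<lambda>x. indicator (cball 0 R) x *\<^sub>R f x)"
    using borel_integrable_compact[of "cball 0 R" f] assms(1)
    by (auto intro: continuous_on_subset simp: set_integrable_def)
  moreover have "(\<lambda>x. indicator (cball 0 R) x *\<^sub>R f x) = f"
    using assms(2) by (auto simp: fun_eq_iff indicator_def not_le)
  ultimately show ?thesis by simp
qed

lemma C1c_integrable:
  assumes "C1c w g"
  shows "integrable lborel w" "integrable lborel g"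
  using assms C1c_continuous[OF assms] unfolding C1c_def
  by (auto intro!: integrable_compact_support)

lemma integral_lborel_shift:
  fixes f :: "'a::euclidean_space \<Rightarrow> 'b::{banach, second_countable_topology}"
  assumes "f \<in> borel_measurable borel"
  shows "(\<integral>x. f (x + h) \<partial>lborel) = (\<integral>x. f x \<partial>lborel)"
  using assms integral_distr[of "(+) h" lborel borel f]
  by (simp add: lborel_distr_plus add.commute)

lemma C1c_mean_value:
  assumes "C1c w g" "\<And>x. norm (g x) \<le> C"
  shows "\<bar>w (x + h) - w x\<bar> \<le> C * norm h"
proof -
  have "norm (w (x + h) - w x) \<le> C * norm (x + h - x)"
  proof (rule differentiable_bound[of UNIV w "\<lambda>x h. h \<bullet> g x"])
    show "(w has_derivative (\<lambda>h. h \<bullet> g x)) (at x within UNIV)" for x using assms by (auto simp: C1c_def)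
    show "onorm (\<lambda>h. h \<bullet> g x) \<le> C" for x
    proof (rule onorm_le)
      fix h
      have "norm (h \<bullet> g x) \<le> norm h * norm (g x)" by (simp add: Cauchy_Schwarz_ineq2)
      also have "\<dots> \<le> norm h * C" using assms(2) by (intro mult_left_mono) auto
      finally show "norm (h \<bullet> g x) \<le> C * norm h" by (simp add: mult.commute)
    qed
  qed auto
  then show ?thesis by simp
qed

text \<open>Difference quotients have integral \<open>0\<close> by translation invariance, and
  they converge boundedly to the derivative.\<close>

lemma integral_grad_eq_0:
  assumes wg: "C1c w g"
  shows "(\<integral>x. e \<bullet> g x \<partial>lborel) = 0"
proof -
  obtain R where R: "R > 0" "\<And>x. norm x > R \<Longrightarrow> w x = 0 \<and> g x = 0"
    using wg by (auto simp: C1c_def)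
  obtain C where C: "C > 0" "\<And>x. norm (g x) \<le> C" using C1c_bounded[OF wg] by metis
  define \<tau> where "\<tau> n = 1 / real (Suc n)" for n
  have \<tau>: "\<tau> n > 0" "\<tau> n \<le> 1" for n by (auto simp: \<tau>_def)
  have \<tau>0: "\<tau> \<longlonglongrightarrow> 0" unfolding \<tau>_def by (rule LIMSEQ_Suc[OF lim_1_over_n])
  have [measurable]: "w \<in> borel_measurable borel" using C1c_continuous[OF wg] by (intro borel_measurable_continuous_onI)
  have "(\<lambda>n. \<integral>x. (w (x + \<tau> n *\<^sub>R e) - w x) / \<tau> n \<partial>lborel) \<longlonglongrightarrow> (\<integral>x. e \<bullet> g x \<partial>lborel)"
  proof (rule integral_dominated_convergence)
    have "continuous_on UNIV g" using wg by (auto simp: C1c_def)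
    then show "(\<lambda>x. e \<bullet> g x) \<in> borel_measurable lborel"
      by (auto intro!: borel_measurable_continuous_onI continuous_intros)
    show "integrable lborel (\<lambda>x. C * norm e * indicator (cball 0 (R + norm e)) x)"
      by (intro integrable_mult_right integrable_real_indicator) (auto simp: emeasure_bounded_finite[unfolded infinity_ennreal_def])
    show "AE x in lborel. (\<lambda>n. (w (x + \<tau> n *\<^sub>R e) - w x) / \<tau> n) \<longlonglongrightarrow> e \<bullet> g x"
    proof (rule AE_I2)
      fix x
      have "((\<lambda>t. (w (x + t *\<^sub>R e) - w x) / t) \<longlongrightarrow> e \<bullet> g x) (at 0)"
        using C1c_line_derivative[OF wg, of x e 0 UNIV] by (simp add: DERIV_def)
      moreover have "filterlim \<tau> (at 0) sequentially"
        using \<tau>0 \<tau> by (auto simp: filterlim_at intro!: always_eventually) (metis less_irrefl)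
      ultimately show "(\<lambda>n. (w (x + \<tau> n *\<^sub>R e) - w x) / \<tau> n) \<longlonglongrightarrow> e \<bullet> g x"
        by (rule filterlim_compose)
    qed
    show "AE x in lborel. norm ((w (x + \<tau> n *\<^sub>R e) - w x) / \<tau> n) \<le> C * norm e * indicator (cball 0 (R + norm e)) x" for n
    proof (rule AE_I2)
      fix x
      show "norm ((w (x + \<tau> n *\<^sub>R e) - w x) / \<tau> n) \<le> C * norm e * indicator (cball 0 (R + norm e)) x"
      proof (cases "norm x \<le> R + norm e")
        case True
        then show ?thesis
          using C1c_mean_value[OF wg C(2), of x "\<tau> n *\<^sub>R e"] \<tau>[of n] by (simp add: divide_simps mult_ac)
      next
        case False
        have "norm (\<tau> n *\<^sub>R e) \<le> norm e" using \<tau>[of n] by (simp add: mult_left_le_one_le)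
        moreover have "norm x \<le> norm (x + \<tau> n *\<^sub>R e) + norm (\<tau> n *\<^sub>R e)"
          using norm_triangle_ineq4[of "x + \<tau> n *\<^sub>R e" "\<tau> n *\<^sub>R e"] by simp
        ultimately have "norm (x + \<tau> n *\<^sub>R e) > R" "norm x > R" using False R(1) norm_ge_zero[of e] by linarith+
        then show ?thesis using R(2) False by simp
      qed
    qed
  qed measurable
  moreover have "(\<integral>x. (w (x + \<tau> n *\<^sub>R e) - w x) / \<tau> n \<partial>lborel) = 0" for n
  proof -
    have i: "integrable lborel w" using C1c_integrable[OF wg] by simp
    have "integrable lborel (\<lambda>x. w (x + \<tau> n *\<^sub>R e))"
      using i integrable_distr_eq[of "(+) (\<tau> n *\<^sub>R e)" lborel borel w]
      by (simp add: lborel_distr_plus add.commute)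
    then have "(\<integral>x. w (x + \<tau> n *\<^sub>R e) - w x \<partial>lborel) = 0"
      using i by (simp add: integral_lborel_shift)
    then show ?thesis by simp
  qed
  ultimately show ?thesis by (simp only: LIMSEQ_const_iff)
qed

lemma integration_by_parts:
  assumes "C1c u g" "C1c v k"
  shows "(\<integral>x. u x * (e \<bullet> k x) \<partial>lborel) = - (\<integral>x. (e \<bullet> g x) * v x \<partial>lborel)"
proof -
  obtain R where R: "R > 0" "\<And>x. norm x > R \<Longrightarrow> u x = 0 \<and> g x = 0"
    using assms(1) by (auto simp: C1c_def)
  have c: "continuous_on UNIV u" "continuous_on UNIV v" "continuous_on UNIV g" "continuous_on UNIV k"
    using assms C1c_continuous by (auto simp: C1c_def)
  have "integrable lborel (\<lambda>x. u x * (e \<bullet> k x))" "integrable lborel (\<lambda>x. (e \<bullet> g x) * v x)"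
    using c R by (auto intro!: integrable_compact_support[where R=R] continuous_intros)
  moreover have "(\<integral>x. u x * (e \<bullet> k x) + (e \<bullet> g x) * v x \<partial>lborel) = 0"
    using integral_grad_eq_0[OF C1c_mult[OF assms], of e] by (simp add: inner_add_right mult_ac)
  ultimately show ?thesis by simp
qed

section \<open>The Loomis--Whitney inequality\<close>

text \<open>Hoelder's inequality
  \<open>\<integral> (\<Prod>C\<^sub>i)\<^sup>1\<^sup>/\<^sup>n \<le> \<Prod>(\<integral> C\<^sub>i)\<^sup>1\<^sup>/\<^sup>n\<close>,
  stated without roots: \<open>B\<close> stands for a function below the \<open>n\<close>-th root
  of the product. After normalising the integrals it is the inequality of arithmetic and geometric
  means.\<close>

lemma rooted_holder:
  fixes C :: "'i \<Rightarrow> 'a \<Rightarrow> ennreal" and B :: "'a \<Rightarrow> ennreal"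
  assumes I: "finite I" "I \<noteq> {}"
    and [measurable]: "B \<in> borel_measurable M" "\<And>i. i \<in> I \<Longrightarrow> C i \<in> borel_measurable M"
    and le: "\<And>x. x \<in> space M \<Longrightarrow> B x ^ card I \<le> (\<Prod>i\<in>I. C i x)"
  shows "(\<integral>\<^sup>+x. B x \<partial>M) ^ card I \<le> (\<Prod>i\<in>I. \<integral>\<^sup>+x. C i x \<partial>M)"
proof -
  define n where "n = card I"
  have n: "n > 0" using I by (auto simp: n_def card_gt_0_iff)
  consider (zero) i where "i \<in> I" "(\<integral>\<^sup>+x. C i x \<partial>M) = 0"
    | (top) i where "\<And>i. i \<in> I \<Longrightarrow> (\<integral>\<^sup>+x. C i x \<partial>M) \<noteq> 0" "i \<in> I" "(\<integral>\<^sup>+x. C i x \<partial>M) = top"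
    | (fin) "\<And>i. i \<in> I \<Longrightarrow> (\<integral>\<^sup>+x. C i x \<partial>M) \<noteq> 0" "\<And>i. i \<in> I \<Longrightarrow> (\<integral>\<^sup>+x. C i x \<partial>M) \<noteq> top"
    by blast
  then show ?thesis
  proof cases
    case zero
    from zero have "AE x in M. C i x = 0"
      by (subst (asm) nn_integral_0_iff_AE) auto
    then have "AE x in M. B x = 0"
    proof (rule AE_mp, intro AE_I2 impI)
      fix x assume x: "x \<in> space M" "C i x = 0"
      have "(\<Prod>i\<in>I. C i x) = 0" using I zero(1) x(2) by (auto simp: prod_zero_iff)
      then have "B x ^ card I = 0" using le[OF x(1)] by (metis le_zero_eq)
      then show "B x = 0" using n unfolding n_def[symmetric] by (metis power_eq_0_iff)
    qed
    then have "(\<integral>\<^sup>+x. B x \<partial>M) = 0" by (subst nn_integral_0_iff_AE) auto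
    then show ?thesis using n by (simp add: n_def zero_power)
  next
    case top
    have "(\<Prod>i\<in>I. \<integral>\<^sup>+x. C i x \<partial>M) = top"
      using I top by (subst ennreal_prod_eq_top) auto
    then show ?thesis by simp
  next
    case fin
    define c where "c i = enn2real (\<integral>\<^sup>+x. C i x \<partial>M)" for i
    have c: "c i > 0" "(\<integral>\<^sup>+x. C i x \<partial>M) = ennreal (c i)" if "i \<in> I" for i
      using fin[OF that] by (auto simp: c_def enn2real_positive_iff less_top zero_less_iff_neq_zero)
    \<comment> \<open>the geometric mean of the integrals, by which the inequality is normalised\<close>
    define \<gamma> where "\<gamma> = root n (\<Prod>i\<in>I. c i)"
    have "(\<Prod>i\<in>I. c i) > 0" using c by (auto intro!: prod_pos)
    then have \<gamma>: "\<gamma> > 0" "\<gamma> ^ n = (\<Prod>i\<in>I. c i)"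
      unfolding \<gamma>_def using n by simp_all
    have fin_AE: "AE x in M. \<forall>i\<in>I. C i x \<noteq> top"
    proof (rule AE_finite_allI[OF I(1)])
      fix i assume i: "i \<in> I"
      show "AE x in M. C i x \<noteq> top"
        using nn_integral_PInf_AE[of "C i" M] fin(2)[OF i] assms(4)[OF i] by simp
    qed
    have bound: "B x \<le> (\<Sum>i\<in>I. ennreal (\<gamma> / (n * c i)) * C i x)"
      if x: "x \<in> space M" "\<forall>i\<in>I. C i x \<noteq> top" for x
    proof -
      define d where "d i = enn2real (C i x)" for i
      have d: "C i x = ennreal (d i)" "d i \<ge> 0" if "i \<in> I" for i
        using x that by (auto simp: d_def less_top)
      have Bpow: "B x ^ n \<le> ennreal (\<Prod>i\<in>I. d i)"
        using le[OF x(1)] by (simp add: n_def d prod_ennreal)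
      have "B x \<noteq> top"
      proof
        assume "B x = top"
        then have "B x ^ n = top" using n by (simp add: power_eq_top_ennreal)
        with Bpow show False by (simp add: top_unique)
      qed
      then obtain \<beta> where \<beta>: "B x = ennreal \<beta>" "\<beta> \<ge> 0" by (cases "B x") auto
      have "\<beta> ^ n \<le> (\<Prod>i\<in>I. d i)"
        using Bpow \<beta> d by (simp add: ennreal_power prod_nonneg)
      also have "\<dots> = (\<Prod>i\<in>I. d i / c i) * \<gamma> ^ n"
        using c unfolding \<gamma>(2) prod.distrib[symmetric] by (intro prod.cong) (auto simp: less_imp_neq[symmetric])
      also have "\<dots> \<le> ((\<Sum>i\<in>I. (1 / n) * (d i / c i)) ^ n) * \<gamma> ^ n"
      proof (rule mult_right_mono)
        define p where "p = (\<Prod>i\<in>I. d i / c i)"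
        have p: "p \<ge> 0" using c d by (auto intro!: prod_nonneg simp: p_def less_imp_le)
        have "p powr (1 / n) \<le> (\<Sum>i\<in>I. (1 / n) * (d i / c i))"
          using arith_geom_mean[OF I, of "\<lambda>i. d i / c i"] c d
          by (simp add: n_def p_def less_imp_le mult.commute)
        then have "(p powr (1 / n)) ^ n \<le> (\<Sum>i\<in>I. (1 / n) * (d i / c i)) ^ n"
          by (intro power_mono) auto
        moreover have "(p powr (1 / n)) ^ n = p"
          using n p by (cases "p = 0") (auto simp: powr_realpow[symmetric] powr_powr)
        ultimately show "(\<Prod>i\<in>I. d i / c i) \<le> (\<Sum>i\<in>I. (1 / n) * (d i / c i)) ^ n" by (simp add: p_def)
      qed (use \<gamma>(1) in simp)
      finally have "\<beta> ^ n \<le> ((\<Sum>i\<in>I. (1 / n) * (d i / c i)) * \<gamma>) ^ n" by (simp add: power_mult_distrib)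
      then have "\<beta> \<le> (\<Sum>i\<in>I. (1 / n) * (d i / c i)) * \<gamma>"
        using n c d \<gamma> by (subst (asm) power_mono_iff) (auto intro!: sum_nonneg mult_nonneg_nonneg simp: \<beta> less_imp_le)
      also have "\<dots> = (\<Sum>i\<in>I. (\<gamma> / (n * c i)) * d i)"
        by (simp add: sum_distrib_left mult_ac)
      finally have "ennreal \<beta> \<le> ennreal (\<Sum>i\<in>I. (\<gamma> / (n * c i)) * d i)" by (rule ennreal_leI)
      also have "\<dots> = (\<Sum>i\<in>I. ennreal (\<gamma> / (n * c i)) * C i x)"
      proof -
        have "ennreal (\<gamma> / (n * c i) * d i) = ennreal (\<gamma> / (n * c i)) * C i x" if "i \<in> I" for i
          using c(1)[OF that] d[OF that] \<gamma>(1) ennreal_mult[of "\<gamma> / (n * c i)" "d i"] by simp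
        moreover have "ennreal (\<Sum>i\<in>I. (\<gamma> / (n * c i)) * d i) = (\<Sum>i\<in>I. ennreal ((\<gamma> / (n * c i)) * d i))"
          using c(1) d(2) \<gamma>(1) by (intro sum_ennreal[symmetric]) (auto simp: less_imp_le)
        ultimately show ?thesis by simp
      qed
      finally show ?thesis using \<beta> by simp
    qed
    have "AE x in M. B x \<le> (\<Sum>i\<in>I. ennreal (\<gamma> / (n * c i)) * C i x)"
      using fin_AE AE_space by eventually_elim (rule bound)
    then have "(\<integral>\<^sup>+x. B x \<partial>M) \<le> (\<integral>\<^sup>+x. (\<Sum>i\<in>I. ennreal (\<gamma> / (n * c i)) * C i x) \<partial>M)"
      by (rule nn_integral_mono_AE)
    also have "\<dots> = (\<Sum>i\<in>I. ennreal (\<gamma> / (n * c i)) * ennreal (c i))"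
      by (simp add: nn_integral_sum nn_integral_cmult c)
    also have "\<dots> = (\<Sum>i\<in>I. ennreal (\<gamma> / n))"
      using c \<gamma> by (intro sum.cong) (auto simp: ennreal_mult''[symmetric] less_imp_le less_imp_neq[symmetric])
    also have "\<dots> = ennreal \<gamma>"
      using n \<gamma> by (simp add: n_def[symmetric] ennreal_of_nat_eq_real_of_nat ennreal_mult''[symmetric])
    finally have "(\<integral>\<^sup>+x. B x \<partial>M) ^ n \<le> ennreal \<gamma> ^ n" by (intro power_mono) auto
    also have "\<dots> = (\<Prod>i\<in>I. \<integral>\<^sup>+x. C i x \<partial>M)"
      using \<gamma> c by (simp add: ennreal_power prod_ennreal less_imp_le)
    finally show ?thesis by (simp add: n_def)
  qed
qed

lemma rooted_holder_const:
  fixes C :: "'i \<Rightarrow> 'a \<Rightarrow> ennreal" and B :: "'a \<Rightarrow> ennreal"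
  assumes I: "finite I" "I \<noteq> {}"
    and [measurable]: "B \<in> borel_measurable M" "\<And>i. i \<in> I \<Longrightarrow> C i \<in> borel_measurable M"
    and le: "\<And>x. x \<in> space M \<Longrightarrow> B x ^ card I \<le> K * (\<Prod>i\<in>I. C i x)"
  shows "(\<integral>\<^sup>+x. B x \<partial>M) ^ card I \<le> K * (\<Prod>i\<in>I. \<integral>\<^sup>+x. C i x \<partial>M)"
proof -
  obtain j where j: "j \<in> I" using I by auto
  define C' where "C' i x = (if i = j then K * C i x else C i x)" for i x
  have eq: "(\<Prod>i\<in>I. f i (if i = j then K * D i else D i)) = K * (\<Prod>i\<in>I. D i)"
    if "\<And>i x. f i x = x" for f :: "'i \<Rightarrow> ennreal \<Rightarrow> ennreal" and D :: "'i \<Rightarrow> ennreal"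
    using I j unfolding that by (simp add: prod.remove[of I j] mult.assoc)
  have "(\<integral>\<^sup>+x. B x \<partial>M) ^ card I \<le> (\<Prod>i\<in>I. \<integral>\<^sup>+x. C' i x \<partial>M)"
    using le eq[of "\<lambda>i x. x"] by (intro rooted_holder I) (auto simp: C'_def)
  also have "\<dots> = (\<Prod>i\<in>I. if i = j then K * (\<integral>\<^sup>+x. C i x \<partial>M) else (\<integral>\<^sup>+x. C i x \<partial>M))"
    by (intro prod.cong) (auto simp: C'_def nn_integral_cmult)
  also have "\<dots> = K * (\<Prod>i\<in>I. \<integral>\<^sup>+x. C i x \<partial>M)" using eq[of "\<lambda>i x. x"] by simp
  finally show ?thesis .
qed

text \<open>The induction is over the set \<open>J\<close> of coordinates integrated so far while
  the index set \<open>K\<close>, and with it the exponent, stays fixed. Integrating one more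
  coordinate \<open>j\<close> leaves the factor \<open>H\<^sub>j\<close> untouched, and Hoelder's
  inequality handles the other \<open>card K - 1\<close> factors.\<close>

lemma (in product_sigma_finite) loomis_whitney_PiM:
  fixes H :: "'i \<Rightarrow> ('i \<Rightarrow> 'a) \<Rightarrow> ennreal" and B :: "('i \<Rightarrow> 'a) \<Rightarrow> ennreal"
  assumes K: "finite K" "card K \<ge> 2" and J: "J \<subseteq> K"
    and [measurable]: "B \<in> borel_measurable (PiM J M)"
      "\<And>i. i \<in> K \<Longrightarrow> H i \<in> borel_measurable (PiM (J - {i}) M)"
    and le: "\<And>x. x \<in> space (PiM J M) \<Longrightarrow> B x ^ (card K - 1) \<le> (\<Prod>i\<in>K. H i (restrict x (J - {i})))"
  shows "(\<integral>\<^sup>+x. B x \<partial>PiM J M) ^ (card K - 1) \<le> (\<Prod>i\<in>K. \<integral>\<^sup>+x. H i x \<partial>PiM (J - {i}) M)"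
proof -
  have "finite J" using J K(1) finite_subset by blast
  then show ?thesis using J assms(4-)
  proof (induction J arbitrary: B H)
    case empty
    then show ?case by (simp add: nn_integral_empty space_PiM_empty)
  next
    case (insert j J)
    note [measurable] = insert.prems(2,3)
    have jK: "j \<in> K" and JK: "J \<subseteq> K" using insert.prems by auto
    have ins: "insert j J - {i} = insert j (J - {i})" if "i \<noteq> j" for i using that by auto
    have Hm: "H i \<in> borel_measurable (PiM (insert j (J - {i})) M)" if "i \<in> K - {j}" for i
      using insert.prems(3)[of i] ins[of i] that by (metis Diff_iff singletonI)
    have Hj: "H j \<in> borel_measurable (PiM J M)"
      using insert.prems(3)[OF jK] insert.hyps by simp
    define B' where "B' t = (\<integral>\<^sup>+x. B (x(j := t)) \<partial>PiM J M)" for t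
    define H' where "H' i t = (\<integral>\<^sup>+x. H i (x(j := t)) \<partial>PiM (J - {i}) M)" for i t
    have B'_meas: "B' \<in> borel_measurable (M j)"
      unfolding B'_def by (intro sigma_finite_measure.borel_measurable_nn_integral sigma_finite insert.hyps) measurable
    have H'_meas: "H' i \<in> borel_measurable (M j)" if "i \<in> K - {j}" for i
    proof -
      have upd: "(\<lambda>p. (snd p)(j := fst p)) \<in> M j \<Otimes>\<^sub>M PiM (J - {i}) M \<rightarrow>\<^sub>M PiM (insert j (J - {i})) M"
        by (rule measurable_fun_upd[where J="J - {i}"]) auto
      show ?thesis
        unfolding H'_def
        using measurable_compose[OF upd Hm[OF that]] insert.hyps
        by (intro sigma_finite_measure.borel_measurable_nn_integral sigma_finite) (simp_all add: case_prod_beta)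
    qed
    define c where "c = (\<integral>\<^sup>+x. H j x \<partial>PiM J M)"
    have step: "B' t ^ (card K - 1) \<le> c * (\<Prod>i\<in>K - {j}. H' i t)" if t: "t \<in> space (M j)" for t
    proof -
      define H2 where "H2 i x = (if i = j then H j x else H i (x(j := t)))" for i x
      have "B' t ^ (card K - 1) \<le> (\<Prod>i\<in>K. \<integral>\<^sup>+x. H2 i x \<partial>PiM (J - {i}) M)"
        unfolding B'_def
      proof (rule insert.IH[OF JK])
        show "(\<lambda>x. B (x(j := t))) \<in> borel_measurable (Pi\<^sub>M J M)" using t by measurable
        show "H2 i \<in> borel_measurable (Pi\<^sub>M (J - {i}) M)" if "i \<in> K" for i
        proof (cases "i = j")
          case True
          then show ?thesis using Hj insert.hyps by (simp add: H2_def[abs_def])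
        next
          case False
          note [measurable] = Hm[of i]
          show ?thesis using t False that by (simp add: H2_def[abs_def])
        qed
        fix x assume x: "x \<in> space (Pi\<^sub>M J M)"
        have xt: "x(j := t) \<in> space (PiM (insert j J) M)"
          using x t by (auto simp: space_PiM PiE_def extensional_def)
        have "B (x(j := t)) ^ (card K - 1) \<le> (\<Prod>i\<in>K. H i (restrict (x(j := t)) (insert j J - {i})))"
          by (rule insert.prems(4)[OF xt])
        also have "\<dots> = (\<Prod>i\<in>K. H2 i (restrict x (J - {i})))"
        proof (rule prod.cong[OF refl])
          fix i assume "i \<in> K"
          have "restrict (x(j := t)) (insert j J - {i}) = (if i = j then restrict x (J - {i}) else (restrict x (J - {i}))(j := t))"
            using insert.hyps by (auto simp: restrict_def fun_eq_iff)
          then show "H i (restrict (x(j := t)) (insert j J - {i})) = H2 i (restrict x (J - {i}))"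
            by (simp add: H2_def)
        qed
        finally show "B (x(j := t)) ^ (card K - 1) \<le> (\<Prod>i\<in>K. H2 i (restrict x (J - {i})))" .
      qed
      also have "\<dots> = c * (\<Prod>i\<in>K - {j}. H' i t)"
        using K jK insert.hyps by (subst prod.remove[of K j]) (auto simp: H2_def[abs_def] c_def H'_def intro!: arg_cong2[where f="(*)"] prod.cong)
      finally show ?thesis .
    qed
    have cardK: "card (K - {j}) = card K - 1" using K jK by simp
    have "(\<integral>\<^sup>+x. B x \<partial>PiM (insert j J) M) = (\<integral>\<^sup>+t. B' t \<partial>M j)"
      unfolding B'_def using insert.hyps by (subst product_nn_integral_insert_rev) auto
    then have "(\<integral>\<^sup>+x. B x \<partial>PiM (insert j J) M) ^ (card K - 1) = (\<integral>\<^sup>+t. B' t \<partial>M j) ^ card (K - {j})"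
      by (simp add: cardK)
    also have "\<dots> \<le> c * (\<Prod>i\<in>K - {j}. \<integral>\<^sup>+t. H' i t \<partial>M j)"
    proof (rule rooted_holder_const)
      show "finite (K - {j})" using K by simp
      have "card (K - {j}) \<noteq> 0" using K cardK by simp
      then show "K - {j} \<noteq> {}" by (metis card.empty)
      show "B' t ^ card (K - {j}) \<le> c * (\<Prod>i\<in>K - {j}. H' i t)" if "t \<in> space (M j)" for t
        using step[OF that] by (simp add: cardK)
    qed (use B'_meas H'_meas in auto)
    also have "\<dots> = c * (\<Prod>i\<in>K - {j}. \<integral>\<^sup>+x. H i x \<partial>PiM (insert j J - {i}) M)"
    proof (intro arg_cong2[where f="(*)"] refl prod.cong)
      fix i assume i: "i \<in> K - {j}"
      show "(\<integral>\<^sup>+t. H' i t \<partial>M j) = (\<integral>\<^sup>+x. H i x \<partial>PiM (insert j J - {i}) M)"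
        using i insert.hyps Hm[OF i] ins[of i] unfolding H'_def by (simp add: product_nn_integral_insert_rev)
    qed
    also have "\<dots> = (\<Prod>i\<in>K. \<integral>\<^sup>+x. H i x \<partial>PiM (insert j J - {i}) M)"
      using K jK insert.hyps
        prod.remove[of K j "\<lambda>i. \<integral>\<^sup>+x. H i x \<partial>PiM (insert j J - {i}) M"]
      by (simp add: c_def)
    finally show ?case .
  qed
qed

section \<open>The fundamental lemma of the calculus of variations\<close>

text \<open>The indicator of a box is a bounded pointwise limit of test functions.\<close>

lemma integral_test_eq_0_imp_integral_box_eq_0:
  fixes g :: "real^'n::finite \<Rightarrow> real"
  assumes g: "locally_integrable \<Omega> g"
    and zero: "\<And>\<psi>. \<psi> \<in> test_functions \<Omega> \<Longrightarrow> (\<integral>x. g x * \<psi> x \<partial>lebesgue_on \<Omega>) = 0"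
    and \<Omega>: "\<Omega> \<in> sets lebesgue"
    and ab: "\<And>i. a $ i < b $ i" "cbox a b \<subseteq> \<Omega>"
  shows "(\<integral>x. indicator (box a b) x * g x \<partial>lebesgue) = 0"
proof -
  define G where "G x = indicator (cbox a b) x * g x" for x
  have G: "integrable lebesgue G"
    using g ab unfolding locally_integrable_def set_integrable_def G_def[abs_def] by auto
  let ?\<psi> = "\<lambda>n. box_bump (1 / real (Suc n)) a b"
  have b_meas: "?\<psi> n \<in> borel_measurable lebesgue" for n
  proof -
    have "continuous_on UNIV (?\<psi> n)"
      by (rule C1c_continuous[OF test_function_C1c[OF box_bump_test_function[OF ab]]]) auto
    then show ?thesis by (intro measurable_completion) (auto intro: borel_measurable_continuous_onI)
  qed
  have "(\<lambda>n. \<integral>x. G x * ?\<psi> n x \<partial>lebesgue) \<longlonglongrightarrow> (\<integral>x. G x * indicator (box a b) x \<partial>lebesgue)"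
  proof (rule integral_dominated_convergence)
    show "integrable lebesgue (\<lambda>x. norm (G x))" using G by (rule integrable_norm)
    show "AE x in lebesgue. (\<lambda>n. G x * ?\<psi> n x) \<longlonglongrightarrow> G x * indicator (box a b) x"
      by (intro AE_I2 tendsto_mult tendsto_const box_bump_tendsto ab)
    show "AE x in lebesgue. norm (G x * ?\<psi> n x) \<le> norm (G x)" for n
      using box_bump_values(1,2)[OF ab(1), of "1 / real (Suc n)"]
      by (intro AE_I2) (auto simp: abs_mult intro!: mult_left_le)
    show "(\<lambda>x. G x * ?\<psi> n x) \<in> borel_measurable lebesgue" for n
      using G b_meas by (intro borel_measurable_times) auto
    show "(\<lambda>x. G x * indicator (box a b) x) \<in> borel_measurable lebesgue"
      using G by (intro borel_measurable_times borel_measurable_indicator) auto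
  qed
  moreover have "(\<integral>x. G x * ?\<psi> n x \<partial>lebesgue) = 0" for n
  proof -
    have "(\<integral>x. G x * ?\<psi> n x \<partial>lebesgue) = (\<integral>x. indicator \<Omega> x *\<^sub>R (g x * ?\<psi> n x) \<partial>lebesgue)"
    proof (rule Bochner_Integration.integral_cong[OF refl])
      fix x
      show "G x * ?\<psi> n x = indicator \<Omega> x *\<^sub>R (g x * ?\<psi> n x)"
        using box_bump_values(3)[OF ab(1), of "1 / real (Suc n)" x] ab(2) box_subset_cbox[of a b]
        by (auto simp: G_def indicator_def)
    qed
    also have "\<dots> = (\<integral>x. g x * ?\<psi> n x \<partial>lebesgue_on \<Omega>)"
      using \<Omega> by (simp add: integral_restrict_space)
    also have "\<dots> = 0" by (intro zero box_bump_test_function ab) auto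
    finally show ?thesis .
  qed
  ultimately have "(\<integral>x. G x * indicator (box a b) x \<partial>lebesgue) = 0"
    by (simp add: LIMSEQ_const_iff)
  moreover have "G x * indicator (box a b) x = indicator (box a b) x * g x" for x
    using box_subset_cbox[of a b] by (auto simp: G_def indicator_def)
  ultimately show ?thesis by simp
qed

text \<open>The densities given by the positive and the negative part of \<open>G\<close> agree on
  boxes, which generate the Borel sets and are stable under intersection.\<close>

lemma AE_eq_0_if_integral_boxes_eq_0:
  fixes G :: "'a::euclidean_space \<Rightarrow> real"
  assumes G: "integrable lborel G"
    and zero: "\<And>c d. (\<integral>x. indicator (box c d) x * G x \<partial>lborel) = 0"
  shows "AE x in lborel. G x = 0"
proof -
  have [measurable]: "G \<in> borel_measurable borel" using G by auto
  have fin: "(\<integral>\<^sup>+x. ennreal (G x) \<partial>lborel) < \<infinity>" "(\<integral>\<^sup>+x. ennreal (- G x) \<partial>lborel) < \<infinity>"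
    using G by (auto simp: real_integrable_def less_top)
  let ?E = "range (\<lambda>(a, b). box a b::'a set)"
  have eq: "density lborel (\<lambda>x. ennreal (G x)) = density lborel (\<lambda>x. ennreal (- G x))"
  proof (rule measure_eqI_generator_eq)
    show "Int_stable ?E"
      by (auto simp: Int_stable_def box_Int_box)
    show "?E \<subseteq> Pow UNIV" "sets (density lborel (\<lambda>x. ennreal (G x))) = sigma_sets UNIV ?E"
      "sets (density lborel (\<lambda>x. ennreal (- G x))) = sigma_sets UNIV ?E"
      by (simp_all add: borel_eq_box)
    let ?A = "\<lambda>n::nat. box (- (real n *\<^sub>R One)) (real n *\<^sub>R One) :: 'a set"
    show "range ?A \<subseteq> ?E" "(\<Union>i. ?A i) = UNIV"
      unfolding UN_box_eq_UNIV by auto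
    show "emeasure (density lborel (\<lambda>x. ennreal (G x))) (?A i) \<noteq> \<infinity>" for i
    proof -
      have "emeasure (density lborel (\<lambda>x. ennreal (G x))) (?A i) \<le> (\<integral>\<^sup>+x. ennreal (G x) \<partial>lborel)"
        by (subst emeasure_density) (auto intro!: nn_integral_mono simp: indicator_def)
      then show ?thesis using fin(1) by (auto simp: top_unique)
    qed
    show "emeasure (density lborel (\<lambda>x. ennreal (G x))) X = emeasure (density lborel (\<lambda>x. ennreal (- G x))) X"
      if X: "X \<in> ?E" for X
    proof -
      have Xm[measurable]: "X \<in> sets borel" using X by auto
      let ?G = "\<lambda>x. indicator X x * G x"
      have i: "integrable lborel ?G"
        using integrable_mult_indicator[OF _ G, of X] Xm by simp
      have f: "(\<integral>\<^sup>+x. ennreal (?G x) \<partial>lborel) \<noteq> \<infinity>" "(\<integral>\<^sup>+x. ennreal (- ?G x) \<partial>lborel) \<noteq> \<infinity>"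
        using i by (auto simp: real_integrable_def)
      have "0 = (\<integral>x. ?G x \<partial>lborel)" using X zero by auto
      also have "\<dots> = enn2real (\<integral>\<^sup>+x. ennreal (?G x) \<partial>lborel) - enn2real (\<integral>\<^sup>+x. ennreal (- ?G x) \<partial>lborel)"
        by (rule real_lebesgue_integral_def[OF i])
      finally have "ennreal (enn2real (\<integral>\<^sup>+x. ennreal (?G x) \<partial>lborel)) = ennreal (enn2real (\<integral>\<^sup>+x. ennreal (- ?G x) \<partial>lborel))"
        by simp
      then have "(\<integral>\<^sup>+x. ennreal (?G x) \<partial>lborel) = (\<integral>\<^sup>+x. ennreal (- ?G x) \<partial>lborel)"
        using f by (simp only: ennreal_enn2real less_top infinity_ennreal_def)
      moreover have "(\<integral>\<^sup>+x. ennreal (?G x) \<partial>lborel) = (\<integral>\<^sup>+x. ennreal (G x) * indicator X x \<partial>lborel)"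
        "(\<integral>\<^sup>+x. ennreal (- ?G x) \<partial>lborel) = (\<integral>\<^sup>+x. ennreal (- G x) * indicator X x \<partial>lborel)"
        by (auto intro!: nn_integral_cong simp: indicator_def)
      ultimately show ?thesis by (simp add: emeasure_density)
    qed
  qed
  have "AE x in lborel. ennreal (G x) = ennreal (- G x)"
    using finite_density_unique[THEN iffD1, OF _ _ _ _ _ eq] fin by auto
  then show ?thesis
  proof eventually_elim
    case (elim x)
    then show ?case
      by (cases "G x" "0::real" rule: linorder_cases) (auto simp: ennreal_neg ennreal_eq_0_iff)
  qed
qed

lemma fundamental_lemma:
  fixes g :: "real^'n::finite \<Rightarrow> real"
  assumes g: "locally_integrable \<Omega> g" and \<Omega>: "open \<Omega>"
    and zero: "\<And>\<psi>. \<psi> \<in> test_functions \<Omega> \<Longrightarrow> (\<integral>x. g x * \<psi> x \<partial>lebesgue_on \<Omega>) = 0"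
  shows "AE x in lebesgue_on \<Omega>. g x = 0"
proof -
  have \<Omega>m: "\<Omega> \<in> sets lebesgue" using \<Omega> by auto
  have box0: "AE x in lebesgue. x \<in> cbox a b \<longrightarrow> g x = 0" if ab: "cbox a b \<subseteq> \<Omega>" for a b
  proof -
    define G where "G x = indicator (box a b) x * g x" for x
    have "set_integrable lebesgue (cbox a b) g" using g ab by (auto simp: locally_integrable_def)
    then have "set_integrable lebesgue (box a b) g"
      by (rule set_integrable_subset) (auto simp: box_subset_cbox)
    then have G: "integrable lebesgue G" by (simp add: G_def[abs_def] set_integrable_def)
    obtain G' where G'[measurable]: "G' \<in> borel_measurable lborel" and GG': "AE x in lborel. G x = G' x"
      using completion_ex_borel_measurable_real[OF borel_measurable_integrable[OF G]] by blast
    have GG'2: "AE x in lebesgue. G x = G' x" by (rule AE_completion[OF GG'])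
    have "integrable lebesgue G'"
      by (rule integrable_cong_AE_imp[OF G measurable_completion[OF G'] GG'2])
    then have iG': "integrable lborel G'" by (simp add: integrable_completion)
    have "(\<integral>x. indicator (box c d) x * G' x \<partial>lborel) = 0" for c d
    proof -
      have "(\<integral>x. indicator (box c d) x * G' x \<partial>lborel) = (\<integral>x. indicator (box c d) x * G' x \<partial>lebesgue)"
        by (rule integral_completion[symmetric]) measurable
      also have "\<dots> = (\<integral>x. indicator (box c d) x * G x \<partial>lebesgue)"
      proof (rule integral_cong_AE)
        show "(\<lambda>x. indicator (box c d) x * G' x) \<in> borel_measurable lebesgue"
          by (intro measurable_completion) measurable
        show "(\<lambda>x. indicator (box c d) x * G x) \<in> borel_measurable lebesgue"
          using G by (intro borel_measurable_times borel_measurable_indicator) auto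
        show "AE x in lebesgue. indicator (box c d) x * G' x = indicator (box c d) x * G x"
          using GG'2 by eventually_elim simp
      qed
      also have "\<dots> = 0"
      proof -
        obtain p q where pq: "box c d \<inter> box a b = box p q" by (simp add: box_Int_box)
        have eq: "indicator (box c d) x * G x = indicator (box p q) x * g x" for x
          unfolding pq[symmetric] G_def by (auto simp: indicator_def)
        show ?thesis
        proof (cases "box p q = {}")
          case True
          then show ?thesis unfolding eq by simp
        next
          case False
          then obtain z where z: "z \<in> box p q" by auto
          have "p $ i < q $ i" for i
          proof -
            have "p $ i < z $ i" "z $ i < q $ i" using z by (auto simp: mem_box_cart)
            then show ?thesis by simp
          qed
          moreover have "cbox p q \<subseteq> cbox a b"
            using pq False by (metis closure_box closure_mono inf_le2 bot.extremum_uniqueI)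
          ultimately show ?thesis unfolding eq
            using ab by (intro integral_test_eq_0_imp_integral_box_eq_0[OF g zero \<Omega>m]) auto
        qed
      qed
      finally show ?thesis .
    qed
    then have "AE x in lborel. G' x = 0" by (intro AE_eq_0_if_integral_boxes_eq_0 iG')
    then have "AE x in lebesgue. G' x = 0" by (rule AE_completion)
    moreover have "AE x in lebesgue. x \<notin> cbox a b - box a b"
      using negligible_frontier_interval[of a b] by (intro AE_not_in) (simp add: negligible_iff_null_sets)
    ultimately show ?thesis
      using GG'2 by eventually_elim (auto simp: G_def indicator_def split: if_splits)
  qed
  obtain D where D: "countable D" "D \<subseteq> Pow \<Omega>" "\<And>X. X \<in> D \<Longrightarrow> \<exists>a b. X = cbox a b" "\<Union>D = \<Omega>"
    using open_countable_Union_open_cbox[OF \<Omega>] by metis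
  have "AE x in lebesgue. \<forall>X\<in>D. x \<in> X \<longrightarrow> g x = 0"
    using D(1)
  proof (rule AE_ball_countable[THEN iffD2], intro ballI)
    fix X assume X: "X \<in> D"
    then obtain a b where "X = cbox a b" using D(3) by blast
    then show "AE x in lebesgue. x \<in> X \<longrightarrow> g x = 0" using box0 D(2) X by auto
  qed
  then have "AE x in lebesgue. x \<in> \<Omega> \<longrightarrow> g x = 0"
    by eventually_elim (use D(4) in auto)
  then show ?thesis using \<Omega>m by (subst AE_restrict_space_iff) auto
qed

section \<open>The Gagliardo--Nirenberg inequality\<close>

lemma C1c_measurable:
  assumes "C1c w g"
  shows "w \<in> borel_measurable borel" "g \<in> borel_measurable borel"
  using assms C1c_continuous[OF assms] by (auto simp: C1c_def intro!: borel_measurable_continuous_onI)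

lemma nn_integral_lborel_shift:
  fixes f :: "'a::euclidean_space \<Rightarrow> ennreal"
  assumes "f \<in> borel_measurable borel"
  shows "(\<integral>\<^sup>+x. f (x + h) \<partial>lborel) = (\<integral>\<^sup>+x. f x \<partial>lborel)"
  using assms nn_integral_distr[of "(+) h" lborel borel f]
  by (simp add: lborel_distr_plus add.commute)

lemma C1c_increment_bound:
  assumes wg: "C1c w g" and ab: "a \<le> b"
  shows "ennreal \<bar>w (x + b *\<^sub>R e) - w (x + a *\<^sub>R e)\<bar> \<le> (\<integral>\<^sup>+t. ennreal (\<bar>e \<bullet> g (x + t *\<^sub>R e)\<bar> * indicator {a..b} t) \<partial>lborel)"
proof -
  have "continuous_on UNIV (\<lambda>t. e \<bullet> g (x + t *\<^sub>R e))"
    using wg by (auto simp: C1c_def intro!: continuous_intros elim!: continuous_on_compose2)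
  then have "has_bochner_integral lborel (\<lambda>t. (e \<bullet> g (x + t *\<^sub>R e)) * indicator {a..b} t)
      (w (x + b *\<^sub>R e) - w (x + a *\<^sub>R e))"
    using ab by (intro has_bochner_integral_FTC_Icc_real[where F="\<lambda>t. w (x + t *\<^sub>R e)"] C1c_line_derivative[OF wg])
       (auto simp: continuous_on_eq_continuous_at)
  then have *: "integrable lborel (\<lambda>t. (e \<bullet> g (x + t *\<^sub>R e)) * indicator {a..b} t)"
    "(\<integral>t. (e \<bullet> g (x + t *\<^sub>R e)) * indicator {a..b} t \<partial>lborel) = w (x + b *\<^sub>R e) - w (x + a *\<^sub>R e)"
    by (auto simp: has_bochner_integral_iff)
  have "ennreal \<bar>w (x + b *\<^sub>R e) - w (x + a *\<^sub>R e)\<bar> \<le> (\<integral>\<^sup>+t. norm ((e \<bullet> g (x + t *\<^sub>R e)) * indicator {a..b} t) \<partial>lborel)"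
    using integral_norm_bound_ennreal[OF *(1)] *(2) by simp
  then show ?thesis by (simp add: abs_mult)
qed

lemma C1c_line_bound:
  assumes wg: "C1c w g" and e: "norm e = 1"
  shows "ennreal \<bar>w x\<bar> \<le> (\<integral>\<^sup>+t. ennreal \<bar>e \<bullet> g (x + t *\<^sub>R e)\<bar> \<partial>lborel)"
proof -
  obtain R where R: "R > 0" "\<And>x. norm x > R \<Longrightarrow> w x = 0 \<and> g x = 0"
    using wg by (auto simp: C1c_def)
  define s where "s = - (R + norm x + 1)"
  have s: "s \<le> 0" using R(1) norm_ge_zero[of x] unfolding s_def by linarith
  have "norm (s *\<^sub>R e) \<le> norm (x + s *\<^sub>R e) + norm x"
    using norm_triangle_ineq4[of "x + s *\<^sub>R e" x] by simp
  moreover have "norm (s *\<^sub>R e) = - s" using e s by simp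
  then have "norm (s *\<^sub>R e) = R + norm x + 1" by (simp add: s_def)
  ultimately have "w (x + s *\<^sub>R e) = 0" using R(2) by simp
  then have "ennreal \<bar>w x\<bar> \<le> (\<integral>\<^sup>+t. ennreal (\<bar>e \<bullet> g (x + t *\<^sub>R e)\<bar> * indicator {s..0} t) \<partial>lborel)"
    using C1c_increment_bound[OF wg s, of x e] by simp
  also have "\<dots> \<le> (\<integral>\<^sup>+t. ennreal \<bar>e \<bullet> g (x + t *\<^sub>R e)\<bar> \<partial>lborel)"
    by (intro nn_integral_mono ennreal_leI) (auto simp: indicator_def)
  finally show ?thesis .
qed

text \<open>The function \<open>|w|\<close> is bounded by the integral of
  \<open>|\<partial>\<^sub>e w|\<close> over each line in a coordinate direction
  \<open>e\<close>, and this integral does not depend on the coordinate \<open>e\<close>. Multiply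
  these bounds and apply the Loomis--Whitney inequality. As there, \<open>B\<close> stands for
  \<open>|w|\<^sup>N\<^sup>/\<^sup>(\<^sup>N\<^sup>-\<^sup>1\<^sup>)\<close>.\<close>

lemma gagliardo_nirenberg:
  fixes w :: "'a::euclidean_space \<Rightarrow> real" and B :: "'a \<Rightarrow> ennreal"
  assumes wg: "C1c w g" and dim: "DIM('a) \<ge> 2"
    and [measurable]: "B \<in> borel_measurable borel"
    and B: "\<And>x. B x ^ (DIM('a) - 1) \<le> ennreal \<bar>w x\<bar> ^ DIM('a)"
  shows "(\<integral>\<^sup>+x. B x \<partial>lborel) ^ (DIM('a) - 1) \<le> (\<Prod>e\<in>Basis. \<integral>\<^sup>+x. ennreal \<bar>e \<bullet> g x\<bar> \<partial>lborel)"
proof -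
  interpret product_sigma_finite "\<lambda>_::'a. lborel :: real measure" ..
  define P where "P x = (\<Sum>b\<in>Basis. x b *\<^sub>R b)" for x :: "'a \<Rightarrow> real"
  have lb: "lborel = distr (PiM Basis (\<lambda>_. lborel)) borel P"
    unfolding P_def[abs_def] by (rule lborel_eq)
  have Pm[measurable]: "P \<in> borel_measurable (PiM Basis (\<lambda>_. lborel))"
    unfolding P_def[abs_def] by measurable
  have gm[measurable]: "g \<in> borel_measurable borel" by (rule C1c_measurable[OF wg])
  \<comment> \<open>the integral of the partial derivative over the line through \<open>y\<close> in direction \<open>e\<close>\<close>
  define H where "H e y = (\<integral>\<^sup>+t. ennreal \<bar>e \<bullet> g (P (y(e := t)))\<bar> \<partial>lborel)" for e y
  have upd: "(\<lambda>p. (fst p)(e := snd p)) \<in> PiM (Basis - {e}) (\<lambda>_. lborel) \<Otimes>\<^sub>M lborel \<rightarrow>\<^sub>M PiM Basis (\<lambda>_. lborel)"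
    if "e \<in> Basis" for e :: 'a
    using that by (intro measurable_fun_upd[where J="Basis - {e}"]) auto
  have Hm: "H e \<in> borel_measurable (PiM (Basis - {e}) (\<lambda>_. lborel))" if e: "e \<in> Basis" for e
  proof -
    have "(\<lambda>p. ennreal \<bar>e \<bullet> g (P ((fst p)(e := snd p)))\<bar>) \<in> borel_measurable (PiM (Basis - {e}) (\<lambda>_. lborel) \<Otimes>\<^sub>M lborel)"
      using measurable_compose[OF upd[OF e] Pm] by measurable
    then show ?thesis
      unfolding H_def[abs_def]
      by (intro sigma_finite_measure.borel_measurable_nn_integral sigma_finite_lborel) (simp add: case_prod_beta)
  qed
  have Pupd: "P (x(e := t)) = P x + (t - x e) *\<^sub>R e" if "e \<in> Basis" for x e t
  proof -
    have "P (x(e := t)) = t *\<^sub>R e + (\<Sum>b\<in>Basis - {e}. x b *\<^sub>R b)"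
      unfolding P_def using that by (subst sum.remove[of _ e]) (auto intro!: sum.cong)
    moreover have "P x = x e *\<^sub>R e + (\<Sum>b\<in>Basis - {e}. x b *\<^sub>R b)"
      unfolding P_def using that by (subst sum.remove[of _ e]) auto
    ultimately show ?thesis by (simp add: algebra_simps)
  qed
  have line: "ennreal \<bar>w (P x)\<bar> \<le> H e (restrict x (Basis - {e}))" if e: "e \<in> Basis" for e x
  proof -
    have "ennreal \<bar>w (P x)\<bar> \<le> (\<integral>\<^sup>+t. ennreal \<bar>e \<bullet> g (P x + t *\<^sub>R e)\<bar> \<partial>lborel)"
      using e by (intro C1c_line_bound wg) auto
    also have "\<dots> = (\<integral>\<^sup>+t. ennreal \<bar>e \<bullet> g (P x + (t + (- x e)) *\<^sub>R e)\<bar> \<partial>lborel)"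
      by (rule nn_integral_lborel_shift[symmetric, where f="\<lambda>t. ennreal \<bar>e \<bullet> g (P x + t *\<^sub>R e)\<bar>"]) measurable
    also have "\<dots> = (\<integral>\<^sup>+t. ennreal \<bar>e \<bullet> g (P (x(e := t)))\<bar> \<partial>lborel)"
      using Pupd[OF e, of x] by simp
    also have "\<dots> = H e (restrict x (Basis - {e}))"
    proof -
      have "P ((restrict x (Basis - {e}))(e := t)) = P (x(e := t))" for t
        unfolding P_def by (intro sum.cong) auto
      then show ?thesis by (simp add: H_def)
    qed
    finally show ?thesis .
  qed
  have "(\<integral>\<^sup>+x. B x \<partial>lborel) = (\<integral>\<^sup>+x. B (P x) \<partial>PiM Basis (\<lambda>_. lborel))"
    by (subst lb, subst nn_integral_distr) auto
  then have "(\<integral>\<^sup>+x. B x \<partial>lborel) ^ (DIM('a) - 1) = (\<integral>\<^sup>+x. B (P x) \<partial>PiM Basis (\<lambda>_. lborel)) ^ (DIM('a) - 1)"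
    by simp
  also have "\<dots> \<le> (\<Prod>e\<in>Basis. \<integral>\<^sup>+x. H e x \<partial>PiM (Basis - {e}) (\<lambda>_. lborel))"
  proof (rule loomis_whitney_PiM[OF _ _ subset_refl])
    fix x
    have "B (P x) ^ (DIM('a) - 1) \<le> (\<Prod>e\<in>(Basis::'a set). ennreal \<bar>w (P x)\<bar>)"
      using B[of "P x"] by simp
    also have "\<dots> \<le> (\<Prod>e\<in>Basis. H e (restrict x (Basis - {e})))"
      by (intro prod_mono_ennreal line)
    finally show "B (P x) ^ (DIM('a) - 1) \<le> (\<Prod>e\<in>Basis. H e (restrict x (Basis - {e})))" .
  qed (use dim Hm in auto)
  also have "\<dots> = (\<Prod>e\<in>Basis. \<integral>\<^sup>+x. ennreal \<bar>e \<bullet> g x\<bar> \<partial>lborel)"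
  proof (rule prod.cong[OF refl])
    fix e :: 'a assume e: "e \<in> Basis"
    have ins: "insert e (Basis - {e}) = Basis" using e by auto
    have m: "(\<lambda>x. ennreal \<bar>e \<bullet> g (P x)\<bar>) \<in> borel_measurable (PiM Basis (\<lambda>_. lborel))" by measurable
    have "(\<integral>\<^sup>+x. ennreal \<bar>e \<bullet> g x\<bar> \<partial>lborel) = (\<integral>\<^sup>+x. ennreal \<bar>e \<bullet> g (P x)\<bar> \<partial>PiM Basis (\<lambda>_. lborel))"
      by (subst lb, subst nn_integral_distr) auto
    also have "\<dots> = (\<integral>\<^sup>+x. H e x \<partial>PiM (Basis - {e}) (\<lambda>_. lborel))"
      using product_nn_integral_insert[of "Basis - {e}" e "\<lambda>x. ennreal \<bar>e \<bullet> g (P x)\<bar>"] m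
      unfolding ins H_def by simp
    finally show "(\<integral>\<^sup>+x. H e x \<partial>PiM (Basis - {e}) (\<lambda>_. lborel)) = (\<integral>\<^sup>+x. ennreal \<bar>e \<bullet> g x\<bar> \<partial>lborel)" by simp
  qed
  finally show ?thesis .
qed

section \<open>Rellich compactness in L1\<close>

lemma C1c_translation_estimate:
  fixes w :: "'a::euclidean_space \<Rightarrow> real"
  assumes wg: "C1c w g"
  shows "(\<integral>\<^sup>+x. ennreal \<bar>w (x + h) - w x\<bar> \<partial>lborel) \<le> ennreal (norm h) * (\<integral>\<^sup>+x. ennreal (norm (g x)) \<partial>lborel)"
proof -
  note [measurable] = C1c_measurable[OF wg]
  let ?I = "indicator {0..1::real} :: real \<Rightarrow> ennreal"
  have "(\<integral>\<^sup>+x. ennreal \<bar>w (x + h) - w x\<bar> \<partial>lborel)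
      \<le> (\<integral>\<^sup>+x. (\<integral>\<^sup>+t. ennreal (norm h) * ennreal (norm (g (x + t *\<^sub>R h))) * ?I t \<partial>lborel) \<partial>lborel)"
  proof (rule nn_integral_mono)
    fix x
    have "ennreal \<bar>w (x + h) - w x\<bar> \<le> (\<integral>\<^sup>+t. ennreal (\<bar>h \<bullet> g (x + t *\<^sub>R h)\<bar> * indicator {0..1} t) \<partial>lborel)"
      using C1c_increment_bound[OF wg, of 0 1 x h] by simp
    also have "\<dots> \<le> (\<integral>\<^sup>+t. ennreal (norm h) * ennreal (norm (g (x + t *\<^sub>R h))) * ?I t \<partial>lborel)"
      by (intro nn_integral_mono)
         (auto simp: indicator_def ennreal_mult[symmetric] intro!: ennreal_leI Cauchy_Schwarz_ineq2)
    finally show "ennreal \<bar>w (x + h) - w x\<bar> \<le> \<dots>" .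
  qed
  also have "\<dots> = (\<integral>\<^sup>+t. (\<integral>\<^sup>+x. ennreal (norm h) * ennreal (norm (g (x + t *\<^sub>R h))) * ?I t \<partial>lborel) \<partial>lborel)"
    by (rule lborel_pair.Fubini') measurable
  also have "\<dots> = (\<integral>\<^sup>+t. ennreal (norm h) * (\<integral>\<^sup>+x. ennreal (norm (g x)) \<partial>lborel) * ?I t \<partial>lborel)"
  proof (rule nn_integral_cong)
    fix t :: real
    have "(\<integral>\<^sup>+x. ennreal (norm h) * ennreal (norm (g (x + t *\<^sub>R h))) * ?I t \<partial>lborel)
        = ennreal (norm h) * (\<integral>\<^sup>+x. ennreal (norm (g (x + t *\<^sub>R h))) \<partial>lborel) * ?I t"
      by (simp add: nn_integral_cmult nn_integral_multc)
    also have "(\<integral>\<^sup>+x. ennreal (norm (g (x + t *\<^sub>R h))) \<partial>lborel) = (\<integral>\<^sup>+x. ennreal (norm (g x)) \<partial>lborel)"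
      by (rule nn_integral_lborel_shift[where f="\<lambda>x. ennreal (norm (g x))"]) measurable
    finally show "(\<integral>\<^sup>+x. ennreal (norm h) * ennreal (norm (g (x + t *\<^sub>R h))) * ?I t \<partial>lborel)
        = ennreal (norm h) * (\<integral>\<^sup>+x. ennreal (norm (g x)) \<partial>lborel) * ?I t" .
  qed
  also have "\<dots> = ennreal (norm h) * (\<integral>\<^sup>+x. ennreal (norm (g x)) \<partial>lborel)"
    by (simp add: nn_integral_cmult)
  finally show ?thesis .
qed

text \<open>A Lipschitz mollifier suffices, since the smeared functions are only required to be
  equi-Lipschitz.\<close>

definition tent :: "real \<Rightarrow> 'a::euclidean_space \<Rightarrow> real" where
  "tent \<epsilon> h = max 0 (\<epsilon> - norm h)"

lemma tent_facts:
  "0 \<le> tent \<epsilon> h" "\<epsilon> \<ge> 0 \<Longrightarrow> tent \<epsilon> h \<le> \<epsilon>" "\<bar>tent \<epsilon> h - tent \<epsilon> k\<bar> \<le> norm (h - k)" "norm h \<ge> \<epsilon> \<Longrightarrow> tent \<epsilon> h = 0"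
proof -
  have "\<bar>norm h - norm k\<bar> \<le> norm (h - k)" by (rule norm_triangle_ineq3)
  then show "\<bar>tent \<epsilon> h - tent \<epsilon> k\<bar> \<le> norm (h - k)" unfolding tent_def by linarith
qed (auto simp: tent_def)

lemma continuous_tent: "continuous_on UNIV (tent \<epsilon>)"
  unfolding tent_def[abs_def] by (intro continuous_intros)

lemma tent_measurable[measurable]: "tent \<epsilon> \<in> borel_measurable borel"
  by (intro borel_measurable_continuous_onI continuous_tent)

lemma tent_integral:
  assumes "\<epsilon> > 0"
  shows "integrable lborel (tent \<epsilon> :: 'a::euclidean_space \<Rightarrow> real)"
    "(\<integral>h. tent \<epsilon> (h::'a) \<partial>lborel) > 0"
proof -
  show i: "integrable lborel (tent \<epsilon> :: 'a \<Rightarrow> real)"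
    by (rule integrable_compact_support[OF continuous_tent, of \<epsilon>]) (auto simp: tent_facts)
  have "(\<integral>h. \<epsilon> / 2 * indicator (cball (0::'a) (\<epsilon> / 2)) h \<partial>lborel) \<le> (\<integral>h. tent \<epsilon> (h::'a) \<partial>lborel)"
  proof (rule integral_mono[OF _ i])
    show "integrable lborel (\<lambda>h. \<epsilon> / 2 * indicator (cball (0::'a) (\<epsilon> / 2)) h)"
      by (intro integrable_mult_right integrable_real_indicator)
         (auto simp: emeasure_bounded_finite[unfolded infinity_ennreal_def])
    show "\<epsilon> / 2 * indicator (cball 0 (\<epsilon> / 2)) h \<le> tent \<epsilon> h" for h :: 'a
      using assms by (auto simp: indicator_def tent_def)
  qed
  moreover have "measure lborel (cball (0::'a) (\<epsilon> / 2)) > 0"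
    using assms content_cball_pos[of "\<epsilon> / 2" "0::'a"] by simp
  then have "\<epsilon> / 2 * measure lborel (cball (0::'a) (\<epsilon> / 2)) > 0" using assms by simp
  ultimately show "(\<integral>h. tent \<epsilon> (h::'a) \<partial>lborel) > 0" by simp
qed

definition smear :: "real \<Rightarrow> ('a::euclidean_space \<Rightarrow> real) \<Rightarrow> 'a \<Rightarrow> real" where
  "smear \<epsilon> w x = (\<integral>y. w y * tent \<epsilon> (y - x) \<partial>lborel)"

lemma smear_integrable:
  assumes "integrable lborel w"
  shows "integrable lborel (\<lambda>y. w y * tent \<epsilon> (y - x))"
proof -
  have [measurable]: "w \<in> borel_measurable borel" using assms by auto
  have "integrable lborel (\<lambda>y. \<bar>\<epsilon>\<bar> * w y)" using assms by simp
  then show ?thesis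
  proof (rule Bochner_Integration.integrable_bound)
    show "AE y in lborel. norm (w y * tent \<epsilon> (y - x)) \<le> norm (\<bar>\<epsilon>\<bar> * w y)"
    proof (rule AE_I2)
      fix y
      have "tent \<epsilon> (y - x) \<le> \<bar>\<epsilon>\<bar>" unfolding tent_def using norm_ge_zero[of "y - x"] by linarith
      then have "\<bar>w y\<bar> * tent \<epsilon> (y - x) \<le> \<bar>w y\<bar> * \<bar>\<epsilon>\<bar>" by (intro mult_left_mono) auto
      then show "norm (w y * tent \<epsilon> (y - x)) \<le> norm (\<bar>\<epsilon>\<bar> * w y)"
        using tent_facts(1)[of \<epsilon> "y - x"] by (simp add: abs_mult mult.commute)
    qed
  qed measurable
qed

lemma smear_bound:
  assumes w: "integrable lborel w" and C: "(\<integral>y. \<bar>w y\<bar> \<partial>lborel) \<le> C" and \<epsilon>: "0 \<le> \<epsilon>" "\<epsilon> \<le> 1"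
  shows "\<bar>smear \<epsilon> w x\<bar> \<le> C"
proof -
  have "\<bar>smear \<epsilon> w x\<bar> \<le> (\<integral>y. \<bar>w y * tent \<epsilon> (y - x)\<bar> \<partial>lborel)"
    unfolding smear_def by (rule integral_abs_bound)
  also have "\<dots> \<le> (\<integral>y. \<bar>w y\<bar> \<partial>lborel)"
  proof (rule integral_mono)
    show "integrable lborel (\<lambda>y. \<bar>w y * tent \<epsilon> (y - x)\<bar>)" "integrable lborel (\<lambda>y. \<bar>w y\<bar>)"
      using smear_integrable[OF w] w by auto
    fix y
    have "\<bar>tent \<epsilon> (y - x)\<bar> \<le> 1"
      using tent_facts(1,2)[of \<epsilon> "y - x"] \<epsilon> by linarith
    then show "\<bar>w y * tent \<epsilon> (y - x)\<bar> \<le> \<bar>w y\<bar>" by (simp add: abs_mult mult_left_le)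
  qed
  finally show ?thesis using C by simp
qed

lemma smear_lipschitz:
  assumes w: "integrable lborel w" and C: "(\<integral>y. \<bar>w y\<bar> \<partial>lborel) \<le> C"
  shows "\<bar>smear \<epsilon> w x - smear \<epsilon> w x'\<bar> \<le> C * norm (x - x')"
proof -
  have "smear \<epsilon> w x - smear \<epsilon> w x' = (\<integral>y. w y * tent \<epsilon> (y - x) - w y * tent \<epsilon> (y - x') \<partial>lborel)"
    unfolding smear_def using smear_integrable[OF w] by simp
  also have "\<bar>\<dots>\<bar> \<le> (\<integral>y. \<bar>w y * tent \<epsilon> (y - x) - w y * tent \<epsilon> (y - x')\<bar> \<partial>lborel)"
    by (rule integral_abs_bound)
  also have "\<dots> \<le> (\<integral>y. \<bar>w y\<bar> * norm (x - x') \<partial>lborel)"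
  proof (rule integral_mono)
    show "integrable lborel (\<lambda>y. \<bar>w y * tent \<epsilon> (y - x) - w y * tent \<epsilon> (y - x')\<bar>)"
      using smear_integrable[OF w] by simp
    show "integrable lborel (\<lambda>y. \<bar>w y\<bar> * norm (x - x'))" using w by simp
    show "\<bar>w y * tent \<epsilon> (y - x) - w y * tent \<epsilon> (y - x')\<bar> \<le> \<bar>w y\<bar> * norm (x - x')" for y
      using tent_facts(3)[of \<epsilon> "y - x" "y - x'"]
      by (simp add: right_diff_distrib[symmetric] abs_mult mult_left_mono norm_minus_commute)
  qed
  also have "\<dots> \<le> C * norm (x - x')" using C by (simp add: mult_right_mono)
  finally show ?thesis .
qed

text \<open>Smearing averages translates of \<open>w\<close> by at most \<open>\<epsilon>\<close>,
  and a translation by \<open>h\<close> moves \<open>w\<close> by at most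
  \<open>|h| \<parallel>\<nabla>w\<parallel>\<close> in \<open>L\<^sup>1\<close>.\<close>

lemma smear_error:
  fixes w :: "'a::euclidean_space \<Rightarrow> real"
  assumes wg: "C1c w g" and \<epsilon>: "\<epsilon> > 0"
  defines "Z \<equiv> (\<integral>h. tent \<epsilon> (h::'a) \<partial>lborel)"
  shows "(\<integral>\<^sup>+x. ennreal \<bar>Z * w x - smear \<epsilon> w x\<bar> \<partial>lborel) \<le> ennreal (\<epsilon> * Z) * (\<integral>\<^sup>+x. ennreal (norm (g x)) \<partial>lborel)"
proof -
  note [measurable] = C1c_measurable[OF wg]
  let ?D = "\<integral>\<^sup>+x. ennreal (norm (g x)) \<partial>lborel"
  have iw: "integrable lborel w" by (rule C1c_integrable[OF wg])
  have shift: "integrable lborel (\<lambda>y. tent \<epsilon> (y - x))" "(\<integral>y. tent \<epsilon> (y - x) \<partial>lborel) = Z" for x :: 'a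
  proof -
    show "(\<integral>y. tent \<epsilon> (y - x) \<partial>lborel) = Z"
      using integral_lborel_shift[of "tent \<epsilon>" "- x"] by (simp add: Z_def)
    show "integrable lborel (\<lambda>y. tent \<epsilon> (y - x))"
      using tent_integral(1)[OF \<epsilon>, where 'a='a] integrable_distr_eq[of "(+) (- x)" lborel borel "tent \<epsilon>"]
      by (simp add: lborel_distr_plus)
  qed
  have pt: "ennreal \<bar>Z * w x - smear \<epsilon> w x\<bar> \<le> (\<integral>\<^sup>+h. ennreal (tent \<epsilon> h) * ennreal \<bar>w (x + h) - w x\<bar> \<partial>lborel)" for x
  proof -
    have eq: "tent \<epsilon> (y - x) * (w x - w y) = w x * tent \<epsilon> (y - x) - w y * tent \<epsilon> (y - x)" for y
      by (simp add: algebra_simps)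
    have i: "integrable lborel (\<lambda>y. tent \<epsilon> (y - x) * (w x - w y))"
      unfolding eq using smear_integrable[OF iw, of \<epsilon> x] shift(1)[of x] by simp
    have "Z * w x - smear \<epsilon> w x = (\<integral>y. tent \<epsilon> (y - x) * (w x - w y) \<partial>lborel)"
      unfolding eq smear_def
      using smear_integrable[OF iw, of \<epsilon> x] shift[of x] by (simp add: mult.commute)
    then have "ennreal \<bar>Z * w x - smear \<epsilon> w x\<bar> \<le> (\<integral>\<^sup>+y. norm (tent \<epsilon> (y - x) * (w x - w y)) \<partial>lborel)"
      using integral_norm_bound_ennreal[OF i] by simp
    also have "\<dots> = (\<integral>\<^sup>+h. norm (tent \<epsilon> (h + x - x) * (w x - w (h + x))) \<partial>lborel)"
      by (rule nn_integral_lborel_shift[symmetric, where f="\<lambda>y. ennreal (norm (tent \<epsilon> (y - x) * (w x - w y)))"]) measurable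
    also have "\<dots> = (\<integral>\<^sup>+h. ennreal (tent \<epsilon> h) * ennreal \<bar>w (x + h) - w x\<bar> \<partial>lborel)"
      by (intro nn_integral_cong) (simp add: abs_mult tent_facts(1) ennreal_mult[symmetric] add.commute abs_minus_commute)
    finally show ?thesis .
  qed
  have "(\<integral>\<^sup>+x. ennreal \<bar>Z * w x - smear \<epsilon> w x\<bar> \<partial>lborel)
      \<le> (\<integral>\<^sup>+x. (\<integral>\<^sup>+h. ennreal (tent \<epsilon> h) * ennreal \<bar>w (x + h) - w x\<bar> \<partial>lborel) \<partial>lborel)"
    by (intro nn_integral_mono pt)
  also have "\<dots> = (\<integral>\<^sup>+h. (\<integral>\<^sup>+x. ennreal (tent \<epsilon> h) * ennreal \<bar>w (x + h) - w x\<bar> \<partial>lborel) \<partial>lborel)"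
    by (rule lborel_pair.Fubini') measurable
  also have "\<dots> \<le> (\<integral>\<^sup>+h. ennreal (tent \<epsilon> (h::'a)) * (ennreal \<epsilon> * ?D) \<partial>lborel)"
  proof (rule nn_integral_mono)
    fix h :: 'a
    have "(\<integral>\<^sup>+x. ennreal (tent \<epsilon> h) * ennreal \<bar>w (x + h) - w x\<bar> \<partial>lborel) \<le> ennreal (tent \<epsilon> h) * (ennreal (norm h) * ?D)"
      using C1c_translation_estimate[OF wg, of h] by (simp add: nn_integral_cmult mult_left_mono)
    also have "\<dots> \<le> ennreal (tent \<epsilon> h) * (ennreal \<epsilon> * ?D)"
    proof (cases "norm h \<ge> \<epsilon>")
      case True
      then show ?thesis by (simp add: tent_facts)
    next
      case False
      then show ?thesis by (intro mult_left_mono mult_right_mono ennreal_leI) auto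
    qed
    finally show "(\<integral>\<^sup>+x. ennreal (tent \<epsilon> h) * ennreal \<bar>w (x + h) - w x\<bar> \<partial>lborel) \<le> \<dots>" .
  qed
  also have "\<dots> = ennreal Z * (ennreal \<epsilon> * ?D)"
    using tent_integral(1)[OF \<epsilon>, where 'a='a]
    by (simp add: nn_integral_multc nn_integral_eq_integral tent_facts Z_def)
  also have "\<dots> = ennreal (\<epsilon> * Z) * ?D"
    using \<epsilon> tent_integral(2)[OF \<epsilon>, where 'a='a] by (simp add: ennreal_mult Z_def mult_ac)
  finally show ?thesis .
qed

lemma equilipschitz_dense_convergent:
  fixes A :: "nat \<Rightarrow> 'a::euclidean_space \<Rightarrow> real"
  assumes lip: "\<And>n x y. \<bar>A n x - A n y\<bar> \<le> C * norm (x - y)" and C: "C \<ge> 0"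
    and dense: "closure Q = UNIV" and conv: "\<And>q. q \<in> Q \<Longrightarrow> convergent (\<lambda>n. A n q)"
  shows "convergent (\<lambda>n. A n x)"
proof (rule Cauchy_convergent, rule CauchyI)
  fix e :: real assume e: "e > 0"
  have "x \<in> closure Q" using dense by simp
  moreover have "e / (3 * (C + 1)) > 0" using C e by simp
  ultimately obtain q where q: "q \<in> Q" "dist q x < e / (3 * (C + 1))"
    unfolding closure_approachable by blast
  have "C * norm (x - q) \<le> C * (e / (3 * (C + 1)))"
    using q(2) C by (intro mult_left_mono) (auto simp: dist_norm norm_minus_commute)
  also have "\<dots> < e / 3" using C e by (simp add: field_simps)
  finally have near: "C * norm (x - q) < e / 3" .
  have "Cauchy (\<lambda>n. A n q)" using conv[OF q(1)] by (rule convergent_Cauchy)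
  from CauchyD[OF this, of "e / 3"] e obtain N
    where N: "\<And>m n. m \<ge> N \<Longrightarrow> n \<ge> N \<Longrightarrow> norm (A m q - A n q) < e / 3" by auto
  show "\<exists>M. \<forall>m\<ge>M. \<forall>n\<ge>M. norm (A m x - A n x) < e"
  proof (intro exI[of _ N] allI impI)
    fix m n assume "m \<ge> N" "n \<ge> N"
    then have "\<bar>A m q - A n q\<bar> < e / 3" using N by auto
    then show "norm (A m x - A n x) < e"
      using near lip[of m x q] lip[of n x q] unfolding real_norm_def by linarith
  qed
qed

text \<open>For each of countably many \<open>\<epsilon>\<close> the smeared functions are bounded
  and equi-Lipschitz; by a diagonal argument a subsequence converges at a countable dense set for
  all these \<open>\<epsilon>\<close>, hence everywhere, hence in \<open>L\<^sup>1\<close> of the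
  ball carrying all supports. The error of smearing is small uniformly in the sequence.\<close>

theorem rellich_L1:
  fixes w :: "nat \<Rightarrow> 'a::euclidean_space \<Rightarrow> real" and g :: "nat \<Rightarrow> 'a \<Rightarrow> 'a"
  assumes wg: "\<And>n. C1c (w n) (g n)"
    and supp: "\<And>n x. norm x > R \<Longrightarrow> w n x = 0"
    and C: "\<And>n. (\<integral>\<^sup>+x. ennreal \<bar>w n x\<bar> \<partial>lborel) \<le> ennreal C"
    and D: "\<And>n. (\<integral>\<^sup>+x. ennreal (norm (g n x)) \<partial>lborel) \<le> ennreal D" and pos: "C \<ge> 0" "D \<ge> 0"
  obtains r :: "nat \<Rightarrow> nat" where "strict_mono r"
    "\<And>e. e > 0 \<Longrightarrow> \<exists>N. \<forall>i\<ge>N. \<forall>j\<ge>N. (\<integral>\<^sup>+x. ennreal \<bar>w (r i) x - w (r j) x\<bar> \<partial>lborel) \<le> ennreal e"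
proof -
  note wm[measurable] = C1c_measurable(1)[OF wg]
  have iw: "integrable lborel (w n)" for n by (rule C1c_integrable[OF wg])
  have C': "(\<integral>x. \<bar>w n x\<bar> \<partial>lborel) \<le> C" for n
  proof -
    have "ennreal (\<integral>x. \<bar>w n x\<bar> \<partial>lborel) = (\<integral>\<^sup>+x. ennreal \<bar>w n x\<bar> \<partial>lborel)"
      using iw[of n] by (intro nn_integral_eq_integral[symmetric]) auto
    then show ?thesis using C[of n] pos(1) by (metis ennreal_le_iff)
  qed
  obtain Q :: "'a set" where Q: "countable Q" "closure Q = UNIV"
    using separable[of "UNIV :: 'a set"] by (metis top.extremum_uniqueI)
  define \<epsilon> where "\<epsilon> k = 1 / real (Suc k)" for k
  have \<epsilon>: "\<epsilon> k > 0" "\<epsilon> k \<le> 1" for k by (auto simp: \<epsilon>_def)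
  have lip: "\<bar>smear \<epsilon> (w n) x - smear \<epsilon> (w n) y\<bar> \<le> C * norm (x - y)" for \<epsilon> n x y
    by (rule smear_lipschitz[OF iw C'])
  obtain r where r: "strict_mono r"
    and conv: "\<And>z. z \<in> UNIV \<times> Q \<Longrightarrow> \<exists>l. (\<lambda>n. smear (\<epsilon> (fst z)) (w (r n)) (snd z)) \<longlonglongrightarrow> l"
  proof (rule function_convergent_subsequence[of "UNIV \<times> Q :: (nat \<times> 'a) set" "\<lambda>n z. smear (\<epsilon> (fst z)) (w n) (snd z)" C])
    show "countable (UNIV \<times> Q :: (nat \<times> 'a) set)" using Q by auto
    show "norm (smear (\<epsilon> (fst z)) (w n) (snd z)) \<le> C" for n z
      using smear_bound[OF iw C'] \<epsilon>[of "fst z"] by (simp add: less_imp_le)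
  qed (use that in auto)
  have conv2: "convergent (\<lambda>n. smear (\<epsilon> k) (w (r n)) x)" for k x
    by (rule equilipschitz_dense_convergent[OF lip pos(1) Q(2)]) (use conv in \<open>force simp: convergent_def\<close>)
  have cauchy: "\<exists>N. \<forall>i\<ge>N. \<forall>j\<ge>N. (\<integral>\<^sup>+x. ennreal \<bar>w (r i) x - w (r j) x\<bar> \<partial>lborel) \<le> ennreal e" if e: "e > 0" for e
  proof -
    obtain k where k: "\<epsilon> k * D \<le> e / 4"
    proof -
      obtain k where "real k > D * 4 / e" using reals_Archimedean2 by blast
      then have "real (Suc k) > D * 4 / e" by simp
      then have "\<epsilon> k * D \<le> e / 4" using e pos by (simp add: \<epsilon>_def field_simps)
      then show ?thesis by (rule that)
    qed
    define Z where "Z = (\<integral>h. tent (\<epsilon> k) (h::'a) \<partial>lborel)"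
    have Z: "Z > 0" unfolding Z_def by (rule tent_integral(2)[OF \<epsilon>(1)])
    define A where "A n = smear (\<epsilon> k) (w (r n))" for n
    have Ac: "continuous_on UNIV (A n)" for n
    proof -
      have "C-lipschitz_on UNIV (A n)"
        by (rule lipschitz_onI) (use lip pos in \<open>auto simp: A_def dist_norm\<close>)
      then show ?thesis by (rule lipschitz_on_continuous_on)
    qed
    have Am[measurable]: "A n \<in> borel_measurable borel" for n
      by (intro borel_measurable_continuous_onI Ac)
    define a where "a x = lim (\<lambda>n. A n x)" for x
    have a: "(\<lambda>n. A n x) \<longlonglongrightarrow> a x" for x
      unfolding a_def A_def using conv2 by (simp add: convergent_LIMSEQ_iff)
    have am[measurable]: "a \<in> borel_measurable borel"
      by (rule borel_measurable_LIMSEQ_real[OF a Am])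
    have [measurable]: "cball (0::'a) R \<in> sets borel" by simp
    let ?I = "indicator (cball (0::'a) R) :: 'a \<Rightarrow> ennreal"
    have bound: "\<bar>A n x\<bar> \<le> C" for n x
      unfolding A_def using smear_bound[OF iw C'] \<epsilon> by (simp add: less_imp_le)
    have "(\<lambda>n. \<integral>\<^sup>+x. ennreal \<bar>A n x - a x\<bar> * ?I x \<partial>lborel) \<longlonglongrightarrow> integral\<^sup>N lborel (\<lambda>x::'a. 0)"
    proof (rule nn_integral_dominated_convergence)
      show "AE x in lborel. ennreal \<bar>A n x - a x\<bar> * ?I x \<le> ennreal (2 * C) * ?I x" for n
      proof (rule AE_I2)
        fix x
        have "\<bar>a x\<bar> \<le> C"
          using a[of x] bound by (intro LIMSEQ_le_const2[OF tendsto_rabs]) auto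
        then have "\<bar>A n x - a x\<bar> \<le> 2 * C" using bound[of n x] by linarith
        then show "ennreal \<bar>A n x - a x\<bar> * ?I x \<le> ennreal (2 * C) * ?I x"
          by (intro mult_right_mono ennreal_leI) auto
      qed
      show "(\<integral>\<^sup>+x. ennreal (2 * C) * ?I x \<partial>lborel) < \<infinity>"
        by (subst nn_integral_cmult)
           (auto simp: ennreal_mult_less_top emeasure_bounded_finite[unfolded infinity_ennreal_def] intro!: borel_measurable_indicator)
      show "AE x in lborel. (\<lambda>n. ennreal \<bar>A n x - a x\<bar> * ?I x) \<longlonglongrightarrow> 0"
      proof (rule AE_I2)
        fix x
        have "(\<lambda>n. \<bar>A n x - a x\<bar>) \<longlonglongrightarrow> 0"
          using a[of x] by (simp add: LIM_zero tendsto_rabs_zero_iff)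
        then have "(\<lambda>n. ennreal \<bar>A n x - a x\<bar>) \<longlonglongrightarrow> ennreal 0" by (rule tendsto_ennrealI)
        then show "(\<lambda>n. ennreal \<bar>A n x - a x\<bar> * ?I x) \<longlonglongrightarrow> 0"
          by (cases "x \<in> cball 0 R") auto
      qed
      show "(\<lambda>x. ennreal \<bar>A n x - a x\<bar> * ?I x) \<in> borel_measurable lborel" for n by measurable
      show "(\<lambda>x. ennreal (2 * C) * ?I x) \<in> borel_measurable lborel" by measurable
    qed simp
    then have lim0: "(\<lambda>n. \<integral>\<^sup>+x. ennreal \<bar>A n x - a x\<bar> * ?I x \<partial>lborel) \<longlonglongrightarrow> 0" by simp
    have "ennreal (Z * e / 4) > 0" using Z e by simp
    from order_tendstoD(2)[OF lim0 this] obtain N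
      where N: "\<And>n. n \<ge> N \<Longrightarrow> (\<integral>\<^sup>+x. ennreal \<bar>A n x - a x\<bar> * ?I x \<partial>lborel) < ennreal (Z * e / 4)"
      unfolding eventually_sequentially by blast
    have "(\<integral>\<^sup>+x. ennreal \<bar>w (r i) x - w (r j) x\<bar> \<partial>lborel) \<le> ennreal e" if ij: "i \<ge> N" "j \<ge> N" for i j
    proof -
      have err: "(\<integral>\<^sup>+x. ennreal \<bar>Z * w n x - smear (\<epsilon> k) (w n) x\<bar> \<partial>lborel) \<le> ennreal (Z * e / 4)" for n
      proof -
        have "(\<integral>\<^sup>+x. ennreal \<bar>Z * w n x - smear (\<epsilon> k) (w n) x\<bar> \<partial>lborel) \<le> ennreal (\<epsilon> k * Z) * ennreal D"
          using smear_error[OF wg \<epsilon>(1), of k n] D[of n] unfolding Z_def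
          by (meson mult_left_mono order_trans zero_le)
        also have "\<dots> = ennreal (Z * (\<epsilon> k * D))" using Z \<epsilon>[of k] pos by (simp add: ennreal_mult[symmetric] mult_ac)
        also have "\<dots> \<le> ennreal (Z * (e / 4))" using k Z by (intro ennreal_leI mult_left_mono) auto
        finally show ?thesis by simp
      qed
      let ?f1 = "\<lambda>x. ennreal \<bar>Z * w (r i) x - A i x\<bar>" and ?f2 = "\<lambda>x. ennreal \<bar>A i x - a x\<bar> * ?I x"
        and ?f3 = "\<lambda>x. ennreal \<bar>A j x - a x\<bar> * ?I x" and ?f4 = "\<lambda>x. ennreal \<bar>Z * w (r j) x - A j x\<bar>"
      have "ennreal Z * (\<integral>\<^sup>+x. ennreal \<bar>w (r i) x - w (r j) x\<bar> \<partial>lborel) = (\<integral>\<^sup>+x. ennreal (Z * \<bar>w (r i) x - w (r j) x\<bar>) \<partial>lborel)"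
        using Z by (subst nn_integral_cmult[symmetric]) (auto simp: ennreal_mult)
      also have "\<dots> \<le> (\<integral>\<^sup>+x. ?f1 x + ?f2 x + ?f3 x + ?f4 x \<partial>lborel)"
      proof (rule nn_integral_mono)
        fix x
        show "ennreal (Z * \<bar>w (r i) x - w (r j) x\<bar>) \<le> ?f1 x + ?f2 x + ?f3 x + ?f4 x"
        proof (cases "norm x \<le> R")
          case True
          have "Z * \<bar>w (r i) x - w (r j) x\<bar> = \<bar>Z * w (r i) x - Z * w (r j) x\<bar>"
            using Z by (simp add: right_diff_distrib[symmetric] abs_mult)
          also have "\<dots> \<le> \<bar>Z * w (r i) x - A i x\<bar> + \<bar>A i x - a x\<bar> + \<bar>A j x - a x\<bar> + \<bar>Z * w (r j) x - A j x\<bar>"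
            by linarith
          finally show ?thesis using True by (simp add: ennreal_plus[symmetric] ennreal_leI del: ennreal_plus)
        next
          case False
          then show ?thesis using supp by simp
        qed
      qed
      also have "\<dots> = (\<integral>\<^sup>+x. ?f1 x \<partial>lborel) + (\<integral>\<^sup>+x. ?f2 x \<partial>lborel) + (\<integral>\<^sup>+x. ?f3 x \<partial>lborel) + (\<integral>\<^sup>+x. ?f4 x \<partial>lborel)"
        by (simp add: nn_integral_add)
      also have "\<dots> \<le> ennreal (Z * e / 4) + ennreal (Z * e / 4) + ennreal (Z * e / 4) + ennreal (Z * e / 4)"
        using N[OF ij(1)] N[OF ij(2)] err[of "r i"] err[of "r j"] unfolding A_def by (intro add_mono) (auto simp: less_imp_le)
      also have "\<dots> = ennreal Z * ennreal e"
        using Z e by (simp add: ennreal_plus[symmetric] ennreal_mult[symmetric] del: ennreal_plus)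
      finally have "ennreal Z * (\<integral>\<^sup>+x. ennreal \<bar>w (r i) x - w (r j) x\<bar> \<partial>lborel) \<le> ennreal Z * ennreal e" .
      then show ?thesis using Z by (simp add: ennreal_mult_le_mult_iff)
    qed
    then show ?thesis by blast
  qed
  show thesis by (rule that[OF r]) (rule cauchy)
qed

section \<open>Young functions with power-like growth\<close>

text \<open>The parameter \<open>N\<close> will be the dimension of the space.\<close>

locale young_growth =
  fixes \<phi> \<Phi> :: "real \<Rightarrow> real" and l m :: real and N :: nat
  assumes phi_pos: "\<And>s. s > 0 \<Longrightarrow> \<phi> s > 0"
    and phi_cont: "continuous_on {0<..} \<phi>"
    and phi_lim_0: "((\<lambda>s. s * \<phi> s) \<longlongrightarrow> 0) (at_right 0)"
    and phi_mono: "mono_on {0<..} (\<lambda>s. s * \<phi> s)"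
    and Phi: "\<And>t. \<Phi> t = (LBINT s=0..\<bar>t\<bar>. s * \<phi> s)"
    and exponents: "1 < l" "l < real N" "1 < m" "m < real N"
    and growth: "\<And>t. t > 0 \<Longrightarrow> l \<le> t\<^sup>2 * \<phi> t / \<Phi> t \<and> t\<^sup>2 * \<phi> t / \<Phi> t \<le> m"
begin

abbreviation p :: "real \<Rightarrow> real" where "p s \<equiv> s * \<phi> s"

lemma p_nonneg: "s \<ge> 0 \<Longrightarrow> p s \<ge> 0"
  using phi_pos[of s] by (cases "s = 0") auto

lemma p_mono: "0 \<le> s \<Longrightarrow> s \<le> t \<Longrightarrow> p s \<le> p t"
  using mono_onD[OF phi_mono, of s t] p_nonneg[of t] by (cases "s = 0") auto

lemma p_cont: "continuous_on {0..} p"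
proof (rule continuous_on_eq_continuous_within[THEN iffD2], intro ballI)
  fix s :: real assume s: "s \<in> {0..}"
  show "continuous (at s within {0..}) p"
  proof (cases "s = 0")
    case True
    have "at (0::real) within {0..} = at_right 0"
      by (rule at_within_nhd[of _ UNIV]) auto
    then show ?thesis using phi_lim_0 True by (simp add: continuous_within)
  next
    case False
    then have "s \<in> {0<..}" using s by simp
    then have "isCont \<phi> s" using phi_cont by (simp add: continuous_on_eq_continuous_at)
    then have "isCont p s" by (intro continuous_mult continuous_ident)
    then show ?thesis by (rule continuous_at_imp_continuous_at_within)
  qed
qed

lemma Phi_integral: "t \<ge> 0 \<Longrightarrow> \<Phi> t = integral {0..t} p"
  unfolding Phi zero_ereal_def
  by (subst interval_integral_eq_integral)
     (auto intro!: borel_integrable_atLeastAtMost' continuous_on_subset[OF p_cont])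

lemma Phi_even: "\<Phi> (- t) = \<Phi> t" "\<Phi> \<bar>t\<bar> = \<Phi> t"
  using Phi[of t] Phi[of "- t"] Phi[of "\<bar>t\<bar>"] by simp_all

lemma Phi_0[simp]: "\<Phi> 0 = 0" by (simp add: Phi_integral)

lemma Phi_DERIV_pos:
  assumes "t > 0" shows "(\<Phi> has_real_derivative p t) (at t)"
proof -
  have "((\<lambda>x. integral {0..x} p) has_real_derivative p t) (at t within {0..t + 1})"
    using assms by (intro integral_has_real_derivative) (auto intro!: continuous_on_subset[OF p_cont])
  then have "((\<lambda>x. integral {0..x} p) has_real_derivative p t) (at t within {0<..<t + 1})"
    by (rule DERIV_subset) auto
  then have "((\<lambda>x. integral {0..x} p) has_real_derivative p t) (at t)"
    using assms by (subst (asm) at_within_open) auto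
  then show ?thesis
    by (rule has_field_derivative_transform_within_open[where S="{0<..}"])
       (use assms in \<open>auto simp: Phi_integral\<close>)
qed

lemma Phi_le_p: "t \<ge> 0 \<Longrightarrow> \<Phi> t \<le> t * p t"
proof -
  assume t: "t \<ge> 0"
  have "integral {0..t} p \<le> integral {0..t} (\<lambda>_. p t)"
    by (intro integral_le integrable_continuous_real continuous_on_subset[OF p_cont]) (auto intro: p_mono)
  then show ?thesis using t by (simp add: Phi_integral)
qed

lemma Phi_nonneg: "\<Phi> t \<ge> 0"
proof -
  have "integral {0..\<bar>t\<bar>} p \<ge> 0"
    by (intro integral_nonneg integrable_continuous_real continuous_on_subset[OF p_cont]) (auto intro: p_nonneg)
  then show ?thesis using Phi_integral[of "\<bar>t\<bar>"] by (simp add: Phi_even)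
qed

lemma p_tendsto_0: "((\<lambda>h. p \<bar>h\<bar>) \<longlongrightarrow> 0) (at 0)"
proof -
  have "filterlim (\<lambda>h::real. \<bar>h\<bar>) (at_right 0) (at 0)"
    by (auto simp: filterlim_at eventually_at_filter intro!: tendsto_rabs_zero)
  from filterlim_compose[OF phi_lim_0 this] show ?thesis .
qed

lemma Phi_DERIV: "(\<Phi> has_real_derivative t * \<phi> \<bar>t\<bar>) (at t)"
proof -
  consider "t > 0" | "t = 0" | "t < 0" by linarith
  then show ?thesis
  proof cases
    case 1
    then show ?thesis using Phi_DERIV_pos by simp
  next
    case 2
    have "((\<lambda>h. (\<Phi> (0 + h) - \<Phi> 0) / h) \<longlongrightarrow> 0) (at 0)"
    proof (rule Lim_null_comparison[OF _ p_tendsto_0])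
      show "\<forall>\<^sub>F h in at 0. norm ((\<Phi> (0 + h) - \<Phi> 0) / h) \<le> p \<bar>h\<bar>"
      proof (rule eventually_at_filter[THEN iffD2], rule always_eventually, intro allI impI)
        fix h :: real assume "h \<noteq> 0"
        then show "norm ((\<Phi> (0 + h) - \<Phi> 0) / h) \<le> p \<bar>h\<bar>"
          using Phi_le_p[of "\<bar>h\<bar>"] Phi_nonneg[of h] by (simp add: Phi_even divide_simps mult.commute)
      qed
    qed
    then show ?thesis using 2 by (simp add: DERIV_def)
  next
    case 3
    have "(uminus has_real_derivative - 1) (at t)" by (auto intro!: derivative_eq_intros)
    then have "((\<lambda>s. \<Phi> (- s)) has_real_derivative - p (- t)) (at t)"
      using 3 DERIV_chain2[where f=\<Phi> and g=uminus and x=t and s=UNIV and Db="- 1", OF Phi_DERIV_pos[of "- t"]]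
      by simp
    then show ?thesis using 3 by (simp add: Phi_even)
  qed
qed

lemma Phi_cont: "continuous_on UNIV \<Phi>"
  using Phi_DERIV by (auto intro!: continuous_at_imp_continuous_on DERIV_isCont)

lemma Phi_measurable[measurable]: "\<Phi> \<in> borel_measurable borel"
  by (rule borel_measurable_continuous_onI[OF Phi_cont])

lemma Phi_convex: "convex_on UNIV \<Phi>"
proof (rule convex_on_realI)
  show "(\<Phi> has_real_derivative t * \<phi> \<bar>t\<bar>) (at t)" for t by (rule Phi_DERIV)
  fix x y :: real assume xy: "x \<le> y"
  consider "0 \<le> x" | "x < 0" "0 \<le> y" | "y < 0" using xy by linarith
  then show "x * \<phi> \<bar>x\<bar> \<le> y * \<phi> \<bar>y\<bar>"
  proof cases
    case 1 then show ?thesis using p_mono[of x y] xy by simp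
  next
    case 2
    then have "x * \<phi> \<bar>x\<bar> \<le> 0" using p_nonneg[of "- x"] by simp
    also have "0 \<le> y * \<phi> \<bar>y\<bar>" using 2 p_nonneg[of y] by simp
    finally show ?thesis .
  next
    case 3 then show ?thesis using p_mono[of "- y" "- x"] xy by simp
  qed
qed auto

lemma Phi_pos: "t > 0 \<Longrightarrow> \<Phi> t > 0"
proof -
  assume t: "t > 0"
  have "\<Phi> t \<noteq> 0"
  proof
    assume "\<Phi> t = 0"
    then show False using growth[OF t] exponents by simp
  qed
  then show ?thesis using Phi_nonneg[of t] by simp
qed

lemma growth_bounds: "t \<ge> 0 \<Longrightarrow> l * \<Phi> t \<le> t * p t" "t \<ge> 0 \<Longrightarrow> t * p t \<le> m * \<Phi> t"
  using growth[of t] Phi_pos[of t] by (cases "t = 0"; simp add: field_simps power2_eq_square)+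

lemma Phi_mono: "0 \<le> s \<Longrightarrow> s \<le> t \<Longrightarrow> \<Phi> s \<le> \<Phi> t"
  by (rule DERIV_nonneg_imp_nondecreasing[of s t]) (use Phi_DERIV p_nonneg in \<open>force\<close>)+

lemma Phi_mono_abs: "\<bar>s\<bar> \<le> \<bar>t\<bar> \<Longrightarrow> \<Phi> s \<le> \<Phi> t"
  using Phi_mono[of "\<bar>s\<bar>" "\<bar>t\<bar>"] by (simp add: Phi_even)

text \<open>If \<open>t G' / G\<close> is at most (at least) \<open>r\<close>, then
  \<open>G / t\<^sup>r\<close> decreases (increases). All scaling bounds for
  \<open>\<Phi>\<close> and the critical function come from this.\<close>

lemma powr_ratio_mono:
  fixes G :: "real \<Rightarrow> real"
  assumes "0 < a" "a \<le> b" and D: "\<And>t. t > 0 \<Longrightarrow> (G has_real_derivative G' t) (at t)"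
  shows "(\<And>t. t > 0 \<Longrightarrow> t * G' t \<le> r * G t) \<Longrightarrow> G b * b powr - r \<le> G a * a powr - r"
    "(\<And>t. t > 0 \<Longrightarrow> t * G' t \<ge> r * G t) \<Longrightarrow> G b * b powr - r \<ge> G a * a powr - r"
proof -
  have *: "((\<lambda>t. G t * t powr - r) has_real_derivative (t * G' t - r * G t) * t powr (- r - 1)) (at t)" if "t > 0" for t
  proof -
    have "t powr - r = t * t powr (- r - 1)" using that by (simp add: powr_mult_base)
    then show ?thesis
      by (auto intro!: derivative_eq_intros D that simp: algebra_simps)
  qed
  { assume "\<And>t. t > 0 \<Longrightarrow> t * G' t \<le> r * G t"
    then show "G b * b powr - r \<le> G a * a powr - r"
      using assms(1,2) by (intro DERIV_nonpos_imp_nonincreasing[of a b "\<lambda>t. G t * t powr - r"])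
        (auto intro!: exI[of _ "(t * G' t - r * G t) * t powr (- r - 1)" for t] * mult_nonpos_nonneg) }
  { assume "\<And>t. t > 0 \<Longrightarrow> t * G' t \<ge> r * G t"
    then show "G b * b powr - r \<ge> G a * a powr - r"
      using assms(1,2) by (intro DERIV_nonneg_imp_nondecreasing[of a b "\<lambda>t. G t * t powr - r"])
        (auto intro!: exI[of _ "(t * G' t - r * G t) * t powr (- r - 1)" for t] * mult_nonneg_nonneg) }
qed

lemma Phi_scale:
  assumes "1 \<le> r"
  shows "r powr l * \<Phi> t \<le> \<Phi> (r * t)" "\<Phi> (r * t) \<le> r powr m * \<Phi> t"
proof -
  have *: "r powr l * \<Phi> t \<le> \<Phi> (r * t) \<and> \<Phi> (r * t) \<le> r powr m * \<Phi> t" if t: "t > 0" for t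
  proof -
    have rt: "t \<le> r * t" using assms t by simp
    have "\<Phi> t * t powr - l \<le> \<Phi> (r * t) * (r * t) powr - l" "\<Phi> (r * t) * (r * t) powr - m \<le> \<Phi> t * t powr - m"
      using powr_ratio_mono[OF t rt Phi_DERIV_pos] growth_bounds by (simp_all add: less_imp_le)
    then show ?thesis using assms t by (simp_all add: powr_mult powr_minus field_simps)
  qed
  show "r powr l * \<Phi> t \<le> \<Phi> (r * t)" "\<Phi> (r * t) \<le> r powr m * \<Phi> t"
    using *[of "\<bar>t\<bar>"] assms Phi_even(2)[of t] Phi_even(2)[of "r * t"] by (cases "t = 0"; simp add: abs_mult)+
qed

lemma Phi_shrink:
  assumes "0 \<le> r" "r \<le> 1"
  shows "\<Phi> (r * t) \<le> r powr l * \<Phi> t" "r powr m * \<Phi> t \<le> \<Phi> (r * t)"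
proof -
  have "\<Phi> (r * t) \<le> r powr l * \<Phi> t \<and> r powr m * \<Phi> t \<le> \<Phi> (r * t)"
  proof (cases "r = 0")
    case False
    then have r: "r > 0" using assms by simp
    have "1 \<le> 1 / r" using r assms by simp
    from Phi_scale[OF this, of "r * t"] show ?thesis
      using r by (simp add: powr_divide field_simps)
  qed simp
  then show "\<Phi> (r * t) \<le> r powr l * \<Phi> t" "r powr m * \<Phi> t \<le> \<Phi> (r * t)" by auto
qed

lemma Phi_shrink_linear: "0 \<le> r \<Longrightarrow> r \<le> 1 \<Longrightarrow> \<Phi> (r * t) \<le> r * \<Phi> t"
proof -
  assume r: "0 \<le> r" "r \<le> 1"
  have "\<Phi> (r * t) \<le> r powr l * \<Phi> t" by (rule Phi_shrink[OF r])
  also have "\<dots> \<le> r * \<Phi> t"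
    using r exponents Phi_nonneg[of t] powr_mono'[of 1 l r] by (intro mult_right_mono) auto
  finally show ?thesis .
qed

lemma Phi_add: "\<Phi> (s + t) \<le> 2 powr m * (\<Phi> s + \<Phi> t)"
proof -
  have "\<Phi> (s + t) = \<Phi> ((1 - 1/2) *\<^sub>R (2 * s) + (1/2) *\<^sub>R (2 * t))" by simp
  also have "\<dots> \<le> (1 - 1/2) * \<Phi> (2 * s) + (1/2) * \<Phi> (2 * t)"
    by (rule convex_onD[OF Phi_convex]) auto
  also have "\<dots> \<le> (1/2) * (2 powr m * \<Phi> s) + (1/2) * (2 powr m * \<Phi> t)"
    using Phi_scale(2)[of 2 s] Phi_scale(2)[of 2 t] by simp
  also have "\<dots> \<le> 2 powr m * (\<Phi> s + \<Phi> t)"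
  proof -
    have "0 \<le> 2 powr m * \<Phi> s" "0 \<le> 2 powr m * \<Phi> t" by (simp_all add: Phi_nonneg)
    then show ?thesis unfolding distrib_left by linarith
  qed
  finally show ?thesis .
qed

lemma Phi_norm_add: "\<Phi> (norm (x + y)) \<le> 2 powr m * (\<Phi> (norm x) + \<Phi> (norm y))"
  by (rule order_trans[OF Phi_mono Phi_add]) (auto intro: norm_triangle_ineq)

lemma Phi_ge_powr: "t \<ge> 1 \<Longrightarrow> t powr l * \<Phi> 1 \<le> \<Phi> t"
  using Phi_scale(1)[of t 1] by simp

lemma Phi_bij: "bij_betw \<Phi> {0..} {0..}" and Phi_strict_mono: "0 \<le> s \<Longrightarrow> s < t \<Longrightarrow> \<Phi> s < \<Phi> t"
proof -
  show sm: "\<Phi> s < \<Phi> t" if st: "0 \<le> s" "s < t" for s t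
  proof (cases "s = 0")
    case False
    then have s: "s > 0" using st by simp
    have "\<Phi> s < (t / s) powr l * \<Phi> s"
      using s st exponents Phi_pos[OF s] by (simp add: gr_one_powr)
    also have "\<dots> \<le> \<Phi> t" using Phi_scale(1)[of "t / s" s] s st by simp
    finally show ?thesis .
  qed (use Phi_pos st in simp)
  have inj: "inj_on \<Phi> {0..}"
    by (rule linorder_inj_onI) (use sm in force)+
  have "y \<in> \<Phi> ` {0..}" if y: "y \<ge> 0" for y
  proof -
    define b where "b = max 1 (y / \<Phi> 1)"
    have "y \<le> b * \<Phi> 1" unfolding b_def using Phi_pos[of 1] by (simp add: max_def field_simps)
    also have "\<dots> \<le> b powr l * \<Phi> 1"
      using exponents Phi_pos[of 1] powr_mono[of 1 l b] by (intro mult_right_mono) (auto simp: b_def)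
    also have "\<dots> \<le> \<Phi> b" by (rule Phi_ge_powr) (simp add: b_def)
    finally have "y \<le> \<Phi> b" .
    moreover have "0 \<le> b" by (simp add: b_def)
    moreover have "continuous_on {0..b} \<Phi>" by (rule continuous_on_subset[OF Phi_cont]) simp
    ultimately obtain x where "0 \<le> x" "x \<le> b" "\<Phi> x = y"
      using IVT'[of \<Phi> 0 y b] y by auto
    then show ?thesis by auto
  qed
  then have "\<Phi> ` {0..} = {0..}" by (auto simp: Phi_nonneg)
  with inj show "bij_betw \<Phi> {0..} {0..}" by (simp add: bij_betw_def)
qed

subsection \<open>The inverse function\<close>

abbreviation q :: "real \<Rightarrow> real" where "q \<equiv> inv_into {0..} \<Phi>"

lemma Phi_q: "s \<ge> 0 \<Longrightarrow> \<Phi> (q s) = s"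
  using Phi_bij by (intro f_inv_into_f) (auto simp: bij_betw_def)

lemma q_nonneg: "s \<ge> 0 \<Longrightarrow> q s \<ge> 0"
  using Phi_bij inv_into_into[of s \<Phi> "{0..}"] by (auto simp: bij_betw_def)

lemma q_Phi: "t \<ge> 0 \<Longrightarrow> q (\<Phi> t) = t"
  using Phi_bij by (intro inv_into_f_f) (auto simp: bij_betw_def)

lemma q_le_iff: "s \<ge> 0 \<Longrightarrow> t \<ge> 0 \<Longrightarrow> q s \<le> t \<longleftrightarrow> s \<le> \<Phi> t"
  using Phi_mono[of "q s" t] Phi_strict_mono[of t "q s"] Phi_q[of s] q_nonneg[of s] by force

lemma q_ge_iff: "s \<ge> 0 \<Longrightarrow> t \<ge> 0 \<Longrightarrow> t \<le> q s \<longleftrightarrow> \<Phi> t \<le> s"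
  using Phi_mono[of t "q s"] Phi_strict_mono[of "q s" t] Phi_q[of s] q_nonneg[of s] by force

lemma q_0[simp]: "q 0 = 0" using q_Phi[of 0] by simp

lemma q_pos: "s > 0 \<Longrightarrow> q s > 0"
  using q_nonneg[of s] Phi_q[of s] by (cases "q s = 0") auto

lemma q_cont: "continuous_on {0<..} q"
proof -
  have "isCont q s" if s: "s > 0" for s
  proof -
    have t: "q s > 0" by (rule q_pos[OF s])
    have "isCont q (\<Phi> (q s))"
    proof (rule isCont_inverse_function[where f=\<Phi> and g=q and x="q s" and d="q s"])
      show "0 < q s" by (rule t)
      show "\<And>z. \<bar>z - q s\<bar> \<le> q s \<Longrightarrow> q (\<Phi> z) = z" by (rule q_Phi) linarith
      show "\<And>z. \<bar>z - q s\<bar> \<le> q s \<Longrightarrow> isCont \<Phi> z" using Phi_DERIV DERIV_isCont by blast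
    qed
    then show ?thesis using s by (simp add: Phi_q)
  qed
  then show ?thesis by (auto intro: continuous_at_imp_continuous_on)
qed

lemma q_scale:
  assumes "1 \<le> r" "s \<ge> 0"
  shows "r powr (1/m) * q s \<le> q (r * s)" "q (r * s) \<le> r powr (1/l) * q s"
proof -
  have r: "1 \<le> r powr (1/m)" "1 \<le> r powr (1/l)" using assms exponents by (auto simp: ge_one_powr_ge_zero)
  have "\<Phi> (r powr (1/m) * q s) \<le> r * s"
    using Phi_scale(2)[OF r(1), of "q s"] assms exponents by (simp add: powr_powr Phi_q)
  then show "r powr (1/m) * q s \<le> q (r * s)"
    using assms by (subst q_ge_iff) (auto simp: q_nonneg)
  have "r * s \<le> \<Phi> (r powr (1/l) * q s)"
    using Phi_scale(1)[OF r(2), of "q s"] assms exponents by (simp add: powr_powr Phi_q)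
  then show "q (r * s) \<le> r powr (1/l) * q s"
    using assms by (subst q_le_iff) (auto simp: q_nonneg)
qed

lemma q_ratio:
  assumes "0 < s" "s \<le> t"
  shows "q s \<le> q t * t powr (- (1/m)) * s powr (1/m)" "q t * t powr (- (1/l)) * s powr (1/l) \<le> q s"
proof -
  have "1 \<le> t / s" using assms by simp
  from q_scale[OF this, of s] have "(t / s) powr (1/m) * q s \<le> q t" "q t \<le> (t / s) powr (1/l) * q s"
    using assms by auto
  then show "q s \<le> q t * t powr (- (1/m)) * s powr (1/m)" "q t * t powr (- (1/l)) * s powr (1/l) \<le> q s"
    using assms by (simp_all add: powr_divide powr_minus field_simps)
qed

end

section \<open>The critical function\<close>

context young_growth
begin

text \<open>The Sobolev conjugate exponents of \<open>m\<close> and \<open>l\<close> are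
  \<open>1 / \<kappa>\<close> and \<open>1 / \<mu>\<close>; the growth of the critical
  function lies between these two powers. That \<open>\<kappa>\<close> is positive is the
  condition \<open>m < N\<close>.\<close>

definition \<kappa> :: real where "\<kappa> = 1 / m - 1 / real N"
definition \<mu> :: real where "\<mu> = 1 / l - 1 / real N"

lemma exps: "0 < \<kappa>" "\<kappa> \<le> \<mu>" "\<mu> < 1" "l \<le> m"
proof -
  have "l * \<Phi> 1 \<le> m * \<Phi> 1" using growth_bounds[of 1] by simp
  then show "l \<le> m" using Phi_pos[of 1] by simp
  then show "0 < \<kappa>" "\<kappa> \<le> \<mu>" using exponents by (auto simp: \<kappa>_def \<mu>_def frac_less2 frac_le)
  have "1 / l < 1" "1 / real N > 0" using exponents by auto
  then show "\<mu> < 1" unfolding \<mu>_def by linarith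
qed

definition k :: "real \<Rightarrow> real" where "k s = q s / s powr ((real N + 1) / real N)"

abbreviation J :: "real \<Rightarrow> real" where "J \<equiv> critical_inv N \<Phi>"

lemma k_pos: "s > 0 \<Longrightarrow> k s > 0"
  by (simp add: k_def q_pos)

lemma k_nonneg: "s \<ge> 0 \<Longrightarrow> k s \<ge> 0"
  by (simp add: k_def q_nonneg)

lemma k_cont: "continuous_on {0<..} k"
  unfolding k_def[abs_def] by (intro continuous_intros q_cont) auto

lemma k_bounds:
  assumes "0 < s" "s \<le> t"
  shows "k s \<le> q t * t powr (- (1/m)) * s powr (\<kappa> - 1)" "q t * t powr (- (1/l)) * s powr (\<mu> - 1) \<le> k s"
proof -
  have N: "real N > 0" using exponents by simp
  have e: "s powr (1/m) / s powr ((real N + 1) / real N) = s powr (\<kappa> - 1)"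
    "s powr (1/l) / s powr ((real N + 1) / real N) = s powr (\<mu> - 1)"
  proof -
    have "1/m - (real N + 1) / real N = \<kappa> - 1" "1/l - (real N + 1) / real N = \<mu> - 1"
      using N by (simp_all add: \<kappa>_def \<mu>_def add_divide_distrib)
    then show "s powr (1/m) / s powr ((real N + 1) / real N) = s powr (\<kappa> - 1)"
      "s powr (1/l) / s powr ((real N + 1) / real N) = s powr (\<mu> - 1)"
      unfolding powr_diff[symmetric] by simp_all
  qed
  have "k s \<le> q t * t powr (- (1/m)) * s powr (1/m) / s powr ((real N + 1) / real N)"
    unfolding k_def by (intro divide_right_mono q_ratio(1) assms) simp
  then show "k s \<le> q t * t powr (- (1/m)) * s powr (\<kappa> - 1)" by (simp add: e(1)[symmetric])
  have "q t * t powr (- (1/l)) * s powr (1/l) / s powr ((real N + 1) / real N) \<le> k s"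
    unfolding k_def by (intro divide_right_mono q_ratio(2) assms) simp
  then show "q t * t powr (- (1/l)) * s powr (\<mu> - 1) \<le> k s" by (simp add: e(2)[symmetric])
qed

lemma powr_integral: "a > -1 \<Longrightarrow> t \<ge> 0 \<Longrightarrow> ((\<lambda>s. s powr a) has_integral t powr (a + 1) / (a + 1)) {0..t}" for a t :: real
  by (rule has_integral_powr_from_0)

lemma k_integrable:
  assumes t: "t \<ge> 0"
  shows "set_integrable lborel {0..t} k"
proof (cases "t = 0")
  case False
  then have t: "t > 0" using t by simp
  have "(\<lambda>s. q t * t powr (- (1/m)) * s powr (\<kappa> - 1)) integrable_on {0..t}"
    using powr_integral[of "\<kappa> - 1" t] exps t by (intro integrable_on_mult_right) (auto simp: integrable_on_def)
  then have "(\<lambda>s. q t * t powr (- (1/m)) * s powr (\<kappa> - 1)) absolutely_integrable_on {0..t}"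
    using t by (intro nonnegative_absolutely_integrable_1) (auto simp: q_nonneg)
  then have i: "set_integrable lborel {0..t} (\<lambda>s. q t * t powr (- (1/m)) * s powr (\<kappa> - 1))"
    unfolding set_integrable_def by (subst (asm) integrable_completion) auto
  have m: "(\<lambda>s. indicator {0..t} s *\<^sub>R k s) \<in> borel_measurable borel"
  proof -
    have "(\<lambda>s. indicator {0<..} s *\<^sub>R k s) \<in> borel_measurable borel"
      by (intro borel_measurable_continuous_on_indicator k_cont) auto
    then have "(\<lambda>s. indicator {0..t} s *\<^sub>R (indicator {0<..} s *\<^sub>R k s)) \<in> borel_measurable borel"
      by measurable
    moreover have "(\<lambda>s. indicator {0..t} s *\<^sub>R (indicator {0<..} s *\<^sub>R k s)) = (\<lambda>s. indicator {0..t} s *\<^sub>R k s)"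
      by (auto simp: fun_eq_iff indicator_def k_def)
    ultimately show ?thesis by (simp only:)
  qed
  show ?thesis
    unfolding set_integrable_def
  proof (rule Bochner_Integration.integrable_bound[OF i[unfolded set_integrable_def]])
    show "(\<lambda>s. indicator {0..t} s *\<^sub>R k s) \<in> borel_measurable lborel" using m by simp
    show "AE s in lborel. norm (indicator {0..t} s *\<^sub>R k s)
        \<le> norm (indicator {0..t} s *\<^sub>R (q t * t powr (- (1/m)) * s powr (\<kappa> - 1)))"
    proof (rule AE_I2)
      fix s
      show "norm (indicator {0..t} s *\<^sub>R k s) \<le> norm (indicator {0..t} s *\<^sub>R (q t * t powr (- (1/m)) * s powr (\<kappa> - 1)))"
      proof (cases "0 < s \<and> s \<le> t")
        case True
        then have "0 \<le> k s" "k s \<le> q t * t powr (- (1/m)) * s powr (\<kappa> - 1)" using k_bounds(1)[of s t] k_nonneg by auto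
        then show ?thesis using True by simp
      next
        case False
        then show ?thesis by (auto simp: indicator_def k_def)
      qed
    qed
  qed
next
  case True
  have "(\<lambda>s. indicator {0..t} s *\<^sub>R k s) = (\<lambda>_. 0)"
    using True by (auto simp: indicator_def k_def fun_eq_iff)
  then show ?thesis unfolding set_integrable_def by simp
qed

lemma J_integral: "t \<ge> 0 \<Longrightarrow> J t = integral {0..t} k"
  unfolding critical_inv_def k_def[symmetric] zero_ereal_def
  by (subst interval_integral_eq_integral) (auto intro!: k_integrable)

lemma k_integrable_on: "0 \<le> a \<Longrightarrow> k integrable_on {a..t}"
proof (cases "a \<le> t")
  case True
  assume a: "0 \<le> a"
  have "k absolutely_integrable_on {0..t}"
    unfolding set_integrable_def
    using k_integrable[of t] True a by (intro integrable_completion[THEN iffD2]) (auto simp: set_integrable_def)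
  then have "k integrable_on {0..t}" by (rule set_lebesgue_integral_eq_integral(1))
  then show ?thesis by (rule integrable_subinterval_real) (use a in auto)
qed auto

text \<open>The integrand \<open>k\<close> lies between multiples of
  \<open>s\<^sup>\<mu>\<^sup>-\<^sup>1\<close> and \<open>s\<^sup>\<kappa>\<^sup>-\<^sup>1\<close>
  on \<open>(0, t]\<close>, with equality at \<open>t\<close>. The right-hand side is
  \<open>t J'(t)\<close>.\<close>

lemma J_bounds:
  assumes t: "t > 0"
  shows "\<mu> * J t \<ge> q t * t powr (- (1 / real N))" "\<kappa> * J t \<le> q t * t powr (- (1 / real N))"
proof -
  have t0: "t \<ge> 0" using t by simp
  have "J t \<le> integral {0..t} (\<lambda>s. q t * t powr (- (1/m)) * s powr (\<kappa> - 1))"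
    unfolding J_integral[OF t0]
  proof (rule integral_le)
    show "(\<lambda>s. q t * t powr (- (1/m)) * s powr (\<kappa> - 1)) integrable_on {0..t}"
      using powr_integral[of "\<kappa> - 1" t] exps t by (intro integrable_on_mult_right) (auto simp: integrable_on_def)
    show "k s \<le> q t * t powr (- (1/m)) * s powr (\<kappa> - 1)" if "s \<in> {0..t}" for s
      using that k_bounds(1)[of s t] by (cases "s = 0") (auto simp: k_def)
  qed (rule k_integrable_on, simp)
  also have "\<dots> = q t * t powr (- (1/m)) * (t powr \<kappa> / \<kappa>)"
    using integral_unique[OF powr_integral[of "\<kappa> - 1" t]] exps t by simp
  also have "\<dots> = q t * t powr (- (1 / real N)) / \<kappa>"
    by (simp add: \<kappa>_def powr_add[symmetric])
  finally show "\<kappa> * J t \<le> q t * t powr (- (1 / real N))" using exps by (simp add: field_simps)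
  have "q t * t powr (- (1 / real N)) / \<mu> = q t * t powr (- (1/l)) * (t powr \<mu> / \<mu>)"
    by (simp add: \<mu>_def powr_add[symmetric])
  also have "\<dots> = integral {0..t} (\<lambda>s. q t * t powr (- (1/l)) * s powr (\<mu> - 1))"
    using integral_unique[OF powr_integral[of "\<mu> - 1" t]] exps t by simp
  also have "\<dots> \<le> J t"
    unfolding J_integral[OF t0]
  proof (rule integral_le)
    show "(\<lambda>s. q t * t powr (- (1/l)) * s powr (\<mu> - 1)) integrable_on {0..t}"
      using powr_integral[of "\<mu> - 1" t] exps t by (intro integrable_on_mult_right) (auto simp: integrable_on_def)
    show "q t * t powr (- (1/l)) * s powr (\<mu> - 1) \<le> k s" if "s \<in> {0..t}" for s
      using that k_bounds(2)[of s t] by (cases "s = 0") (auto simp: k_def)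
  qed (rule k_integrable_on, simp)
  finally show "\<mu> * J t \<ge> q t * t powr (- (1 / real N))" using exps by (simp add: field_simps)
qed

lemma J_0[simp]: "J 0 = 0" by (simp add: J_integral)

lemma J_pos: "t > 0 \<Longrightarrow> J t > 0"
proof -
  assume t: "t > 0"
  have "0 < q t * t powr (- (1 / real N))" using q_pos[OF t] t by simp
  also have "\<dots> \<le> \<mu> * J t" by (rule J_bounds(1)[OF t])
  finally show ?thesis using exps by (simp add: zero_less_mult_iff)
qed

lemma J_DERIV:
  assumes t: "t > 0" shows "(J has_real_derivative k t) (at t)"
proof -
  define a where "a = t / 2"
  have "((\<lambda>x. integral {a..x} k) has_real_derivative k t) (at t within {a..2 * t})"
    using t by (intro integral_has_real_derivative continuous_on_subset[OF k_cont]) (auto simp: a_def)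
  then have "((\<lambda>x. integral {a..x} k) has_real_derivative k t) (at t within {a<..<2 * t})"
    by (rule DERIV_subset) auto
  then have "((\<lambda>x. integral {a..x} k) has_real_derivative k t) (at t)"
    using t by (subst (asm) at_within_open) (auto simp: a_def)
  then have "((\<lambda>x. integral {0..a} k + integral {a..x} k) has_real_derivative k t) (at t)"
    by (auto intro!: derivative_eq_intros)
  then show ?thesis
  proof (rule has_field_derivative_transform_within_open[where S="{a<..}"])
    show "open {a<..}" "t \<in> {a<..}" using t by (auto simp: a_def)
    show "integral {0..a} k + integral {a..x} k = J x" if "x \<in> {a<..}" for x
      using that t by (simp add: J_integral a_def Henstock_Kurzweil_Integration.integral_combine k_integrable_on)
  qed
qed

lemma J_strict_mono: "0 \<le> s \<Longrightarrow> s < t \<Longrightarrow> J s < J t"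
proof (cases "s = 0")
  case True
  assume "s < t" then show ?thesis using True J_pos by simp
next
  case False
  assume "0 \<le> s" "s < t"
  then have s: "0 < s" "s < t" using False by auto
  show ?thesis
  proof (rule DERIV_pos_imp_increasing[OF s(2)])
    fix x assume "s \<le> x" "x \<le> t"
    then show "\<exists>y. DERIV J x :> y \<and> y > 0"
      using s J_DERIV[of x] k_pos[of x] by (intro exI[of _ "k x"]) simp
  qed
qed

lemma t_times_k: "t > 0 \<Longrightarrow> t * k t = q t * t powr (- (1 / real N))"
proof -
  assume t: "t > 0"
  have "t powr ((real N + 1) / real N) = t * t powr (1 / real N)"
    using t exponents by (simp add: add_divide_distrib powr_add)
  then show ?thesis using t by (simp add: k_def powr_minus field_simps)
qed

lemma J_scale:
  assumes "0 < s" "s \<le> t"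
  shows "J t * t powr - \<mu> \<le> J s * s powr - \<mu>" "J s * s powr - \<kappa> \<le> J t * t powr - \<kappa>"
  by (rule powr_ratio_mono[OF assms J_DERIV]; simp add: t_times_k J_bounds)+

lemma J_unbounded: "t \<ge> 1 \<Longrightarrow> J 1 * t powr \<kappa> \<le> J t"
  using J_scale(2)[of 1 t] by (simp add: powr_minus field_simps)

lemma J_small: "0 < t \<Longrightarrow> t \<le> 1 \<Longrightarrow> J t \<le> J 1 * t powr \<kappa>"
  using J_scale(2)[of t 1] by (simp add: powr_minus field_simps)

lemma J_cont: "continuous_on {0..} J"
proof (rule continuous_on_eq_continuous_within[THEN iffD2], intro ballI)
  fix s :: real assume s: "s \<in> {0..}"
  show "continuous (at s within {0..}) J"
  proof (cases "s = 0")
    case False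
    then have "isCont J s" using J_DERIV[of s] s by (simp add: DERIV_isCont)
    then show ?thesis by (rule continuous_at_imp_continuous_at_within)
  next
    case True
    have "at (0::real) within {0..} = at_right 0"
      by (rule at_within_nhd[of _ UNIV]) auto
    moreover have "(J \<longlongrightarrow> 0) (at_right 0)"
    proof (rule real_tendsto_sandwich)
      show "\<forall>\<^sub>F t in at_right 0. 0 \<le> J t"
        unfolding eventually_at_right_field by (intro exI[of _ 1]) (auto intro: less_imp_le J_pos)
      show "\<forall>\<^sub>F t in at_right 0. J t \<le> J 1 * t powr \<kappa>"
        unfolding eventually_at_right_field by (intro exI[of _ 1]) (auto intro: J_small)
      have "((\<lambda>t::real. t powr \<kappa>) \<longlongrightarrow> 0 powr \<kappa>) (at_right 0)"
        using exps by (intro tendsto_powr2) (auto simp: eventually_at_right_field intro!: tendsto_ident_at exI[of _ 1])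
      from tendsto_mult[OF tendsto_const[of "J 1"] this]
      show "((\<lambda>t. J 1 * t powr \<kappa>) \<longlongrightarrow> 0) (at_right 0)" using exps by simp
    qed auto
    ultimately show ?thesis using True by (simp add: continuous_within)
  qed
qed

lemma J_nonneg: "t \<ge> 0 \<Longrightarrow> J t \<ge> 0"
  using J_pos[of t] by (cases "t = 0") auto

lemma J_bij: "bij_betw J {0..} {0..}"
proof -
  have inj: "inj_on J {0..}"
    by (rule linorder_inj_onI) (use J_strict_mono in force)+
  have "y \<in> J ` {0..}" if y: "y \<ge> 0" for y
  proof -
    define b where "b = (max 1 (y / J 1)) powr (1 / \<kappa>)"
    have b: "1 \<le> b" using exps by (auto simp: b_def ge_one_powr_ge_zero)
    have "y \<le> J 1 * max 1 (y / J 1)" using J_pos[of 1] by (simp add: max_def field_simps)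
    also have "max 1 (y / J 1) = b powr \<kappa>" using exps by (simp add: b_def powr_powr)
    also have "J 1 * \<dots> \<le> J b" by (rule J_unbounded[OF b])
    finally have "y \<le> J b" .
    moreover have "continuous_on {0..b} J" by (rule continuous_on_subset[OF J_cont]) simp
    ultimately obtain x where "0 \<le> x" "x \<le> b" "J x = y"
      using IVT'[of J 0 y b] y b by auto
    then show ?thesis by auto
  qed
  then have "J ` {0..} = {0..}" by (auto simp: J_nonneg)
  with inj show ?thesis by (simp add: bij_betw_def)
qed

abbreviation S :: "real \<Rightarrow> real" where "S \<equiv> critical_fun N \<Phi>"

lemma S_J: "t \<ge> 0 \<Longrightarrow> S (J t) = t"
  using J_nonneg[of t] by (simp add: critical_fun_def inv_into_f_f[OF bij_betw_imp_inj_on[OF J_bij]])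

lemma S_cases:
  obtains t where "t \<ge> 0" "\<bar>s\<bar> = J t" "S s = t"
proof -
  have "\<bar>s\<bar> \<in> J ` {0..}" using J_bij by (simp add: bij_betw_def)
  then obtain t where t: "t \<ge> 0" "\<bar>s\<bar> = J t" by auto
  then show ?thesis using S_J[of t] J_nonneg[of t] by (intro that[of t]) (auto simp: critical_fun_def)
qed

lemma S_even: "S (- s) = S s" "S \<bar>s\<bar> = S s"
  by (simp_all add: critical_fun_def)

lemma S_nonneg: "S s \<ge> 0" using S_cases[of s] by metis

lemma J_S: "s \<ge> 0 \<Longrightarrow> J (S s) = s" using S_cases[of s] by (metis abs_of_nonneg)

lemma S_0[simp]: "S 0 = 0" using S_J[of 0] by simp

lemma S_pos: "s > 0 \<Longrightarrow> S s > 0"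
  using J_S[of s] S_nonneg[of s] by (cases "S s = 0") auto

lemma S_mono: "0 \<le> s \<Longrightarrow> s \<le> t \<Longrightarrow> S s \<le> S t"
  using J_S[of s] J_S[of t] J_strict_mono[of "S t" "S s"] S_nonneg[of t] by force

lemma S_DERIV:
  assumes s: "s > 0" shows "(S has_real_derivative inverse (k (S s))) (at s)"
proof (rule DERIV_inverse_function[where a=0 and b="s + 1" and f=J])
  show "(J has_real_derivative k (S s)) (at (S s))" by (rule J_DERIV[OF S_pos[OF s]])
  show "k (S s) \<noteq> 0" using k_pos[OF S_pos[OF s]] by simp
  show "\<And>y. 0 < y \<Longrightarrow> y < s + 1 \<Longrightarrow> J (S y) = y" by (simp add: J_S)
  have t: "S s > 0" by (rule S_pos[OF s])
  have "isCont S (J (S s))"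
  proof (rule isCont_inverse_function[where f=J and g=S and x="S s" and d="S s / 2"])
    show "0 < S s / 2" using t by simp
    show "S (J z) = z" if "\<bar>z - S s\<bar> \<le> S s / 2" for z
    proof (rule S_J)
      show "0 \<le> z" using that t by linarith
    qed
    show "isCont J z" if "\<bar>z - S s\<bar> \<le> S s / 2" for z
    proof -
      have "z > 0" using that t by linarith
      then show ?thesis using J_DERIV DERIV_isCont by blast
    qed
  qed
  then show "isCont S s" using s by (simp add: J_S)
qed (use s in auto)

lemma S_cont: "continuous_on UNIV S"
proof -
  have *: "isCont S s" if "s > 0" for s using S_DERIV[OF that] by (rule DERIV_isCont)
  have "isCont S 0"
  proof -
    have "\<forall>e>0. \<exists>d>0. \<forall>x. \<bar>x\<bar> < d \<longrightarrow> \<bar>S x\<bar> < e"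
    proof (intro allI impI)
      fix e :: real assume e: "e > 0"
      show "\<exists>d>0. \<forall>x. \<bar>x\<bar> < d \<longrightarrow> \<bar>S x\<bar> < e"
      proof (intro exI[of _ "J e"] conjI allI impI)
        show "J e > 0" by (rule J_pos[OF e])
        fix x assume "\<bar>x\<bar> < J e"
        then have "J (S x) < J e" using J_S[of "\<bar>x\<bar>"] by (simp add: S_even)
        then have "S x < e" using J_strict_mono[of e "S x"] e by (cases "S x" e rule: linorder_cases) auto
        then show "\<bar>S x\<bar> < e" using S_nonneg[of x] by simp
      qed
    qed
    then show ?thesis by (simp add: isCont_def LIM_def) meson
  qed
  moreover have "isCont S s" if "s < 0" for s
  proof -
    have "isCont (\<lambda>x. S (- x)) s"
      by (rule isCont_o2[where f=uminus and g=S]) (use *[of "- s"] that in auto)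
    then show ?thesis by (simp add: S_even)
  qed
  ultimately have "isCont S s" for s using * by (cases s "0::real" rule: linorder_cases) auto
  then show ?thesis by (simp add: continuous_at_imp_continuous_on)
qed

lemma S_measurable[measurable]: "S \<in> borel_measurable borel"
  by (rule borel_measurable_continuous_onI[OF S_cont])

lemma S_scale:
  assumes "1 \<le> r"
  shows "S (r * s) \<le> r powr (1 / \<kappa>) * S s" "r powr (1 / \<mu>) * S s \<le> S (r * s)"
proof -
  have *: "S (r * s) \<le> r powr (1 / \<kappa>) * S s \<and> r powr (1 / \<mu>) * S s \<le> S (r * s)" if s: "s > 0" for s
  proof -
    define t t' where "t = S s" and "t' = S (r * s)"
    have rs: "s \<le> r * s" using assms s by simp
    have t: "t > 0" "t \<le> t'" "J t = s" "J t' = r * s"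
      using s rs S_pos[of s] S_mono[of s "r * s"] J_S[of s] J_S[of "r * s"] by (auto simp: t_def t'_def)
    have t': "t' > 0" using t by simp
    have "r * s * t' powr - \<mu> \<le> s * t powr - \<mu>" "s * t powr - \<kappa> \<le> r * s * t' powr - \<kappa>"
      using J_scale[OF t(1,2)] t by simp_all
    then have a: "r * t powr \<mu> \<le> t' powr \<mu>" "t' powr \<kappa> \<le> r * t powr \<kappa>"
      using s t(1) t' by (simp_all add: powr_minus field_simps)
    have "(r * t powr \<mu>) powr (1 / \<mu>) \<le> (t' powr \<mu>) powr (1 / \<mu>)"
      using a(1) exps assms by (intro powr_mono2) auto
    moreover have "(t' powr \<kappa>) powr (1 / \<kappa>) \<le> (r * t powr \<kappa>) powr (1 / \<kappa>)"
      using a(2) exps assms by (intro powr_mono2) auto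
    ultimately show ?thesis using exps t(1) t' assms
      by (simp add: powr_mult powr_powr t_def[symmetric] t'_def[symmetric])
  qed
  show "S (r * s) \<le> r powr (1 / \<kappa>) * S s" "r powr (1 / \<mu>) * S s \<le> S (r * s)"
    using *[of "\<bar>s\<bar>"] assms S_even(2)[of s] S_even(2)[of "r * s"] by (cases "s = 0"; simp add: abs_mult)+
qed

lemma S_scale_linear: "1 \<le> r \<Longrightarrow> r * S s \<le> S (r * s)"
proof -
  assume r: "1 \<le> r"
  have "r powr 1 \<le> r powr (1 / \<mu>)" using r exps by (intro powr_mono) auto
  then have "r * S s \<le> r powr (1 / \<mu>) * S s" using r S_nonneg[of s] by (intro mult_right_mono) auto
  also have "\<dots> \<le> S (r * s)" by (rule S_scale(2)[OF r])
  finally show ?thesis .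
qed

lemma S_ratio_mono:
  assumes "0 < s" "s \<le> t" shows "S s / s \<le> S t / t"
  using S_scale_linear[of "t / s" s] assms by (simp add: field_simps)

lemma S_add: "S (s + t) \<le> 2 powr (1 / \<kappa>) * (S s + S t)"
proof -
  let ?M = "max \<bar>s\<bar> \<bar>t\<bar>"
  have "S (s + t) = S \<bar>s + t\<bar>" by (simp add: S_even)
  also have "\<dots> \<le> S (2 * ?M)" by (intro S_mono) auto
  also have "\<dots> \<le> 2 powr (1 / \<kappa>) * S ?M" by (rule S_scale) simp
  also have "\<dots> \<le> 2 powr (1 / \<kappa>) * (S s + S t)"
    using S_even S_nonneg[of s] S_nonneg[of t] by (intro mult_left_mono) (auto simp: max_def)
  finally show ?thesis .
qed

lemma S_superlinear:
  obtains s0 where "s0 > 0" "\<And>s. s \<ge> s0 \<Longrightarrow> c * s \<le> S s"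
proof -
  define d where "d = 1 / \<mu> - 1"
  define r where "r = max 1 (\<bar>c\<bar> / S 1) powr (1 / d)"
  have e: "d > 0" using exps by (simp add: d_def)
  have r: "r \<ge> 1" using e by (auto simp: r_def ge_one_powr_ge_zero)
  show ?thesis
  proof (rule that[of r])
    show "r > 0" using r by simp
    fix s assume s: "s \<ge> r"
    have "r powr d = max 1 (\<bar>c\<bar> / S 1)" using e by (simp add: r_def powr_powr)
    moreover have "r powr d \<le> s powr d" using s r e by (intro powr_mono2) auto
    ultimately have "\<bar>c\<bar> / S 1 \<le> s powr d" by linarith
    then have "c \<le> s powr d * S 1" using S_pos[of 1] by (simp add: field_simps)
    then have "c * s \<le> s powr d * S 1 * s" using s r by (intro mult_right_mono) auto
    also have "\<dots> = s powr (1 / \<mu>) * S 1" using s r by (simp add: powr_diff d_def)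
    also have "\<dots> \<le> S s" using S_scale(2)[of s 1] s r by simp
    finally show "c * s \<le> S s" .
  qed
qed

text \<open>For \<open>s = J t\<close> one has
  \<open>s \<le> q t / (\<kappa> t\<^sup>1\<^sup>/\<^sup>N)\<close>, where \<open>q\<close>
  inverts \<open>\<Phi>\<close>; so \<open>s\<close> is a small fraction of \<open>q t\<close>
  once \<open>t\<close> is large, and then \<open>\<Phi> s\<close> is a small fraction of
  \<open>t = S s\<close>. Below that threshold \<open>\<Phi>\<close> is at most linear. Thus
  \<open>\<Phi>\<close> is subcritical.\<close>

lemma Phi_le_S:
  assumes \<epsilon>: "\<epsilon> > 0"
  obtains M where "M \<ge> 0" "\<And>s. \<Phi> s \<le> \<epsilon> * S s + M * \<bar>s\<bar>"
proof -
  have N: "real N > 0" using exponents by simp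
  define \<epsilon>' where "\<epsilon>' = min 1 \<epsilon>"
  have \<epsilon>': "0 < \<epsilon>'" "\<epsilon>' \<le> 1" "\<epsilon>' \<le> \<epsilon>" using \<epsilon> by (auto simp: \<epsilon>'_def)
  \<comment> \<open>beyond \<open>T\<close> the quotient \<open>J t / q t\<close> is at most \<open>\<epsilon>'\<close>\<close>
  define T where "T = (1 / (\<epsilon>' * \<kappa>)) powr real N"
  have T: "T > 0" using \<epsilon>' exps by (simp add: T_def)
  define M where "M = \<Phi> (J T) / J T"
  have JT: "J T > 0" by (rule J_pos[OF T])
  show ?thesis
  proof (rule that[of M])
    show M: "M \<ge> 0" using JT Phi_nonneg by (simp add: M_def)
    fix s :: real
    obtain t where t: "t \<ge> 0" "\<bar>s\<bar> = J t" "S s = t" by (rule S_cases)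
    show "\<Phi> s \<le> \<epsilon> * S s + M * \<bar>s\<bar>"
    proof (cases "t \<le> T")
      case True
      then have "\<bar>s\<bar> \<le> J T" using t J_strict_mono[of t T] by (cases "t = T") auto
      then have "\<Phi> (\<bar>s\<bar> / J T * J T) \<le> \<bar>s\<bar> / J T * \<Phi> (J T)"
        using JT by (intro Phi_shrink_linear) auto
      then have "\<Phi> s \<le> M * \<bar>s\<bar>" using JT by (simp add: M_def Phi_even mult.commute)
      moreover have "0 \<le> \<epsilon> * S s" using \<epsilon> S_nonneg by simp
      ultimately show ?thesis by simp
    next
      case False
      then have t0: "t > 0" using T by simp
      have "T powr (1 / real N) \<le> t powr (1 / real N)" using False T N by (intro powr_mono2) auto
      then have "1 / (\<epsilon>' * \<kappa>) \<le> t powr (1 / real N)"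
        using N \<epsilon>' exps by (simp add: T_def powr_powr)
      then have "t powr (- (1 / real N)) / \<kappa> \<le> \<epsilon>'"
        using \<epsilon>' exps t0 by (simp add: powr_minus field_simps)
      then have "q t * (t powr (- (1 / real N)) / \<kappa>) \<le> q t * \<epsilon>'"
        using q_nonneg[OF t(1)] by (intro mult_left_mono)
      moreover have "J t \<le> q t * (t powr (- (1 / real N)) / \<kappa>)"
        using J_bounds(2)[OF t0] exps by (simp add: field_simps)
      ultimately have "\<bar>s\<bar> \<le> \<epsilon>' * q t" using t by (simp add: mult.commute)
      then have "\<Phi> s \<le> \<Phi> (\<epsilon>' * q t)" using \<epsilon>' q_nonneg[OF t(1)] by (intro Phi_mono_abs) (simp add: abs_mult)
      also have "\<dots> \<le> \<epsilon>' * \<Phi> (q t)" using \<epsilon>' by (intro Phi_shrink_linear) auto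
      also have "\<dots> \<le> \<epsilon> * S s" using \<epsilon>' t Phi_q[OF t(1)] by (simp add: mult_right_mono)
      also have "\<dots> \<le> \<epsilon> * S s + M * \<bar>s\<bar>" using M by simp
      finally show ?thesis .
    qed
  qed
qed

end

section \<open>The Sobolev inequality for compactly supported functions\<close>

context young_growth
begin

text \<open>Gagliardo--Nirenberg is applied to \<open>G(w)\<close> with
  \<open>G = S\<^sup>c\<close>, so that
  \<open>|G(w)|\<^sup>N\<^sup>/\<^sup>(\<^sup>N\<^sup>-\<^sup>1\<^sup>) = S(w)\<close>. The
  definition of the critical function gives
  \<open>S' = S\<^sup>(\<^sup>N\<^sup>+\<^sup>1\<^sup>)\<^sup>/\<^sup>N / q(S)\<close>, whence
  \<open>G' = c Q\<close> on the positive half-line.\<close>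

definition c :: real where "c = (real N - 1) / real N"
definition Q :: "real \<Rightarrow> real" where "Q r = S r / q (S r)"
definition G :: "real \<Rightarrow> real" where "G r = S r powr c"
definition G' :: "real \<Rightarrow> real" where "G' r = sgn r * c * Q r"

lemma c_bounds: "0 < c" "c < 1" "c > \<mu>"
proof -
  have N: "real N > 1" using exponents by linarith
  then show "0 < c" "c < 1" by (auto simp: c_def)
  have "1 / l < 1" using exponents by auto
  then show "c > \<mu>" using N by (simp add: c_def \<mu>_def diff_divide_distrib)
qed

lemma Q_nonneg: "Q r \<ge> 0"
  by (simp add: Q_def S_nonneg q_nonneg)

text \<open>Since \<open>c > \<mu>\<close>, the function \<open>G\<close> vanishes at
  \<open>0\<close> faster than linearly and is therefore differentiable there.\<close>

lemma G_small:
  assumes "r \<noteq> 0" "\<bar>r\<bar> \<le> 1"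
  shows "G r / \<bar>r\<bar> \<le> S 1 powr c * \<bar>r\<bar> powr (c / \<mu> - 1)"
proof -
  have "(1 / \<bar>r\<bar>) powr (1 / \<mu>) * S r \<le> S 1"
    using S_scale(2)[of "1 / \<bar>r\<bar>" "\<bar>r\<bar>"] assms by (simp add: S_even)
  then have "S r \<le> S 1 * \<bar>r\<bar> powr (1 / \<mu>)"
    using assms by (simp add: powr_divide powr_minus field_simps)
  then have "G r \<le> (S 1 * \<bar>r\<bar> powr (1 / \<mu>)) powr c"
    unfolding G_def using S_nonneg[of r] c_bounds by (intro powr_mono2) auto
  also have "\<dots> = S 1 powr c * (\<bar>r\<bar> powr (c / \<mu>))"
    using S_nonneg[of 1] by (simp add: powr_mult powr_powr)
  finally show ?thesis using assms by (simp add: powr_diff field_simps)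
qed

lemma Q_le_G:
  assumes "r \<noteq> 0" shows "Q r \<le> G r / (\<kappa> * \<bar>r\<bar>)"
proof -
  define t where "t = S r"
  have t: "t > 0" "J t = \<bar>r\<bar>" using S_pos[of "\<bar>r\<bar>"] J_S[of "\<bar>r\<bar>"] assms by (auto simp: t_def S_even)
  have qt: "q t > 0" by (rule q_pos[OF t(1)])
  have "\<kappa> * \<bar>r\<bar> \<le> q t * t powr (- (1 / real N))" using J_bounds(2)[OF t(1)] t by simp
  then have "t * (\<kappa> * \<bar>r\<bar>) \<le> t * (q t * t powr (- (1 / real N)))" using t by (intro mult_left_mono) auto
  also have "\<dots> = q t * (t powr 1 * t powr (- (1 / real N)))" using t by simp
  also have "t powr 1 * t powr (- (1 / real N)) = t powr c"
    using exponents unfolding powr_add[symmetric] c_def by (simp add: diff_divide_distrib)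
  finally have "t * (\<kappa> * \<bar>r\<bar>) \<le> q t * t powr c" .
  then show ?thesis unfolding Q_def G_def t_def[symmetric]
    using qt assms exps by (simp add: field_simps)
qed

lemma G_quotient_tendsto_0: "((\<lambda>r. G r / \<bar>r\<bar>) \<longlongrightarrow> 0) (at 0)"
proof (rule Lim_null_comparison)
  show "\<forall>\<^sub>F r in at 0. norm (G r / \<bar>r\<bar>) \<le> S 1 powr c * \<bar>r\<bar> powr (c / \<mu> - 1)"
    unfolding eventually_at
    by (intro exI[of _ 1]) (use G_small in \<open>auto simp: G_def dist_real_def\<close>)
  have e: "c / \<mu> - 1 > 0" using c_bounds exps by (simp add: field_simps)
  have "((\<lambda>r::real. \<bar>r\<bar>) \<longlongrightarrow> 0) (at 0)" by (rule tendsto_rabs_zero[OF tendsto_ident_at])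
  from tendsto_powr2[OF this tendsto_const _ e]
  have "((\<lambda>r::real. \<bar>r\<bar> powr (c / \<mu> - 1)) \<longlongrightarrow> 0) (at 0)" by simp
  from tendsto_mult[OF tendsto_const[of "S 1 powr c"] this]
  show "((\<lambda>r. S 1 powr c * \<bar>r\<bar> powr (c / \<mu> - 1)) \<longlongrightarrow> 0) (at 0)" by simp
qed

lemma G_DERIV_pos:
  assumes r: "r > 0" shows "(G has_real_derivative c * Q r) (at r)"
proof -
  have S: "S r > 0" by (rule S_pos[OF r])
  have "(G has_real_derivative (c * S r powr (c - 1)) * inverse (k (S r))) (at r)"
    unfolding G_def[abs_def]
    using S by (intro DERIV_chain2[where f="\<lambda>s. s powr c" and g=S] has_real_derivative_powr S_DERIV r)
  moreover have "S r powr (c - 1) * inverse (k (S r)) = Q r"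
  proof -
    have "c - 1 = - (1 / real N)" using exponents by (simp add: c_def diff_divide_distrib)
    then have p: "S r powr (c - 1) = S r powr (- (1 / real N))" by (simp only:)
    have "S r powr (c - 1) * inverse (k (S r)) = S r * (S r powr (- (1 / real N)) / (S r * k (S r)))"
      unfolding p using S k_pos[OF S] by (simp add: field_simps)
    also have "\<dots> = Q r" unfolding t_times_k[OF S] Q_def using S by simp
    finally show ?thesis .
  qed
  ultimately show ?thesis by (simp add: mult.assoc)
qed

lemma G_DERIV: "(G has_real_derivative G' r) (at r)"
proof -
  consider "r > 0" | "r = 0" | "r < 0" by linarith
  then show ?thesis
  proof cases
    case 1
    then show ?thesis using G_DERIV_pos by (simp add: G'_def)
  next
    case 2
    have "((\<lambda>h. G h / h) \<longlongrightarrow> 0) (at 0)"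
      using G_quotient_tendsto_0 by (rule tendsto_rabs_zero_cancel[OF tendsto_cong[THEN iffD1, rotated]])
         (auto simp: G_def intro!: always_eventually)
    then show ?thesis using 2 by (simp add: DERIV_def G'_def G_def)
  next
    case 3
    have "(uminus has_real_derivative - 1) (at r)" by (auto intro!: derivative_eq_intros)
    then have "((\<lambda>s. G (- s)) has_real_derivative c * Q (- r) * - 1) (at r)"
      using 3 DERIV_chain2[where f=G and g=uminus and x=r and s=UNIV and Db="- 1", OF G_DERIV_pos[of "- r"]]
      by simp
    then show ?thesis using 3 by (simp add: G_def[abs_def] Q_def G'_def S_even)
  qed
qed

lemma Q_cont: "isCont Q r" if "r \<noteq> 0"
proof -
  have S: "S r > 0" using S_pos[of "\<bar>r\<bar>"] that by (simp add: S_even)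
  have "isCont q (S r)" using q_cont S by (simp add: continuous_on_eq_continuous_at)
  moreover have Sc: "isCont S r" using S_cont by (simp add: continuous_on_eq_continuous_at)
  ultimately have "isCont (\<lambda>r. q (S r)) r" by (rule isCont_o2[rotated])
  then show ?thesis unfolding Q_def[abs_def] using Sc q_pos[OF S] by (intro continuous_intros) auto
qed

lemma G'_cont: "continuous_on UNIV G'"
proof -
  have "isCont G' r" for r
  proof (cases "r = 0")
    case False
    then show ?thesis unfolding G'_def[abs_def] using Q_cont[OF False] by (auto intro!: continuous_intros)
  next
    case True
    have "((\<lambda>h. G' h) \<longlongrightarrow> 0) (at 0)"
    proof (rule Lim_null_comparison)
      show "\<forall>\<^sub>F h in at 0. norm (G' h) \<le> c * (G h / \<bar>h\<bar> / \<kappa>)"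
      proof (rule eventually_at_filter[THEN iffD2], rule always_eventually, intro allI impI)
        fix h :: real assume h: "h \<noteq> 0"
        have "norm (G' h) = c * Q h" using h c_bounds Q_nonneg[of h] by (simp add: G'_def abs_mult abs_sgn_eq)
        also have "\<dots> \<le> c * (G h / (\<kappa> * \<bar>h\<bar>))" using Q_le_G[OF h] c_bounds by (intro mult_left_mono) auto
        finally show "norm (G' h) \<le> c * (G h / \<bar>h\<bar> / \<kappa>)" by (simp add: mult.commute)
      qed
      have "((\<lambda>h. c * (G h / \<bar>h\<bar> / \<kappa>)) \<longlongrightarrow> c * (0 / \<kappa>)) (at 0)"
        using exps by (intro tendsto_intros G_quotient_tendsto_0) auto
      then show "((\<lambda>h. c * (G h / \<bar>h\<bar> / \<kappa>)) \<longlongrightarrow> 0) (at 0)" by simp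
    qed
    moreover have "G' 0 = 0" by (simp add: G'_def)
    ultimately show ?thesis using True by (simp add: isCont_def)
  qed
  then show ?thesis by (simp add: continuous_at_imp_continuous_on)
qed

text \<open>Write \<open>S r = \<Phi> \<sigma>\<close>, so that
  \<open>Q r = \<Phi> \<sigma> / \<sigma>\<close>, and distinguish whether
  \<open>\<tau>\<close> is below or above \<open>\<sigma> / 2\<close>.\<close>

lemma Q_young:
  assumes \<tau>: "\<tau> \<ge> 0" shows "Q r * \<tau> \<le> S r / 2 + 2 powr (m - 1) * \<Phi> \<tau>"
proof -
  define \<sigma> where "\<sigma> = q (S r)"
  have \<sigma>: "\<sigma> \<ge> 0" "\<Phi> \<sigma> = S r" by (auto simp: \<sigma>_def q_nonneg Phi_q S_nonneg)
  have Q: "Q r = \<Phi> \<sigma> / \<sigma>" by (simp only: Q_def \<sigma>(2)) (simp only: \<sigma>_def)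
  show ?thesis
  proof (cases "\<tau> \<le> \<sigma> / 2")
    case True
    then have "\<Phi> \<sigma> / \<sigma> * \<tau> \<le> \<Phi> \<sigma> / \<sigma> * (\<sigma> / 2)" using \<sigma> S_nonneg[of r] by (intro mult_left_mono) auto
    also have "\<dots> \<le> \<Phi> \<sigma> / 2" using Phi_nonneg[of \<sigma>] by (cases "\<sigma> = 0") auto
    finally have "Q r * \<tau> \<le> S r / 2" unfolding Q \<sigma>(2) .
    moreover have "0 \<le> 2 powr (m - 1) * \<Phi> \<tau>" by (simp add: Phi_nonneg)
    ultimately show ?thesis by simp
  next
    case False
    then have \<tau>: "\<tau> > 0" "\<sigma> < 2 * \<tau>" using \<sigma> by auto
    have "\<Phi> \<sigma> / \<sigma> * \<tau> \<le> \<Phi> (2 * \<tau>) / 2"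
    proof (cases "\<sigma> = 0")
      case False
      then have s: "\<sigma> > 0" using \<sigma> by simp
      have "\<Phi> (\<sigma> / (2 * \<tau>) * (2 * \<tau>)) \<le> \<sigma> / (2 * \<tau>) * \<Phi> (2 * \<tau>)"
        using \<tau> s by (intro Phi_shrink_linear) auto
      then show ?thesis using \<tau> s by (simp add: field_simps)
    qed (simp add: Phi_nonneg)
    also have "\<dots> \<le> 2 powr m * \<Phi> \<tau> / 2" using Phi_scale(2)[of 2 \<tau>] by simp
    also have "\<dots> = 2 powr (m - 1) * \<Phi> \<tau>" by (simp add: powr_diff)
    finally show ?thesis using Q S_nonneg[of r] by simp
  qed
qed

lemma C1c_G:
  assumes "C1c w g" shows "C1c (\<lambda>x. G (w x)) (\<lambda>x. G' (w x) *\<^sub>R g x)"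
proof -
  obtain R where R: "R > 0" "\<And>x. norm x > R \<Longrightarrow> w x = 0 \<and> g x = 0"
    using assms by (auto simp: C1c_def)
  have "((\<lambda>x. G (w x)) has_derivative (\<lambda>h. h \<bullet> (G' (w x) *\<^sub>R g x))) (at x)" for x
  proof -
    have "(w has_derivative (\<lambda>h. h \<bullet> g x)) (at x)" using assms by (simp add: C1c_def)
    from has_derivative_compose[OF this, of G "\<lambda>h. G' (w x) * h"] show ?thesis
      using G_DERIV[of "w x"] by (simp add: has_field_derivative_def)
  qed
  moreover have "continuous_on UNIV (\<lambda>x. G' (w x) *\<^sub>R g x)"
    using assms C1c_continuous[OF assms] G'_cont
    by (intro continuous_intros continuous_on_compose2[OF G'_cont]) (auto simp: C1c_def)
  ultimately show ?thesis using R unfolding C1c_def by (auto simp: G_def)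
qed

lemma sobolev_level_bound:
  fixes w :: "'a::euclidean_space \<Rightarrow> real"
  assumes wg: "C1c w g" and N: "N = DIM('a)"
  shows "(\<integral>\<^sup>+x. ennreal (S (w x)) \<partial>lborel) ^ (N - 1)
    \<le> (\<integral>\<^sup>+x. ennreal (S (w x)) / 2 + ennreal (2 powr (m - 1)) * ennreal (\<Phi> (norm (g x))) \<partial>lborel) ^ N"
proof -
  note [measurable] = C1c_measurable[OF wg]
  have N2: "N \<ge> 2" using exponents by linarith
  have "(\<integral>\<^sup>+x. ennreal (S (w x)) \<partial>lborel) ^ (DIM('a) - 1)
      \<le> (\<Prod>e\<in>Basis. \<integral>\<^sup>+x. ennreal \<bar>e \<bullet> (G' (w x) *\<^sub>R g x)\<bar> \<partial>lborel)"
  proof (rule gagliardo_nirenberg[OF C1c_G[OF wg]])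
    show "2 \<le> DIM('a)" using N2 N by simp
    show "(\<lambda>x. ennreal (S (w x))) \<in> borel_measurable borel" by measurable
    fix x
    have "G (w x) ^ N = S (w x) ^ (N - 1)"
    proof (cases "S (w x) = 0")
      case False
      then have "S (w x) > 0" using S_nonneg[of "w x"] by simp
      moreover have "real (N - 1) = c * real N" using N2 by (simp add: c_def of_nat_diff)
      ultimately show ?thesis
        by (simp add: G_def powr_realpow[symmetric] powr_powr del: of_nat_diff)
    qed (use N2 in \<open>simp add: G_def zero_power\<close>)
    then have "ennreal (S (w x)) ^ (N - 1) \<le> ennreal \<bar>G (w x)\<bar> ^ N"
      by (simp add: ennreal_power S_nonneg) (simp add: G_def)
    then show "ennreal (S (w x)) ^ (DIM('a) - 1) \<le> ennreal \<bar>G (w x)\<bar> ^ DIM('a)"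
      unfolding N[symmetric] .
  qed
  also have "\<dots> \<le> (\<Prod>e\<in>(Basis::'a set). \<integral>\<^sup>+x. ennreal (S (w x)) / 2 + ennreal (2 powr (m - 1)) * ennreal (\<Phi> (norm (g x))) \<partial>lborel)"
  proof (intro prod_mono_ennreal nn_integral_mono)
    fix e x :: 'a assume e: "e \<in> Basis"
    have "\<bar>e \<bullet> (G' (w x) *\<^sub>R g x)\<bar> \<le> Q (w x) * norm (g x)"
    proof -
      have "\<bar>G' (w x)\<bar> \<le> Q (w x)"
      proof -
        have "\<bar>G' (w x)\<bar> = \<bar>sgn (w x)\<bar> * c * Q (w x)" using c_bounds Q_nonneg by (simp add: G'_def abs_mult)
        also have "\<dots> \<le> 1 * Q (w x)"
          using c_bounds Q_nonneg[of "w x"] by (intro mult_right_mono) (auto simp: abs_sgn_eq)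
        finally show ?thesis by simp
      qed
      moreover have "\<bar>e \<bullet> g x\<bar> \<le> norm (g x)" using e Basis_le_norm by (metis inner_commute)
      ultimately show ?thesis by (simp add: abs_mult mult_mono')
    qed
    also have "\<dots> \<le> S (w x) / 2 + 2 powr (m - 1) * \<Phi> (norm (g x))" by (rule Q_young) simp
    finally have "ennreal \<bar>e \<bullet> (G' (w x) *\<^sub>R g x)\<bar> \<le> ennreal (S (w x) / 2 + 2 powr (m - 1) * \<Phi> (norm (g x)))"
      by (rule ennreal_leI)
    also have "\<dots> = ennreal (S (w x)) / 2 + ennreal (2 powr (m - 1)) * ennreal (\<Phi> (norm (g x)))"
      by (simp add: S_nonneg Phi_nonneg ennreal_mult divide_ennreal[symmetric])
    finally show "ennreal \<bar>e \<bullet> (G' (w x) *\<^sub>R g x)\<bar> \<le> \<dots>" .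
  qed
  finally show ?thesis using N by simp
qed

text \<open>A continuity argument: if the integral of \<open>S(w)\<close> exceeded
  \<open>1\<close>, then the integral of \<open>S(s w)\<close> would be \<open>1\<close> for some
  \<open>s\<close> in \<open>[0, 1]\<close>, and the level bound would say
  \<open>1 \<le> (1/2 + d)\<^sup>N\<close> with
  \<open>d = 2\<^sup>m\<^sup>-\<^sup>1 \<integral> \<Phi>(|\<nabla>w|) < 1/2\<close>.\<close>

theorem sobolev_C1c:
  fixes w :: "'a::euclidean_space \<Rightarrow> real"
  assumes wg: "C1c w g" and N: "N = DIM('a)"
    and small: "(\<integral>\<^sup>+x. ennreal (\<Phi> (norm (g x))) \<partial>lborel) < ennreal (2 powr - m)"
  shows "(\<integral>\<^sup>+x. ennreal (S (w x)) \<partial>lborel) \<le> 1"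
proof (rule ccontr)
  assume not: "\<not> ?thesis"
  note [measurable] = C1c_measurable[OF wg]
  obtain R where R: "R > 0" "\<And>x. norm x > R \<Longrightarrow> w x = 0 \<and> g x = 0"
    using wg by (auto simp: C1c_def)
  have N2: "N \<ge> 2" using exponents by linarith
  have i: "integrable lborel (\<lambda>x. S (s * w x))" for s
    using R C1c_continuous[OF wg]
    by (intro integrable_compact_support[where R=R] continuous_on_compose2[OF S_cont] continuous_intros) auto
  define X where "X s = (\<integral>x. S (s * w x) \<partial>lborel)" for s
  have Xnn: "ennreal (X s) = (\<integral>\<^sup>+x. ennreal (S (s * w x)) \<partial>lborel)" for s
    unfolding X_def using i by (intro nn_integral_eq_integral[symmetric]) (auto simp: S_nonneg)
  have "continuous_on {0..1} X"
  proof (rule continuous_on_sequentiallyI)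
    fix u :: "nat \<Rightarrow> real" and a assume u: "\<forall>n. u n \<in> {0..1}" "a \<in> {0..1}" "u \<longlonglongrightarrow> a"
    show "(\<lambda>n. X (u n)) \<longlonglongrightarrow> X a"
      unfolding X_def
    proof (rule integral_dominated_convergence[OF _ _ i[of 1]])
      show "AE x in lborel. (\<lambda>n. S (u n * w x)) \<longlonglongrightarrow> S (a * w x)"
        using u(3) by (intro AE_I2 continuous_on_tendsto_compose[OF S_cont] tendsto_intros) auto
      show "AE x in lborel. norm (S (u n * w x)) \<le> S (1 * w x)" for n
      proof (rule AE_I2)
        fix x
        have "\<bar>u n * w x\<bar> \<le> \<bar>w x\<bar>" using u(1) by (auto simp: abs_mult mult_left_le_one_le)
        then have "S \<bar>u n * w x\<bar> \<le> S \<bar>w x\<bar>" by (intro S_mono) auto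
        then show "norm (S (u n * w x)) \<le> S (1 * w x)" by (simp add: S_even S_nonneg)
      qed
    qed measurable
  qed
  moreover have "X 0 = 0" by (simp add: X_def)
  moreover have "X 1 > 1"
  proof -
    have "ennreal 1 < ennreal (X 1)" using not Xnn[of 1] by (simp add: not_le)
    then show ?thesis by (simp add: ennreal_less_iff del: ennreal_1)
  qed
  ultimately obtain s where s: "0 \<le> s" "s \<le> 1" "X s = 1"
    using IVT'[of X 0 1 1] by auto
  have sg: "C1c (\<lambda>x. s * w x) (\<lambda>x. s *\<^sub>R g x)"
    using wg R unfolding C1c_def by (auto intro!: derivative_eq_intros continuous_intros)
  define D where "D = (\<integral>\<^sup>+x. ennreal (\<Phi> (norm (g x))) \<partial>lborel)"
  have "D < top" using small unfolding D_def by (rule less_le_trans) simp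
  then obtain d where d: "d \<ge> 0" "D = ennreal d" by (cases D) auto
  have dsmall: "d < 2 powr - m" using small d unfolding D_def[symmetric] by (simp add: ennreal_less_iff)
  have "1 = ennreal (X s) ^ (N - 1)" using s by simp
  also have "\<dots> \<le> (\<integral>\<^sup>+x. ennreal (S (s * w x)) / 2 + ennreal (2 powr (m - 1)) * ennreal (\<Phi> (norm (s *\<^sub>R g x))) \<partial>lborel) ^ N"
    unfolding Xnn by (rule sobolev_level_bound[OF sg N])
  also have "\<dots> \<le> (\<integral>\<^sup>+x. ennreal (S (s * w x)) / 2 + ennreal (2 powr (m - 1)) * ennreal (\<Phi> (norm (g x))) \<partial>lborel) ^ N"
    using s by (intro power_mono nn_integral_mono add_mono mult_left_mono ennreal_leI Phi_mono)
      (auto simp: mult_left_le_one_le)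
  also have "(\<integral>\<^sup>+x. ennreal (S (s * w x)) / 2 + ennreal (2 powr (m - 1)) * ennreal (\<Phi> (norm (g x))) \<partial>lborel)
      = ennreal (X s) / 2 + ennreal (2 powr (m - 1)) * D"
    unfolding Xnn D_def by (subst nn_integral_add) (auto simp: nn_integral_cmult nn_integral_divide)
  also have "\<dots> = ennreal (1 / 2 + 2 powr (m - 1) * d)"
  proof -
    have "ennreal 1 / ennreal 2 = ennreal (1 / 2)" by (rule divide_ennreal) auto
    then have "ennreal (X s) / 2 = ennreal (1 / 2)" using s by simp
    then show ?thesis using d by (simp only: ennreal_mult[symmetric] ennreal_plus[symmetric]) (simp add: ennreal_mult)
  qed
  also have "\<dots> ^ N = ennreal ((1 / 2 + 2 powr (m - 1) * d) ^ N)"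
    using d by (intro ennreal_power) simp
  finally have ge: "1 \<le> (1 / 2 + 2 powr (m - 1) * d) ^ N" by simp
  have "1 / 2 + 2 powr (m - 1) * d < 1"
  proof -
    have "2 powr (m - 1) * d < 2 powr (m - 1) * 2 powr - m" using dsmall by (intro mult_strict_left_mono) auto
    also have "\<dots> = 1 / 2" by (simp add: powr_diff powr_minus_divide)
    finally show ?thesis by simp
  qed
  moreover have "0 < 1 / 2 + 2 powr (m - 1) * d" using d by (simp add: add_pos_nonneg)
  ultimately have "(1 / 2 + 2 powr (m - 1) * d) ^ N < 1"
    using d N2 power_Suc_less_one[of "1 / 2 + 2 powr (m - 1) * d" "N - 1"] by simp
  with ge show False by simp
qed

end

section \<open>The space of weakly differentiable functions with zero boundary values\<close>

locale orlicz_sobolev = young_growth \<phi> \<Phi> l m "CARD('n::finite)"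
  for \<phi> \<Phi> :: "real \<Rightarrow> real" and l m :: real +
  fixes \<Omega> :: "(real^'n) set"
  assumes open_\<Omega>: "open \<Omega>" and bounded_\<Omega>: "bounded \<Omega>"
begin

abbreviation M :: "(real^'n) measure" where "M \<equiv> lebesgue_on \<Omega>"

definition \<rho> :: "(real^'n \<Rightarrow> real) \<Rightarrow> ennreal" where
  "\<rho> u = (\<integral>\<^sup>+x. ennreal (\<Phi> (u x)) \<partial>M)"

lemma \<Omega>_sets: "\<Omega> \<in> sets lebesgue"
  using open_\<Omega> by auto

lemma borel_M: "f \<in> borel_measurable borel \<Longrightarrow> f \<in> borel_measurable M"
  by (intro measurable_restrict_space1 measurable_completion) simp

lemma finite_M: "finite_measure M"
  using open_\<Omega> bounded_\<Omega> by (intro finite_measure_lebesgue_on) (simp add: lmeasurable_open)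

lemma emeasure_M: "emeasure M \<Omega> < \<infinity>"
  using finite_measure.emeasure_finite[OF finite_M, of \<Omega>] by (simp add: less_top)

lemma nn_integral_M:
  assumes "\<And>x. x \<notin> \<Omega> \<Longrightarrow> f x = 0"
  shows "(\<integral>\<^sup>+x. f x \<partial>M) = (\<integral>\<^sup>+x. f x \<partial>lborel)"
proof -
  have "(\<integral>\<^sup>+x. f x \<partial>M) = (\<integral>\<^sup>+x. f x * indicator \<Omega> x \<partial>lebesgue)"
    using \<Omega>_sets by (intro nn_integral_restrict_space) auto
  also have "\<dots> = (\<integral>\<^sup>+x. f x \<partial>lebesgue)"
    using assms by (intro nn_integral_cong) (auto simp: indicator_def)
  finally show ?thesis by (simp add: nn_integral_completion)
qed

lemma integral_M:
  fixes f :: "real^'n \<Rightarrow> real"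
  assumes "\<And>x. x \<notin> \<Omega> \<Longrightarrow> f x = 0" "f \<in> borel_measurable borel"
  shows "(\<integral>x. f x \<partial>M) = (\<integral>x. f x \<partial>lborel)"
proof -
  have "(\<integral>x. f x \<partial>M) = (\<integral>x. indicator \<Omega> x *\<^sub>R f x \<partial>lebesgue)"
    using \<Omega>_sets by (intro integral_restrict_space) auto
  also have "\<dots> = (\<integral>x. f x \<partial>lebesgue)"
    using assms by (intro Bochner_Integration.integral_cong) (auto simp: indicator_def)
  finally show ?thesis using assms by (simp add: integral_completion)
qed

lemma \<rho>_cong_AE: "AE x in M. u x = v x \<Longrightarrow> \<rho> u = \<rho> v"
  unfolding \<rho>_def by (rule nn_integral_cong_AE) auto

lemma \<rho>_mono: "AE x in M. \<bar>u x\<bar> \<le> \<bar>v x\<bar> \<Longrightarrow> \<rho> u \<le> \<rho> v"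
  unfolding \<rho>_def by (rule nn_integral_mono_AE) (auto intro: ennreal_leI Phi_mono_abs)

lemma \<rho>_abs: "\<rho> (\<lambda>x. \<bar>u x\<bar>) = \<rho> u"
  by (simp add: \<rho>_def Phi_even)

lemma \<rho>_0[simp]: "\<rho> (\<lambda>x. 0) = 0" by (simp add: \<rho>_def)

lemma Phi_M[measurable]: "u \<in> borel_measurable M \<Longrightarrow> (\<lambda>x. \<Phi> (u x)) \<in> borel_measurable M"
  by measurable

lemma \<rho>_add:
  assumes [measurable]: "u \<in> borel_measurable M" "v \<in> borel_measurable M"
    and le: "AE x in M. \<bar>w x\<bar> \<le> \<bar>u x\<bar> + \<bar>v x\<bar>"
  shows "\<rho> w \<le> ennreal (2 powr m) * (\<rho> u + \<rho> v)"
proof -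
  have "\<rho> w \<le> (\<integral>\<^sup>+x. ennreal (2 powr m) * (ennreal (\<Phi> (u x)) + ennreal (\<Phi> (v x))) \<partial>M)"
    unfolding \<rho>_def
  proof (rule nn_integral_mono_AE, use le in eventually_elim)
    fix x assume "\<bar>w x\<bar> \<le> \<bar>u x\<bar> + \<bar>v x\<bar>"
    then have "\<Phi> (w x) \<le> \<Phi> (\<bar>u x\<bar> + \<bar>v x\<bar>)" by (intro Phi_mono_abs) simp
    also have "\<dots> \<le> 2 powr m * (\<Phi> (u x) + \<Phi> (v x))" using Phi_add[of "\<bar>u x\<bar>" "\<bar>v x\<bar>"] by (simp add: Phi_even)
    finally have "ennreal (\<Phi> (w x)) \<le> ennreal (2 powr m * (\<Phi> (u x) + \<Phi> (v x)))" by (rule ennreal_leI)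
    then show "ennreal (\<Phi> (w x)) \<le> ennreal (2 powr m) * (ennreal (\<Phi> (u x)) + ennreal (\<Phi> (v x)))"
      by (simp add: ennreal_mult Phi_nonneg)
  qed
  also have "\<dots> = ennreal (2 powr m) * (\<rho> u + \<rho> v)"
    unfolding \<rho>_def by (simp add: nn_integral_cmult nn_integral_add)
  finally show ?thesis .
qed

lemma \<rho>_scale:
  assumes [measurable]: "u \<in> borel_measurable M"
  shows "\<rho> (\<lambda>x. r * u x) \<le> ennreal (max 1 \<bar>r\<bar> powr m) * \<rho> u"
proof -
  have "\<rho> (\<lambda>x. r * u x) \<le> (\<integral>\<^sup>+x. ennreal (max 1 \<bar>r\<bar> powr m) * ennreal (\<Phi> (u x)) \<partial>M)"
    unfolding \<rho>_def
  proof (rule nn_integral_mono)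
    fix x
    have "\<Phi> (r * u x) \<le> \<Phi> (max 1 \<bar>r\<bar> * u x)"
      by (intro Phi_mono_abs) (auto simp: abs_mult intro!: mult_right_mono)
    also have "\<dots> \<le> max 1 \<bar>r\<bar> powr m * \<Phi> (u x)" by (rule Phi_scale) simp
    finally have "ennreal (\<Phi> (r * u x)) \<le> ennreal (max 1 \<bar>r\<bar> powr m * \<Phi> (u x))" by (rule ennreal_leI)
    then show "ennreal (\<Phi> (r * u x)) \<le> ennreal (max 1 \<bar>r\<bar> powr m) * ennreal (\<Phi> (u x))"
      by (simp add: ennreal_mult Phi_nonneg)
  qed
  then show ?thesis unfolding \<rho>_def by (simp add: nn_integral_cmult)
qed

lemma abs_le_eps_Phi:
  assumes "\<epsilon> > 0" shows "\<bar>t\<bar> \<le> \<epsilon> + \<epsilon> / \<Phi> \<epsilon> * \<Phi> t"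
proof (cases "\<bar>t\<bar> \<le> \<epsilon>")
  case True
  moreover have "0 \<le> \<epsilon> / \<Phi> \<epsilon> * \<Phi> t" using assms Phi_nonneg[of t] Phi_pos[of \<epsilon>] by simp
  ultimately show ?thesis by linarith
next
  case False
  then have t: "\<bar>t\<bar> > 0" "\<epsilon> / \<bar>t\<bar> \<le> 1" using assms by auto
  have "\<Phi> (\<epsilon> / \<bar>t\<bar> * \<bar>t\<bar>) \<le> \<epsilon> / \<bar>t\<bar> * \<Phi> \<bar>t\<bar>" using t assms by (intro Phi_shrink_linear) auto
  then have "\<bar>t\<bar> * \<Phi> \<epsilon> \<le> \<epsilon> * \<Phi> t" using t by (simp add: field_simps Phi_even)
  then have "\<bar>t\<bar> \<le> \<epsilon> / \<Phi> \<epsilon> * \<Phi> t" using Phi_pos[OF assms] by (simp add: field_simps)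
  then show ?thesis using assms by simp
qed

lemma L1_le_\<rho>:
  assumes [measurable]: "u \<in> borel_measurable M" and \<epsilon>: "\<epsilon> > 0"
  shows "(\<integral>\<^sup>+x. ennreal \<bar>u x\<bar> \<partial>M) \<le> ennreal \<epsilon> * emeasure M \<Omega> + ennreal (\<epsilon> / \<Phi> \<epsilon>) * \<rho> u"
proof -
  have "(\<integral>\<^sup>+x. ennreal \<bar>u x\<bar> \<partial>M) \<le> (\<integral>\<^sup>+x. ennreal \<epsilon> + ennreal (\<epsilon> / \<Phi> \<epsilon>) * ennreal (\<Phi> (u x)) \<partial>M)"
  proof (rule nn_integral_mono)
    fix x
    have "ennreal \<bar>u x\<bar> \<le> ennreal (\<epsilon> + \<epsilon> / \<Phi> \<epsilon> * \<Phi> (u x))" by (intro ennreal_leI abs_le_eps_Phi \<epsilon>)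
    also have "\<dots> = ennreal \<epsilon> + ennreal (\<epsilon> / \<Phi> \<epsilon>) * ennreal (\<Phi> (u x))"
      using \<epsilon> Phi_pos[OF \<epsilon>] Phi_nonneg[of "u x"] ennreal_mult[of "\<epsilon> / \<Phi> \<epsilon>" "\<Phi> (u x)"]
      by (subst ennreal_plus) auto
    finally show "ennreal \<bar>u x\<bar> \<le> \<dots>" .
  qed
  also have "\<dots> = ennreal \<epsilon> * emeasure M \<Omega> + ennreal (\<epsilon> / \<Phi> \<epsilon>) * \<rho> u"
    unfolding \<rho>_def by (simp add: nn_integral_add nn_integral_cmult)
  finally show ?thesis .
qed

lemma L1_small:
  assumes "e > 0"
  obtains d where "d > 0" "\<And>u. u \<in> borel_measurable M \<Longrightarrow> \<rho> u \<le> ennreal d \<Longrightarrow> (\<integral>\<^sup>+x. ennreal \<bar>u x\<bar> \<partial>M) \<le> ennreal e"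
proof -
  define V where "V = measure M \<Omega>"
  have V: "emeasure M \<Omega> = ennreal V" "V \<ge> 0"
    unfolding V_def using finite_M by (auto simp: finite_measure.emeasure_eq_measure)
  define \<epsilon> where "\<epsilon> = e / (2 * (V + 1))"
  have \<epsilon>: "\<epsilon> > 0" using assms V by (simp add: \<epsilon>_def)
  define d where "d = e / 2 * (\<Phi> \<epsilon> / \<epsilon>)"
  have d: "d > 0" using assms \<epsilon> Phi_pos[OF \<epsilon>] by (simp add: d_def)
  show ?thesis
  proof (rule that[OF d])
    fix u assume u: "u \<in> borel_measurable M" "\<rho> u \<le> ennreal d"
    have "(\<integral>\<^sup>+x. ennreal \<bar>u x\<bar> \<partial>M) \<le> ennreal \<epsilon> * ennreal V + ennreal (\<epsilon> / \<Phi> \<epsilon>) * ennreal d"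
      using L1_le_\<rho>[OF u(1) \<epsilon>] u(2) unfolding V(1)
      by (meson add_left_mono mult_left_mono order_trans zero_le)
    also have "\<dots> = ennreal (\<epsilon> * V + \<epsilon> / \<Phi> \<epsilon> * d)"
      using \<epsilon> V d Phi_pos[OF \<epsilon>] ennreal_mult[of "\<epsilon> / \<Phi> \<epsilon>" d] ennreal_mult[of \<epsilon> V]
      by (subst ennreal_plus) auto
    also have "\<dots> \<le> ennreal e"
    proof (rule ennreal_leI)
      have "\<epsilon> * V \<le> e / 2" unfolding \<epsilon>_def using V assms by (simp add: field_simps)
      moreover have "\<epsilon> / \<Phi> \<epsilon> * d = e / 2" using Phi_pos[OF \<epsilon>] \<epsilon> by (simp add: d_def)
      ultimately show "\<epsilon> * V + \<epsilon> / \<Phi> \<epsilon> * d \<le> e" by simp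
    qed
    finally show "(\<integral>\<^sup>+x. ennreal \<bar>u x\<bar> \<partial>M) \<le> ennreal e" .
  qed
qed

lemma integrable_if_\<rho>_finite:
  assumes [measurable]: "u \<in> borel_measurable M" and fin: "\<rho> u < \<infinity>"
  shows "integrable M u"
proof (rule integrableI_bounded)
  have "(\<integral>\<^sup>+x. ennreal \<bar>u x\<bar> \<partial>M) \<le> ennreal 1 * emeasure M \<Omega> + ennreal (1 / \<Phi> 1) * \<rho> u"
    by (rule L1_le_\<rho>) auto
  also have "\<dots> < \<infinity>" using fin emeasure_M by (simp add: ennreal_mult_less_top)
  finally show "(\<integral>\<^sup>+x. norm (u x) \<partial>M) < \<infinity>" by simp
qed measurable

lemma locally_integrable_M:
  assumes "integrable M u" shows "locally_integrable \<Omega> u"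
  unfolding locally_integrable_def
proof (intro allI impI)
  fix K assume K: "compact K \<and> K \<subseteq> \<Omega>"
  have "set_integrable lebesgue \<Omega> u"
    unfolding set_integrable_def using assms \<Omega>_sets by (subst (asm) integrable_restrict_space) auto
  then show "set_integrable lebesgue K u"
    by (rule set_integrable_subset) (use K in \<open>auto simp: fmeasurableD lmeasurable_compact\<close>)
qed

lemma measurable_if_locally_integrable:
  fixes u :: "real^'n \<Rightarrow> real"
  assumes "locally_integrable \<Omega> u" shows "u \<in> borel_measurable M"
proof -
  obtain D where D: "countable D" "D \<subseteq> Pow \<Omega>" "\<And>X. X \<in> D \<Longrightarrow> \<exists>a b. X = cbox a b" "\<Union>D = \<Omega>"
    using open_countable_Union_open_cbox[OF open_\<Omega>] by metis
  show ?thesis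
  proof (rule measurable_piecewise_restrict[OF D(1)])
    show "space M \<subseteq> \<Union>D" using D(4) by simp
    fix X assume X: "X \<in> D"
    obtain a b where ab: "X = cbox a b" using D(3)[OF X] by auto
    have XO: "X \<subseteq> \<Omega>" using D(2) X by auto
    show "X \<inter> space M \<in> sets M" using ab XO \<Omega>_sets by (auto simp: sets_restrict_space_iff Int_absorb2)
    have "set_integrable lebesgue X u" using assms ab XO by (auto simp: locally_integrable_def)
    then have "u \<in> borel_measurable (lebesgue_on X)"
      unfolding set_integrable_def using ab by (subst (asm) integrable_restrict_space[symmetric]) auto
    moreover have "restrict_space M X = lebesgue_on X"
      using XO by (simp add: restrict_restrict_space \<Omega>_sets ab Int_absorb1)
    ultimately show "u \<in> borel_measurable (restrict_space M X)" by simp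
  qed
qed

subsection \<open>Test functions\<close>

lemma test_measurable:
  assumes "\<psi> \<in> test_functions \<Omega>"
  shows "\<psi> \<in> borel_measurable M" "grad \<psi> \<in> borel_measurable M"
  using C1c_measurable[OF test_function_C1c[OF assms]] by (auto intro: borel_M)

lemma test_bounded:
  assumes "\<psi> \<in> test_functions \<Omega>"
  obtains C where "C > 0" "\<And>x. \<bar>\<psi> x\<bar> \<le> C" "\<And>x. norm (grad \<psi> x) \<le> C"
  using C1c_bounded[OF test_function_C1c[OF assms]] by metis

lemma \<rho>_bounded:
  assumes "\<And>x. \<bar>u x\<bar> \<le> C" shows "\<rho> u < \<infinity>"
proof -
  have "\<rho> u \<le> (\<integral>\<^sup>+x. ennreal (\<Phi> C) \<partial>M)"
    unfolding \<rho>_def using assms by (intro nn_integral_mono ennreal_leI Phi_mono_abs) (metis abs_ge_self order_trans)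
  also have "\<dots> < \<infinity>" using emeasure_M by (simp add: ennreal_mult_less_top)
  finally show ?thesis .
qed

lemma \<rho>_test_finite:
  assumes "\<psi> \<in> test_functions \<Omega>"
  shows "\<rho> \<psi> < \<infinity>" "\<rho> (\<lambda>x. norm (grad \<psi> x)) < \<infinity>"
proof -
  obtain C where "\<And>x. \<bar>\<psi> x\<bar> \<le> C" "\<And>x. norm (grad \<psi> x) \<le> C" using test_bounded[OF assms] by metis
  then show "\<rho> \<psi> < \<infinity>" "\<rho> (\<lambda>x. norm (grad \<psi> x)) < \<infinity>" by (rule_tac [!] \<rho>_bounded) auto
qed

lemma grad_component: "partial_deriv i \<psi> x = axis i 1 \<bullet> grad \<psi> x"
  by (simp add: grad_def inner_axis')

lemma test_by_parts:
  assumes "\<psi> \<in> test_functions \<Omega>" "\<eta> \<in> test_functions \<Omega>"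
  shows "(\<integral>x. \<psi> x * partial_deriv i \<eta> x \<partial>M) = - (\<integral>x. partial_deriv i \<psi> x * \<eta> x \<partial>M)"
proof -
  note [measurable] = C1c_measurable[OF test_function_C1c[OF assms(1)]] C1c_measurable[OF test_function_C1c[OF assms(2)]]
  show ?thesis unfolding grad_component
    using integration_by_parts[OF test_function_C1c[OF assms(1)] test_function_C1c[OF assms(2)], of "axis i 1"]
    by (subst (1 2) integral_M) (auto simp: test_function_support[OF assms(1)] test_function_support[OF assms(2)])
qed

subsection \<open>Pairs of a function and its gradient\<close>

text \<open>The closure of the test functions in the modular sense, with the gradient as a
  separate argument: a weak gradient is determined only up to null sets, and the representative
  chosen by \<^const>\<open>weak_grad\<close> behaves badly under limits.\<close>

definition W0 :: "(real^'n \<Rightarrow> real) \<Rightarrow> (real^'n \<Rightarrow> real^'n) \<Rightarrow> bool" where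
  "W0 u g \<longleftrightarrow> u \<in> borel_measurable M \<and> g \<in> borel_measurable M \<and>
    (\<forall>e>0. \<exists>\<psi>\<in>test_functions \<Omega>. \<rho> (\<lambda>x. u x - \<psi> x) \<le> ennreal e \<and> \<rho> (\<lambda>x. norm (g x - grad \<psi> x)) \<le> ennreal e)"

lemma W0_measurable: assumes "W0 u g" shows "u \<in> borel_measurable M" "g \<in> borel_measurable M"
  using assms by (auto simp: W0_def)

lemma W0_test: "\<psi> \<in> test_functions \<Omega> \<Longrightarrow> W0 \<psi> (grad \<psi>)"
  using test_measurable by (auto simp: W0_def intro!: bexI[of _ \<psi>])

lemma W0_finite:
  assumes W: "W0 u g" shows "\<rho> u < \<infinity>" "\<rho> (\<lambda>x. norm (g x)) < \<infinity>"
proof -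
  note [measurable] = W0_measurable[OF W]
  obtain \<psi> where \<psi>: "\<psi> \<in> test_functions \<Omega>" "\<rho> (\<lambda>x. u x - \<psi> x) \<le> ennreal 1" "\<rho> (\<lambda>x. norm (g x - grad \<psi> x)) \<le> ennreal 1"
    using W unfolding W0_def by (metis zero_less_one)
  note [measurable] = test_measurable[OF \<psi>(1)]
  have fin: "\<rho> (\<lambda>x. u x - \<psi> x) < \<infinity>" "\<rho> (\<lambda>x. norm (g x - grad \<psi> x)) < \<infinity>"
    using \<psi>(2,3) by (auto elim!: le_less_trans)
  have "\<rho> u \<le> ennreal (2 powr m) * (\<rho> (\<lambda>x. u x - \<psi> x) + \<rho> \<psi>)" by (rule \<rho>_add) auto
  also have "\<dots> < \<infinity>" using \<rho>_test_finite[OF \<psi>(1)] fin by (simp add: ennreal_mult_less_top)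
  finally show "\<rho> u < \<infinity>" .
  have "\<rho> (\<lambda>x. norm (g x)) \<le> ennreal (2 powr m) * (\<rho> (\<lambda>x. norm (g x - grad \<psi> x)) + \<rho> (\<lambda>x. norm (grad \<psi> x)))"
  proof (rule \<rho>_add)
    have "norm (g x) \<le> norm (g x - grad \<psi> x) + norm (grad \<psi> x)" for x
      using norm_triangle_ineq[of "g x - grad \<psi> x" "grad \<psi> x"] by simp
    then show "AE x in M. \<bar>norm (g x)\<bar> \<le> \<bar>norm (g x - grad \<psi> x)\<bar> + \<bar>norm (grad \<psi> x)\<bar>" by simp
  qed measurable
  also have "\<dots> < \<infinity>" using \<rho>_test_finite[OF \<psi>(1)] fin by (simp add: ennreal_mult_less_top)
  finally show "\<rho> (\<lambda>x. norm (g x)) < \<infinity>" .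
qed

lemma W0_closed:
  assumes [measurable]: "u \<in> borel_measurable M" "g \<in> borel_measurable M"
    and ap: "\<And>e. e > 0 \<Longrightarrow> \<exists>v k. W0 v k \<and> \<rho> (\<lambda>x. u x - v x) \<le> ennreal e \<and> \<rho> (\<lambda>x. norm (g x - k x)) \<le> ennreal e"
  shows "W0 u g"
  unfolding W0_def
proof (intro conjI allI impI assms(1,2))
  fix e :: real assume e: "e > 0"
  define d where "d = e / (2 powr m * 2)"
  have d: "d > 0" using e by (simp add: d_def)
  obtain v k where vk: "W0 v k" "\<rho> (\<lambda>x. u x - v x) \<le> ennreal d" "\<rho> (\<lambda>x. norm (g x - k x)) \<le> ennreal d"
    using ap[OF d] by blast
  obtain \<psi> where \<psi>: "\<psi> \<in> test_functions \<Omega>" "\<rho> (\<lambda>x. v x - \<psi> x) \<le> ennreal d" "\<rho> (\<lambda>x. norm (k x - grad \<psi> x)) \<le> ennreal d"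
    using vk(1) d unfolding W0_def by metis
  note [measurable] = W0_measurable[OF vk(1)] test_measurable[OF \<psi>(1)]
  have dd: "ennreal (2 powr m) * (ennreal d + ennreal d) = ennreal e"
    using d e by (simp add: ennreal_plus[symmetric] ennreal_mult[symmetric] d_def del: ennreal_plus)
  have "\<rho> (\<lambda>x. u x - \<psi> x) \<le> ennreal (2 powr m) * (\<rho> (\<lambda>x. u x - v x) + \<rho> (\<lambda>x. v x - \<psi> x))"
    by (rule \<rho>_add) auto
  also have "\<dots> \<le> ennreal e" unfolding dd[symmetric] by (intro mult_left_mono add_mono vk \<psi>) auto
  finally have 1: "\<rho> (\<lambda>x. u x - \<psi> x) \<le> ennreal e" .
  have "\<rho> (\<lambda>x. norm (g x - grad \<psi> x)) \<le> ennreal (2 powr m) * (\<rho> (\<lambda>x. norm (g x - k x)) + \<rho> (\<lambda>x. norm (k x - grad \<psi> x)))"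
  proof (rule \<rho>_add)
    have "norm (g x - grad \<psi> x) \<le> norm (g x - k x) + norm (k x - grad \<psi> x)" for x
      using norm_triangle_ineq[of "g x - k x" "k x - grad \<psi> x"] by simp
    then show "AE x in M. \<bar>norm (g x - grad \<psi> x)\<bar> \<le> \<bar>norm (g x - k x)\<bar> + \<bar>norm (k x - grad \<psi> x)\<bar>" by simp
  qed measurable
  also have "\<dots> \<le> ennreal e" unfolding dd[symmetric] by (intro mult_left_mono add_mono vk \<psi>) auto
  finally have "\<rho> (\<lambda>x. norm (g x - grad \<psi> x)) \<le> ennreal e" .
  with 1 \<psi>(1) show "\<exists>\<psi>\<in>test_functions \<Omega>. \<rho> (\<lambda>x. u x - \<psi> x) \<le> ennreal e \<and> \<rho> (\<lambda>x. norm (g x - grad \<psi> x)) \<le> ennreal e"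
    by blast
qed

lemma W0_linear:
  assumes W: "W0 u g" "W0 v gv"
  shows "W0 (\<lambda>x. r * u x + s * v x) (\<lambda>x. r *\<^sub>R g x + s *\<^sub>R gv x)"
  unfolding W0_def
proof (intro conjI allI impI)
  note [measurable] = W0_measurable[OF W(1)] W0_measurable[OF W(2)]
  show "(\<lambda>x. r * u x + s * v x) \<in> borel_measurable M" "(\<lambda>x. r *\<^sub>R g x + s *\<^sub>R gv x) \<in> borel_measurable M"
    by measurable
  fix e :: real assume e: "e > 0"
  define A where "A = max 1 \<bar>r\<bar> powr m + max 1 \<bar>s\<bar> powr m"
  have A: "A > 0" by (simp add: A_def add_pos_pos)
  define d where "d = e / (2 powr m * A)"
  have d: "d > 0" using e A by (simp add: d_def)
  obtain \<psi> where \<psi>: "\<psi> \<in> test_functions \<Omega>" "\<rho> (\<lambda>x. u x - \<psi> x) \<le> ennreal d" "\<rho> (\<lambda>x. norm (g x - grad \<psi> x)) \<le> ennreal d"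
    using W(1) d unfolding W0_def by metis
  obtain \<eta> where \<eta>: "\<eta> \<in> test_functions \<Omega>" "\<rho> (\<lambda>x. v x - \<eta> x) \<le> ennreal d" "\<rho> (\<lambda>x. norm (gv x - grad \<eta> x)) \<le> ennreal d"
    using W(2) d unfolding W0_def by metis
  note [measurable] = test_measurable[OF \<psi>(1)] test_measurable[OF \<eta>(1)]
  have comb: "\<rho> w \<le> ennreal e"
    if [measurable]: "a \<in> borel_measurable M" "b \<in> borel_measurable M"
      and le: "\<And>x. \<bar>w x\<bar> \<le> \<bar>r * a x\<bar> + \<bar>s * b x\<bar>" and ab: "\<rho> a \<le> ennreal d" "\<rho> b \<le> ennreal d" for a b w
  proof -
    have "\<rho> w \<le> ennreal (2 powr m) * (\<rho> (\<lambda>x. r * a x) + \<rho> (\<lambda>x. s * b x))"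
      by (rule \<rho>_add) (auto intro: le)
    also have "\<dots> \<le> ennreal (2 powr m) * (ennreal (max 1 \<bar>r\<bar> powr m) * ennreal d + ennreal (max 1 \<bar>s\<bar> powr m) * ennreal d)"
      using \<rho>_scale[of a r] \<rho>_scale[of b s] ab
      by (intro mult_left_mono add_mono) (auto elim!: order_trans intro!: mult_left_mono)
    also have "\<dots> = ennreal (2 powr m * (A * d))"
      using d by (simp add: A_def ennreal_mult ennreal_plus distrib_right)
    also have "2 powr m * (A * d) = e" using A by (simp add: d_def)
    finally show ?thesis .
  qed
  show "\<exists>\<psi>\<in>test_functions \<Omega>. \<rho> (\<lambda>x. r * u x + s * v x - \<psi> x) \<le> ennreal e \<and>
      \<rho> (\<lambda>x. norm (r *\<^sub>R g x + s *\<^sub>R gv x - grad \<psi> x)) \<le> ennreal e"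
  proof (intro bexI[of _ "\<lambda>x. r * \<psi> x + s * \<eta> x"] conjI)
    show "(\<lambda>x. r * \<psi> x + s * \<eta> x) \<in> test_functions \<Omega>" by (rule test_functions_linear[OF \<psi>(1) \<eta>(1)])
    show "\<rho> (\<lambda>x. r * u x + s * v x - (r * \<psi> x + s * \<eta> x)) \<le> ennreal e"
    proof (rule comb[OF _ _ _ \<psi>(2) \<eta>(2)])
      fix x
      have "r * u x + s * v x - (r * \<psi> x + s * \<eta> x) = r * (u x - \<psi> x) + s * (v x - \<eta> x)" by (simp add: algebra_simps)
      then show "\<bar>r * u x + s * v x - (r * \<psi> x + s * \<eta> x)\<bar> \<le> \<bar>r * (u x - \<psi> x)\<bar> + \<bar>s * (v x - \<eta> x)\<bar>"
        by (simp add: abs_triangle_ineq)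
    qed measurable
    show "\<rho> (\<lambda>x. norm (r *\<^sub>R g x + s *\<^sub>R gv x - grad (\<lambda>x. r * \<psi> x + s * \<eta> x) x)) \<le> ennreal e"
    proof (rule comb[OF _ _ _ \<psi>(3) \<eta>(3)])
      fix x
      have "r *\<^sub>R g x + s *\<^sub>R gv x - grad (\<lambda>x. r * \<psi> x + s * \<eta> x) x = r *\<^sub>R (g x - grad \<psi> x) + s *\<^sub>R (gv x - grad \<eta> x)"
        unfolding grad_linear[OF \<psi>(1) \<eta>(1)] by (simp add: algebra_simps)
      then show "\<bar>norm (r *\<^sub>R g x + s *\<^sub>R gv x - grad (\<lambda>x. r * \<psi> x + s * \<eta> x) x)\<bar> \<le> \<bar>r * norm (g x - grad \<psi> x)\<bar> + \<bar>s * norm (gv x - grad \<eta> x)\<bar>"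
        using norm_triangle_ineq[of "r *\<^sub>R (g x - grad \<psi> x)" "s *\<^sub>R (gv x - grad \<eta> x)"] by (simp add: abs_mult)
    qed measurable
  qed
qed

end

section \<open>Identification with the Orlicz--Sobolev space\<close>

context orlicz_sobolev
begin

lemma integral_times_bounded:
  fixes u \<eta> :: "real^'n \<Rightarrow> real"
  assumes u: "integrable M u" and e: "\<eta> \<in> borel_measurable M" "\<And>x. \<bar>\<eta> x\<bar> \<le> C"
  shows "integrable M (\<lambda>x. u x * \<eta> x)" "\<bar>\<integral>x. u x * \<eta> x \<partial>M\<bar> \<le> C * (\<integral>x. \<bar>u x\<bar> \<partial>M)"
proof -
  have C: "C \<ge> 0" using order_trans[OF abs_ge_zero e(2)] .
  have [measurable]: "u \<in> borel_measurable M" "\<eta> \<in> borel_measurable M" using u e by auto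
  have le: "norm (u x * \<eta> x) \<le> C * \<bar>u x\<bar>" for x
    using mult_left_mono[OF e(2)[of x], of "\<bar>u x\<bar>"] by (simp add: abs_mult mult.commute)
  show i: "integrable M (\<lambda>x. u x * \<eta> x)"
  proof (rule Bochner_Integration.integrable_bound)
    show "integrable M (\<lambda>x. C * \<bar>u x\<bar>)" using u by simp
    show "AE x in M. norm (u x * \<eta> x) \<le> norm (C * \<bar>u x\<bar>)"
      using le C by (intro AE_I2) (simp add: abs_mult)
  qed measurable
  have "\<bar>\<integral>x. u x * \<eta> x \<partial>M\<bar> \<le> (\<integral>x. \<bar>u x * \<eta> x\<bar> \<partial>M)" by (rule integral_abs_bound)
  also have "\<dots> \<le> (\<integral>x. C * \<bar>u x\<bar> \<partial>M)" using i u le by (intro integral_mono) auto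
  finally show "\<bar>\<integral>x. u x * \<eta> x \<partial>M\<bar> \<le> C * (\<integral>x. \<bar>u x\<bar> \<partial>M)" by simp
qed

lemma integrable_indicator_compact:
  assumes "locally_integrable \<Omega> u" "compact K" "K \<subseteq> \<Omega>"
  shows "integrable M (\<lambda>x. indicator K x * u x)"
proof -
  have "(\<lambda>x. indicator K x *\<^sub>R u x) = (\<lambda>x. indicator \<Omega> x *\<^sub>R (indicator K x * u x))"
    using assms(3) by (auto simp: fun_eq_iff indicator_def)
  moreover have "integrable lebesgue (\<lambda>x. indicator K x *\<^sub>R u x)"
    using assms unfolding locally_integrable_def set_integrable_def by blast
  ultimately have "integrable lebesgue (\<lambda>x. indicator \<Omega> x *\<^sub>R (indicator K x * u x))" by (simp only:)
  then show ?thesis using \<Omega>_sets by (subst integrable_restrict_space) auto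
qed

lemma component_measurable:
  assumes "g \<in> borel_measurable M" shows "(\<lambda>x. (g x :: real^'n) $ i) \<in> borel_measurable M"
proof -
  have "(\<lambda>x. axis i 1 \<bullet> g x) \<in> borel_measurable M" using assms by measurable
  then show ?thesis by (simp add: inner_axis')
qed

lemma W0_component_\<rho>: "\<rho> (\<lambda>x. (g x :: real^'n) $ i) \<le> \<rho> (\<lambda>x. norm (g x))"
  by (rule \<rho>_mono) (auto simp: component_le_norm_cart)

lemma W0_has_weak_partial:
  assumes W: "W0 u g"
  shows "has_weak_partial \<Omega> i u (\<lambda>x. g x $ i)"
  unfolding has_weak_partial_def
proof (intro conjI ballI)
  note m[measurable] = W0_measurable[OF W]
  have gi[measurable]: "(\<lambda>x. g x $ i) \<in> borel_measurable M" by (rule component_measurable[OF m(2)])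
  have iu: "integrable M u" by (rule integrable_if_\<rho>_finite[OF m(1) W0_finite(1)[OF W]])
  have ig: "integrable M (\<lambda>x. g x $ i)"
    by (rule integrable_if_\<rho>_finite[OF gi]) (rule le_less_trans[OF W0_component_\<rho> W0_finite(2)[OF W]])
  show "locally_integrable \<Omega> u" "locally_integrable \<Omega> (\<lambda>x. g x $ i)"
    using iu ig by (auto intro: locally_integrable_M)
  fix \<eta> assume \<eta>: "\<eta> \<in> test_functions \<Omega>"
  obtain C where C: "C > 0" "\<And>x. \<bar>\<eta> x\<bar> \<le> C" "\<And>x. norm (grad \<eta> x) \<le> C" using test_bounded[OF \<eta>] by metis
  note \<eta>m[measurable] = test_measurable[OF \<eta>]
  have pm[measurable]: "partial_deriv i \<eta> \<in> borel_measurable M"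
    using component_measurable[OF \<eta>m(2), of i] by (simp add: grad_def)
  have pC: "\<bar>partial_deriv i \<eta> x\<bar> \<le> C" for x
    using component_le_norm_cart[of "grad \<eta> x" i] C(3)[of x] by (simp add: grad_def)
  define a where "a = (\<integral>x. u x * partial_deriv i \<eta> x \<partial>M) + (\<integral>x. g x $ i * \<eta> x \<partial>M)"
  have small: "\<bar>a\<bar> \<le> e" if e: "e > 0" for e
  proof -
    have "e / (2 * C) > 0" using e C by simp
    from L1_small[OF this] obtain d where d: "d > 0"
      "\<And>u. u \<in> borel_measurable M \<Longrightarrow> \<rho> u \<le> ennreal d \<Longrightarrow> (\<integral>\<^sup>+x. ennreal \<bar>u x\<bar> \<partial>M) \<le> ennreal (e / (2 * C))"
      by metis
    obtain \<psi> where \<psi>: "\<psi> \<in> test_functions \<Omega>" "\<rho> (\<lambda>x. u x - \<psi> x) \<le> ennreal d" "\<rho> (\<lambda>x. norm (g x - grad \<psi> x)) \<le> ennreal d"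
      using W d(1) unfolding W0_def by metis
    note \<psi>m[measurable] = test_measurable[OF \<psi>(1)]
    have W\<psi>: "W0 \<psi> (grad \<psi>)" by (rule W0_test[OF \<psi>(1)])
    have psim[measurable]: "(\<lambda>x. grad \<psi> x $ i) \<in> borel_measurable M" by (rule component_measurable[OF \<psi>m(2)])
    have i\<psi>: "integrable M \<psi>" by (rule integrable_if_\<rho>_finite[OF \<psi>m(1) W0_finite(1)[OF W\<psi>]])
    have ig\<psi>: "integrable M (\<lambda>x. grad \<psi> x $ i)"
      by (rule integrable_if_\<rho>_finite[OF psim]) (rule le_less_trans[OF W0_component_\<rho> W0_finite(2)[OF W\<psi>]])
    have est: "\<bar>\<integral>x. v x * \<zeta> x \<partial>M\<bar> \<le> e / 2"
      if v: "integrable M v" "\<rho> v \<le> ennreal d" and z: "\<zeta> \<in> borel_measurable M" "\<And>x. \<bar>\<zeta> x\<bar> \<le> C" for v \<zeta>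
    proof -
      have "ennreal (\<integral>x. \<bar>v x\<bar> \<partial>M) = (\<integral>\<^sup>+x. ennreal \<bar>v x\<bar> \<partial>M)"
        using v by (intro nn_integral_eq_integral[symmetric]) auto
      also have "\<dots> \<le> ennreal (e / (2 * C))" using v by (intro d(2)) auto
      finally have "(\<integral>x. \<bar>v x\<bar> \<partial>M) \<le> e / (2 * C)" using e C by (subst (asm) ennreal_le_iff) auto
      then have "C * (\<integral>x. \<bar>v x\<bar> \<partial>M) \<le> e / 2" using C by (simp add: field_simps)
      with integral_times_bounded(2)[OF v(1) z] show ?thesis by simp
    qed
    have "(\<integral>x. u x * partial_deriv i \<eta> x \<partial>M) - (\<integral>x. \<psi> x * partial_deriv i \<eta> x \<partial>M)
        = (\<integral>x. (u x - \<psi> x) * partial_deriv i \<eta> x \<partial>M)"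
      using integral_times_bounded(1)[OF iu pm pC] integral_times_bounded(1)[OF i\<psi> pm pC]
      by (simp add: left_diff_distrib)
    moreover have "(\<integral>x. g x $ i * \<eta> x \<partial>M) - (\<integral>x. grad \<psi> x $ i * \<eta> x \<partial>M)
        = (\<integral>x. (g x $ i - grad \<psi> x $ i) * \<eta> x \<partial>M)"
      using integral_times_bounded(1)[OF ig \<eta>m(1) C(2)] integral_times_bounded(1)[OF ig\<psi> \<eta>m(1) C(2)]
      by (simp add: left_diff_distrib)
    moreover have "(\<integral>x. \<psi> x * partial_deriv i \<eta> x \<partial>M) = - (\<integral>x. grad \<psi> x $ i * \<eta> x \<partial>M)"
      using test_by_parts[OF \<psi>(1) \<eta>, of i] by (simp add: grad_def)
    ultimately have "a = (\<integral>x. (u x - \<psi> x) * partial_deriv i \<eta> x \<partial>M) + (\<integral>x. (g x $ i - grad \<psi> x $ i) * \<eta> x \<partial>M)"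
      by (simp add: a_def)
    moreover have "\<bar>\<integral>x. (u x - \<psi> x) * partial_deriv i \<eta> x \<partial>M\<bar> \<le> e / 2"
      using iu i\<psi> by (intro est \<psi>(2) pm pC) auto
    moreover have "\<bar>\<integral>x. (g x $ i - grad \<psi> x $ i) * \<eta> x \<partial>M\<bar> \<le> e / 2"
    proof (intro est \<eta>m(1) C(2))
      have "\<rho> (\<lambda>x. (g x - grad \<psi> x) $ i) \<le> ennreal d" using W0_component_\<rho> \<psi>(3) by (rule order_trans)
      then show "\<rho> (\<lambda>x. g x $ i - grad \<psi> x $ i) \<le> ennreal d" by simp
    qed (use ig ig\<psi> in auto)
    ultimately show ?thesis by linarith
  qed
  have "a = 0"
  proof (rule ccontr)
    assume "a \<noteq> 0"
    then show False using small[of "\<bar>a\<bar> / 2"] by simp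
  qed
  then show "(\<integral>x. u x * partial_deriv i \<eta> x \<partial>M) = - (\<integral>x. g x $ i * \<eta> x \<partial>M)" by (simp add: a_def)
qed

lemma test_integrable:
  assumes "locally_integrable \<Omega> u" and \<eta>: "\<eta> \<in> test_functions \<Omega>"
  shows "integrable M (\<lambda>x. u x * \<eta> x)"
proof -
  let ?K = "closure {x. \<eta> x \<noteq> 0}"
  have K: "compact ?K" "?K \<subseteq> \<Omega>" using \<eta> by (auto simp: test_functions_def)
  have um[measurable]: "u \<in> borel_measurable M" by (rule measurable_if_locally_integrable[OF assms(1)])
  note [measurable] = test_measurable[OF \<eta>]
  obtain C where C: "C > 0" "\<And>x. \<bar>\<eta> x\<bar> \<le> C" using test_bounded[OF \<eta>] by metis
  have i: "integrable M (\<lambda>x. indicator ?K x * u x)" by (rule integrable_indicator_compact[OF assms(1) K])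
  have "integrable M (\<lambda>x. (indicator ?K x * u x) * \<eta> x)"
    by (rule integral_times_bounded(1)[OF i _ C(2)]) measurable
  moreover have "(indicator ?K x * u x) * \<eta> x = u x * \<eta> x" for x
    using closure_subset[of "{x. \<eta> x \<noteq> 0}"] by (auto simp: indicator_def)
  ultimately show ?thesis by simp
qed

text \<open>The difference of two candidates is orthogonal to all test functions.\<close>

lemma weak_partial_unique:
  assumes "has_weak_partial \<Omega> i u g1" "has_weak_partial \<Omega> i u g2"
  shows "AE x in M. g1 x = g2 x"
proof -
  have l: "locally_integrable \<Omega> g1" "locally_integrable \<Omega> g2" using assms by (auto simp: has_weak_partial_def)
  have "AE x in M. g1 x - g2 x = 0"
  proof (rule fundamental_lemma[OF _ open_\<Omega>])
    show "locally_integrable \<Omega> (\<lambda>x. g1 x - g2 x)" using l by (auto simp: locally_integrable_def intro: set_integral_diff)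
    fix \<psi> assume \<psi>: "\<psi> \<in> test_functions \<Omega>"
    have "(\<integral>x. g1 x * \<psi> x \<partial>M) = (\<integral>x. g2 x * \<psi> x \<partial>M)"
      using assms \<psi> by (simp add: has_weak_partial_def)
    then show "(\<integral>x. (g1 x - g2 x) * \<psi> x \<partial>M) = 0"
      using test_integrable[OF l(1) \<psi>] test_integrable[OF l(2) \<psi>] by (simp add: left_diff_distrib)
  qed
  then show ?thesis by simp
qed

lemma weak_partial_AE:
  assumes "has_weak_partial \<Omega> i u g"
  shows "has_weak_partial \<Omega> i u (weak_partial \<Omega> i u)" "AE x in M. weak_partial \<Omega> i u x = g x"
proof -
  show 1: "has_weak_partial \<Omega> i u (weak_partial \<Omega> i u)"
    unfolding weak_partial_def by (rule someI[of "has_weak_partial \<Omega> i u", OF assms])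
  show "AE x in M. weak_partial \<Omega> i u x = g x" by (rule weak_partial_unique[OF 1 assms])
qed

lemma W0_weak_grad:
  assumes W: "W0 u g" shows "AE x in M. weak_grad \<Omega> u x = g x"
proof -
  have "AE x in M. \<forall>i\<in>UNIV. weak_partial \<Omega> i u x = g x $ i"
    by (intro AE_finite_allI weak_partial_AE(2) W0_has_weak_partial W) simp
  then show ?thesis by eventually_elim (simp add: weak_grad_def vec_eq_iff)
qed

subsection \<open>The Luxemburg norm and the modular\<close>

lemma \<rho>_alt: "(\<integral>\<^sup>+x. ennreal (\<Phi> (u x / r)) \<partial>M) = \<rho> (\<lambda>x. (1 / r) * u x)"
  by (simp add: \<rho>_def)

lemma luxemburg_le:
  assumes "r > 0" "\<rho> (\<lambda>x. (1 / r) * u x) \<le> 1"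
  shows "luxemburg_norm \<Omega> \<Phi> u \<le> r"
  unfolding luxemburg_norm_def \<rho>_alt
  by (rule cInf_lower) (use assms in \<open>auto intro!: bdd_belowI[of _ 0]\<close>)

lemma luxemburg_small:
  assumes d: "0 < d" and [measurable]: "u \<in> borel_measurable M"
    and le: "\<rho> u \<le> ennreal (1 / max 1 (1 / d) powr m)"
  shows "luxemburg_norm \<Omega> \<Phi> u \<le> d"
proof (rule luxemburg_le[OF d])
  define A where "A = max 1 (1 / d) powr m"
  have A: "A > 0" by (simp add: A_def)
  have "\<rho> (\<lambda>x. (1 / d) * u x) \<le> ennreal A * \<rho> u" using \<rho>_scale[of u "1 / d"] d by (simp add: A_def)
  also have "\<dots> \<le> ennreal A * ennreal (1 / A)" using le by (intro mult_left_mono) (auto simp: A_def)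
  also have "\<dots> = 1" using A by (simp add: ennreal_mult[symmetric])
  finally show "\<rho> (\<lambda>x. (1 / d) * u x) \<le> 1" .
qed

lemma \<rho>_le_if_luxemburg_less:
  assumes d: "d \<le> 1" and [measurable]: "u \<in> borel_measurable M" and fin: "\<rho> u < \<infinity>"
    and less: "luxemburg_norm \<Omega> \<Phi> u < d"
  shows "\<rho> u \<le> ennreal d"
proof -
  let ?X = "{c. c > 0 \<and> \<rho> (\<lambda>x. (1 / c) * u x) \<le> 1}"
  have "?X \<noteq> {}"
  proof -
    obtain R where R: "R \<ge> 0" "\<rho> u = ennreal R" using fin by (cases "\<rho> u") auto
    define c where "c = max 1 R"
    have c: "c \<ge> 1" "R \<le> c" by (auto simp: c_def)
    have "\<rho> (\<lambda>x. (1 / c) * u x) \<le> (\<integral>\<^sup>+x. ennreal (1 / c) * ennreal (\<Phi> (u x)) \<partial>M)"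
      unfolding \<rho>_def
    proof (rule nn_integral_mono)
      fix x
      have "\<Phi> (1 / c * u x) \<le> 1 / c * \<Phi> (u x)" using c by (intro Phi_shrink_linear) auto
      then show "ennreal (\<Phi> (1 / c * u x)) \<le> ennreal (1 / c) * ennreal (\<Phi> (u x))"
        using c Phi_nonneg by (subst ennreal_mult[symmetric]) (auto intro: ennreal_leI)
    qed
    also have "\<dots> = ennreal (1 / c) * ennreal R" by (simp add: nn_integral_cmult R(2)[symmetric] \<rho>_def)
    also have "\<dots> = ennreal (R / c)" using c R by (simp add: ennreal_mult[symmetric])
    also have "\<dots> \<le> 1" using c by simp
    finally have "c \<in> ?X" using c by simp
    then show ?thesis by blast
  qed
  moreover have "Inf ?X < d" using less unfolding luxemburg_norm_def \<rho>_alt .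
  ultimately obtain r where r: "r \<in> ?X" "r < d" by (rule cInf_lessD[THEN bexE])
  then have r0: "r > 0" "\<rho> (\<lambda>x. (1 / r) * u x) \<le> 1" by auto
  have "\<rho> u \<le> (\<integral>\<^sup>+x. ennreal r * ennreal (\<Phi> (1 / r * u x)) \<partial>M)"
    unfolding \<rho>_def
  proof (rule nn_integral_mono)
    fix x
    have "\<Phi> (r * (1 / r * u x)) \<le> r * \<Phi> (1 / r * u x)" using r r0 d by (intro Phi_shrink_linear) auto
    then show "ennreal (\<Phi> (u x)) \<le> ennreal r * ennreal (\<Phi> (1 / r * u x))"
      using r0(1) Phi_nonneg by (subst ennreal_mult[symmetric]) (auto intro: ennreal_leI)
  qed
  also have "\<dots> = ennreal r * \<rho> (\<lambda>x. (1 / r) * u x)" by (simp add: nn_integral_cmult \<rho>_def)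
  also have "\<dots> \<le> ennreal r * 1" using r0 by (intro mult_left_mono) auto
  also have "\<dots> \<le> ennreal d" using r by (simp add: ennreal_leI)
  finally show ?thesis .
qed

text \<open>Because \<open>\<Phi>(r t) \<le> r \<Phi>(t)\<close> for
  \<open>r \<le> 1\<close>, every admissible scale below \<open>1\<close> would force the
  modular below \<open>1\<close>.\<close>

lemma luxemburg_eq_1:
  assumes [measurable]: "u \<in> borel_measurable M" and one: "\<rho> u = 1"
  shows "luxemburg_norm \<Omega> \<Phi> u = 1"
proof (rule antisym)
  show "luxemburg_norm \<Omega> \<Phi> u \<le> 1" by (rule luxemburg_le) (auto simp: one)
  show "1 \<le> luxemburg_norm \<Omega> \<Phi> u"
    unfolding luxemburg_norm_def \<rho>_alt
  proof (rule cInf_greatest)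
    have "\<rho> (\<lambda>x. (1 / 1) * u x) \<le> 1" by (simp add: one)
    then have "1 \<in> {c. c > 0 \<and> \<rho> (\<lambda>x. (1 / c) * u x) \<le> 1}" by simp
    then show "{c. c > 0 \<and> \<rho> (\<lambda>x. (1 / c) * u x) \<le> 1} \<noteq> {}" by blast
    fix r assume r: "r \<in> {c. c > 0 \<and> \<rho> (\<lambda>x. (1 / c) * u x) \<le> 1}"
    show "1 \<le> r"
    proof (rule ccontr)
      assume "\<not> 1 \<le> r"
      then have r1: "0 < r" "r < 1" using r by auto
      have "1 = \<rho> u" using one by simp
      also have "\<dots> \<le> (\<integral>\<^sup>+x. ennreal r * ennreal (\<Phi> (1 / r * u x)) \<partial>M)"
        unfolding \<rho>_def
      proof (rule nn_integral_mono)
        fix x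
        have "\<Phi> (r * (1 / r * u x)) \<le> r * \<Phi> (1 / r * u x)" using r1 by (intro Phi_shrink_linear) auto
        then show "ennreal (\<Phi> (u x)) \<le> ennreal r * ennreal (\<Phi> (1 / r * u x))"
          using r1(1) Phi_nonneg by (subst ennreal_mult[symmetric]) (auto intro: ennreal_leI)
      qed
      also have "\<dots> = ennreal r * \<rho> (\<lambda>x. (1 / r) * u x)" by (simp add: nn_integral_cmult \<rho>_def)
      also have "\<dots> \<le> ennreal r * 1" using r by (intro mult_left_mono) auto
      also have "\<dots> < 1" using r1 by (simp add: ennreal_less_one_iff)
      finally show False by simp
    qed
  qed
qed

lemma luxemburg_cong_AE: "AE x in M. u x = v x \<Longrightarrow> luxemburg_norm \<Omega> \<Phi> u = luxemburg_norm \<Omega> \<Phi> v"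
proof -
  assume "AE x in M. u x = v x"
  then have "\<rho> (\<lambda>x. (1 / r) * u x) = \<rho> (\<lambda>x. (1 / r) * v x)" for r by (intro \<rho>_cong_AE) auto
  then show ?thesis unfolding luxemburg_norm_def \<rho>_alt by simp
qed

lemma orlicz_space_iff: "u \<in> orlicz_space \<Omega> \<Phi> \<longleftrightarrow> u \<in> borel_measurable M \<and> \<rho> u < \<infinity>"
proof
  assume "u \<in> orlicz_space \<Omega> \<Phi>"
  then obtain r where [measurable]: "u \<in> borel_measurable M" and r: "r > 0" "\<rho> (\<lambda>x. (1 / r) * u x) < \<infinity>"
    unfolding orlicz_space_def \<rho>_alt by auto
  have "\<rho> (\<lambda>x. r * ((1 / r) * u x)) \<le> ennreal (max 1 \<bar>r\<bar> powr m) * \<rho> (\<lambda>x. (1 / r) * u x)" by (rule \<rho>_scale) measurable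
  also have "\<dots> < \<infinity>" using r by (simp add: ennreal_mult_less_top)
  finally show "u \<in> borel_measurable M \<and> \<rho> u < \<infinity>" using r by simp
next
  assume "u \<in> borel_measurable M \<and> \<rho> u < \<infinity>"
  then show "u \<in> orlicz_space \<Omega> \<Phi>" unfolding orlicz_space_def \<rho>_alt by (auto intro!: exI[of _ 1])
qed

lemma \<rho>_norm_le_components:
  assumes [measurable]: "g \<in> borel_measurable M"
  shows "\<rho> (\<lambda>x. norm (g x :: real^'n)) \<le> ennreal (real CARD('n) powr m) * (\<Sum>i\<in>UNIV. \<rho> (\<lambda>x. g x $ i))"
proof -
  let ?N = "real CARD('n)"
  have N: "?N \<ge> 1" using exponents by linarith
  note [measurable] = component_measurable[OF assms]
  have "\<rho> (\<lambda>x. norm (g x)) \<le> (\<integral>\<^sup>+x. ennreal (?N powr m) * (\<Sum>i\<in>UNIV. ennreal (\<Phi> (g x $ i))) \<partial>M)"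
    unfolding \<rho>_def
  proof (rule nn_integral_mono)
    fix x
    obtain j where j: "\<And>i. \<bar>g x $ i\<bar> \<le> \<bar>g x $ j\<bar>"
      using Max_in[of "range (\<lambda>i. \<bar>g x $ i\<bar>)"] Max_ge[of "range (\<lambda>i. \<bar>g x $ i\<bar>)"] by fastforce
    have "norm (g x) \<le> (\<Sum>i\<in>UNIV. \<bar>g x $ i\<bar>)" by (rule norm_le_l1_cart)
    also have "\<dots> \<le> (\<Sum>i\<in>(UNIV::'n set). \<bar>g x $ j\<bar>)" by (intro sum_mono j)
    finally have "norm (g x) \<le> ?N * \<bar>g x $ j\<bar>" by simp
    then have "\<Phi> (norm (g x)) \<le> \<Phi> (?N * g x $ j)" by (intro Phi_mono_abs) (simp add: abs_mult)
    also have "\<dots> \<le> ?N powr m * \<Phi> (g x $ j)" by (rule Phi_scale(2)[OF N])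
    also have "\<dots> \<le> ?N powr m * (\<Sum>i\<in>UNIV. \<Phi> (g x $ i))"
      by (intro mult_left_mono member_le_sum) (auto simp: Phi_nonneg)
    finally have "ennreal (\<Phi> (norm (g x))) \<le> ennreal (?N powr m * (\<Sum>i\<in>UNIV. \<Phi> (g x $ i)))" by (rule ennreal_leI)
    also have "\<dots> = ennreal (?N powr m) * (\<Sum>i\<in>UNIV. ennreal (\<Phi> (g x $ i)))"
      by (simp add: ennreal_mult sum_nonneg Phi_nonneg sum_ennreal)
    finally show "ennreal (\<Phi> (norm (g x))) \<le> \<dots>" .
  qed
  also have "\<dots> = ennreal (?N powr m) * (\<Sum>i\<in>UNIV. \<rho> (\<lambda>x. g x $ i))"
    unfolding \<rho>_def by (simp add: nn_integral_cmult nn_integral_sum)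
  finally show ?thesis .
qed

lemma has_weak_partial_diff_test:
  assumes u: "has_weak_partial \<Omega> i u g" and \<psi>: "\<psi> \<in> test_functions \<Omega>"
  shows "has_weak_partial \<Omega> i (\<lambda>x. u x - \<psi> x) (\<lambda>x. g x - partial_deriv i \<psi> x)"
proof -
  have p: "has_weak_partial \<Omega> i \<psi> (partial_deriv i \<psi>)"
    using W0_has_weak_partial[OF W0_test[OF \<psi>], of i] by (simp add: grad_def)
  have l: "locally_integrable \<Omega> u" "locally_integrable \<Omega> g" "locally_integrable \<Omega> \<psi>" "locally_integrable \<Omega> (partial_deriv i \<psi>)"
    using u p by (auto simp: has_weak_partial_def)
  show ?thesis
    unfolding has_weak_partial_def
  proof (intro conjI ballI)
    show "locally_integrable \<Omega> (\<lambda>x. u x - \<psi> x)" "locally_integrable \<Omega> (\<lambda>x. g x - partial_deriv i \<psi> x)"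
      using l by (auto simp: locally_integrable_def intro: set_integral_diff)
    fix \<eta> assume \<eta>: "\<eta> \<in> test_functions \<Omega>"
    obtain C where C: "\<And>x. norm (grad \<eta> x) \<le> C" using test_bounded[OF \<eta>] by metis
    have int_p: "integrable M (\<lambda>x. w x * partial_deriv i \<eta> x)" if w: "locally_integrable \<Omega> w" for w
    proof -
      let ?K = "closure {x. \<eta> x \<noteq> 0}"
      have K: "compact ?K" "?K \<subseteq> \<Omega>" using \<eta> by (auto simp: test_functions_def)
      have [measurable]: "w \<in> borel_measurable M" by (rule measurable_if_locally_integrable[OF w])
      have [measurable]: "partial_deriv i \<eta> \<in> borel_measurable M"
        using component_measurable[OF test_measurable(2)[OF \<eta>], of i] by (simp add: grad_def)
      have pC: "\<bar>partial_deriv i \<eta> x\<bar> \<le> C" for x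
        using component_le_norm_cart[of "grad \<eta> x" i] C[of x] by (simp add: grad_def)
      have i: "integrable M (\<lambda>x. indicator ?K x * w x)" by (rule integrable_indicator_compact[OF w K])
      have "integrable M (\<lambda>x. (indicator ?K x * w x) * partial_deriv i \<eta> x)"
        by (rule integral_times_bounded(1)[OF i _ pC]) measurable
      moreover have "(indicator ?K x * w x) * partial_deriv i \<eta> x = w x * partial_deriv i \<eta> x" for x
      proof (cases "x \<in> ?K")
        case False
        have "\<eta> \<in> test_functions ?K" using \<eta> by (auto simp: test_functions_def)
        then have "grad \<eta> x = 0" using False by (rule test_function_support)
        then have "partial_deriv i \<eta> x = 0" by (simp add: grad_def vec_eq_iff)
        then show ?thesis by simp
      qed simp
      ultimately show ?thesis by simp
    qed
    show "(\<integral>x. (u x - \<psi> x) * partial_deriv i \<eta> x \<partial>M) = - (\<integral>x. (g x - partial_deriv i \<psi> x) * \<eta> x \<partial>M)"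
      using u p \<eta> int_p[OF l(1)] int_p[OF l(3)] test_integrable[OF l(2) \<eta>] test_integrable[OF l(4) \<eta>]
      by (simp add: has_weak_partial_def left_diff_distrib)
  qed
qed

theorem W0_imp_sobolev_orlicz0:
  assumes W: "W0 u g" shows "u \<in> sobolev_orlicz0 \<Omega> \<Phi>"
proof -
  note m[measurable] = W0_measurable[OF W]
  have cm: "(\<lambda>x. g x $ i) \<in> borel_measurable M" for i by (rule component_measurable[OF m(2)])
  have "u \<in> sobolev_orlicz \<Omega> \<Phi>"
    unfolding sobolev_orlicz_def orlicz_space_iff
  proof (intro CollectI conjI allI m(1) W0_finite(1)[OF W])
    fix i
    show "\<exists>g\<in>orlicz_space \<Omega> \<Phi>. has_weak_partial \<Omega> i u g"
    proof (rule bexI[where x="\<lambda>x. g x $ i"])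
      show "has_weak_partial \<Omega> i u (\<lambda>x. g x $ i)" by (rule W0_has_weak_partial[OF W])
      show "(\<lambda>x. g x $ i) \<in> orlicz_space \<Omega> \<Phi>"
        unfolding orlicz_space_iff using cm le_less_trans[OF W0_component_\<rho> W0_finite(2)[OF W]] by auto
    qed
  qed
  moreover have "\<exists>\<psi>\<in>test_functions \<Omega>. sobolev_orlicz_norm \<Omega> \<Phi> (\<lambda>x. u x - \<psi> x) < \<epsilon>" if \<epsilon>: "\<epsilon> > 0" for \<epsilon>
  proof -
    define d where "d = \<epsilon> / (2 + real CARD('n))"
    have d: "d > 0" using \<epsilon> by (simp add: d_def)
    define e where "e = 1 / max 1 (1 / d) powr m"
    have "e > 0" by (simp add: e_def)
    then obtain \<psi> where \<psi>: "\<psi> \<in> test_functions \<Omega>" "\<rho> (\<lambda>x. u x - \<psi> x) \<le> ennreal e" "\<rho> (\<lambda>x. norm (g x - grad \<psi> x)) \<le> ennreal e"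
      using W unfolding W0_def by metis
    note \<psi>m[measurable] = test_measurable[OF \<psi>(1)]
    have pm[measurable]: "(\<lambda>x. (g x - grad \<psi> x) $ i) \<in> borel_measurable M" for i
      by (rule component_measurable) measurable
    have "luxemburg_norm \<Omega> \<Phi> (\<lambda>x. u x - \<psi> x) \<le> d"
      by (rule luxemburg_small[OF d]) (use \<psi>(2) in \<open>auto simp: e_def\<close>)
    moreover have "luxemburg_norm \<Omega> \<Phi> (weak_partial \<Omega> i (\<lambda>x. u x - \<psi> x)) \<le> d" for i
    proof -
      have "has_weak_partial \<Omega> i (\<lambda>x. u x - \<psi> x) (\<lambda>x. (g x - grad \<psi> x) $ i)"
        using has_weak_partial_diff_test[OF W0_has_weak_partial[OF W, of i] \<psi>(1)] by (simp add: grad_def)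
      from luxemburg_cong_AE[OF weak_partial_AE(2)[OF this]]
      have "luxemburg_norm \<Omega> \<Phi> (weak_partial \<Omega> i (\<lambda>x. u x - \<psi> x)) = luxemburg_norm \<Omega> \<Phi> (\<lambda>x. (g x - grad \<psi> x) $ i)" .
      also have "\<dots> \<le> d"
        by (rule luxemburg_small[OF d pm]) (use order_trans[OF W0_component_\<rho> \<psi>(3)] in \<open>simp add: e_def\<close>)
      finally show ?thesis .
    qed
    ultimately have "sobolev_orlicz_norm \<Omega> \<Phi> (\<lambda>x. u x - \<psi> x) \<le> d + (\<Sum>i\<in>(UNIV::'n set). d)"
      unfolding sobolev_orlicz_norm_def by (intro add_mono sum_mono)
    also have "\<dots> = d * (1 + real CARD('n))" by (simp add: algebra_simps)
    also have "\<dots> < \<epsilon>" using \<epsilon> by (simp add: d_def field_simps)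
    finally show ?thesis using \<psi>(1) by blast
  qed
  ultimately show ?thesis by (simp add: sobolev_orlicz0_def)
qed

text \<open>The infimum defining the norm is over a nonempty set of positive numbers; nonemptiness
  is what has to be shown.\<close>

lemma luxemburg_nonneg:
  assumes "u \<in> orlicz_space \<Omega> \<Phi>" shows "0 \<le> luxemburg_norm \<Omega> \<Phi> u"
proof (rule ccontr)
  assume "\<not> ?thesis"
  then have neg: "luxemburg_norm \<Omega> \<Phi> u < 0" by simp
  have u: "u \<in> borel_measurable M" "\<rho> u < \<infinity>" using assms by (auto simp: orlicz_space_iff)
  have "\<rho> u \<le> ennreal 0" by (rule \<rho>_le_if_luxemburg_less[OF _ u neg]) simp
  then have z: "\<rho> u = 0" by simp
  have "\<rho> (\<lambda>x. (1 / 1) * u x) \<le> 1" using z by simp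
  then have "1 \<in> {c. c > 0 \<and> \<rho> (\<lambda>x. (1 / c) * u x) \<le> 1}" by simp
  then have "{c. c > 0 \<and> \<rho> (\<lambda>x. (1 / c) * u x) \<le> 1} \<noteq> {}" by blast
  then have "0 \<le> luxemburg_norm \<Omega> \<Phi> u"
    unfolding luxemburg_norm_def \<rho>_alt by (rule cInf_greatest) auto
  then show False using neg by simp
qed

theorem sobolev_orlicz0_imp_W0:
  assumes u: "u \<in> sobolev_orlicz0 \<Omega> \<Phi>" shows "W0 u (weak_grad \<Omega> u)"
proof -
  have us: "u \<in> sobolev_orlicz \<Omega> \<Phi>" and ap: "\<And>\<epsilon>. \<epsilon> > 0 \<Longrightarrow> \<exists>\<psi>\<in>test_functions \<Omega>. sobolev_orlicz_norm \<Omega> \<Phi> (\<lambda>x. u x - \<psi> x) < \<epsilon>"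
    using u by (auto simp: sobolev_orlicz0_def)
  have um[measurable]: "u \<in> borel_measurable M" and uf: "\<rho> u < \<infinity>" using us by (auto simp: sobolev_orlicz_def orlicz_space_iff)
  have wp: "has_weak_partial \<Omega> i u (weak_partial \<Omega> i u)" and wo: "\<rho> (weak_partial \<Omega> i u) < \<infinity>" for i
  proof -
    obtain g where g: "g \<in> orlicz_space \<Omega> \<Phi>" "has_weak_partial \<Omega> i u g" using us by (auto simp: sobolev_orlicz_def)
    show "has_weak_partial \<Omega> i u (weak_partial \<Omega> i u)" by (rule weak_partial_AE(1)[OF g(2)])
    show "\<rho> (weak_partial \<Omega> i u) < \<infinity>"
      using \<rho>_cong_AE[OF weak_partial_AE(2)[OF g(2)]] g(1) by (simp add: orlicz_space_iff)
  qed
  have wm[measurable]: "weak_partial \<Omega> i u \<in> borel_measurable M" for i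
    using wp[of i] by (auto simp: has_weak_partial_def intro: measurable_if_locally_integrable)
  have gm[measurable]: "weak_grad \<Omega> u \<in> borel_measurable M"
  proof -
    have "weak_grad \<Omega> u = (\<lambda>x. \<Sum>i\<in>UNIV. weak_partial \<Omega> i u x *\<^sub>R axis i 1)"
      by (simp add: fun_eq_iff vec_eq_iff weak_grad_def axis_def if_distrib cong: if_cong)
    then show ?thesis by simp
  qed
  show ?thesis
    unfolding W0_def
  proof (intro conjI allI impI um gm)
    fix e :: real assume e: "e > 0"
    define N' where "N' = real CARD('n) powr m * real CARD('n)"
    have N': "N' > 0" by (simp add: N'_def)
    define d where "d = min 1 (min e (e / N'))"
    have d: "0 < d" "d \<le> 1" "d \<le> e" "N' * d \<le> e" using e N' by (auto simp: d_def min_def field_simps)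
    obtain \<psi> where \<psi>: "\<psi> \<in> test_functions \<Omega>" "sobolev_orlicz_norm \<Omega> \<Phi> (\<lambda>x. u x - \<psi> x) < d" using ap[OF d(1)] by blast
    note \<psi>m[measurable] = test_measurable[OF \<psi>(1)]
    have pm: "partial_deriv i \<psi> \<in> borel_measurable M" for i
      using component_measurable[OF \<psi>m(2), of i] by (simp add: grad_def)
    have f1: "\<rho> (\<lambda>x. u x - \<psi> x) < \<infinity>"
    proof -
      have "\<rho> (\<lambda>x. u x - \<psi> x) \<le> ennreal (2 powr m) * (\<rho> u + \<rho> \<psi>)" by (rule \<rho>_add) auto
      also have "\<dots> < \<infinity>" using uf \<rho>_test_finite(1)[OF \<psi>(1)] by (simp add: ennreal_mult_less_top)
      finally show ?thesis .
    qed
    define D where "D i = (\<lambda>x. weak_partial \<Omega> i u x - partial_deriv i \<psi> x)" for i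
    have Dm[measurable]: "D i \<in> borel_measurable M" for i unfolding D_def using wm pm by measurable
    have fD: "\<rho> (D i) < \<infinity>" for i
    proof -
      have "\<rho> (D i) \<le> ennreal (2 powr m) * (\<rho> (weak_partial \<Omega> i u) + \<rho> (partial_deriv i \<psi>))"
        by (rule \<rho>_add[OF wm pm]) (auto simp: D_def)
      moreover have "\<rho> (partial_deriv i \<psi>) < \<infinity>"
        using le_less_trans[OF W0_component_\<rho>[of "grad \<psi>" i] \<rho>_test_finite(2)[OF \<psi>(1)]] by (simp add: grad_def)
      ultimately show ?thesis using wo[of i] by (simp add: ennreal_mult_less_top le_less_trans)
    qed
    have lD: "luxemburg_norm \<Omega> \<Phi> (weak_partial \<Omega> i (\<lambda>x. u x - \<psi> x)) = luxemburg_norm \<Omega> \<Phi> (D i)" for i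
      unfolding D_def by (intro luxemburg_cong_AE weak_partial_AE(2) has_weak_partial_diff_test wp \<psi>(1))
    have nn: "0 \<le> luxemburg_norm \<Omega> \<Phi> (\<lambda>x. u x - \<psi> x)" "\<And>i. 0 \<le> luxemburg_norm \<Omega> \<Phi> (D i)"
      using f1 fD Dm by (auto intro!: luxemburg_nonneg simp: orlicz_space_iff)
    have sum: "luxemburg_norm \<Omega> \<Phi> (\<lambda>x. u x - \<psi> x) + (\<Sum>i\<in>UNIV. luxemburg_norm \<Omega> \<Phi> (D i)) < d"
      using \<psi>(2) unfolding sobolev_orlicz_norm_def lD .
    have "0 \<le> (\<Sum>i\<in>UNIV. luxemburg_norm \<Omega> \<Phi> (D i))" by (intro sum_nonneg nn)
    then have "luxemburg_norm \<Omega> \<Phi> (\<lambda>x. u x - \<psi> x) < d" using sum by linarith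
    then have "\<rho> (\<lambda>x. u x - \<psi> x) \<le> ennreal d" by (intro \<rho>_le_if_luxemburg_less d(2) f1) measurable
    then have r1: "\<rho> (\<lambda>x. u x - \<psi> x) \<le> ennreal e" using d(3) by (meson ennreal_leI order_trans)
    have rD: "\<rho> (D i) \<le> ennreal d" for i
    proof -
      have "luxemburg_norm \<Omega> \<Phi> (D i) \<le> (\<Sum>i\<in>UNIV. luxemburg_norm \<Omega> \<Phi> (D i))" by (intro member_le_sum nn) auto
      then have "luxemburg_norm \<Omega> \<Phi> (D i) < d" using sum nn(1) by linarith
      then show ?thesis by (intro \<rho>_le_if_luxemburg_less d(2) fD) measurable
    qed
    have "\<rho> (\<lambda>x. norm (weak_grad \<Omega> u x - grad \<psi> x)) \<le> ennreal (real CARD('n) powr m) * (\<Sum>i\<in>UNIV. \<rho> (\<lambda>x. (weak_grad \<Omega> u x - grad \<psi> x) $ i))"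
      by (rule \<rho>_norm_le_components) measurable
    also have "\<dots> = ennreal (real CARD('n) powr m) * (\<Sum>i\<in>UNIV. \<rho> (D i))"
      by (simp add: D_def weak_grad_def grad_def)
    also have "\<dots> \<le> ennreal (real CARD('n) powr m) * (\<Sum>i\<in>(UNIV::'n set). ennreal d)"
      by (intro mult_left_mono sum_mono rD) auto
    also have "\<dots> = ennreal (N' * d)"
      using d by (simp add: N'_def ennreal_mult ennreal_of_nat_eq_real_of_nat mult.assoc)
    also have "\<dots> \<le> ennreal e" using d(4) by (rule ennreal_leI)
    finally have "\<rho> (\<lambda>x. norm (weak_grad \<Omega> u x - grad \<psi> x)) \<le> ennreal e" .
    with r1 \<psi>(1) show "\<exists>\<psi>\<in>test_functions \<Omega>. \<rho> (\<lambda>x. u x - \<psi> x) \<le> ennreal e \<and> \<rho> (\<lambda>x. norm (weak_grad \<Omega> u x - grad \<psi> x)) \<le> ennreal e"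
      by blast
  qed
qed

end

section \<open>Compactness\<close>

context orlicz_sobolev
begin

lemma L1_real:
  fixes f :: "real^'n \<Rightarrow> 'b::{banach, second_countable_topology}"
  assumes "integrable M f"
  shows "ennreal (\<integral>x. norm (f x) \<partial>M) = (\<integral>\<^sup>+x. ennreal (norm (f x)) \<partial>M)"
  using assms by (intro nn_integral_eq_integral[symmetric]) auto

text \<open>Modular Cauchy sequences are Cauchy in \<open>L\<^sup>1\<close>, so a subsequence
  converges almost everywhere; Fatou's lemma transfers the modular bound to the limit.\<close>

lemma \<rho>_complete:
  fixes f :: "nat \<Rightarrow> real^'n \<Rightarrow> 'b::{banach, second_countable_topology}"
  assumes i: "\<And>n. integrable M (f n)"
    and cauchy: "\<And>e. e > 0 \<Longrightarrow> \<exists>K. \<forall>i\<ge>K. \<forall>j\<ge>i. \<rho> (\<lambda>x. norm (f i x - f j x)) \<le> ennreal e"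
  obtains h r where "h \<in> borel_measurable M" "strict_mono (r :: nat \<Rightarrow> nat)"
    "AE x in M. (\<lambda>n. f (r n) x) \<longlonglongrightarrow> h x"
    "\<And>e. e > 0 \<Longrightarrow> \<exists>K. \<forall>n\<ge>K. \<rho> (\<lambda>x. norm (f n x - h x)) \<le> ennreal e"
proof -
  have fm[measurable]: "f n \<in> borel_measurable M" for n using i by auto
  have l1: "\<exists>K. \<forall>i\<ge>K. \<forall>j\<ge>K. (\<integral>x. norm (f i x - f j x) \<partial>M) < e" if e: "e > 0" for e
  proof -
    have "e / 2 > 0" using e by simp
    from L1_small[OF this] obtain d where d: "d > 0"
      "\<And>u. u \<in> borel_measurable M \<Longrightarrow> \<rho> u \<le> ennreal d \<Longrightarrow> (\<integral>\<^sup>+x. ennreal \<bar>u x\<bar> \<partial>M) \<le> ennreal (e / 2)"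
      by metis
    obtain K where K: "\<forall>i\<ge>K. \<forall>j\<ge>i. \<rho> (\<lambda>x. norm (f i x - f j x)) \<le> ennreal d" using cauchy[OF d(1)] by blast
    have *: "(\<integral>x. norm (f i x - f j x) \<partial>M) < e" if ij: "K \<le> i" "i \<le> j" for i j
    proof -
      have "ennreal (\<integral>x. norm (f i x - f j x) \<partial>M) = (\<integral>\<^sup>+x. ennreal \<bar>norm (f i x - f j x)\<bar> \<partial>M)"
        using i by (subst L1_real) auto
      also have "\<dots> \<le> ennreal (e / 2)" using K ij by (intro d(2)) auto
      finally have "(\<integral>x. norm (f i x - f j x) \<partial>M) \<le> e / 2" using e by (subst (asm) ennreal_le_iff) auto
      then show ?thesis using e by simp
    qed
    have "(\<integral>x. norm (f i x - f j x) \<partial>M) < e" if ij: "K \<le> i" "K \<le> j" for i j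
      using *[of i j] *[of j i] ij by (cases "i \<le> j") (auto simp: norm_minus_commute)
    then show ?thesis by blast
  qed
  obtain r where r: "strict_mono r" "AE x in M. Cauchy (\<lambda>n. f (r n) x)"
    by (rule cauchy_L1_AE_cauchy_subseq[OF i l1]) auto
  define h where "h x = lim (\<lambda>n. f (r n) x)" for x
  have hm[measurable]: "h \<in> borel_measurable M" unfolding h_def by (rule borel_measurable_lim_metric) auto
  have lim: "AE x in M. (\<lambda>n. f (r n) x) \<longlonglongrightarrow> h x"
    using r(2) by eventually_elim (simp add: h_def Cauchy_convergent_iff convergent_LIMSEQ_iff)
  have "\<exists>K. \<forall>n\<ge>K. \<rho> (\<lambda>x. norm (f n x - h x)) \<le> ennreal e" if e: "e > 0" for e
  proof -
    obtain K where K: "\<forall>i\<ge>K. \<forall>j\<ge>i. \<rho> (\<lambda>x. norm (f i x - f j x)) \<le> ennreal e" using cauchy[OF e] by blast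
    have "\<rho> (\<lambda>x. norm (f n x - h x)) \<le> ennreal e" if n: "n \<ge> K" for n
    proof -
      have "\<rho> (\<lambda>x. norm (f n x - h x)) = (\<integral>\<^sup>+x. liminf (\<lambda>j. ennreal (\<Phi> (norm (f n x - f (r j) x)))) \<partial>M)"
        unfolding \<rho>_def
      proof (rule nn_integral_cong_AE, use lim in eventually_elim)
        fix x assume "(\<lambda>n. f (r n) x) \<longlonglongrightarrow> h x"
        then have "(\<lambda>j. norm (f n x - f (r j) x)) \<longlonglongrightarrow> norm (f n x - h x)" by (intro tendsto_intros)
        then have "(\<lambda>j. ennreal (\<Phi> (norm (f n x - f (r j) x)))) \<longlonglongrightarrow> ennreal (\<Phi> (norm (f n x - h x)))"
          by (intro tendsto_ennrealI continuous_on_tendsto_compose[OF Phi_cont]) auto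
        then show "ennreal (\<Phi> (norm (f n x - h x))) = liminf (\<lambda>j. ennreal (\<Phi> (norm (f n x - f (r j) x))))"
          by (simp add: lim_imp_Liminf)
      qed
      also have "\<dots> \<le> liminf (\<lambda>j. \<rho> (\<lambda>x. norm (f n x - f (r j) x)))"
        unfolding \<rho>_def by (rule nn_integral_liminf) measurable
      also have "\<dots> \<le> ennreal e"
      proof (rule Liminf_le)
        have "\<rho> (\<lambda>x. norm (f n x - f (r j) x)) \<le> ennreal e" if "j \<ge> n" for j
          using K n that seq_suble[OF r(1), of j] by (meson order_trans)
        then show "\<forall>\<^sub>F j in sequentially. \<rho> (\<lambda>x. norm (f n x - f (r j) x)) \<le> ennreal e"
          by (auto simp: eventually_sequentially)
      qed simp
      finally show ?thesis .
    qed
    then show ?thesis by blast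
  qed
  with hm r(1) lim show ?thesis by (rule that)
qed

text \<open>A scaling factor that brings gradients of modular at most \<open>D\<close>, after an
  approximation by test functions, below the threshold \<open>2\<^sup>-\<^sup>m\<close> of the
  Sobolev inequality.\<close>

definition \<theta> :: "real \<Rightarrow> real" where
  "\<theta> D = 2 * 2 powr m * (2 powr m * (D + 1) + 1)"

lemma \<theta>_ge_1: "D \<ge> 0 \<Longrightarrow> \<theta> D \<ge> 1"
proof -
  assume D: "D \<ge> 0"
  have "1 \<le> 2 powr m" using exponents by (simp add: ge_one_powr_ge_zero)
  then have "1 * 1 \<le> (2 * 2 powr m) * (2 powr m * (D + 1) + 1)"
    using D by (intro mult_mono) auto
  then show ?thesis by (simp add: \<theta>_def)
qed

lemma test_sobolev:
  assumes \<psi>: "\<psi> \<in> test_functions \<Omega>" and D: "D \<ge> 0"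
    and le: "\<rho> (\<lambda>x. norm (grad \<psi> x)) \<le> ennreal (2 powr m * (D + 1))"
  shows "(\<integral>\<^sup>+x. ennreal (S (\<psi> x / \<theta> D)) \<partial>M) \<le> 1"
proof -
  note th = \<theta>_ge_1[OF D]
  note \<psi>C = test_function_C1c[OF \<psi>]
  note [measurable] = C1c_measurable[OF \<psi>C]
  define r where "r = 1 / \<theta> D"
  have r: "0 < r" "r \<le> 1" using th by (auto simp: r_def)
  have C: "C1c (\<lambda>x. r * \<psi> x) (\<lambda>x. r *\<^sub>R grad \<psi> x)"
    using \<psi>C unfolding C1c_def by (auto intro!: derivative_eq_intros continuous_intros)
  have "(\<integral>\<^sup>+x. ennreal (\<Phi> (norm (r *\<^sub>R grad \<psi> x))) \<partial>lborel) \<le> (\<integral>\<^sup>+x. ennreal r * ennreal (\<Phi> (norm (grad \<psi> x))) \<partial>lborel)"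
  proof (rule nn_integral_mono)
    fix x
    have "\<Phi> (norm (r *\<^sub>R grad \<psi> x)) \<le> r * \<Phi> (norm (grad \<psi> x))"
      using r Phi_shrink_linear[of r "norm (grad \<psi> x)"] by simp
    then show "ennreal (\<Phi> (norm (r *\<^sub>R grad \<psi> x))) \<le> ennreal r * ennreal (\<Phi> (norm (grad \<psi> x)))"
      using r Phi_nonneg by (subst ennreal_mult[symmetric]) (auto intro: ennreal_leI)
  qed
  also have "\<dots> = ennreal r * \<rho> (\<lambda>x. norm (grad \<psi> x))"
    unfolding \<rho>_def by (subst nn_integral_M) (auto simp: nn_integral_cmult test_function_support[OF \<psi>])
  also have "\<dots> \<le> ennreal r * ennreal (2 powr m * (D + 1))" using le by (rule mult_left_mono) simp
  also have "\<dots> = ennreal (r * (2 powr m * (D + 1)))" using r D by (simp add: ennreal_mult)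
  also have "\<dots> < ennreal (2 powr - m)"
  proof (rule ennreal_lessI)
    have B: "2 powr m * (D + 1) + 1 > 0" using D by (intro add_nonneg_pos) auto
    have "r * (2 powr m * (D + 1)) \<le> r * (2 powr m * (D + 1) + 1)" using r by simp
    also have "\<dots> = 1 / (2 * 2 powr m)" using B by (simp add: r_def \<theta>_def)
    also have "\<dots> < 2 powr - m" by (simp add: powr_minus_divide field_simps)
    finally show "r * (2 powr m * (D + 1)) < 2 powr - m" .
  qed simp
  finally have "(\<integral>\<^sup>+x. ennreal (S (r * \<psi> x)) \<partial>lborel) \<le> 1"
    by (intro sobolev_C1c[OF C]) auto
  then show ?thesis
    by (subst nn_integral_M) (auto simp: test_function_support[OF \<psi>] r_def)
qed

lemma W0_sequence:
  assumes W: "W0 u g" and e: "e > 0"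
  obtains \<psi> where "\<And>n::nat. \<psi> n \<in> test_functions \<Omega>" "AE x in M. (\<lambda>n. \<psi> n x) \<longlonglongrightarrow> u x"
    "\<And>n. \<rho> (\<lambda>x. norm (g x - grad (\<psi> n) x)) \<le> ennreal e"
proof -
  have "\<exists>\<psi>. \<psi> \<in> test_functions \<Omega> \<and> (\<integral>\<^sup>+x. ennreal \<bar>u x - \<psi> x\<bar> \<partial>M) \<le> ennreal (1 / real (Suc n)) \<and> \<rho> (\<lambda>x. norm (g x - grad \<psi> x)) \<le> ennreal e" for n
  proof -
    have "1 / real (Suc n) > 0" by simp
    from L1_small[OF this] obtain d where d: "d > 0"
      "\<And>u. u \<in> borel_measurable M \<Longrightarrow> \<rho> u \<le> ennreal d \<Longrightarrow> (\<integral>\<^sup>+x. ennreal \<bar>u x\<bar> \<partial>M) \<le> ennreal (1 / real (Suc n))"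
      by metis
    have de: "min d e > 0" using d e by simp
    obtain \<psi> where \<psi>: "\<psi> \<in> test_functions \<Omega>" "\<rho> (\<lambda>x. u x - \<psi> x) \<le> ennreal (min d e)" "\<rho> (\<lambda>x. norm (g x - grad \<psi> x)) \<le> ennreal (min d e)"
      using W de unfolding W0_def by metis
    have "(\<integral>\<^sup>+x. ennreal \<bar>u x - \<psi> x\<bar> \<partial>M) \<le> ennreal (1 / real (Suc n))"
      using W0_measurable(1)[OF W] test_measurable(1)[OF \<psi>(1)] \<psi>(2)
      by (intro d(2)) (auto elim!: order_trans intro!: ennreal_leI)
    moreover have "\<rho> (\<lambda>x. norm (g x - grad \<psi> x)) \<le> ennreal e"
      using \<psi>(3) by (rule order_trans) (auto intro!: ennreal_leI)
    ultimately show ?thesis using \<psi>(1) by blast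
  qed
  then have "\<forall>n. \<exists>\<psi>. \<psi> \<in> test_functions \<Omega> \<and> (\<integral>\<^sup>+x. ennreal \<bar>u x - \<psi> x\<bar> \<partial>M) \<le> ennreal (1 / real (Suc n)) \<and> \<rho> (\<lambda>x. norm (g x - grad \<psi> x)) \<le> ennreal e"
    by blast
  from choice[OF this] obtain \<psi> where \<psi>: "\<And>n. \<psi> n \<in> test_functions \<Omega>" "\<And>n. (\<integral>\<^sup>+x. ennreal \<bar>u x - \<psi> n x\<bar> \<partial>M) \<le> ennreal (1 / real (Suc n))"
    "\<And>n. \<rho> (\<lambda>x. norm (g x - grad (\<psi> n) x)) \<le> ennreal e"
    by blast
  have iu: "integrable M u" by (rule integrable_if_\<rho>_finite[OF W0_measurable(1)[OF W] W0_finite(1)[OF W]])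
  have i\<psi>: "integrable M (\<psi> n)" for n
    by (rule integrable_if_\<rho>_finite[OF test_measurable(1)[OF \<psi>(1)] \<rho>_test_finite(1)[OF \<psi>(1)]])
  have "(\<integral>x. norm (u x - \<psi> n x) \<partial>M) \<le> 1 / real (Suc n)" for n
  proof -
    have "ennreal (\<integral>x. norm (u x - \<psi> n x) \<partial>M) \<le> ennreal (1 / real (Suc n))"
      using \<psi>(2)[of n] iu i\<psi> by (subst L1_real) auto
    then show ?thesis by (subst (asm) ennreal_le_iff) auto
  qed
  then have "(\<lambda>n. \<integral>x. norm (u x - \<psi> n x) \<partial>M) \<longlonglongrightarrow> 0"
    by (intro tendsto_sandwich[OF _ _ tendsto_const LIMSEQ_Suc[OF lim_1_over_n]]) auto
  from tendsto_L1_AE_subseq[OF _ this] iu i\<psi> obtain r :: "nat \<Rightarrow> nat" where r: "strict_mono r" "AE x in M. (\<lambda>n. u x - \<psi> (r n) x) \<longlonglongrightarrow> 0"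
    by auto
  show ?thesis
  proof (rule that[of "\<lambda>n. \<psi> (r n)"])
    show "AE x in M. (\<lambda>n. \<psi> (r n) x) \<longlonglongrightarrow> u x"
      using r(2)
    proof eventually_elim
      case (elim x)
      from tendsto_diff[OF tendsto_const[of "u x"] elim] show ?case by simp
    qed
  qed (use \<psi> in auto)
qed

lemma grad_approx_bound:
  assumes W: "W0 u g" and D: "\<rho> (\<lambda>x. norm (g x)) \<le> ennreal D" "D \<ge> 0"
    and \<psi>: "\<psi> \<in> test_functions \<Omega>" "\<rho> (\<lambda>x. norm (g x - grad \<psi> x)) \<le> ennreal 1"
  shows "\<rho> (\<lambda>x. norm (grad \<psi> x)) \<le> ennreal (2 powr m * (D + 1))"
proof -
  note [measurable] = W0_measurable[OF W] test_measurable[OF \<psi>(1)]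
  have "\<rho> (\<lambda>x. norm (grad \<psi> x)) \<le> ennreal (2 powr m) * (\<rho> (\<lambda>x. norm (g x)) + \<rho> (\<lambda>x. norm (g x - grad \<psi> x)))"
  proof (rule \<rho>_add)
    have "norm (grad \<psi> x) \<le> norm (g x) + norm (g x - grad \<psi> x)" for x
      using norm_triangle_ineq4[of "g x" "g x - grad \<psi> x"] by simp
    then show "AE x in M. \<bar>norm (grad \<psi> x)\<bar> \<le> \<bar>norm (g x)\<bar> + \<bar>norm (g x - grad \<psi> x)\<bar>" by simp
  qed measurable
  also have "\<dots> \<le> ennreal (2 powr m) * (ennreal D + ennreal 1)" using D \<psi>(2) by (intro mult_left_mono add_mono) auto
  also have "\<dots> = ennreal (2 powr m * (D + 1))" using D by (simp add: ennreal_mult ennreal_plus)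
  finally show ?thesis .
qed

theorem W0_sobolev:
  assumes W: "W0 u g" and D: "\<rho> (\<lambda>x. norm (g x)) \<le> ennreal D" "D \<ge> 0"
  shows "(\<integral>\<^sup>+x. ennreal (S (u x / \<theta> D)) \<partial>M) \<le> 1"
proof -
  obtain \<psi> where \<psi>: "\<And>n::nat. \<psi> n \<in> test_functions \<Omega>" "AE x in M. (\<lambda>n. \<psi> n x) \<longlonglongrightarrow> u x"
    "\<And>n. \<rho> (\<lambda>x. norm (g x - grad (\<psi> n) x)) \<le> ennreal 1"
    using W0_sequence[OF W, of 1] by auto
  have [measurable]: "\<psi> n \<in> borel_measurable M" for n by (rule test_measurable[OF \<psi>(1)])
  have "(\<integral>\<^sup>+x. ennreal (S (u x / \<theta> D)) \<partial>M) = (\<integral>\<^sup>+x. liminf (\<lambda>n. ennreal (S (\<psi> n x / \<theta> D))) \<partial>M)"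
  proof (rule nn_integral_cong_AE, use \<psi>(2) in eventually_elim)
    fix x assume "(\<lambda>n. \<psi> n x) \<longlonglongrightarrow> u x"
    then have "(\<lambda>n. \<psi> n x / \<theta> D) \<longlonglongrightarrow> u x / \<theta> D" using \<theta>_ge_1[OF D(2)] by (intro tendsto_intros) auto
    then have "(\<lambda>n. ennreal (S (\<psi> n x / \<theta> D))) \<longlonglongrightarrow> ennreal (S (u x / \<theta> D))"
      by (intro tendsto_ennrealI continuous_on_tendsto_compose[OF S_cont]) auto
    then show "ennreal (S (u x / \<theta> D)) = liminf (\<lambda>n. ennreal (S (\<psi> n x / \<theta> D)))"
      by (simp add: lim_imp_Liminf)
  qed
  also have "\<dots> \<le> liminf (\<lambda>n. \<integral>\<^sup>+x. ennreal (S (\<psi> n x / \<theta> D)) \<partial>M)"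
    by (rule nn_integral_liminf) measurable
  also have "\<dots> \<le> 1"
    by (rule Liminf_le) (auto intro!: always_eventually test_sobolev \<psi> grad_approx_bound[OF W D] D)
  finally show ?thesis .
qed

lemma W0_L1_bound:
  assumes D: "D \<ge> 0"
  obtains C where "C \<ge> 0" "\<And>u g. W0 u g \<Longrightarrow> \<rho> (\<lambda>x. norm (g x)) \<le> ennreal D \<Longrightarrow> (\<integral>\<^sup>+x. ennreal \<bar>u x\<bar> \<partial>M) \<le> ennreal C"
proof -
  obtain s0 where s0: "s0 > 0" "\<And>s. s \<ge> s0 \<Longrightarrow> 1 * s \<le> S s" by (rule S_superlinear[of 1]) (rule that)
  define V where "V = measure M \<Omega>"
  have V: "emeasure M \<Omega> = ennreal V" "V \<ge> 0"
    unfolding V_def using finite_M by (auto simp: finite_measure.emeasure_eq_measure)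
  note th = \<theta>_ge_1[OF D]
  define C where "C = \<theta> D * (s0 * V + 1)"
  have C: "C \<ge> 0" using s0 V th by (simp add: C_def)
  show ?thesis
  proof (rule that[OF C])
    fix u g assume W: "W0 u g" and g: "\<rho> (\<lambda>x. norm (g x)) \<le> ennreal D"
    note [measurable] = W0_measurable[OF W]
    have "(\<integral>\<^sup>+x. ennreal \<bar>u x\<bar> \<partial>M) \<le> (\<integral>\<^sup>+x. ennreal (\<theta> D) * (ennreal s0 + ennreal (S (u x / \<theta> D))) \<partial>M)"
    proof (rule nn_integral_mono)
      fix x
      have "\<bar>u x / \<theta> D\<bar> \<le> s0 + S (u x / \<theta> D)"
        using s0(2)[of "\<bar>u x / \<theta> D\<bar>"] s0(1) S_nonneg[of "u x / \<theta> D"] S_even(2)[of "u x / \<theta> D"]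
        by (cases "s0 \<le> \<bar>u x / \<theta> D\<bar>") auto
      then have "\<theta> D * \<bar>u x / \<theta> D\<bar> \<le> \<theta> D * (s0 + S (u x / \<theta> D))" using th by (intro mult_left_mono) auto
      moreover have "\<theta> D * \<bar>u x / \<theta> D\<bar> = \<bar>u x\<bar>"
      proof -
        have "\<theta> D * \<bar>u x / \<theta> D\<bar> = \<bar>\<theta> D * (u x / \<theta> D)\<bar>" using th by (simp only: abs_mult)
        then show ?thesis using th by simp
      qed
      ultimately have "\<bar>u x\<bar> \<le> \<theta> D * (s0 + S (u x / \<theta> D))" by (simp only:)
      then have "ennreal \<bar>u x\<bar> \<le> ennreal (\<theta> D * (s0 + S (u x / \<theta> D)))" by (rule ennreal_leI)
      also have "\<dots> = ennreal (\<theta> D) * (ennreal s0 + ennreal (S (u x / \<theta> D)))"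
        using th s0 S_nonneg[of "u x / \<theta> D"] by (simp add: ennreal_mult ennreal_plus)
      finally show "ennreal \<bar>u x\<bar> \<le> \<dots>" .
    qed
    also have "\<dots> = ennreal (\<theta> D) * (ennreal s0 * ennreal V + (\<integral>\<^sup>+x. ennreal (S (u x / \<theta> D)) \<partial>M))"
      by (simp add: nn_integral_cmult nn_integral_add V)
    also have "\<dots> \<le> ennreal (\<theta> D) * (ennreal s0 * ennreal V + 1)"
      by (intro mult_left_mono add_left_mono W0_sobolev[OF W g D]) auto
    also have "\<dots> = ennreal C"
      using th s0 V by (simp add: C_def ennreal_mult ennreal_plus)
    finally show "(\<integral>\<^sup>+x. ennreal \<bar>u x\<bar> \<partial>M) \<le> ennreal C" .
  qed
qed

lemma test_gradient_L1:
  assumes D: "D \<ge> 0"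
  obtains C where "C \<ge> 0" "\<And>\<psi>. \<psi> \<in> test_functions \<Omega> \<Longrightarrow> \<rho> (\<lambda>x. norm (grad \<psi> x)) \<le> ennreal D \<Longrightarrow>
    (\<integral>\<^sup>+x. ennreal (norm (grad \<psi> x)) \<partial>lborel) \<le> ennreal C"
proof -
  define V where "V = measure M \<Omega>"
  have V: "emeasure M \<Omega> = ennreal V" "V \<ge> 0"
    unfolding V_def using finite_M by (auto simp: finite_measure.emeasure_eq_measure)
  define C where "C = V + 1 / \<Phi> 1 * D"
  have p1: "\<Phi> 1 > 0" by (rule Phi_pos) simp
  have C: "C \<ge> 0" using V D p1 by (simp add: C_def)
  show ?thesis
  proof (rule that[OF C])
    fix \<psi> assume \<psi>: "\<psi> \<in> test_functions \<Omega>" "\<rho> (\<lambda>x. norm (grad \<psi> x)) \<le> ennreal D"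
    note [measurable] = test_measurable[OF \<psi>(1)]
    have "(\<integral>\<^sup>+x. ennreal (norm (grad \<psi> x)) \<partial>lborel) = (\<integral>\<^sup>+x. ennreal \<bar>norm (grad \<psi> x)\<bar> \<partial>M)"
      by (subst nn_integral_M) (auto simp: test_function_support[OF \<psi>(1)])
    also have "\<dots> \<le> ennreal 1 * emeasure M \<Omega> + ennreal (1 / \<Phi> 1) * \<rho> (\<lambda>x. norm (grad \<psi> x))"
      by (rule L1_le_\<rho>) auto
    also have "\<dots> \<le> ennreal 1 * ennreal V + ennreal (1 / \<Phi> 1) * ennreal D"
      unfolding V(1) by (intro add_left_mono mult_left_mono \<psi>(2)) auto
    also have "\<dots> = ennreal C"
      using V D p1 ennreal_mult[of "1 / \<Phi> 1" D] unfolding C_def by (subst ennreal_plus) auto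
    finally show "(\<integral>\<^sup>+x. ennreal (norm (grad \<psi> x)) \<partial>lborel) \<le> ennreal C" .
  qed
qed

lemma W0_rellich:
  assumes W: "\<And>n::nat. W0 (u n) (g n)" and D: "\<And>n. \<rho> (\<lambda>x. norm (g n x)) \<le> ennreal D" "D \<ge> 0"
  obtains r :: "nat \<Rightarrow> nat" where "strict_mono r"
    "\<And>e. e > 0 \<Longrightarrow> \<exists>K. \<forall>i\<ge>K. \<forall>j\<ge>K. (\<integral>\<^sup>+x. ennreal \<bar>u (r i) x - u (r j) x\<bar> \<partial>M) \<le> ennreal e"
proof -
  have um[measurable]: "u n \<in> borel_measurable M" for n by (rule W0_measurable[OF W])
  have "\<exists>\<psi>. \<psi> \<in> test_functions \<Omega> \<and> (\<integral>\<^sup>+x. ennreal \<bar>u n x - \<psi> x\<bar> \<partial>M) \<le> ennreal (1 / real (Suc n)) \<and>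
      \<rho> (\<lambda>x. norm (g n x - grad \<psi> x)) \<le> ennreal 1" for n
  proof -
    have "1 / real (Suc n) > 0" by simp
    from L1_small[OF this] obtain d where d: "d > 0"
      "\<And>u. u \<in> borel_measurable M \<Longrightarrow> \<rho> u \<le> ennreal d \<Longrightarrow> (\<integral>\<^sup>+x. ennreal \<bar>u x\<bar> \<partial>M) \<le> ennreal (1 / real (Suc n))"
      by metis
    have "min d 1 > 0" using d by simp
    then obtain \<psi> where \<psi>: "\<psi> \<in> test_functions \<Omega>" "\<rho> (\<lambda>x. u n x - \<psi> x) \<le> ennreal (min d 1)" "\<rho> (\<lambda>x. norm (g n x - grad \<psi> x)) \<le> ennreal (min d 1)"
      using W[of n] unfolding W0_def by metis
    have "(\<integral>\<^sup>+x. ennreal \<bar>u n x - \<psi> x\<bar> \<partial>M) \<le> ennreal (1 / real (Suc n))"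
      using test_measurable(1)[OF \<psi>(1)] \<psi>(2)
      by (intro d(2)) (auto elim!: order_trans intro!: ennreal_leI)
    moreover have "\<rho> (\<lambda>x. norm (g n x - grad \<psi> x)) \<le> ennreal 1"
      using \<psi>(3) by (rule order_trans) (rule ennreal_leI, simp)
    ultimately show ?thesis using \<psi>(1) by blast
  qed
  then have "\<forall>n. \<exists>\<psi>. \<psi> \<in> test_functions \<Omega> \<and> (\<integral>\<^sup>+x. ennreal \<bar>u n x - \<psi> x\<bar> \<partial>M) \<le> ennreal (1 / real (Suc n)) \<and>
      \<rho> (\<lambda>x. norm (g n x - grad \<psi> x)) \<le> ennreal 1" by blast
  from choice[OF this] obtain \<psi> where \<psi>: "\<And>n. \<psi> n \<in> test_functions \<Omega>"
    "\<And>n. (\<integral>\<^sup>+x. ennreal \<bar>u n x - \<psi> n x\<bar> \<partial>M) \<le> ennreal (1 / real (Suc n))"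
    "\<And>n. \<rho> (\<lambda>x. norm (g n x - grad (\<psi> n) x)) \<le> ennreal 1" by blast
  have [measurable]: "\<psi> n \<in> borel_measurable M" for n by (rule test_measurable[OF \<psi>(1)])
  define D1 where "D1 = 2 powr m * (D + 1)"
  have D1: "D1 \<ge> 0" "\<rho> (\<lambda>x. norm (grad (\<psi> n) x)) \<le> ennreal D1" for n
    using D grad_approx_bound[OF W D \<psi>(1,3)] by (auto simp: D1_def)
  obtain C where C: "C \<ge> 0" "\<And>n. (\<integral>\<^sup>+x. ennreal (norm (grad (\<psi> n) x)) \<partial>lborel) \<le> ennreal C"
    using test_gradient_L1[OF D1(1)] D1(2) \<psi>(1) by metis
  obtain C' where C': "C' \<ge> 0" "\<And>n. (\<integral>\<^sup>+x. ennreal \<bar>\<psi> n x\<bar> \<partial>M) \<le> ennreal C'"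
    using W0_L1_bound[OF D1(1)] W0_test[OF \<psi>(1)] D1(2) by metis
  have C'l: "(\<integral>\<^sup>+x. ennreal \<bar>\<psi> n x\<bar> \<partial>lborel) \<le> ennreal C'" for n
    using C'(2)[of n] by (subst (asm) nn_integral_M) (auto simp: test_function_support[OF \<psi>(1)])
  obtain R where R: "\<And>x. x \<in> \<Omega> \<Longrightarrow> norm x \<le> R" using bounded_\<Omega> by (auto simp: bounded_iff)
  have supp: "\<psi> n x = 0" if "norm x > R" for n x
    using R[of x] that by (intro test_function_support(1)[OF \<psi>(1)]) auto
  obtain r :: "nat \<Rightarrow> nat" where r: "strict_mono r"
    and rc: "\<And>e. e > 0 \<Longrightarrow> \<exists>K. \<forall>i\<ge>K. \<forall>j\<ge>K. (\<integral>\<^sup>+x. ennreal \<bar>\<psi> (r i) x - \<psi> (r j) x\<bar> \<partial>lborel) \<le> ennreal e"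
    by (rule rellich_L1[of \<psi> "\<lambda>n. grad (\<psi> n)" R C' C]) (use test_function_C1c[OF \<psi>(1)] supp C'l C C'(1) in auto)
  show ?thesis
  proof (rule that[OF r])
    fix e :: real assume e: "e > 0"
    then have e3: "e / 3 > 0" by simp
    obtain K where K: "\<forall>i\<ge>K. \<forall>j\<ge>K. (\<integral>\<^sup>+x. ennreal \<bar>\<psi> (r i) x - \<psi> (r j) x\<bar> \<partial>lborel) \<le> ennreal (e / 3)"
      using rc[OF e3] by blast
    obtain K' where K': "inverse (real (Suc K')) < e / 3" using reals_Archimedean[OF e3] by blast
    have tail: "(\<integral>\<^sup>+x. ennreal \<bar>u (r i) x - \<psi> (r i) x\<bar> \<partial>M) \<le> ennreal (e / 3)" if i: "i \<ge> K'" for i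
    proof -
      have "real (Suc K') \<le> real (Suc (r i))" using i seq_suble[OF r, of i] by simp
      then have "1 / real (Suc (r i)) \<le> inverse (real (Suc K'))" by (simp add: field_simps)
      then have "1 / real (Suc (r i)) \<le> e / 3" using K' by linarith
      then show ?thesis using \<psi>(2)[of "r i"] by (meson ennreal_leI order_trans)
    qed
    have "(\<integral>\<^sup>+x. ennreal \<bar>u (r i) x - u (r j) x\<bar> \<partial>M) \<le> ennreal e" if ij: "i \<ge> max K K'" "j \<ge> max K K'" for i j
    proof -
      let ?a = "\<lambda>x. ennreal \<bar>u (r i) x - \<psi> (r i) x\<bar>" and ?b = "\<lambda>x. ennreal \<bar>\<psi> (r i) x - \<psi> (r j) x\<bar>"
        and ?c = "\<lambda>x. ennreal \<bar>u (r j) x - \<psi> (r j) x\<bar>"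
      have "(\<integral>\<^sup>+x. ennreal \<bar>u (r i) x - u (r j) x\<bar> \<partial>M) \<le> (\<integral>\<^sup>+x. ?a x + ?b x + ?c x \<partial>M)"
      proof (rule nn_integral_mono)
        fix x
        have "\<bar>u (r i) x - u (r j) x\<bar> \<le> \<bar>u (r i) x - \<psi> (r i) x\<bar> + \<bar>\<psi> (r i) x - \<psi> (r j) x\<bar> + \<bar>u (r j) x - \<psi> (r j) x\<bar>"
          by linarith
        then show "ennreal \<bar>u (r i) x - u (r j) x\<bar> \<le> ?a x + ?b x + ?c x"
          by (simp add: ennreal_plus[symmetric] ennreal_leI del: ennreal_plus)
      qed
      also have "\<dots> = (\<integral>\<^sup>+x. ?a x \<partial>M) + (\<integral>\<^sup>+x. ?b x \<partial>M) + (\<integral>\<^sup>+x. ?c x \<partial>M)"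
        by (simp add: nn_integral_add)
      also have "(\<integral>\<^sup>+x. ?b x \<partial>M) = (\<integral>\<^sup>+x. ?b x \<partial>lborel)"
        by (rule nn_integral_M) (simp add: test_function_support[OF \<psi>(1)])
      also have "(\<integral>\<^sup>+x. ?a x \<partial>M) + (\<integral>\<^sup>+x. ?b x \<partial>lborel) + (\<integral>\<^sup>+x. ?c x \<partial>M) \<le> ennreal (e / 3) + ennreal (e / 3) + ennreal (e / 3)"
        using ij K by (intro add_mono tail) auto
      also have "\<dots> = ennreal e" using e by (simp add: ennreal_plus[symmetric] del: ennreal_plus)
      finally show ?thesis .
    qed
    then show "\<exists>K. \<forall>i\<ge>K. \<forall>j\<ge>K. (\<integral>\<^sup>+x. ennreal \<bar>u (r i) x - u (r j) x\<bar> \<partial>M) \<le> ennreal e" by blast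
  qed
qed

lemma W0_diff: "W0 u g \<Longrightarrow> W0 v g' \<Longrightarrow> W0 (\<lambda>x. u x - v x) (\<lambda>x. g x - g' x)"
  using W0_linear[of u g v g' 1 "- 1"] by simp

lemma \<rho>_gradient_diff:
  assumes "W0 u g" "W0 v g'" "\<rho> (\<lambda>x. norm (g x)) \<le> ennreal D" "\<rho> (\<lambda>x. norm (g' x)) \<le> ennreal D" "D \<ge> 0"
  shows "\<rho> (\<lambda>x. norm (g x - g' x)) \<le> ennreal (2 powr m * (2 * D))"
proof -
  note [measurable] = W0_measurable[OF assms(1)] W0_measurable[OF assms(2)]
  have "\<rho> (\<lambda>x. norm (g x - g' x)) \<le> ennreal (2 powr m) * (\<rho> (\<lambda>x. norm (g x)) + \<rho> (\<lambda>x. norm (g' x)))"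
    by (rule \<rho>_add) (auto intro: norm_triangle_ineq4)
  also have "\<dots> \<le> ennreal (2 powr m) * (ennreal D + ennreal D)" using assms by (intro mult_left_mono add_mono) auto
  also have "\<dots> = ennreal (2 powr m * (2 * D))" using assms(5) by (simp add: ennreal_mult ennreal_plus[symmetric] del: ennreal_plus)
  finally show ?thesis .
qed

text \<open>Interpolation: \<open>\<Phi> \<le> \<epsilon> S + M |\<cdot>|\<close>, and the
  first term is controlled by the Sobolev inequality.\<close>

lemma \<rho>_small_if_L1_small:
  assumes D: "D \<ge> 0" and e: "e > 0"
  obtains d where "d > 0" "\<And>u g. W0 u g \<Longrightarrow> \<rho> (\<lambda>x. norm (g x)) \<le> ennreal D \<Longrightarrow>
    (\<integral>\<^sup>+x. ennreal \<bar>u x\<bar> \<partial>M) \<le> ennreal d \<Longrightarrow> \<rho> u \<le> ennreal e"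
proof -
  note th = \<theta>_ge_1[OF D]
  define A where "A = \<theta> D powr m"
  have A: "A > 0" using th by (simp add: A_def)
  have "e / (2 * A) > 0" using e A by simp
  from Phi_le_S[OF this] obtain B where B: "B \<ge> 0" "\<And>s. \<Phi> s \<le> e / (2 * A) * S s + B * \<bar>s\<bar>" by metis
  define d where "d = e / (2 * (A * B + 1))"
  have AB: "A * B \<ge> 0" using A B by simp
  have d: "d > 0" using e AB by (simp add: d_def)
  have ABd: "A * B * d \<le> e / 2" using e AB by (simp add: d_def field_simps)
  show ?thesis
  proof (rule that[OF d])
    fix u g assume W: "W0 u g" and g: "\<rho> (\<lambda>x. norm (g x)) \<le> ennreal D" and l: "(\<integral>\<^sup>+x. ennreal \<bar>u x\<bar> \<partial>M) \<le> ennreal d"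
    note [measurable] = W0_measurable[OF W]
    have "\<rho> u \<le> (\<integral>\<^sup>+x. ennreal (e / 2) * ennreal (S (u x / \<theta> D)) + ennreal (A * B) * ennreal \<bar>u x\<bar> \<partial>M)"
      unfolding \<rho>_def
    proof (rule nn_integral_mono)
      fix x
      define t where "t = u x / \<theta> D"
      have ut: "u x = \<theta> D * t" using th by (simp add: t_def)
      have "\<Phi> (u x) \<le> A * \<Phi> t" unfolding ut A_def by (rule Phi_scale(2)[OF th])
      also have "\<dots> \<le> A * (e / (2 * A) * S t + B * \<bar>t\<bar>)" using A by (intro mult_left_mono B(2)) auto
      also have "\<dots> = e / 2 * S t + A * B * \<bar>t\<bar>" using A by (simp add: field_simps)
      also have "\<dots> \<le> e / 2 * S t + A * B * \<bar>u x\<bar>"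
      proof -
        have "\<bar>t\<bar> \<le> \<bar>u x\<bar>" using th mult_right_mono[of 1 "\<theta> D" "\<bar>t\<bar>"] by (simp add: ut abs_mult)
        then show ?thesis using AB by (intro add_left_mono mult_left_mono)
      qed
      finally have "ennreal (\<Phi> (u x)) \<le> ennreal (e / 2 * S t + A * B * \<bar>u x\<bar>)" by (rule ennreal_leI)
      also have "\<dots> = ennreal (e / 2) * ennreal (S t) + ennreal (A * B) * ennreal \<bar>u x\<bar>"
        using e AB S_nonneg[of t] ennreal_mult[of "e / 2" "S t"] ennreal_mult[of "A * B" "\<bar>u x\<bar>"] by (subst ennreal_plus) auto
      finally show "ennreal (\<Phi> (u x)) \<le> ennreal (e / 2) * ennreal (S (u x / \<theta> D)) + ennreal (A * B) * ennreal \<bar>u x\<bar>"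
        unfolding t_def .
    qed
    also have "\<dots> = ennreal (e / 2) * (\<integral>\<^sup>+x. ennreal (S (u x / \<theta> D)) \<partial>M) + ennreal (A * B) * (\<integral>\<^sup>+x. ennreal \<bar>u x\<bar> \<partial>M)"
      by (simp add: nn_integral_cmult nn_integral_add)
    also have "\<dots> \<le> ennreal (e / 2) * 1 + ennreal (A * B) * ennreal d"
      by (intro add_mono mult_left_mono W0_sobolev[OF W g D] l) auto
    also have "\<dots> = ennreal (e / 2 + A * B * d)"
      using e AB d ennreal_mult[of "A * B" d] by (subst ennreal_plus) auto
    also have "\<dots> \<le> ennreal e" using ABd by (intro ennreal_leI) simp
    finally show "\<rho> u \<le> ennreal e" .
  qed
qed

theorem W0_compact_\<rho>:
  assumes W: "\<And>n::nat. W0 (u n) (g n)" and D: "\<And>n. \<rho> (\<lambda>x. norm (g n x)) \<le> ennreal D" "D \<ge> 0"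
  obtains r v where "strict_mono (r :: nat \<Rightarrow> nat)" "v \<in> borel_measurable M"
    "AE x in M. (\<lambda>n. u (r n) x) \<longlonglongrightarrow> v x"
    "\<And>e. e > 0 \<Longrightarrow> \<exists>K. \<forall>n\<ge>K. \<rho> (\<lambda>x. u (r n) x - v x) \<le> ennreal e"
proof -
  obtain r :: "nat \<Rightarrow> nat" where r: "strict_mono r"
    and rc: "\<And>e. e > 0 \<Longrightarrow> \<exists>K. \<forall>i\<ge>K. \<forall>j\<ge>K. (\<integral>\<^sup>+x. ennreal \<bar>u (r i) x - u (r j) x\<bar> \<partial>M) \<le> ennreal e"
    by (rule W0_rellich[OF W D]) (rule that)
  define D2 where "D2 = 2 powr m * (2 * D)"
  have D2: "D2 \<ge> 0" using D by (simp add: D2_def)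
  have i: "integrable M (u n)" for n by (rule integrable_if_\<rho>_finite[OF W0_measurable(1)[OF W] W0_finite(1)[OF W]])
  have cauchy: "\<exists>K. \<forall>i\<ge>K. \<forall>j\<ge>i. \<rho> (\<lambda>x. norm (u (r i) x - u (r j) x)) \<le> ennreal e" if e: "e > 0" for e
  proof -
    obtain d where d: "d > 0" "\<And>u g. W0 u g \<Longrightarrow> \<rho> (\<lambda>x. norm (g x)) \<le> ennreal D2 \<Longrightarrow>
      (\<integral>\<^sup>+x. ennreal \<bar>u x\<bar> \<partial>M) \<le> ennreal d \<Longrightarrow> \<rho> u \<le> ennreal e"
      by (rule \<rho>_small_if_L1_small[OF D2 e]) (rule that)
    obtain K where K: "\<forall>i\<ge>K. \<forall>j\<ge>K. (\<integral>\<^sup>+x. ennreal \<bar>u (r i) x - u (r j) x\<bar> \<partial>M) \<le> ennreal d" using rc[OF d(1)] by blast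
    have "\<rho> (\<lambda>x. norm (u (r i) x - u (r j) x)) \<le> ennreal e" if ij: "i \<ge> K" "j \<ge> i" for i j
    proof -
      have "\<rho> (\<lambda>x. u (r i) x - u (r j) x) \<le> ennreal e"
      proof (rule d(2)[OF W0_diff[OF W W]])
        show "\<rho> (\<lambda>x. norm (g (r i) x - g (r j) x)) \<le> ennreal D2"
          unfolding D2_def by (rule \<rho>_gradient_diff[OF W W D(1) D(1) D(2)])
        show "(\<integral>\<^sup>+x. ennreal \<bar>u (r i) x - u (r j) x\<bar> \<partial>M) \<le> ennreal d" using K ij by auto
      qed
      then show ?thesis by (simp add: \<rho>_abs)
    qed
    then show ?thesis by blast
  qed
  obtain v s where v: "v \<in> borel_measurable M" "strict_mono (s :: nat \<Rightarrow> nat)"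
    "AE x in M. (\<lambda>n. u (r (s n)) x) \<longlonglongrightarrow> v x"
    and vc: "\<And>e. e > 0 \<Longrightarrow> \<exists>K. \<forall>n\<ge>K. \<rho> (\<lambda>x. norm (u (r n) x - v x)) \<le> ennreal e"
    by (rule \<rho>_complete[of "\<lambda>n. u (r n)", OF i cauchy]) (assumption, rule that)
  show ?thesis
  proof (rule that[of "\<lambda>n. r (s n)" v])
    show "strict_mono (\<lambda>n. r (s n))" using r v(2) by (simp add: strict_mono_def)
    fix e :: real assume "e > 0"
    then obtain K where K: "\<forall>n\<ge>K. \<rho> (\<lambda>x. norm (u (r n) x - v x)) \<le> ennreal e" using vc by blast
    have "\<rho> (\<lambda>x. u (r (s n)) x - v x) \<le> ennreal e" if "n \<ge> K" for n
    proof -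
      have "s n \<ge> K" using that seq_suble[OF v(2), of n] by simp
      then show ?thesis using K by (simp add: \<rho>_abs)
    qed
    then show "\<exists>K. \<forall>n\<ge>K. \<rho> (\<lambda>x. u (r (s n)) x - v x) \<le> ennreal e" by blast
  qed (use v in auto)
qed

end

section \<open>A uniformly convex Young function\<close>

lemma powr_midpoint_strict:
  fixes x y r :: real
  assumes r: "r > 1" and xy: "0 \<le> x" "x < y"
  shows "((x + y) / 2) powr r < (x powr r + y powr r) / 2"
proof -
  define z where "z = (x + y) / 2"
  have z: "x < z" "z < y" "y - z = z - x" using xy by (auto simp: z_def field_simps)
  have cont: "continuous_on {a..b} (\<lambda>t. t powr r)" if "0 \<le> a" for a b :: real
    using that r by (intro continuous_on_powr') (auto intro: continuous_intros)
  have der: "((\<lambda>t. t powr r) has_real_derivative r * t powr (r - 1)) (at t)" if "t > 0" for t :: real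
    using that by (rule has_real_derivative_powr)
  have mvt: "\<exists>t. a < t \<and> t < b \<and> b powr r - a powr r = (b - a) * (r * t powr (r - 1))" if ab: "0 \<le> a" "a < b" for a b :: real
  proof -
    have "(\<lambda>t. t powr r) differentiable (at t)" if "a < t" "t < b" for t
      using der[of t] that ab by (auto simp: real_differentiable_def)
    from MVT[OF ab(2) cont[OF ab(1)] this] obtain l t
      where t: "a < t" "t < b" "DERIV (\<lambda>t. t powr r) t :> l" "b powr r - a powr r = (b - a) * l" by blast
    have "l = r * t powr (r - 1)" using DERIV_unique[OF t(3) der] t ab by simp
    then show ?thesis using t by blast
  qed
  obtain s where s: "x < s" "s < z" "z powr r - x powr r = (z - x) * (r * s powr (r - 1))" using mvt[OF xy(1) z(1)] by blast
  obtain t where t: "z < t" "t < y" "y powr r - z powr r = (y - z) * (r * t powr (r - 1))" using mvt[OF _ z(2)] xy z by force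
  have "s powr (r - 1) < t powr (r - 1)" using s t xy r by (intro powr_less_mono2) auto
  then have "(z - x) * (r * s powr (r - 1)) < (y - z) * (r * t powr (r - 1))"
    unfolding z(3) using r z(1) by (intro mult_strict_left_mono) auto
  then have "z powr r - x powr r < y powr r - z powr r" using s t by simp
  then show ?thesis by (simp add: z_def)
qed

lemma norm_powr_midpoint_strict:
  fixes a b :: "'a::real_inner"
  assumes r: "r > 1" and ab: "a \<noteq> b"
  shows "norm ((1/2) *\<^sub>R (a + b)) powr r < (norm a powr r + norm b powr r) / 2"
proof -
  have tri: "norm ((1/2) *\<^sub>R (a + b)) \<le> (norm a + norm b) / 2" using norm_triangle_ineq[of a b] by simp
  have mono: "norm ((1/2) *\<^sub>R (a + b)) powr r \<le> ((norm a + norm b) / 2) powr r"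
    using tri r by (intro powr_mono2) auto
  show ?thesis
  proof (cases "norm a = norm b")
    case False
    then consider "norm a < norm b" | "norm b < norm a" by linarith
    then have "((norm a + norm b) / 2) powr r < (norm a powr r + norm b powr r) / 2"
    proof cases
      case 1 then show ?thesis using powr_midpoint_strict[OF r norm_ge_zero] by simp
    next
      case 2 then show ?thesis using powr_midpoint_strict[OF r norm_ge_zero] by (simp add: add.commute)
    qed
    then show ?thesis using mono by simp
  next
    case True
    have "norm (a + b) \<noteq> norm a + norm b"
    proof
      assume "norm (a + b) = norm a + norm b"
      then have "norm a *\<^sub>R b = norm b *\<^sub>R a" by (simp add: norm_triangle_eq)
      then show False using True ab by (cases "norm b = 0") auto
    qed
    then have "norm ((1/2) *\<^sub>R (a + b)) < norm b" using norm_triangle_ineq[of a b] True by simp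
    then have "norm ((1/2) *\<^sub>R (a + b)) powr r < norm b powr r" using r by (intro powr_less_mono2) auto
    then show ?thesis using True by simp
  qed
qed

text \<open>By homogeneity it suffices to consider the compact set of pairs with larger norm
  \<open>1\<close>, on which the strict midpoint inequality has a positive minimal gap.\<close>

lemma norm_powr_uniform_midpoint:
  fixes \<epsilon> r :: real
  assumes r: "r > 1" and \<epsilon>: "\<epsilon> > 0"
  obtains \<delta> where "0 < \<delta>" "\<delta> \<le> 1"
    "\<And>a b :: 'a::euclidean_space. norm (a - b) \<ge> \<epsilon> * max (norm a) (norm b) \<Longrightarrow>
      norm ((1/2) *\<^sub>R (a + b)) powr r \<le> (1 - \<delta>) * ((norm a powr r + norm b powr r) / 2)"
proof -
  define C where "C = {z :: 'a \<times> 'a. max (norm (fst z)) (norm (snd z)) = 1 \<and> norm (fst z - snd z) \<ge> \<epsilon>}"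
  define f where "f z = (norm (fst z) powr r + norm (snd z) powr r) / 2 - norm ((1/2) *\<^sub>R (fst z + snd z)) powr r" for z :: "'a \<times> 'a"
  have "closed C"
    unfolding C_def by (intro closed_Collect_conj closed_Collect_eq closed_Collect_le continuous_intros)
  moreover have "bounded C"
  proof (rule bounded_subset)
    show "bounded (cball (0::'a) 1 \<times> cball (0::'a) 1)" by (intro bounded_Times bounded_cball)
    show "C \<subseteq> cball 0 1 \<times> cball 0 1" by (auto simp: C_def)
  qed
  ultimately have C: "compact C" by (simp add: compact_eq_bounded_closed)
  have fpos: "f z > 0" if "z \<in> C" for z
  proof -
    have "fst z \<noteq> snd z" using that \<epsilon> by (auto simp: C_def)
    then show ?thesis using norm_powr_midpoint_strict[OF r] by (simp add: f_def)
  qed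
  have fc: "continuous_on C f"
    unfolding f_def using r by (intro continuous_intros continuous_on_powr') (auto intro!: continuous_intros)
  obtain \<delta> where \<delta>: "0 < \<delta>" "\<And>z. z \<in> C \<Longrightarrow> \<delta> \<le> f z"
  proof (cases "C = {}")
    case True
    then show ?thesis using that[of 1] by auto
  next
    case False
    obtain z where "z \<in> C" "\<forall>y\<in>C. f z \<le> f y" using continuous_attains_inf[OF C False fc] by blast
    then show ?thesis using that[of "f z"] fpos by auto
  qed
  \<comment> \<open>Multiplying by the mean, which is at most \<open>1\<close> on \<open>C\<close>, turns the additive gap into a factor.\<close>
  define \<delta>' where "\<delta>' = min 1 \<delta>"
  have \<delta>': "0 < \<delta>'" "\<delta>' \<le> 1" "\<delta>' \<le> \<delta>" using \<delta> by (auto simp: \<delta>'_def)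
  show ?thesis
  proof (rule that[OF \<delta>'(1,2)])
    fix a b :: 'a assume ab: "norm (a - b) \<ge> \<epsilon> * max (norm a) (norm b)"
    define M where "M = max (norm a) (norm b)"
    show "norm ((1/2) *\<^sub>R (a + b)) powr r \<le> (1 - \<delta>') * ((norm a powr r + norm b powr r) / 2)"
    proof (cases "M = 0")
      case True
      have "norm a \<le> M" "norm b \<le> M" by (auto simp: M_def)
      then have "a = 0" "b = 0" using True by auto
      then show ?thesis by simp
    next
      case False
      have "M \<ge> 0" unfolding M_def by (simp add: le_max_iff_disj)
      then have M: "M > 0" using False by simp
      define z where "z = ((1 / M) *\<^sub>R a, (1 / M) *\<^sub>R b)"
      have na: "norm ((1 / M) *\<^sub>R a) = norm a / M" "norm ((1 / M) *\<^sub>R b) = norm b / M" using M by auto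
      have "max (norm a / M) (norm b / M) = 1" using M by (auto simp: M_def max_def)
      moreover have "(1 / M) *\<^sub>R a - (1 / M) *\<^sub>R b = (1 / M) *\<^sub>R (a - b)" by (simp add: scaleR_diff_right)
      then have "norm ((1 / M) *\<^sub>R a - (1 / M) *\<^sub>R b) = norm (a - b) / M" using M by simp
      moreover have "norm (a - b) / M \<ge> \<epsilon>" using ab M by (simp add: M_def[symmetric] field_simps)
      ultimately have zC: "z \<in> C" using M by (simp add: C_def z_def)
      have half: "(1/2) *\<^sub>R ((1 / M) *\<^sub>R a + (1 / M) *\<^sub>R b) = (1 / M) *\<^sub>R ((1/2) *\<^sub>R (a + b))"
        by (simp add: scaleR_add_right mult.commute)
      have nh: "norm ((1/2) *\<^sub>R ((1 / M) *\<^sub>R a + (1 / M) *\<^sub>R b)) = norm ((1/2) *\<^sub>R (a + b)) / M"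
        unfolding half using M by simp
      define A where "A = (norm a powr r + norm b powr r) / 2"
      define B where "B = norm ((1/2) *\<^sub>R (a + b)) powr r"
      have Mr: "M powr r > 0" using M by simp
      have "f z = (A - B) / M powr r"
        unfolding f_def z_def fst_conv snd_conv na nh A_def B_def using M by (simp add: powr_divide field_simps)
      then have "\<delta>' \<le> (A - B) / M powr r" using \<delta>(2)[OF zC] \<delta>'(3) by linarith
      then have "\<delta>' * M powr r \<le> A - B" using Mr by (simp add: field_simps)
      moreover have "A \<le> M powr r"
      proof -
        have "norm a powr r \<le> M powr r" "norm b powr r \<le> M powr r" using r by (auto intro!: powr_mono2 simp: M_def)
        then show ?thesis by (simp add: A_def)
      qed
      then have "\<delta>' * A \<le> \<delta>' * M powr r" using \<delta>' by (intro mult_left_mono) auto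
      ultimately have "B \<le> (1 - \<delta>') * A" by (simp add: algebra_simps)
      then show ?thesis by (simp add: A_def B_def)
    qed
  qed
qed

context young_growth
begin

text \<open>The function \<open>\<Phi>\<close> itself need not be uniformly convex. As
  \<open>\<Phi>(t) / t\<^sup>l\<close> increases, \<open>\<Phi>\<close> is equivalent to
  \<open>\<Psi>(t) = KK(t\<^sup>l)\<close> with \<open>KK\<close> convex: the supremum of the
  hinges \<open>(\<Phi>(s) / s\<^sup>l) (\<tau> - s\<^sup>l)\<^sup>+\<close>. The uniform
  convexity of \<open>|\<cdot>|\<^sup>l\<close> then passes to \<open>\<Psi>(|\<cdot>|)\<close>.
  The inner maximum extends the function monotonically to negative arguments.\<close>

definition KK :: "real \<Rightarrow> real" where
  "KK \<tau> = (SUP s\<in>{0<..}. \<Phi> s / s powr l * max 0 (max 0 \<tau> - s powr l))"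

lemma KK_term:
  assumes s: "s > 0" and \<tau>: "\<tau> \<ge> 0"
  shows "\<Phi> s / s powr l * max 0 (max 0 \<tau> - s powr l) \<le> \<Phi> (\<tau> powr (1 / l))"
proof (cases "s powr l < \<tau>")
  case True
  define t where "t = \<tau> powr (1 / l)"
  have \<tau>0: "\<tau> > 0" using True powr_ge_zero[of s l] by linarith
  have t: "t > 0" "\<tau> = t powr l" using \<tau>0 exponents by (auto simp: t_def powr_powr)
  have "s < t"
  proof (rule ccontr)
    assume "\<not> s < t"
    then have "t powr l \<le> s powr l" using t exponents by (intro powr_mono2) auto
    then show False using True t by simp
  qed
  then have "\<Phi> (s / t * t) \<le> (s / t) powr l * \<Phi> t" using s t by (intro Phi_shrink) auto
  then have "\<Phi> s / s powr l \<le> \<Phi> t / t powr l" using s t by (simp add: powr_divide field_simps)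
  then have "\<Phi> s / s powr l * max 0 (max 0 \<tau> - s powr l) \<le> \<Phi> t / t powr l * t powr l"
    using True \<tau>0 t s Phi_nonneg by (intro mult_mono) (auto simp: max_def)
  also have "\<dots> = \<Phi> t" using t(1) by simp
  finally show ?thesis unfolding t_def .
next
  case False
  then show ?thesis using \<tau> Phi_nonneg by (simp add: max_def)
qed

lemma KK_bdd: "\<tau> \<ge> 0 \<Longrightarrow> bdd_above ((\<lambda>s. \<Phi> s / s powr l * max 0 (max 0 \<tau> - s powr l)) ` {0<..})"
  by (rule bdd_aboveI2[where M="\<Phi> (\<tau> powr (1 / l))"]) (rule KK_term, auto)

lemma KK_upper: "s > 0 \<Longrightarrow> \<tau> \<ge> 0 \<Longrightarrow> \<Phi> s / s powr l * max 0 (max 0 \<tau> - s powr l) \<le> KK \<tau>"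
  unfolding KK_def by (rule cSUP_upper[OF _ KK_bdd]) auto

lemma KK_least: "(\<And>s. s > 0 \<Longrightarrow> \<Phi> s / s powr l * max 0 (max 0 \<tau> - s powr l) \<le> B) \<Longrightarrow> KK \<tau> \<le> B"
  unfolding KK_def by (rule cSUP_least) auto

lemma KK_le: "\<tau> \<ge> 0 \<Longrightarrow> KK \<tau> \<le> \<Phi> (\<tau> powr (1 / l))"
  by (rule KK_least) (rule KK_term)

lemma KK_nonneg: "\<tau> \<ge> 0 \<Longrightarrow> KK \<tau> \<ge> 0"
  by (rule order_trans[OF _ KK_upper[of 1]]) (auto simp: Phi_nonneg)

lemma KK_weight: "\<Phi> s / s powr l \<ge> 0"
  by (simp add: Phi_nonneg)

lemma KK_mono: "mono KK"
proof (rule monoI)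
  fix x y :: real assume xy: "x \<le> y"
  have "KK y = KK (max 0 y)" by (simp add: KK_def)
  moreover have "KK x \<le> KK (max 0 y)"
  proof (rule KK_least)
    fix s :: real assume s: "s > 0"
    have "\<Phi> s / s powr l * max 0 (max 0 x - s powr l) \<le> \<Phi> s / s powr l * max 0 (max 0 (max 0 y) - s powr l)"
      using xy by (intro mult_left_mono KK_weight) auto
    also have "\<dots> \<le> KK (max 0 y)" using s by (intro KK_upper) auto
    finally show "\<Phi> s / s powr l * max 0 (max 0 x - s powr l) \<le> KK (max 0 y)" .
  qed
  ultimately show "KK x \<le> KK y" by simp
qed

lemma KK_shrink:
  assumes "0 \<le> r" "r \<le> 1" "\<tau> \<ge> 0" shows "KK (r * \<tau>) \<le> r * KK \<tau>"
proof (rule KK_least)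
  fix s :: real assume s: "s > 0"
  have "r * s powr l \<le> 1 * s powr l" using assms by (intro mult_right_mono) auto
  then have "r * \<tau> - s powr l \<le> r * (\<tau> - s powr l)" by (simp add: right_diff_distrib)
  also have "\<dots> \<le> r * max 0 (\<tau> - s powr l)" using assms by (intro mult_left_mono) auto
  finally have "max 0 (r * \<tau> - s powr l) \<le> r * max 0 (\<tau> - s powr l)" using assms by simp
  then have "\<Phi> s / s powr l * max 0 (r * \<tau> - s powr l) \<le> \<Phi> s / s powr l * (r * max 0 (\<tau> - s powr l))"
    by (intro mult_left_mono KK_weight)
  also have "\<dots> = r * (\<Phi> s / s powr l * max 0 (max 0 \<tau> - s powr l))" using assms by simp
  also have "\<dots> \<le> r * KK \<tau>" using assms s by (intro mult_left_mono KK_upper) auto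
  finally show "\<Phi> s / s powr l * max 0 (max 0 (r * \<tau>) - s powr l) \<le> r * KK \<tau>" using assms by simp
qed

lemma KK_midpoint:
  assumes "x \<ge> 0" "y \<ge> 0" shows "KK ((x + y) / 2) \<le> (KK x + KK y) / 2"
proof (rule KK_least)
  fix s :: real assume s: "s > 0"
  have "max 0 (max 0 ((x + y) / 2) - s powr l) \<le> (max 0 (max 0 x - s powr l) + max 0 (max 0 y - s powr l)) / 2"
    using assms by (auto simp: max_def field_simps)
  then have "\<Phi> s / s powr l * max 0 (max 0 ((x + y) / 2) - s powr l)
      \<le> \<Phi> s / s powr l * ((max 0 (max 0 x - s powr l) + max 0 (max 0 y - s powr l)) / 2)"
    by (intro mult_left_mono KK_weight)
  also have "\<dots> = (\<Phi> s / s powr l * max 0 (max 0 x - s powr l) + \<Phi> s / s powr l * max 0 (max 0 y - s powr l)) / 2"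
    by (simp add: ring_distribs)
  also have "\<dots> \<le> (KK x + KK y) / 2" using KK_upper[OF s assms(1)] KK_upper[OF s assms(2)]
    by (intro divide_right_mono add_mono) auto
  finally show "\<Phi> s / s powr l * max 0 (max 0 ((x + y) / 2) - s powr l) \<le> (KK x + KK y) / 2" .
qed

definition \<Psi> :: "real \<Rightarrow> real" where "\<Psi> t = KK (t powr l)"

lemma \<Psi>_nonneg: "\<Psi> t \<ge> 0" by (simp add: \<Psi>_def KK_nonneg)

lemma \<Psi>_le: "t \<ge> 0 \<Longrightarrow> \<Psi> t \<le> \<Phi> t"
  using KK_le[of "t powr l"] exponents by (simp add: \<Psi>_def powr_powr)

text \<open>The hinge with \<open>s\<^sup>l = t\<^sup>l / 2\<close> is already large
  enough.\<close>

lemma \<Psi>_ge: "t \<ge> 0 \<Longrightarrow> (1/2) powr m * \<Phi> t \<le> \<Psi> t"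
proof (cases "t = 0")
  case True
  then show ?thesis using \<Psi>_nonneg by simp
next
  case False
  assume "t \<ge> 0"
  then have t: "t > 0" using False by simp
  define s where "s = (1/2) powr (1 / l) * t"
  have sl: "s powr l = t powr l / 2" "s > 0" using t exponents by (auto simp: s_def powr_mult powr_powr)
  have "(1/2) powr m * \<Phi> t \<le> \<Phi> (1/2 * t)" by (rule Phi_shrink) auto
  also have "\<dots> \<le> \<Phi> s"
  proof (rule Phi_mono)
    have "(1/2::real) powr 1 \<le> (1/2) powr (1 / l)" using exponents by (intro powr_mono') auto
    then show "1/2 * t \<le> s" using t by (simp add: s_def)
  qed (use t in simp)
  also have "\<dots> = \<Phi> s / s powr l * max 0 (max 0 (t powr l) - s powr l)"
    using t unfolding sl(1) by (simp add: max_def)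
  also have "\<dots> \<le> \<Psi> t" unfolding \<Psi>_def using sl by (intro KK_upper) auto
  finally show ?thesis .
qed

lemma \<Psi>_measurable[measurable]: "\<Psi> \<in> borel_measurable borel"
proof -
  have [measurable]: "KK \<in> borel_measurable borel" by (rule borel_measurable_mono[OF KK_mono])
  show ?thesis unfolding \<Psi>_def[abs_def] by measurable
qed

definition gap :: "'a::real_normed_vector \<Rightarrow> 'a \<Rightarrow> real" where
  "gap a b = (\<Psi> (norm a) + \<Psi> (norm b)) / 2 - \<Psi> (norm ((1/2) *\<^sub>R (a + b)))"

lemma gap_nonneg: "gap (a :: 'a::real_inner) b \<ge> 0"
proof -
  have "norm ((1/2) *\<^sub>R (a + b)) powr l \<le> (norm a powr l + norm b powr l) / 2"
    using norm_powr_midpoint_strict[OF exponents(1), of a b] by (cases "a = b") (auto simp: scaleR_2[symmetric])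
  then have "\<Psi> (norm ((1/2) *\<^sub>R (a + b))) \<le> KK ((norm a powr l + norm b powr l) / 2)"
    unfolding \<Psi>_def by (rule monoD[OF KK_mono])
  also have "\<dots> \<le> (\<Psi> (norm a) + \<Psi> (norm b)) / 2" unfolding \<Psi>_def by (rule KK_midpoint) auto
  finally show ?thesis by (simp add: gap_def)
qed

text \<open>If \<open>a - b\<close> is small compared with \<open>a\<close> and
  \<open>b\<close>, the second term suffices. Otherwise the midpoint loses a fixed fraction of the
  mean of \<open>\<Psi>\<close>, which is therefore bounded by a multiple of the gap.\<close>

lemma Phi_diff_le_gap:
  assumes \<eta>: "0 < \<eta>" "\<eta> \<le> 1"
  obtains C where "C \<ge> 0" "\<And>a b :: 'a::euclidean_space. \<Phi> (norm (a - b)) \<le> C * gap a b + \<eta> * (\<Phi> (norm a) + \<Phi> (norm b))"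
proof -
  obtain \<delta> where \<delta>: "0 < \<delta>" "\<delta> \<le> 1"
    "\<And>a b :: 'a. norm (a - b) \<ge> \<eta> * max (norm a) (norm b) \<Longrightarrow>
      norm ((1/2) *\<^sub>R (a + b)) powr l \<le> (1 - \<delta>) * ((norm a powr l + norm b powr l) / 2)"
    using norm_powr_uniform_midpoint[OF exponents(1) \<eta>(1), where 'a='a] by metis
  define C where "C = 2 powr m * (2 * 2 powr m / \<delta>)"
  have C: "C \<ge> 0" using \<delta> by (simp add: C_def)
  show ?thesis
  proof (rule that[OF C])
    fix a b :: 'a
    let ?N = "max (norm a) (norm b)"
    have sum0: "0 \<le> \<Phi> (norm a) + \<Phi> (norm b)" by (simp add: Phi_nonneg)
    show "\<Phi> (norm (a - b)) \<le> C * gap a b + \<eta> * (\<Phi> (norm a) + \<Phi> (norm b))"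
    proof (cases "norm (a - b) \<ge> \<eta> * ?N")
      case False
      then have "\<Phi> (norm (a - b)) \<le> \<Phi> (\<eta> * ?N)" by (intro Phi_mono) auto
      also have "\<dots> \<le> \<eta> * \<Phi> ?N" using \<eta> by (intro Phi_shrink_linear) auto
      also have "\<dots> \<le> \<eta> * (\<Phi> (norm a) + \<Phi> (norm b))"
        using \<eta> Phi_nonneg by (intro mult_left_mono) (auto simp: max_def)
      also have "\<dots> \<le> C * gap a b + \<eta> * (\<Phi> (norm a) + \<Phi> (norm b))" using C gap_nonneg[of a b] by simp
      finally show ?thesis .
    next
      case True
      let ?A = "(norm a powr l + norm b powr l) / 2"
      have "\<Psi> (norm ((1/2) *\<^sub>R (a + b))) \<le> KK ((1 - \<delta>) * ?A)"
        unfolding \<Psi>_def by (rule monoD[OF KK_mono \<delta>(3)[OF True]])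
      also have "\<dots> \<le> (1 - \<delta>) * KK ?A" using \<delta> by (intro KK_shrink) auto
      also have "\<dots> \<le> (1 - \<delta>) * ((\<Psi> (norm a) + \<Psi> (norm b)) / 2)"
        using \<delta> unfolding \<Psi>_def by (intro mult_left_mono KK_midpoint) auto
      finally have "\<Psi> (norm ((1/2) *\<^sub>R (a + b))) \<le> (1 - \<delta>) * ((\<Psi> (norm a) + \<Psi> (norm b)) / 2)" .
      then have "\<delta> * ((\<Psi> (norm a) + \<Psi> (norm b)) / 2) \<le> gap a b"
        unfolding gap_def left_diff_distrib mult_1 by linarith
      moreover have "(1/2) powr m * (\<Phi> (norm a) + \<Phi> (norm b)) \<le> \<Psi> (norm a) + \<Psi> (norm b)"
        using \<Psi>_ge[of "norm a"] \<Psi>_ge[of "norm b"] by (simp add: distrib_left)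
      then have "\<delta> * (((1/2) powr m * (\<Phi> (norm a) + \<Phi> (norm b))) / 2) \<le> \<delta> * ((\<Psi> (norm a) + \<Psi> (norm b)) / 2)"
        using \<delta> by (intro mult_left_mono) auto
      ultimately have "\<delta> * (((1/2) powr m * (\<Phi> (norm a) + \<Phi> (norm b))) / 2) \<le> gap a b" by simp
      then have "\<Phi> (norm a) + \<Phi> (norm b) \<le> 2 * 2 powr m / \<delta> * gap a b"
        using \<delta> by (simp add: powr_divide field_simps)
      then have "2 powr m * (\<Phi> (norm a) + \<Phi> (norm b)) \<le> 2 powr m * (2 * 2 powr m / \<delta> * gap a b)" by (intro mult_left_mono) auto
      moreover have "\<Phi> (norm (a - b)) \<le> 2 powr m * (\<Phi> (norm a) + \<Phi> (norm b))"
        using Phi_norm_add[of a "- b"] by simp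
      ultimately have "\<Phi> (norm (a - b)) \<le> C * gap a b" by (simp add: C_def mult.assoc)
      moreover have "0 \<le> \<eta> * (\<Phi> (norm a) + \<Phi> (norm b))" using \<eta> sum0 by simp
      ultimately show ?thesis by simp
    qed
  qed
qed

end

section \<open>Limits of gradients through midpoints\<close>

text \<open>Iterated midpoints of members of a sequence from index \<open>n0\<close> on, taken
  simultaneously for the functions and for their gradients. They replace the convex combinations
  in Mazur's lemma.\<close>

inductive mid :: "(nat \<Rightarrow> 'a \<Rightarrow> real) \<Rightarrow> (nat \<Rightarrow> 'a \<Rightarrow> 'b::real_vector) \<Rightarrow> nat \<Rightarrow> ('a \<Rightarrow> real) \<Rightarrow> ('a \<Rightarrow> 'b) \<Rightarrow> bool"
  for u g n0 where
  mid_base: "n \<ge> n0 \<Longrightarrow> mid u g n0 (u n) (g n)"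
| mid_half: "mid u g n0 v h \<Longrightarrow> mid u g n0 v' h' \<Longrightarrow>
    mid u g n0 (\<lambda>x. (1/2) * v x + (1/2) * v' x) (\<lambda>x. (1/2) *\<^sub>R h x + (1/2) *\<^sub>R h' x)"

lemma mid_antimono: "mid u g n0 v h \<Longrightarrow> n1 \<le> n0 \<Longrightarrow> mid u g n1 v h"
proof (induction rule: mid.induct)
  case (mid_base n)
  then show ?case by (intro mid.mid_base) simp
next
  case (mid_half v h v' h')
  then show ?case by (intro mid.mid_half)
qed

context orlicz_sobolev
begin

lemma \<rho>_half:
  assumes [measurable]: "a \<in> borel_measurable M" "b \<in> borel_measurable M"
    and le: "\<And>x. \<bar>w x\<bar> \<le> (1/2) * \<bar>a x\<bar> + (1/2) * \<bar>b x\<bar>" and E: "\<rho> a \<le> E" "\<rho> b \<le> E"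
  shows "\<rho> w \<le> E"
proof -
  have "\<rho> w \<le> (\<integral>\<^sup>+x. ennreal (1/2) * ennreal (\<Phi> (a x)) + ennreal (1/2) * ennreal (\<Phi> (b x)) \<partial>M)"
    unfolding \<rho>_def
  proof (rule nn_integral_mono)
    fix x
    have "\<Phi> (w x) \<le> \<Phi> ((1/2) * \<bar>a x\<bar> + (1/2) * \<bar>b x\<bar>)" using le[of x] by (intro Phi_mono_abs) simp
    also have "\<dots> \<le> (1 - 1/2) * \<Phi> \<bar>a x\<bar> + (1/2) * \<Phi> \<bar>b x\<bar>"
      using convex_onD[OF Phi_convex, of "1/2" "\<bar>a x\<bar>" "\<bar>b x\<bar>"] by simp
    finally have "ennreal (\<Phi> (w x)) \<le> ennreal ((1/2) * \<Phi> (a x) + (1/2) * \<Phi> (b x))"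
      by (intro ennreal_leI) (simp add: Phi_even)
    also have "\<dots> = ennreal ((1/2) * \<Phi> (a x)) + ennreal ((1/2) * \<Phi> (b x))"
      by (intro ennreal_plus) (auto simp: Phi_nonneg)
    also have "\<dots> = ennreal (1/2) * ennreal (\<Phi> (a x)) + ennreal (1/2) * ennreal (\<Phi> (b x))"
      using ennreal_mult[of "1/2" "\<Phi> (a x)"] ennreal_mult[of "1/2" "\<Phi> (b x)"] Phi_nonneg by simp
    finally show "ennreal (\<Phi> (w x)) \<le> \<dots>" .
  qed
  also have "\<dots> = ennreal (1/2) * \<rho> a + ennreal (1/2) * \<rho> b"
  proof -
    have "(\<integral>\<^sup>+x. r * ennreal (\<Phi> (a x)) + r * ennreal (\<Phi> (b x)) \<partial>M) = r * \<rho> a + r * \<rho> b" for r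
      unfolding \<rho>_def by (simp add: nn_integral_add nn_integral_cmult)
    then show ?thesis .
  qed
  also have "\<dots> \<le> ennreal (1/2) * E + ennreal (1/2) * E" using E by (intro add_mono mult_left_mono) auto
  also have "\<dots> = (ennreal (1/2) + ennreal (1/2)) * E" by (rule distrib_right[symmetric])
  also have "ennreal (1/2) + ennreal (1/2) = 1" by (subst ennreal_plus[symmetric]) auto
  finally show ?thesis by simp
qed

lemma mid_W0:
  assumes "mid u g n0 v h" "\<And>n. W0 (u n) (g n)"
  shows "W0 v h"
  using assms(1)
proof (induction rule: mid.induct)
  case (mid_half v h v' h')
  show ?case by (rule W0_linear[OF mid_half(3,4)])
qed (rule assms(2))

lemma mid_gradient_bound:
  assumes "mid u g n0 v h" "\<And>n. W0 (u n) (g n)" "\<And>n. n \<ge> n0 \<Longrightarrow> \<rho> (\<lambda>x. norm (g n x)) \<le> E"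
  shows "\<rho> (\<lambda>x. norm (h x)) \<le> E"
  using assms(1)
proof (induction rule: mid.induct)
  case (mid_half v h v' h')
  note [measurable] = W0_measurable(2)[OF mid_W0[OF mid_half(1) assms(2)]] W0_measurable(2)[OF mid_W0[OF mid_half(2) assms(2)]]
  show ?case
  proof (rule \<rho>_half[OF _ _ _ mid_half(3,4)])
    show "\<bar>norm ((1/2) *\<^sub>R h x + (1/2) *\<^sub>R h' x)\<bar> \<le> (1/2) * \<bar>norm (h x)\<bar> + (1/2) * \<bar>norm (h' x)\<bar>" for x
      using norm_triangle_ineq[of "(1/2) *\<^sub>R h x" "(1/2) *\<^sub>R h' x"] by simp
  qed measurable
qed (use assms in auto)

lemma mid_function_bound:
  assumes "mid u g n0 v h" "\<And>n. W0 (u n) (g n)" "w \<in> borel_measurable M"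
    "\<And>n. n \<ge> n0 \<Longrightarrow> \<rho> (\<lambda>x. u n x - w x) \<le> E"
  shows "\<rho> (\<lambda>x. v x - w x) \<le> E"
  using assms(1)
proof (induction rule: mid.induct)
  case (mid_half v h v' h')
  note [measurable] = W0_measurable(1)[OF mid_W0[OF mid_half(1) assms(2)]] W0_measurable(1)[OF mid_W0[OF mid_half(2) assms(2)]] assms(3)
  show ?case
  proof (rule \<rho>_half[OF _ _ _ mid_half(3,4)])
    fix x
    have "(1/2) * v x + (1/2) * v' x - w x = (1/2) * (v x - w x) + (1/2) * (v' x - w x)" by (simp add: field_simps)
    then show "\<bar>(1/2) * v x + (1/2) * v' x - w x\<bar> \<le> (1/2) * \<bar>v x - w x\<bar> + (1/2) * \<bar>v' x - w x\<bar>"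
      using abs_triangle_ineq[of "(1/2) * (v x - w x)" "(1/2) * (v' x - w x)"] by (simp add: abs_mult)
  qed measurable
qed (use assms in auto)

definition JJ :: "(real^'n \<Rightarrow> real^'n) \<Rightarrow> real" where
  "JJ h = (\<integral>x. \<Psi> (norm (h x)) \<partial>M)"

lemma integrable_Phi:
  assumes [measurable]: "u \<in> borel_measurable M" and "\<rho> u < \<infinity>"
  shows "integrable M (\<lambda>x. \<Phi> (u x))"
  using assms by (intro integrableI_bounded) (auto simp: \<rho>_def Phi_nonneg)

lemma integrable_\<Psi>:
  assumes [measurable]: "h \<in> borel_measurable M" and fin: "\<rho> (\<lambda>x. norm (h x)) < \<infinity>"
  shows "integrable M (\<lambda>x. \<Psi> (norm (h x)))"
  by (rule Bochner_Integration.integrable_bound[OF integrable_Phi[OF _ fin]])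
     (auto simp: \<Psi>_nonneg Phi_nonneg \<Psi>_le)

lemma \<rho>_eq_integral:
  assumes [measurable]: "u \<in> borel_measurable M" and fin: "\<rho> u < \<infinity>"
  shows "\<rho> u = ennreal (\<integral>x. \<Phi> (u x) \<partial>M)"
  unfolding \<rho>_def by (rule nn_integral_eq_integral[OF integrable_Phi[OF assms]]) (auto simp: Phi_nonneg)

lemma Cauchy_diff_small:
  fixes d :: "nat \<Rightarrow> real"
  assumes mono: "\<And>i j. i \<le> j \<Longrightarrow> d i \<le> d j" and bd: "\<And>i. d i \<le> B" and e: "e > 0"
  shows "\<exists>K. \<forall>i\<ge>K. \<forall>j\<ge>i. d j - d i \<le> e"
proof -
  have "bdd_above (range d)" using bd by (auto intro!: bdd_aboveI)
  then have "d \<longlonglongrightarrow> (SUP i. d i)" using mono by (intro LIMSEQ_incseq_SUP) (auto simp: incseq_def)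
  then have "Cauchy d" by (rule LIMSEQ_imp_Cauchy)
  from CauchyD[OF this e] obtain K where K: "\<And>i j. i \<ge> K \<Longrightarrow> j \<ge> K \<Longrightarrow> norm (d i - d j) < e" by blast
  have "d j - d i \<le> e" if "i \<ge> K" "j \<ge> i" for i j using K[of j i] that by auto
  then show ?thesis by blast
qed

text \<open>Take midpoints of the tails whose \<open>\<Psi>\<close>-energy \<open>JJ\<close> is
  close to the infimum \<open>d\<^sub>n\<close> over that tail. The numbers
  \<open>d\<^sub>n\<close> increase and are bounded. The midpoint of two selected gradients still
  competes in the earlier tail, so their integrated gap is at most about
  \<open>(d\<^sub>j - d\<^sub>i) / 2\<close>, and a small gap forces a small distance.\<close>

theorem mazur:
  assumes W: "\<And>n::nat. W0 (u n) (g n)" and D: "\<And>n. \<rho> (\<lambda>x. norm (g n x)) \<le> ennreal D" "D \<ge> 0"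
  obtains v h where "\<And>n. mid u g n (v n) (h n)"
    "\<And>e. e > 0 \<Longrightarrow> \<exists>K. \<forall>i\<ge>K. \<forall>j\<ge>i. \<rho> (\<lambda>x. norm (h i x - h j x)) \<le> ennreal e"
proof -
  define X where "X n = {JJ h | v h. mid u g n v h}" for n
  define d where "d n = Inf (X n)" for n
  have nonempty: "X n \<noteq> {}" for n using mid_base[of n n u g] by (auto simp: X_def)
  have fin: "\<rho> (\<lambda>x. norm (h x)) \<le> ennreal D" if "mid u g n v h" for n v h
    by (rule mid_gradient_bound[OF that W D(1)])
  have fin': "\<rho> (\<lambda>x. norm (h x)) < \<infinity>" if "mid u g n v h" for n v h
    using fin[OF that] by (auto elim!: le_less_trans)
  have hm: "h \<in> borel_measurable M" if "mid u g n v h" for n v h by (rule W0_measurable(2)[OF mid_W0[OF that W]])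
  have intPsi: "integrable M (\<lambda>x. \<Psi> (norm (h x)))" if "mid u g n v h" for n v h
    by (rule integrable_\<Psi>[OF hm[OF that] fin'[OF that]])
  have PhiD: "(\<integral>x. \<Phi> (norm (h x)) \<partial>M) \<le> D" if "mid u g n v h" for n v h
  proof -
    note [measurable] = hm[OF that]
    have "ennreal (\<integral>x. \<Phi> (norm (h x)) \<partial>M) \<le> ennreal D"
      using fin[OF that] \<rho>_eq_integral[OF _ fin'[OF that]] by simp
    then show ?thesis using D(2) by (simp add: ennreal_le_iff)
  qed
  have JD: "0 \<le> JJ h" "JJ h \<le> D" if "mid u g n v h" for n v h
  proof -
    note [measurable] = hm[OF that]
    show "0 \<le> JJ h" unfolding JJ_def by (intro integral_nonneg_AE) (auto simp: \<Psi>_nonneg)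
    have "JJ h \<le> (\<integral>x. \<Phi> (norm (h x)) \<partial>M)"
      unfolding JJ_def by (intro integral_mono intPsi[OF that] integrable_Phi fin'[OF that]) (auto simp: \<Psi>_le)
    then show "JJ h \<le> D" using PhiD[OF that] by simp
  qed
  have bdd: "bdd_below (X n)" for n unfolding X_def by (rule bdd_belowI[of _ 0]) (auto dest: JD)
  have d_le: "d n \<le> JJ h" if "mid u g n v h" for n v h
    unfolding d_def by (rule cInf_lower[OF _ bdd]) (use that in \<open>auto simp: X_def\<close>)
  have d_mono: "d i \<le> d j" if "i \<le> j" for i j
    unfolding d_def using that by (intro cInf_superset_mono nonempty bdd) (auto simp: X_def intro: mid_antimono)
  have d_D: "d n \<le> D" for n
    using d_le[OF mid_base[of n n u g]] JD(2)[OF mid_base[of n n u g]] by simp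
  have "\<exists>v h. mid u g n v h \<and> JJ h < d n + 1 / real (Suc n)" for n
  proof -
    have "Inf (X n) < d n + 1 / real (Suc n)" by (simp add: d_def)
    then obtain y where "y \<in> X n" "y < d n + 1 / real (Suc n)" using cInf_lessD[OF nonempty] by blast
    then show ?thesis by (auto simp: X_def)
  qed
  then have "\<forall>n. \<exists>vh. mid u g n (fst vh) (snd vh) \<and> JJ (snd vh) < d n + 1 / real (Suc n)" by simp
  from choice[OF this] obtain vh where vh: "\<And>n. mid u g n (fst (vh n)) (snd (vh n))" "\<And>n. JJ (snd (vh n)) < d n + 1 / real (Suc n)" by blast
  define h where "h n = snd (vh n)" for n
  have mh: "mid u g n (fst (vh n)) (h n)" and Jh: "JJ (h n) < d n + 1 / real (Suc n)" for n using vh by (auto simp: h_def)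
  have hmeas[measurable]: "h n \<in> borel_measurable M" for n by (rule hm[OF mh])
  have gap_int: "integrable M (\<lambda>x. gap (h i x) (h j x))" "(\<integral>x. gap (h i x) (h j x) \<partial>M) \<le> (d j - d i) / 2 + 1 / real (Suc i)" if ij: "i \<le> j" for i j
  proof -
    have mj: "mid u g i (fst (vh j)) (h j)" by (rule mid_antimono[OF mh ij])
    have mm: "mid u g i (\<lambda>x. (1/2) * fst (vh i) x + (1/2) * fst (vh j) x) (\<lambda>x. (1/2) *\<^sub>R h i x + (1/2) *\<^sub>R h j x)"
      by (rule mid_half[OF mh mj])
    have i3: "integrable M (\<lambda>x. \<Psi> (norm ((1/2) *\<^sub>R (h i x + h j x))))"
      using intPsi[OF mm] by (simp add: scaleR_add_right)
    note ints = intPsi[OF mh[of i]] intPsi[OF mh[of j]] i3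
    show "integrable M (\<lambda>x. gap (h i x) (h j x))" unfolding gap_def using ints by simp
    have "(\<integral>x. gap (h i x) (h j x) \<partial>M) = (JJ (h i) + JJ (h j)) / 2 - JJ (\<lambda>x. (1/2) *\<^sub>R h i x + (1/2) *\<^sub>R h j x)"
      unfolding gap_def JJ_def using ints by (simp add: scaleR_add_right)
    also have "\<dots> \<le> ((d i + 1 / real (Suc i)) + (d j + 1 / real (Suc j))) / 2 - d i"
      by (intro diff_mono divide_right_mono add_mono less_imp_le[OF Jh] d_le[OF mm]) simp
    also have "\<dots> \<le> (d j - d i) / 2 + 1 / real (Suc i)"
    proof -
      define p where "p = 1 / real (Suc i)"
      define p' where "p' = 1 / real (Suc j)"
      have "p' \<le> p" unfolding p_def p'_def using ij by (intro divide_left_mono) auto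
      moreover have "(x + r + (y + s)) / 2 - x \<le> (y - x) / 2 + r" if "s \<le> r" for x y r s :: real
        using that by (simp add: field_simps)
      ultimately show ?thesis unfolding p_def p'_def by blast
    qed
    finally show "(\<integral>x. gap (h i x) (h j x) \<partial>M) \<le> (d j - d i) / 2 + 1 / real (Suc i)" .
  qed
  show ?thesis
  proof (rule that[of "\<lambda>n. fst (vh n)" h])
    show "mid u g n (fst (vh n)) (h n)" for n by (rule mh)
    fix e :: real assume e: "e > 0"
    define \<eta> where "\<eta> = min 1 (e / (4 * (D + 1)))"
    have \<eta>: "0 < \<eta>" "\<eta> \<le> 1" using e D by (auto simp: \<eta>_def)
    have \<eta>D: "\<eta> * (2 * D) \<le> e / 2"
    proof -
      have "\<eta> * (2 * D) \<le> e / (4 * (D + 1)) * (2 * D)" using D by (intro mult_right_mono) (auto simp: \<eta>_def)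
      also have "\<dots> \<le> e / 2" using e D by (simp add: field_simps)
      finally show ?thesis .
    qed
    obtain C where C: "C \<ge> 0" "\<And>a b :: real^'n. \<Phi> (norm (a - b)) \<le> C * gap a b + \<eta> * (\<Phi> (norm a) + \<Phi> (norm b))"
      using Phi_diff_le_gap[OF \<eta>, where 'a="real^'n"] by metis
    define e' where "e' = e / (4 * (C + 1))"
    have e': "e' > 0" using e C by (simp add: e'_def)
    have Ce': "C * (2 * e') \<le> e / 2" using e C by (simp add: e'_def field_simps)
    obtain K1 where K1: "\<forall>i\<ge>K1. \<forall>j\<ge>i. d j - d i \<le> e'" using Cauchy_diff_small[of d D, OF d_mono d_D e'] by blast
    obtain K2 where K2: "inverse (real (Suc K2)) < e'" using reals_Archimedean[OF e'] by blast
    have "\<rho> (\<lambda>x. norm (h i x - h j x)) \<le> ennreal e" if ij: "i \<ge> max K1 K2" "j \<ge> i" for i j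
    proof -
      have "1 / real (Suc i) \<le> inverse (real (Suc K2))" using ij by (simp add: field_simps)
      then have "(\<integral>x. gap (h i x) (h j x) \<partial>M) \<le> 2 * e'"
      proof -
        assume *: "1 / real (Suc i) \<le> inverse (real (Suc K2))"
        have "d j - d i \<le> e'" using K1 ij by auto
        moreover have "1 / real (Suc i) \<le> e'" using * K2 by (rule order_trans[OF _ less_imp_le])
        moreover have "t \<le> 2 * z" if "t \<le> x / 2 + y" "x \<le> z" "y \<le> z" "0 < z" for t x y z :: real
        proof -
          have "x / 2 \<le> z / 2" using that(2) by simp
          then have "t \<le> z / 2 + z" using that by (meson add_mono order_trans)
          also have "\<dots> \<le> 2 * z" using that(4) by simp
          finally show ?thesis .
        qed
        ultimately show ?thesis using gap_int(2)[OF ij(2)] e' by blast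
      qed
      then have g1: "C * (\<integral>x. gap (h i x) (h j x) \<partial>M) \<le> e / 2"
        using mult_left_mono[OF _ C(1), of "\<integral>x. gap (h i x) (h j x) \<partial>M" "2 * e'"] Ce' by simp
      have iP: "integrable M (\<lambda>x. \<Phi> (norm (h i x)))" "integrable M (\<lambda>x. \<Phi> (norm (h j x)))"
        by (intro integrable_Phi fin'[OF mh], measurable)+
      have g2: "\<eta> * ((\<integral>x. \<Phi> (norm (h i x)) \<partial>M) + (\<integral>x. \<Phi> (norm (h j x)) \<partial>M)) \<le> e / 2"
      proof -
        have "\<eta> * ((\<integral>x. \<Phi> (norm (h i x)) \<partial>M) + (\<integral>x. \<Phi> (norm (h j x)) \<partial>M)) \<le> \<eta> * (2 * D)"
          using PhiD[OF mh[of i]] PhiD[OF mh[of j]] \<eta> by (intro mult_left_mono) auto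
        then show ?thesis using \<eta>D by simp
      qed
      have ib: "integrable M (\<lambda>x. C * gap (h i x) (h j x) + \<eta> * (\<Phi> (norm (h i x)) + \<Phi> (norm (h j x))))"
        using gap_int(1)[OF ij(2)] iP by simp
      have "\<rho> (\<lambda>x. norm (h i x - h j x)) \<le> (\<integral>\<^sup>+x. ennreal (C * gap (h i x) (h j x) + \<eta> * (\<Phi> (norm (h i x)) + \<Phi> (norm (h j x)))) \<partial>M)"
        unfolding \<rho>_def by (intro nn_integral_mono ennreal_leI C(2))
      also have "\<dots> = ennreal (\<integral>x. C * gap (h i x) (h j x) + \<eta> * (\<Phi> (norm (h i x)) + \<Phi> (norm (h j x))) \<partial>M)"
        using C \<eta> by (intro nn_integral_eq_integral ib AE_I2 add_nonneg_nonneg mult_nonneg_nonneg gap_nonneg Phi_nonneg) auto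
      also have "(\<integral>x. C * gap (h i x) (h j x) + \<eta> * (\<Phi> (norm (h i x)) + \<Phi> (norm (h j x))) \<partial>M)
          = C * (\<integral>x. gap (h i x) (h j x) \<partial>M) + \<eta> * ((\<integral>x. \<Phi> (norm (h i x)) \<partial>M) + (\<integral>x. \<Phi> (norm (h j x)) \<partial>M))"
        using gap_int(1)[OF ij(2)] iP by simp
      also have "ennreal \<dots> \<le> ennreal e" using g1 g2 by (intro ennreal_leI) simp
      finally show ?thesis .
    qed
    then show "\<exists>K. \<forall>i\<ge>K. \<forall>j\<ge>i. \<rho> (\<lambda>x. norm (h i x - h j x)) \<le> ennreal e" by blast
  qed
qed

lemma \<rho>_liminf:
  fixes f :: "nat \<Rightarrow> real^'n \<Rightarrow> 'b::{banach, second_countable_topology}"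
  assumes [measurable]: "\<And>n. f n \<in> borel_measurable M" "h \<in> borel_measurable M"
    and lim: "AE x in M. (\<lambda>n. f n x) \<longlonglongrightarrow> h x" and le: "\<And>n. n \<ge> K \<Longrightarrow> \<rho> (\<lambda>x. norm (f n x)) \<le> E"
  shows "\<rho> (\<lambda>x. norm (h x)) \<le> E"
proof -
  have "\<rho> (\<lambda>x. norm (h x)) = (\<integral>\<^sup>+x. liminf (\<lambda>n. ennreal (\<Phi> (norm (f n x)))) \<partial>M)"
    unfolding \<rho>_def
  proof (rule nn_integral_cong_AE, use lim in eventually_elim)
    fix x assume "(\<lambda>n. f n x) \<longlonglongrightarrow> h x"
    then have "(\<lambda>n. norm (f n x)) \<longlonglongrightarrow> norm (h x)" by (intro tendsto_intros)
    then have "(\<lambda>n. ennreal (\<Phi> (norm (f n x)))) \<longlonglongrightarrow> ennreal (\<Phi> (norm (h x)))"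
      by (intro tendsto_ennrealI continuous_on_tendsto_compose[OF Phi_cont]) auto
    then show "ennreal (\<Phi> (norm (h x))) = liminf (\<lambda>n. ennreal (\<Phi> (norm (f n x))))" by (simp add: lim_imp_Liminf)
  qed
  also have "\<dots> \<le> liminf (\<lambda>n. \<rho> (\<lambda>x. norm (f n x)))" unfolding \<rho>_def by (rule nn_integral_liminf) measurable
  also have "\<dots> \<le> E" by (rule Liminf_le) (auto simp: eventually_sequentially intro: le)
  finally show ?thesis .
qed

text \<open>The gradients along a modularly convergent subsequence need not converge, but
  midpoints of their tails do by \<open>mazur\<close>. Midpoints of the functions have the same
  limit \<open>v\<close> as the functions, and convexity gives midpoints no larger modular than
  the sequence has, which is the last claim.\<close>

theorem W0_compact:
  assumes W: "\<And>n::nat. W0 (u n) (g n)" and D: "\<And>n. \<rho> (\<lambda>x. norm (g n x)) \<le> ennreal D" "D \<ge> 0"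
  obtains r v h where "strict_mono (r :: nat \<Rightarrow> nat)" "W0 v h"
    "AE x in M. (\<lambda>n. u (r n) x) \<longlonglongrightarrow> v x"
    "\<And>e. e > 0 \<Longrightarrow> \<exists>K. \<forall>n\<ge>K. \<rho> (\<lambda>x. u (r n) x - v x) \<le> ennreal e"
    "\<And>E K. (\<And>n. n \<ge> K \<Longrightarrow> \<rho> (\<lambda>x. norm (g (r n) x)) \<le> E) \<Longrightarrow> \<rho> (\<lambda>x. norm (h x)) \<le> E"
proof -
  obtain r v where r: "strict_mono (r :: nat \<Rightarrow> nat)" and vm[measurable]: "v \<in> borel_measurable M"
    and ae: "AE x in M. (\<lambda>n. u (r n) x) \<longlonglongrightarrow> v x"
    and vr: "\<And>e. e > 0 \<Longrightarrow> \<exists>K. \<forall>n\<ge>K. \<rho> (\<lambda>x. u (r n) x - v x) \<le> ennreal e"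
    by (rule W0_compact_\<rho>[OF W D]) (rule that)
  define u' where "u' n = u (r n)" for n
  define g' where "g' n = g (r n)" for n
  have W': "W0 (u' n) (g' n)" for n unfolding u'_def g'_def by (rule W)
  have D': "\<rho> (\<lambda>x. norm (g' n x)) \<le> ennreal D" for n unfolding g'_def by (rule D)
  obtain w h where mid: "\<And>n. mid u' g' n (w n) (h n)"
    and hc: "\<And>e. e > 0 \<Longrightarrow> \<exists>K. \<forall>i\<ge>K. \<forall>j\<ge>i. \<rho> (\<lambda>x. norm (h i x - h j x)) \<le> ennreal e"
    by (rule mazur[OF W' D' D(2)]) (rule that)
  have Wwh: "W0 (w n) (h n)" for n by (rule mid_W0[OF mid W'])
  have hm[measurable]: "h n \<in> borel_measurable M" for n by (rule W0_measurable(2)[OF Wwh])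
  have "\<rho> (\<lambda>x. norm (h n x)) < \<infinity>" for n by (rule W0_finite(2)[OF Wwh])
  then have "integrable M (\<lambda>x. norm (h n x))" for n by (intro integrable_if_\<rho>_finite) measurable
  then have ih: "integrable M (h n)" for n by (subst integrable_norm_iff[symmetric]) auto
  obtain H s where Hm[measurable]: "H \<in> borel_measurable M" and s: "strict_mono (s :: nat \<Rightarrow> nat)"
    and Hae: "AE x in M. (\<lambda>n. h (s n) x) \<longlonglongrightarrow> H x"
    and Hr: "\<And>e. e > 0 \<Longrightarrow> \<exists>K. \<forall>n\<ge>K. \<rho> (\<lambda>x. norm (h n x - H x)) \<le> ennreal e"
    by (rule \<rho>_complete[OF ih hc]) (assumption, rule that)
  show ?thesis
  proof (rule that[OF r _ ae vr])
    show "W0 v H"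
    proof (rule W0_closed)
      fix e :: real assume e: "e > 0"
      obtain K1 where K1: "\<forall>n\<ge>K1. \<rho> (\<lambda>x. u (r n) x - v x) \<le> ennreal e" using vr[OF e] by blast
      obtain K2 where K2: "\<forall>n\<ge>K2. \<rho> (\<lambda>x. norm (h n x - H x)) \<le> ennreal e" using Hr[OF e] by blast
      define n where "n = max K1 K2"
      have "\<rho> (\<lambda>x. w n x - v x) \<le> ennreal e"
        by (rule mid_function_bound[OF mid W' vm]) (use K1 in \<open>auto simp: n_def u'_def\<close>)
      moreover have "\<rho> (\<lambda>x. norm (h n x - H x)) \<le> ennreal e" using K2 by (simp add: n_def)
      ultimately have "W0 (w n) (h n) \<and> \<rho> (\<lambda>x. v x - w n x) \<le> ennreal e \<and> \<rho> (\<lambda>x. norm (H x - h n x)) \<le> ennreal e"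
        using Wwh[of n] \<rho>_abs[of "\<lambda>x. w n x - v x"] \<rho>_abs[of "\<lambda>x. v x - w n x"] by (simp add: abs_minus_commute norm_minus_commute)
      then show "\<exists>v' k. W0 v' k \<and> \<rho> (\<lambda>x. v x - v' x) \<le> ennreal e \<and> \<rho> (\<lambda>x. norm (H x - k x)) \<le> ennreal e" by blast
    qed measurable
    fix E K assume E: "\<And>n. n \<ge> K \<Longrightarrow> \<rho> (\<lambda>x. norm (g (r n) x)) \<le> E"
    show "\<rho> (\<lambda>x. norm (H x)) \<le> E"
    proof (rule \<rho>_liminf[OF _ Hm Hae])
      fix n assume n: "n \<ge> K"
      show "\<rho> (\<lambda>x. norm (h (s n) x)) \<le> E"
      proof (rule mid_gradient_bound[OF mid W'])
        fix i assume "i \<ge> s n"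
        then have "i \<ge> K" using n seq_suble[OF s, of n] by simp
        then show "\<rho> (\<lambda>x. norm (g' i x)) \<le> E" unfolding g'_def by (rule E)
      qed
    qed measurable
  qed
qed

end

section \<open>The nonlinear terms\<close>

lemma measurable_if_AE_eq_lebesgue_on:
  fixes f g :: "'a::euclidean_space \<Rightarrow> real"
  assumes \<Omega>: "\<Omega> \<in> sets lebesgue" and g: "g \<in> borel_measurable (lebesgue_on \<Omega>)"
    and eq: "AE x in lebesgue_on \<Omega>. f x = g x"
  shows "f \<in> borel_measurable (lebesgue_on \<Omega>)"
proof (rule measurableI)
  fix A :: "real set" assume A: "A \<in> sets borel"
  have "AE x in lebesgue. x \<in> \<Omega> \<longrightarrow> f x = g x"
    using eq \<Omega> by (subst (asm) AE_restrict_space_iff) auto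
  then obtain N where N: "{x. \<not> (x \<in> \<Omega> \<longrightarrow> f x = g x)} \<subseteq> N" "N \<in> null_sets lebesgue"
    unfolding eventually_ae_filter by auto
  have gA: "g -` A \<inter> \<Omega> \<in> sets lebesgue"
    using measurable_sets[OF g A] \<Omega> by (simp add: sets_restrict_space_iff)
  have null: "X \<in> sets lebesgue" if "X \<subseteq> N" for X
    using N(2) that by (meson completion.complete2 null_setsD2)
  have "f -` A \<inter> \<Omega> = (g -` A \<inter> \<Omega> - N) \<union> (f -` A \<inter> \<Omega> \<inter> N)"
    using N(1) by auto
  also have "\<dots> \<in> sets lebesgue"
    by (rule sets.Un[OF sets.Diff[OF gA null_setsD2[OF N(2)]] null]) auto
  finally show "f -` A \<inter> space (lebesgue_on \<Omega>) \<in> sets (lebesgue_on \<Omega>)"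
    using \<Omega> by (simp add: sets_restrict_space_iff)
qed simp

text \<open>Step-function approximation for composing with Caratheodory functions.\<close>

lemma floor_approx_tendsto: "(\<lambda>n. real_of_int \<lfloor>real (Suc n) * s\<rfloor> / real (Suc n)) \<longlonglongrightarrow> s"
proof (rule LIMSEQ_I)
  fix e :: real assume e: "e > 0"
  obtain K where K: "inverse (real (Suc K)) < e" using reals_Archimedean[OF e] by blast
  show "\<exists>no. \<forall>n\<ge>no. norm (real_of_int \<lfloor>real (Suc n) * s\<rfloor> / real (Suc n) - s) < e"
  proof (intro exI allI impI)
    fix n assume n: "n \<ge> K"
    define r where "r = real (Suc n)"
    have r: "r > 0" by (simp add: r_def)
    have "\<bar>real_of_int \<lfloor>r * s\<rfloor> - r * s\<bar> \<le> 1" by linarith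
    then have "\<bar>real_of_int \<lfloor>r * s\<rfloor> - r * s\<bar> / r \<le> 1 / r" using r by (intro divide_right_mono) auto
    moreover have "\<bar>real_of_int \<lfloor>r * s\<rfloor> / r - s\<bar> = \<bar>real_of_int \<lfloor>r * s\<rfloor> - r * s\<bar> / r"
    proof -
      have "real_of_int \<lfloor>r * s\<rfloor> / r - s = (real_of_int \<lfloor>r * s\<rfloor> - r * s) / r" using r by (simp add: field_simps)
      then show ?thesis using r by (simp add: abs_divide)
    qed
    moreover have "1 / r \<le> inverse (real (Suc K))" using n by (simp add: r_def field_simps)
    ultimately have "\<bar>real_of_int \<lfloor>r * s\<rfloor> / r - s\<bar> < e" using K by linarith
    then show "norm (real_of_int \<lfloor>real (Suc n) * s\<rfloor> / real (Suc n) - s) < e" by (simp add: r_def)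
  qed
qed

lemma caratheodory_compose_measurable:
  fixes f :: "'a \<Rightarrow> real \<Rightarrow> real"
  assumes f: "\<And>s. (\<lambda>x. f x s) \<in> borel_measurable M" and u[measurable]: "u \<in> borel_measurable M"
    and cont: "\<And>x. x \<in> space M \<Longrightarrow> continuous_on UNIV (f x)"
  shows "(\<lambda>x. f x (u x)) \<in> borel_measurable M"
proof (rule borel_measurable_LIMSEQ_real)
  show "(\<lambda>x. f x (real_of_int \<lfloor>real (Suc n) * u x\<rfloor> / real (Suc n))) \<in> borel_measurable M" for n
  proof (rule measurable_compose_countable[where f="\<lambda>i x. f x (real_of_int i / real (Suc n))" and g="\<lambda>x. \<lfloor>real (Suc n) * u x\<rfloor>"])
    show "(\<lambda>x. f x (real_of_int i / real (Suc n))) \<in> borel_measurable M" for i :: int by (rule f)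
    show "(\<lambda>x. \<lfloor>real (Suc n) * u x\<rfloor>) \<in> measurable M (count_space UNIV)" by measurable
  qed
  show "(\<lambda>n. f x (real_of_int \<lfloor>real (Suc n) * u x\<rfloor> / real (Suc n))) \<longlonglongrightarrow> f x (u x)" if "x \<in> space M" for x
    by (rule continuous_on_tendsto_compose[OF cont[OF that] floor_approx_tendsto]) auto
qed

locale nonlinear_problem = orlicz_sobolev \<phi> \<Phi> l m \<Omega>
  for \<phi> \<Phi> :: "real \<Rightarrow> real" and l m :: real and \<Omega> :: "(real^'n::finite) set" +
  fixes f F :: "real^'n \<Rightarrow> real \<Rightarrow> real" and a A :: real and b B h :: "real^'n \<Rightarrow> real"
  assumes f_cara: "caratheodory \<Omega> f"
    and F: "\<And>x t. F x t = (LBINT s=0..t. f x s)"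
    and a_nonneg: "a \<ge> 0" and b_dual: "b \<in> orlicz_dual \<Omega> S" and b_nonneg: "AE x in M. b x \<ge> 0"
    and f_growth: "AE x in M. \<forall>s. \<bar>f x s * s\<bar> \<le> a * S s + b x * \<bar>s\<bar>"
    and A_nonneg: "A \<ge> 0" and B_int: "integrable M B" and B_nonneg: "AE x in M. B x \<ge> 0"
    and F_growth: "AE x in M. \<forall>s. F x s \<le> A * \<bar>s\<bar> powr l + B x"
    and h_dual: "h \<in> orlicz_dual \<Omega> \<Phi>"
begin

text \<open>The points at which all hypotheses that hold almost everywhere are valid
  simultaneously.\<close>

definition good :: "real^'n \<Rightarrow> bool" where
  "good x \<longleftrightarrow> continuous_on UNIV (f x) \<and> 0 \<le> b x \<and> 0 \<le> B x \<and>
    (\<forall>s. \<bar>f x s * s\<bar> \<le> a * S s + b x * \<bar>s\<bar>) \<and> (\<forall>s. F x s \<le> A * \<bar>s\<bar> powr l + B x)"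

lemma good_AE: "AE x in M. good x"
proof -
  have "AE x in M. continuous_on UNIV (f x)" using f_cara by (simp add: caratheodory_def)
  then show ?thesis using b_nonneg f_growth B_nonneg F_growth by eventually_elim (simp add: good_def)
qed

lemma F_0[simp]: "F x 0 = 0"
  unfolding F zero_ereal_def by (rule interval_integral_endpoints_same)

lemma F_DERIV:
  assumes "good x" shows "(F x has_real_derivative f x t) (at t)"
proof -
  define r where "r = \<bar>t\<bar> + 1"
  have "((\<lambda>u. LBINT y=0..u. f x y) has_vector_derivative (f x t)) (at t within {-r..r})"
    unfolding zero_ereal_def
    using assms by (intro interval_integral_FTC2) (auto simp: r_def good_def intro: continuous_on_subset)
  then have "((\<lambda>u. F x u) has_real_derivative f x t) (at t within {-r..r})"
    unfolding F by (simp add: has_real_derivative_iff_has_vector_derivative)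
  then have "(F x has_real_derivative f x t) (at t within {-r<..<r})"
    by (rule DERIV_subset) auto
  then show ?thesis by (subst (asm) at_within_open) (auto simp: r_def)
qed

lemma F_cont: "good x \<Longrightarrow> continuous_on UNIV (F x)"
  using F_DERIV by (auto intro!: continuous_at_imp_continuous_on DERIV_isCont)

text \<open>Divide the growth condition by \<open>|s|\<close>, use that \<open>S s / s\<close>
  increases, and obtain the value at \<open>0\<close> by continuity. Dividing matters: an estimate
  for \<open>f(x, s) t\<close> with \<open>s \<noteq> t\<close> is needed later.\<close>

lemma f_bound:
  assumes g: "good x" and s: "\<bar>s\<bar> \<le> w" and w: "w > 0"
  shows "\<bar>f x s\<bar> \<le> a * (S w / w) + b x"
proof -
  have pos: "\<bar>f x s\<bar> \<le> a * (S w / w) + b x" if s: "s \<noteq> 0" "\<bar>s\<bar> \<le> w" for s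
  proof -
    have "\<bar>f x s\<bar> * \<bar>s\<bar> \<le> a * S \<bar>s\<bar> + b x * \<bar>s\<bar>" using g by (auto simp: good_def abs_mult S_even)
    then have "\<bar>f x s\<bar> \<le> a * (S \<bar>s\<bar> / \<bar>s\<bar>) + b x" using s by (simp add: field_simps)
    also have "\<dots> \<le> a * (S w / w) + b x"
      using s a_nonneg by (intro add_right_mono mult_left_mono S_ratio_mono) auto
    finally show ?thesis .
  qed
  show ?thesis
  proof (cases "s = 0")
    case True
    have "(\<lambda>n. \<bar>f x (w / real (Suc n))\<bar>) \<longlonglongrightarrow> \<bar>f x 0\<bar>"
    proof (intro tendsto_rabs continuous_on_tendsto_compose[of UNIV "f x"])
      show "continuous_on UNIV (f x)" using g by (simp add: good_def)
      have "(\<lambda>n. w * (1 / real (Suc n))) \<longlonglongrightarrow> w * 0" by (intro tendsto_intros LIMSEQ_Suc[OF lim_1_over_n])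
      then show "(\<lambda>n. w / real (Suc n)) \<longlonglongrightarrow> 0" by simp
    qed auto
    moreover have "\<bar>f x (w / real (Suc n))\<bar> \<le> a * (S w / w) + b x" for n
      using w by (intro pos) (auto simp: divide_le_eq)
    ultimately have "\<bar>f x 0\<bar> \<le> a * (S w / w) + b x" by (intro LIMSEQ_le_const2) auto
    then show ?thesis using True by simp
  qed (use pos s in auto)
qed

lemma F_increment:
  assumes g: "good x" and s: "\<bar>s\<bar> \<le> w" "\<bar>t\<bar> \<le> w" and w: "w > 0"
  shows "\<bar>F x t - F x s\<bar> \<le> \<bar>t - s\<bar> * (a * (S w / w) + b x)"
proof -
  have *: "\<bar>F x t - F x s\<bar> \<le> \<bar>t - s\<bar> * (a * (S w / w) + b x)" if st: "s < t" "\<bar>s\<bar> \<le> w" "\<bar>t\<bar> \<le> w" for s t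
  proof -
    obtain z where z: "s < z" "z < t" "F x t - F x s = (t - s) * f x z"
      using MVT2[OF st(1), of "F x" "f x"] F_DERIV[OF g] by blast
    have "\<bar>f x z\<bar> \<le> a * (S w / w) + b x" using z st by (intro f_bound g w) auto
    then show ?thesis unfolding z(3) abs_mult by (rule mult_left_mono) simp
  qed
  consider "s < t" | "s = t" | "t < s" by linarith
  then show ?thesis
  proof cases
    case 3 then show ?thesis using *[of t s] s by (simp add: abs_minus_commute)
  qed (use * s in auto)
qed

lemma F_bound:
  assumes g: "good x" shows "\<bar>F x s\<bar> \<le> a * S s + b x * \<bar>s\<bar>"
proof (cases "s = 0")
  case False
  then have "\<bar>F x s - F x 0\<bar> \<le> \<bar>s - 0\<bar> * (a * (S \<bar>s\<bar> / \<bar>s\<bar>) + b x)" by (intro F_increment g) auto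
  moreover have "\<bar>s - 0\<bar> * (a * (S \<bar>s\<bar> / \<bar>s\<bar>) + b x) = a * S s + b x * \<bar>s\<bar>"
    using False by (simp add: S_even distrib_left)
  ultimately show ?thesis by simp
qed simp

subsection \<open>Measurability of superposition operators\<close>

lemma good_representative:
  obtains N where "N \<in> null_sets M" "\<And>x. x \<in> \<Omega> - N \<Longrightarrow> good x"
  using good_AE unfolding eventually_ae_filter by auto

lemma f_compose_measurable:
  assumes [measurable]: "u \<in> borel_measurable M"
  shows "(\<lambda>x. f x (u x)) \<in> borel_measurable M"
proof -
  obtain N where N: "N \<in> null_sets M" "\<And>x. x \<in> \<Omega> - N \<Longrightarrow> good x" by (rule good_representative) (rule that)
  have [measurable]: "N \<in> sets M" using N by auto
  define f' where "f' x s = (if x \<in> N then 0 else f x s)" for x s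
  have [measurable]: "(\<lambda>x. f x s) \<in> borel_measurable M" for s using f_cara by (simp add: caratheodory_def)
  have "(\<lambda>x. f' x (u x)) \<in> borel_measurable M"
  proof (rule caratheodory_compose_measurable[where f=f' and u=u])
    show "(\<lambda>x. f' x s) \<in> borel_measurable M" for s unfolding f'_def by measurable
    show "continuous_on UNIV (f' x)" if "x \<in> space M" for x
      using N(2)[of x] that by (cases "x \<in> N") (auto simp: f'_def[abs_def] good_def)
  qed measurable
  moreover have "AE x in M. f x (u x) = f' x (u x)"
    using AE_not_in[OF N(1)] by eventually_elim (simp add: f'_def)
  ultimately show ?thesis by (rule measurable_if_AE_eq_lebesgue_on[OF \<Omega>_sets])
qed

text \<open>A Caratheodory function, modified on a null set, is jointly measurable; Fubini does
  the rest.\<close>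

lemma F_measurable: "(\<lambda>x. F x s) \<in> borel_measurable M"
proof -
  obtain N where N: "N \<in> null_sets M" "\<And>x. x \<in> \<Omega> - N \<Longrightarrow> good x" by (rule good_representative) (rule that)
  have [measurable]: "N \<in> sets M" using N by auto
  define f' where "f' x s = (if x \<in> N then 0 else f x s)" for x s
  have fm[measurable]: "(\<lambda>x. f x s) \<in> borel_measurable M" for s using f_cara by (simp add: caratheodory_def)
  have joint: "(\<lambda>z. f' (fst z) (snd z)) \<in> borel_measurable (M \<Otimes>\<^sub>M lborel)"
  proof (rule caratheodory_compose_measurable[of "\<lambda>z. f' (fst z)"])
    show "(\<lambda>z. f' (fst z) s) \<in> borel_measurable (M \<Otimes>\<^sub>M lborel)" for s unfolding f'_def by measurable
    show "continuous_on UNIV (f' (fst z))" if "z \<in> space (M \<Otimes>\<^sub>M lborel)" for z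
      using N(2)[of "fst z"] that by (cases "fst z \<in> N") (auto simp: f'_def[abs_def] good_def space_pair_measure)
  qed measurable
  have set_meas: "(\<lambda>x. \<integral>t. indicator I t *\<^sub>R f' x t \<partial>lborel) \<in> borel_measurable M" if [measurable]: "I \<in> sets borel" for I :: "real set"
    by (rule sigma_finite_measure.borel_measurable_lebesgue_integral[OF sigma_finite_lborel])
       (use joint in \<open>simp add: case_prod_beta\<close>)
  have "(\<lambda>x. LBINT t=0..s. f' x t) \<in> borel_measurable M"
    unfolding interval_lebesgue_integral_def set_lebesgue_integral_def
    using set_meas[of "einterval 0 (ereal s)"] set_meas[of "einterval (ereal s) 0"]
    by (cases "(0::ereal) \<le> ereal s") auto
  moreover have "AE x in M. F x s = (LBINT t=0..s. f' x t)"
    using AE_not_in[OF N(1)] by eventually_elim (simp add: f'_def F)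
  ultimately show ?thesis by (rule measurable_if_AE_eq_lebesgue_on[OF \<Omega>_sets])
qed

lemma F_compose_measurable:
  assumes [measurable]: "u \<in> borel_measurable M"
  shows "(\<lambda>x. F x (u x)) \<in> borel_measurable M"
proof -
  obtain N where N: "N \<in> null_sets M" "\<And>x. x \<in> \<Omega> - N \<Longrightarrow> good x" by (rule good_representative) (rule that)
  have [measurable]: "N \<in> sets M" using N by auto
  define F' where "F' x s = (if x \<in> N then 0 else F x s)" for x s
  note [measurable] = F_measurable
  have "(\<lambda>x. F' x (u x)) \<in> borel_measurable M"
  proof (rule caratheodory_compose_measurable[where f=F' and u=u])
    show "(\<lambda>x. F' x s) \<in> borel_measurable M" for s unfolding F'_def by measurable
    show "continuous_on UNIV (F' x)" if "x \<in> space M" for x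
      using F_cont[OF N(2)[of x]] that by (cases "x \<in> N") (auto simp: F'_def[abs_def])
  qed measurable
  moreover have "AE x in M. F x (u x) = F' x (u x)"
    using AE_not_in[OF N(1)] by eventually_elim (simp add: F'_def)
  ultimately show ?thesis by (rule measurable_if_AE_eq_lebesgue_on[OF \<Omega>_sets])
qed

subsection \<open>Duality pairings\<close>

text \<open>Young's inequality for a function in the dual space, with the constants arranged so
  that the first term is integrable whatever \<open>s\<close> is. Superlinearity makes the
  conjugate a supremum over a bounded set.\<close>

lemma young_pairing:
  assumes P: "\<And>s. P s \<ge> 0" "\<And>s. P \<bar>s\<bar> = P s" and super: "\<And>c. \<exists>s0>0. \<forall>s\<ge>s0. c * s \<le> P s"
    and \<beta>: "\<beta> \<in> orlicz_dual \<Omega> P" and P0: "P 0 = 0"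
  obtains H r where "r \<ge> 0" "integrable M H" "\<And>x. H x \<ge> 0" "\<And>x s. \<bar>\<beta> x * s\<bar> \<le> H x + r * P s"
proof -
  obtain r where [measurable]: "\<beta> \<in> borel_measurable M" and r: "r > 0"
    and fin: "(\<integral>\<^sup>+x. ennreal (orlicz_conjugate P (\<beta> x / r)) \<partial>M) < \<infinity>"
    using \<beta> by (auto simp: orlicz_dual_def orlicz_space_def)
  have bdd: "bdd_above ((\<lambda>s. s * \<bar>t\<bar> - P s) ` {0..})" for t
  proof -
    obtain s0 where s0: "s0 > 0" "\<forall>s\<ge>s0. \<bar>t\<bar> * s \<le> P s" using super by blast
    show ?thesis
    proof (rule bdd_aboveI2[where M="s0 * \<bar>t\<bar>"])
      fix s :: real assume s: "s \<in> {0..}"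
      show "s * \<bar>t\<bar> - P s \<le> s0 * \<bar>t\<bar>"
      proof (cases "s \<ge> s0")
        case True
        then have "s * \<bar>t\<bar> - P s \<le> 0" using s0 by (simp add: mult.commute)
        also have "0 \<le> s0 * \<bar>t\<bar>" using s0 by simp
        finally show ?thesis .
      next
        case False
        then have "s * \<bar>t\<bar> \<le> s0 * \<bar>t\<bar>" by (intro mult_right_mono) auto
        then show ?thesis using P(1)[of s] by linarith
      qed
    qed
  qed
  have young: "s * \<bar>t\<bar> - P s \<le> orlicz_conjugate P t" if "s \<ge> 0" for s t
    unfolding orlicz_conjugate_def using that by (intro cSUP_upper bdd) auto
  have c0: "orlicz_conjugate P t \<ge> 0" for t using young[of 0 t] P0 by simp
  have cmono: "orlicz_conjugate P t \<le> orlicz_conjugate P t'" if "\<bar>t\<bar> \<le> \<bar>t'\<bar>" for t t'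
    unfolding orlicz_conjugate_def
  proof (rule cSUP_mono[OF _ bdd])
    fix s :: real assume s: "s \<in> {0..}"
    then have "s * \<bar>t\<bar> \<le> s * \<bar>t'\<bar>" using that by (intro mult_left_mono) auto
    then show "\<exists>s'\<in>{0..}. s * \<bar>t\<bar> - P s \<le> s' * \<bar>t'\<bar> - P s'" using s by (intro bexI[of _ s]) auto
  qed auto
  have mono: "mono (\<lambda>t. orlicz_conjugate P (max 0 t))"
    by (rule monoI) (rule cmono, auto)
  have "(\<lambda>t. orlicz_conjugate P (max 0 \<bar>t\<bar>)) \<in> borel_measurable borel"
    using borel_measurable_mono[OF mono] by measurable
  then have [measurable]: "orlicz_conjugate P \<in> borel_measurable borel"
    by (simp add: orlicz_conjugate_def[abs_def])
  define H where "H x = r * orlicz_conjugate P (\<beta> x / r)" for x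
  show ?thesis
  proof (rule that[of r H])
    show "r \<ge> 0" using r by simp
    have "integrable M (\<lambda>x. orlicz_conjugate P (\<beta> x / r))"
      using fin by (intro integrableI_bounded) (auto simp: c0)
    then show "integrable M H" unfolding H_def by simp
    show "H x \<ge> 0" for x using r c0 by (simp add: H_def)
    fix x s
    have "\<bar>s\<bar> * \<bar>\<beta> x / r\<bar> - P \<bar>s\<bar> \<le> orlicz_conjugate P (\<beta> x / r)" by (rule young) simp
    then have "r * (\<bar>s\<bar> * \<bar>\<beta> x / r\<bar>) \<le> r * (orlicz_conjugate P (\<beta> x / r) + P s)"
      using r P(2)[of s] by (intro mult_left_mono) auto
    moreover have "r * (\<bar>s\<bar> * \<bar>\<beta> x / r\<bar>) = \<bar>\<beta> x * s\<bar>" using r by (simp add: abs_divide abs_mult)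
    ultimately show "\<bar>\<beta> x * s\<bar> \<le> H x + r * P s" by (simp add: H_def distrib_left)
  qed
qed

lemma Phi_superlinear: "\<exists>s0>0. \<forall>s\<ge>s0. r * s \<le> \<Phi> s"
proof -
  define s0 where "s0 = max 1 (\<bar>r\<bar> / \<Phi> 1) powr (1 / (l - 1))"
  have l1: "l - 1 > 0" using exponents by simp
  have s0: "s0 \<ge> 1" using l1 by (auto simp: s0_def ge_one_powr_ge_zero)
  have "r * s \<le> \<Phi> s" if s: "s \<ge> s0" for s
  proof -
    have p1: "\<Phi> 1 > 0" by (rule Phi_pos) simp
    have "s0 powr (l - 1) = max 1 (\<bar>r\<bar> / \<Phi> 1)" using l1 by (simp add: s0_def powr_powr)
    moreover have "s0 powr (l - 1) \<le> s powr (l - 1)" using s s0 l1 by (intro powr_mono2) auto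
    ultimately have "\<bar>r\<bar> / \<Phi> 1 \<le> s powr (l - 1)" by linarith
    then have "r \<le> s powr (l - 1) * \<Phi> 1" using p1 by (simp add: field_simps)
    then have "r * s \<le> s powr (l - 1) * \<Phi> 1 * s" using s s0 by (intro mult_right_mono) auto
    also have "\<dots> = s powr l * \<Phi> 1" using s s0 by (simp add: powr_diff)
    also have "\<dots> \<le> \<Phi> s" using s s0 by (intro Phi_ge_powr) simp
    finally show ?thesis .
  qed
  then show ?thesis using s0 by (intro exI[of _ s0]) auto
qed

lemma h_pairing:
  obtains H r where "r \<ge> 0" "integrable M H" "\<And>x. H x \<ge> 0" "\<And>x s. \<bar>h x * s\<bar> \<le> H x + r * \<Phi> s"
proof (rule young_pairing[of \<Phi> h])
  show "\<exists>s0>0. \<forall>s\<ge>s0. r * s \<le> \<Phi> s" for r by (rule Phi_superlinear)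
qed (use that in \<open>auto simp: Phi_nonneg Phi_even h_dual\<close>)

lemma b_pairing:
  obtains H r where "r \<ge> 0" "integrable M H" "\<And>x. H x \<ge> 0" "\<And>x s. \<bar>b x * s\<bar> \<le> H x + r * S s"
proof (rule young_pairing[of S b])
  show "\<exists>s0>0. \<forall>s\<ge>s0. r * s \<le> S s" for r using S_superlinear[of r] by metis
qed (use that in \<open>auto simp: S_nonneg S_even b_dual\<close>)

lemma dual_measurable: "b \<in> borel_measurable M" "h \<in> borel_measurable M"
  using b_dual h_dual by (auto simp: orlicz_dual_def orlicz_space_def)

lemma W0_S_integrable:
  assumes W: "W0 u g" shows "integrable M (\<lambda>x. S (u x))"
proof -
  note [measurable] = W0_measurable[OF W]
  obtain D where D: "D \<ge> 0" "\<rho> (\<lambda>x. norm (g x)) = ennreal D" using W0_finite(2)[OF W] by (cases "\<rho> (\<lambda>x. norm (g x))") auto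
  note th = \<theta>_ge_1[OF D(1)]
  have le: "(\<integral>\<^sup>+x. ennreal (S (u x / \<theta> D)) \<partial>M) \<le> 1" using W0_sobolev[OF W _ D(1)] D(2) by simp
  have i: "integrable M (\<lambda>x. \<theta> D powr (1 / \<kappa>) * S (u x / \<theta> D))"
  proof (intro integrable_mult_right integrableI_bounded)
    show "(\<integral>\<^sup>+x. ennreal (norm (S (u x / \<theta> D))) \<partial>M) < \<infinity>"
      using le by (simp add: S_nonneg) (metis ennreal_one_less_top le_less_trans)
  qed measurable
  show ?thesis
  proof (rule Bochner_Integration.integrable_bound[OF i])
    show "AE x in M. norm (S (u x)) \<le> norm (\<theta> D powr (1 / \<kappa>) * S (u x / \<theta> D))"
    proof (rule AE_I2)
      fix x
      have "S (\<theta> D * (u x / \<theta> D)) \<le> \<theta> D powr (1 / \<kappa>) * S (u x / \<theta> D)" by (rule S_scale(1)[OF th])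
      then show "norm (S (u x)) \<le> norm (\<theta> D powr (1 / \<kappa>) * S (u x / \<theta> D))" using th by (simp add: S_nonneg abs_mult)
    qed
  qed measurable
qed

lemma b_integrable:
  assumes W: "W0 u g" shows "integrable M (\<lambda>x. b x * \<bar>u x\<bar>)"
proof -
  note [measurable] = W0_measurable[OF W] dual_measurable
  obtain H r where H: "r \<ge> 0" "integrable M H" "\<And>x. H x \<ge> 0" "\<And>x s. \<bar>b x * s\<bar> \<le> H x + r * S s" by (rule b_pairing) (rule that)
  have i: "integrable M (\<lambda>x. H x + r * S (u x))" using H(2) W0_S_integrable[OF W] by simp
  show ?thesis
    by (rule Bochner_Integration.integrable_bound[OF i])
       (use H(1,3,4) S_nonneg in \<open>auto simp: abs_mult intro!: order_trans[OF _ abs_ge_self]\<close>)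
qed

lemma h_integrable:
  assumes W: "W0 u g" shows "integrable M (\<lambda>x. h x * u x)"
proof -
  note [measurable] = W0_measurable[OF W] dual_measurable
  obtain H r where H: "r \<ge> 0" "integrable M H" "\<And>x. H x \<ge> 0" "\<And>x s. \<bar>h x * s\<bar> \<le> H x + r * \<Phi> s" by (rule h_pairing) (rule that)
  have i: "integrable M (\<lambda>x. H x + r * \<Phi> (u x))"
    using H(2) integrable_Phi[OF W0_measurable(1)[OF W] W0_finite(1)[OF W]] by simp
  show ?thesis
    by (rule Bochner_Integration.integrable_bound[OF i])
       (use H(1,3,4) Phi_nonneg in \<open>auto simp: abs_mult intro!: order_trans[OF _ abs_ge_self]\<close>)
qed

lemma F_integrable:
  assumes W: "W0 u g" shows "integrable M (\<lambda>x. F x (u x))"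
proof -
  note [measurable] = F_compose_measurable[OF W0_measurable(1)[OF W]]
  have i: "integrable M (\<lambda>x. a * S (u x) + b x * \<bar>u x\<bar>)" using W0_S_integrable[OF W] b_integrable[OF W] by simp
  show ?thesis
    by (rule Bochner_Integration.integrable_bound[OF i])
       (use good_AE in \<open>auto elim!: eventually_mono intro!: order_trans[OF F_bound abs_ge_self]\<close>)
qed

end

section \<open>The Euler--Lagrange equation\<close>

context young_growth
begin

lemma Phi_norm_DERIV:
  fixes x y :: "'a::real_inner"
  shows "((\<lambda>t. \<Phi> (norm (x + t *\<^sub>R y))) has_real_derivative \<phi> (norm x) * (x \<bullet> y)) (at 0)"
proof (cases "x = 0")
  case True
  have "((\<lambda>t. \<Phi> (norm y * t)) has_real_derivative 0 * norm y) (at 0)"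
    by (rule DERIV_chain2[where f=\<Phi> and g="\<lambda>t. norm y * t"])
       (use Phi_DERIV[of 0] in \<open>auto intro!: derivative_eq_intros\<close>)
  moreover have "\<Phi> (norm (x + t *\<^sub>R y)) = \<Phi> (norm y * t)" for t
  proof -
    have "\<Phi> (norm (x + t *\<^sub>R y)) = \<Phi> \<bar>norm y * t\<bar>" using True by (simp add: abs_mult mult.commute)
    then show ?thesis by (simp only: Phi_even)
  qed
  ultimately show ?thesis using True by simp
next
  case False
  have "((\<lambda>t. x + t *\<^sub>R y) has_derivative (\<lambda>t. t *\<^sub>R y)) (at 0)"
    by (auto intro!: derivative_eq_intros)
  moreover have "(norm has_derivative (\<lambda>h. h \<bullet> sgn x)) (at (x + 0 *\<^sub>R y))"
    using has_derivative_norm[OF False] by (simp add: inner_commute)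
  ultimately have "((\<lambda>t. norm (x + t *\<^sub>R y)) has_derivative (\<lambda>t. (t *\<^sub>R y) \<bullet> sgn x)) (at 0)"
    by (rule has_derivative_compose)
  moreover have "(\<lambda>t. (t *\<^sub>R y) \<bullet> sgn x) = (*) (y \<bullet> sgn x)" by (auto simp: fun_eq_iff)
  ultimately have n: "((\<lambda>t. norm (x + t *\<^sub>R y)) has_real_derivative y \<bullet> sgn x) (at 0)"
    by (simp add: has_field_derivative_def)
  have "(\<Phi> has_real_derivative p (norm x)) (at (norm (x + 0 *\<^sub>R y)))"
    using Phi_DERIV[of "norm x"] by simp
  from DERIV_chain2[OF this n]
  have "((\<lambda>t. \<Phi> (norm (x + t *\<^sub>R y))) has_real_derivative p (norm x) * (y \<bullet> sgn x)) (at 0)" .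
  moreover have "p (norm x) * (y \<bullet> sgn x) = \<phi> (norm x) * (x \<bullet> y)"
    using False by (simp add: sgn_div_norm inner_commute field_simps)
  ultimately show ?thesis by simp
qed

lemma Phi_increment:
  assumes "0 \<le> x" "0 \<le> y" "x \<le> w" "y \<le> w"
  shows "\<bar>\<Phi> y - \<Phi> x\<bar> \<le> \<bar>y - x\<bar> * p w"
proof -
  have *: "\<bar>\<Phi> y - \<Phi> x\<bar> \<le> \<bar>y - x\<bar> * p w" if xy: "0 \<le> x" "x < y" "y \<le> w" for x y
  proof -
    obtain z where z: "x < z" "z < y" "\<Phi> y - \<Phi> x = (y - x) * (z * \<phi> \<bar>z\<bar>)"
      using MVT2[OF xy(2), of \<Phi> "\<lambda>t. t * \<phi> \<bar>t\<bar>"] Phi_DERIV by blast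
    have "0 \<le> p z" "p z \<le> p w" using z xy by (auto intro: p_nonneg p_mono)
    then have "\<bar>z * \<phi> \<bar>z\<bar>\<bar> \<le> p w" using z xy by simp
    then show ?thesis unfolding z(3) abs_mult by (intro mult_left_mono) auto
  qed
  consider "x < y" | "x = y" | "y < x" by linarith
  then show ?thesis
  proof cases
    case 3 then show ?thesis using *[of y x] assms by (simp add: abs_minus_commute)
  qed (use * assms in auto)
qed

text \<open>The mean value theorem bounds the increment by
  \<open>t |y| \<Phi>'(|x| + |y|)\<close>, and
  \<open>s \<Phi>'(s) \<le> m \<Phi>(s)\<close> removes the derivative.\<close>

lemma Phi_norm_increment:
  fixes x y :: "'a::real_normed_vector"
  assumes t: "0 \<le> t" "t \<le> 1"
  shows "\<bar>\<Phi> (norm (x + t *\<^sub>R y)) - \<Phi> (norm x)\<bar> \<le> t * (m * \<Phi> (norm x + norm y))"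
proof -
  let ?w = "norm x + norm y"
  have ty: "norm (t *\<^sub>R y) \<le> norm y" "norm (t *\<^sub>R y) = t * norm y" using t by (auto simp: mult_left_le_one_le)
  have "norm (x + t *\<^sub>R y) \<le> ?w" using norm_triangle_ineq[of x "t *\<^sub>R y"] ty by linarith
  then have "\<bar>\<Phi> (norm (x + t *\<^sub>R y)) - \<Phi> (norm x)\<bar> \<le> \<bar>norm (x + t *\<^sub>R y) - norm x\<bar> * p ?w"
    by (intro Phi_increment) auto
  also have "\<dots> \<le> (t * ?w) * p ?w"
  proof (rule mult_right_mono)
    have "\<bar>norm (x + t *\<^sub>R y) - norm x\<bar> \<le> norm (t *\<^sub>R y)" using norm_triangle_ineq3[of "x + t *\<^sub>R y" x] by simp
    also have "\<dots> \<le> t * ?w" unfolding ty(2) using t by (intro mult_left_mono) auto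
    finally show "\<bar>norm (x + t *\<^sub>R y) - norm x\<bar> \<le> t * ?w" .
  qed (simp add: p_nonneg)
  also have "\<dots> = t * (?w * p ?w)" by (simp add: mult_ac)
  also have "\<dots> \<le> t * (m * \<Phi> ?w)" using t by (intro mult_left_mono growth_bounds) auto
  finally show ?thesis .
qed

end

lemma DERIV_sequence:
  assumes "(G has_real_derivative D) (at 0)"
  shows "(\<lambda>n. (G (1 / real (Suc n)) - G 0) / (1 / real (Suc n))) \<longlonglongrightarrow> D"
proof -
  have "((\<lambda>t. (G t - G 0) / t) \<longlongrightarrow> D) (at 0)" using assms by (simp add: DERIV_def)
  moreover have "filterlim (\<lambda>n. 1 / real (Suc n)) (at 0) sequentially"
    using LIMSEQ_Suc[OF lim_1_over_n[where 'a=real]] by (auto simp: filterlim_at intro!: always_eventually)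
  ultimately show ?thesis by (rule filterlim_compose)
qed

lemma difference_quotient_limit:
  fixes X :: "real \<Rightarrow> 'a \<Rightarrow> real"
  assumes int: "\<And>t. integrable M (X t)" and Y: "integrable M Y"
    and D: "AE x in M. ((\<lambda>t. X t x) has_real_derivative X' x) (at 0)"
    and bd: "\<And>t. 0 < t \<Longrightarrow> t \<le> 1 \<Longrightarrow> AE x in M. \<bar>X t x - X 0 x\<bar> \<le> t * Y x"
    and X'm: "X' \<in> borel_measurable M"
  shows "integrable M X'"
    "(\<lambda>n. ((\<integral>x. X (1 / real (Suc n)) x \<partial>M) - (\<integral>x. X 0 x \<partial>M)) / (1 / real (Suc n))) \<longlonglongrightarrow> (\<integral>x. X' x \<partial>M)"
proof -
  define \<tau> where "\<tau> n = 1 / real (Suc n)" for n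
  have \<tau>: "0 < \<tau> n" "\<tau> n \<le> 1" for n by (auto simp: \<tau>_def)
  have m: "(\<lambda>x. (X (\<tau> n) x - X 0 x) / \<tau> n) \<in> borel_measurable M" for n
    using int by (intro borel_measurable_divide borel_measurable_diff) auto
  have lim: "AE x in M. (\<lambda>n. (X (\<tau> n) x - X 0 x) / \<tau> n) \<longlonglongrightarrow> X' x"
    using D by eventually_elim (unfold \<tau>_def, rule DERIV_sequence)
  have le: "AE x in M. norm ((X (\<tau> n) x - X 0 x) / \<tau> n) \<le> Y x" for n
    using bd[OF \<tau>, of n] by eventually_elim (use \<tau>[of n] in \<open>simp add: abs_divide divide_le_eq mult.commute\<close>)
  note dc = X'm m Y lim le
  show "integrable M X'" by (rule integrable_dominated_convergence[OF dc])
  have "(\<lambda>n. \<integral>x. (X (\<tau> n) x - X 0 x) / \<tau> n \<partial>M) \<longlonglongrightarrow> (\<integral>x. X' x \<partial>M)"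
    by (rule integral_dominated_convergence[OF dc])
  moreover have "(\<integral>x. (X (\<tau> n) x - X 0 x) / \<tau> n \<partial>M) = ((\<integral>x. X (\<tau> n) x \<partial>M) - (\<integral>x. X 0 x \<partial>M)) / \<tau> n" for n
    using int by simp
  ultimately show "(\<lambda>n. ((\<integral>x. X (1 / real (Suc n)) x \<partial>M) - (\<integral>x. X 0 x \<partial>M)) / (1 / real (Suc n))) \<longlonglongrightarrow> (\<integral>x. X' x \<partial>M)"
    by (simp only: \<tau>_def)
qed

context orlicz_sobolev
begin

lemma W0_Phi_integrable: "W0 u g \<Longrightarrow> integrable M (\<lambda>x. \<Phi> (u x))" "W0 u g \<Longrightarrow> integrable M (\<lambda>x. \<Phi> (norm (g x)))"
  using integrable_Phi[of "\<lambda>x. norm (g x)"] integrable_Phi[of u] W0_measurable W0_finite by auto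

end

context nonlinear_problem
begin

definition energy :: "(real^'n \<Rightarrow> real) \<Rightarrow> (real^'n \<Rightarrow> real^'n) \<Rightarrow> real" where
  "energy u g = (\<integral>x. \<Phi> (norm (g x)) \<partial>M) - (\<integral>x. F x (u x) \<partial>M) - (\<integral>x. h x * u x \<partial>M)"

lemma W0_line: "W0 u g \<Longrightarrow> W0 v gv \<Longrightarrow> W0 (\<lambda>x. u x + t * v x) (\<lambda>x. g x + t *\<^sub>R gv x)"
  using W0_linear[of u g v gv 1 t] by simp

lemma principal_part_variation:
  assumes W: "W0 u g" "W0 v gv"
  shows "integrable M (\<lambda>x. \<phi> (norm (g x)) * (g x \<bullet> gv x))"
    "(\<lambda>n. ((\<integral>x. \<Phi> (norm (g x + (1 / real (Suc n)) *\<^sub>R gv x)) \<partial>M) - (\<integral>x. \<Phi> (norm (g x + 0 *\<^sub>R gv x)) \<partial>M)) / (1 / real (Suc n)))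
      \<longlonglongrightarrow> (\<integral>x. \<phi> (norm (g x)) * (g x \<bullet> gv x) \<partial>M)"
proof -
  note [measurable] = W0_measurable[OF W(1)] W0_measurable[OF W(2)]
  have "\<rho> (\<lambda>x. norm (g x) + norm (gv x)) \<le> ennreal (2 powr m) * (\<rho> (\<lambda>x. norm (g x)) + \<rho> (\<lambda>x. norm (gv x)))"
    by (rule \<rho>_add) auto
  also have "\<dots> < \<infinity>" using W0_finite(2)[OF W(1)] W0_finite(2)[OF W(2)] by (simp add: ennreal_mult_less_top)
  finally have "integrable M (\<lambda>x. \<Phi> (norm (g x) + norm (gv x)))" by (intro integrable_Phi) measurable
  then have Y: "integrable M (\<lambda>x. m * \<Phi> (norm (g x) + norm (gv x)))" by simp
  have int: "integrable M (\<lambda>x. \<Phi> (norm (g x + t *\<^sub>R gv x)))" for t by (rule W0_Phi_integrable(2)[OF W0_line[OF W]])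
  have \<phi>m: "(\<lambda>x. \<phi> (norm (g x)) * (g x \<bullet> gv x)) \<in> borel_measurable M"
  proof -
    have "(\<lambda>s. indicator {0<..} s *\<^sub>R \<phi> s) \<in> borel_measurable borel"
      by (intro borel_measurable_continuous_on_indicator phi_cont) auto
    then have [measurable]: "(\<lambda>s. indicator {0<..} s *\<^sub>R \<phi> s) \<in> borel_measurable borel" .
    have "(\<lambda>x. (indicator {0<..} (norm (g x)) *\<^sub>R \<phi> (norm (g x))) * (g x \<bullet> gv x)) \<in> borel_measurable M"
      using measurable_compose[OF _ \<open>(\<lambda>s. indicator {0<..} s *\<^sub>R \<phi> s) \<in> borel_measurable borel\<close>, of "\<lambda>x. norm (g x)" M]
      by measurable
    moreover have "(indicator {0<..} (norm (g x)) *\<^sub>R \<phi> (norm (g x))) * (g x \<bullet> gv x) = \<phi> (norm (g x)) * (g x \<bullet> gv x)" for x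
      by (cases "g x = 0") auto
    ultimately show ?thesis by (simp only:)
  qed
  have D: "AE x in M. ((\<lambda>t. \<Phi> (norm (g x + t *\<^sub>R gv x))) has_real_derivative \<phi> (norm (g x)) * (g x \<bullet> gv x)) (at 0)"
    by (intro AE_I2 Phi_norm_DERIV)
  have bd: "AE x in M. \<bar>\<Phi> (norm (g x + t *\<^sub>R gv x)) - \<Phi> (norm (g x + 0 *\<^sub>R gv x))\<bar> \<le> t * (m * \<Phi> (norm (g x) + norm (gv x)))"
    if "0 < t" "t \<le> 1" for t
    using Phi_norm_increment[of t "g x" "gv x" for x] that by (intro AE_I2) simp
  note * = difference_quotient_limit[of M "\<lambda>t x. \<Phi> (norm (g x + t *\<^sub>R gv x))", OF int Y D bd \<phi>m]
  show "integrable M (\<lambda>x. \<phi> (norm (g x)) * (g x \<bullet> gv x))" by (rule *(1))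
  show "(\<lambda>n. ((\<integral>x. \<Phi> (norm (g x + (1 / real (Suc n)) *\<^sub>R gv x)) \<partial>M) - (\<integral>x. \<Phi> (norm (g x + 0 *\<^sub>R gv x)) \<partial>M)) / (1 / real (Suc n)))
      \<longlonglongrightarrow> (\<integral>x. \<phi> (norm (g x)) * (g x \<bullet> gv x) \<partial>M)" by (rule *(2))
qed

text \<open>On the segment from \<open>u\<close> to \<open>u + v\<close> the nonlinearity is
  bounded by its growth bound at \<open>w = |u| + |v|\<close>, which gives the dominating
  function \<open>a S(w) + b |v|\<close>.\<close>

lemma nonlinear_part_variation:
  assumes W: "W0 u g" "W0 v gv"
  shows "integrable M (\<lambda>x. f x (u x) * v x)"
    "(\<lambda>n. ((\<integral>x. F x (u x + (1 / real (Suc n)) * v x) \<partial>M) - (\<integral>x. F x (u x + 0 * v x) \<partial>M)) / (1 / real (Suc n)))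
      \<longlonglongrightarrow> (\<integral>x. f x (u x) * v x \<partial>M)"
proof -
  note [measurable] = W0_measurable[OF W(1)] W0_measurable[OF W(2)] f_compose_measurable
  define w where "w x = \<bar>u x\<bar> + \<bar>v x\<bar>" for x
  have Sw: "integrable M (\<lambda>x. S (w x))"
  proof (rule Bochner_Integration.integrable_bound)
    show "integrable M (\<lambda>x. 2 powr (1 / \<kappa>) * (S (u x) + S (v x)))" using W0_S_integrable[OF W(1)] W0_S_integrable[OF W(2)] by simp
    show "(\<lambda>x. S (w x)) \<in> borel_measurable M" unfolding w_def by measurable
    show "AE x in M. norm (S (w x)) \<le> norm (2 powr (1 / \<kappa>) * (S (u x) + S (v x)))"
      using S_add[of "\<bar>u x\<bar>" "\<bar>v x\<bar>" for x] by (intro AE_I2) (simp add: w_def S_nonneg S_even)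
  qed
  have Y: "integrable M (\<lambda>x. a * S (w x) + b x * \<bar>v x\<bar>)" using Sw b_integrable[OF W(2)] by simp
  have int: "integrable M (\<lambda>x. F x (u x + t * v x))" for t by (rule F_integrable[OF W0_line[OF W]])
  have m: "(\<lambda>x. f x (u x) * v x) \<in> borel_measurable M" by measurable
  have D: "AE x in M. ((\<lambda>t. F x (u x + t * v x)) has_real_derivative f x (u x) * v x) (at 0)"
    using good_AE
  proof eventually_elim
    case (elim x)
    have "((\<lambda>t. u x + t * v x) has_real_derivative v x) (at 0)" by (auto intro!: derivative_eq_intros)
    moreover have "(F x has_real_derivative f x (u x)) (at (u x + 0 * v x))" using F_DERIV[OF elim] by simp
    ultimately show ?case by (rule DERIV_chain2[rotated])
  qed
  have bd: "AE x in M. \<bar>F x (u x + t * v x) - F x (u x + 0 * v x)\<bar> \<le> t * (a * S (w x) + b x * \<bar>v x\<bar>)" if t: "0 < t" "t \<le> 1" for t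
    using good_AE
  proof eventually_elim
    case (elim x)
    have bx: "b x \<ge> 0" using elim by (simp add: good_def)
    have tv: "\<bar>t * v x\<bar> \<le> \<bar>v x\<bar>" using t by (simp add: abs_mult mult_left_le_one_le)
    show ?case
    proof (cases "w x = 0")
      case True
      then have "u x = 0" "v x = 0" by (auto simp: w_def)
      then show ?thesis using t a_nonneg S_nonneg[of "w x"] by simp
    next
      case False
      then have w: "w x > 0" by (simp add: w_def)
      have "\<bar>F x (u x + t * v x) - F x (u x)\<bar> \<le> \<bar>u x + t * v x - u x\<bar> * (a * (S (w x) / w x) + b x)"
        using tv by (intro F_increment elim w) (auto simp: w_def)
      also have "\<dots> = t * (a * (\<bar>v x\<bar> * (S (w x) / w x)) + b x * \<bar>v x\<bar>)" using t by (simp add: abs_mult algebra_simps)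
      also have "\<dots> \<le> t * (a * S (w x) + b x * \<bar>v x\<bar>)"
      proof -
        have "\<bar>v x\<bar> * (S (w x) / w x) \<le> w x * (S (w x) / w x)" using w S_nonneg[of "w x"] by (intro mult_right_mono) (auto simp: w_def)
        also have "\<dots> = S (w x)" using w by simp
        finally show ?thesis using t a_nonneg by (intro mult_left_mono add_right_mono) auto
      qed
      finally show ?thesis by simp
    qed
  qed
  note * = difference_quotient_limit[of M "\<lambda>t x. F x (u x + t * v x)", OF int Y D bd m]
  show "integrable M (\<lambda>x. f x (u x) * v x)" by (rule *(1))
  show "(\<lambda>n. ((\<integral>x. F x (u x + (1 / real (Suc n)) * v x) \<partial>M) - (\<integral>x. F x (u x + 0 * v x) \<partial>M)) / (1 / real (Suc n)))
      \<longlonglongrightarrow> (\<integral>x. f x (u x) * v x \<partial>M)" by (rule *(2))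
qed

lemma minimiser_variation_nonneg:
  assumes W: "W0 u g" "W0 v gv" and min: "\<And>v gv. W0 v gv \<Longrightarrow> energy u g \<le> energy v gv"
  shows "0 \<le> (\<integral>x. \<phi> (norm (g x)) * (g x \<bullet> gv x) \<partial>M) - (\<integral>x. f x (u x) * v x \<partial>M) - (\<integral>x. h x * v x \<partial>M)"
proof -
  define \<tau> where "\<tau> n = 1 / real (Suc n)" for n
  have \<tau>: "\<tau> n > 0" for n by (simp add: \<tau>_def)
  let ?P = "\<lambda>t. \<integral>x. \<Phi> (norm (g x + t *\<^sub>R gv x)) \<partial>M" and ?Q = "\<lambda>t. \<integral>x. F x (u x + t * v x) \<partial>M"
  let ?d = "\<integral>x. h x * v x \<partial>M"
  have lim: "(\<lambda>n. (?P (\<tau> n) - ?P 0) / \<tau> n - (?Q (\<tau> n) - ?Q 0) / \<tau> n - ?d)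
    \<longlonglongrightarrow> (\<integral>x. \<phi> (norm (g x)) * (g x \<bullet> gv x) \<partial>M) - (\<integral>x. f x (u x) * v x \<partial>M) - ?d"
    unfolding \<tau>_def by (intro tendsto_diff principal_part_variation(2)[OF W] nonlinear_part_variation(2)[OF W] tendsto_const)
  have "0 \<le> (?P (\<tau> n) - ?P 0) / \<tau> n - (?Q (\<tau> n) - ?Q 0) / \<tau> n - ?d" for n
  proof -
    have hl: "(\<integral>x. h x * (u x + \<tau> n * v x) \<partial>M) = (\<integral>x. h x * u x \<partial>M) + \<tau> n * ?d"
    proof -
      have "(\<integral>x. h x * (u x + \<tau> n * v x) \<partial>M) = (\<integral>x. h x * u x + \<tau> n * (h x * v x) \<partial>M)"
        by (intro Bochner_Integration.integral_cong) (auto simp: algebra_simps)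
      then show ?thesis using h_integrable[OF W(1)] h_integrable[OF W(2)] by simp
    qed
    have "energy u g \<le> energy (\<lambda>x. u x + \<tau> n * v x) (\<lambda>x. g x + \<tau> n *\<^sub>R gv x)" by (rule min[OF W0_line[OF W]])
    then have "0 \<le> (?P (\<tau> n) - ?P 0) - (?Q (\<tau> n) - ?Q 0) - \<tau> n * ?d" unfolding energy_def hl by simp
    then have "0 \<le> ((?P (\<tau> n) - ?P 0) - (?Q (\<tau> n) - ?Q 0) - \<tau> n * ?d) / \<tau> n" using \<tau>[of n] by simp
    also have "\<dots> = (?P (\<tau> n) - ?P 0) / \<tau> n - (?Q (\<tau> n) - ?Q 0) / \<tau> n - ?d" using \<tau>[of n] by (simp add: diff_divide_distrib)
    finally show ?thesis .
  qed
  then show ?thesis by (intro LIMSEQ_le_const[OF lim]) auto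
qed

text \<open>The one-sided variation along \<open>v\<close> and along \<open>- v\<close> gives
  both inequalities. The given gradient \<open>g\<close> is first exchanged for the representative
  \<^const>\<open>weak_grad\<close>.\<close>

theorem minimiser_is_weak_solution:
  assumes W: "W0 u g" and min: "\<And>v gv. W0 v gv \<Longrightarrow> energy u g \<le> energy v gv"
  shows "weak_solution \<Omega> \<phi> \<Phi> f h u"
  unfolding weak_solution_def
proof (intro conjI ballI)
  show "u \<in> sobolev_orlicz0 \<Omega> \<Phi>" by (rule W0_imp_sobolev_orlicz0[OF W])
  have Wu: "W0 u (weak_grad \<Omega> u)" by (rule sobolev_orlicz0_imp_W0[OF W0_imp_sobolev_orlicz0[OF W]])
  have gu: "AE x in M. weak_grad \<Omega> u x = g x" by (rule W0_weak_grad[OF W])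
  have "energy u (weak_grad \<Omega> u) = energy u g"
  proof -
    have "(\<integral>x. \<Phi> (norm (weak_grad \<Omega> u x)) \<partial>M) = (\<integral>x. \<Phi> (norm (g x)) \<partial>M)"
      using gu W0_measurable(2)[OF W] W0_measurable(2)[OF Wu] by (intro integral_cong_AE) auto
    then show ?thesis by (simp add: energy_def)
  qed
  then have min': "energy u (weak_grad \<Omega> u) \<le> energy v gv" if "W0 v gv" for v gv using min[OF that] by simp
  fix v assume v: "v \<in> sobolev_orlicz0 \<Omega> \<Phi>"
  let ?g = "weak_grad \<Omega> u" and ?gv = "weak_grad \<Omega> v"
  have Wv: "W0 v ?gv" by (rule sobolev_orlicz0_imp_W0[OF v])
  have Wm: "W0 (\<lambda>x. - v x) (\<lambda>x. - ?gv x)" using W0_linear[OF Wv Wv, of "- 1" 0] by simp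
  have eq: "(\<phi> (norm (?g x)) *\<^sub>R ?g x) \<bullet> ?gv x = \<phi> (norm (?g x)) * (?g x \<bullet> ?gv x)" for x by simp
  show "integrable M (\<lambda>x. (\<phi> (norm (?g x)) *\<^sub>R ?g x) \<bullet> ?gv x)"
    unfolding eq by (rule principal_part_variation(1)[OF Wu Wv])
  show "integrable M (\<lambda>x. f x (u x) * v x)" by (rule nonlinear_part_variation(1)[OF Wu Wv])
  show "integrable M (\<lambda>x. h x * v x)" by (rule h_integrable[OF Wv])
  show "(\<integral>x. (\<phi> (norm (?g x)) *\<^sub>R ?g x) \<bullet> ?gv x \<partial>M) = (\<integral>x. f x (u x) * v x \<partial>M) + (\<integral>x. h x * v x \<partial>M)"
    unfolding eq using minimiser_variation_nonneg[OF Wu Wv min'] minimiser_variation_nonneg[OF Wu Wm min'] by simp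
qed

end

section \<open>Coercivity and existence of a minimiser\<close>

lemma ereal_integral_mono_AE:
  assumes "AE x in M. X x \<le> Y x" shows "ereal_integral M X \<le> ereal_integral M Y"
  unfolding ereal_integral_def
proof (rule ereal_minus_mono)
  show "enn2ereal (\<integral>\<^sup>+x. e2ennreal (X x) \<partial>M) \<le> enn2ereal (\<integral>\<^sup>+x. e2ennreal (Y x) \<partial>M)"
    unfolding less_eq_ennreal.rep_eq[symmetric]
    by (rule nn_integral_mono_AE) (use assms in \<open>eventually_elim, simp add: e2ennreal_mono\<close>)
  show "enn2ereal (\<integral>\<^sup>+x. e2ennreal (- Y x) \<partial>M) \<le> enn2ereal (\<integral>\<^sup>+x. e2ennreal (- X x) \<partial>M)"
    unfolding less_eq_ennreal.rep_eq[symmetric]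
    by (rule nn_integral_mono_AE) (use assms in \<open>eventually_elim, simp add: e2ennreal_mono\<close>)
qed

lemma ereal_integral_cong_AE: "AE x in M. X x = Y x \<Longrightarrow> ereal_integral M X = ereal_integral M Y"
  by (intro antisym ereal_integral_mono_AE) auto

lemma ereal_integral_real:
  assumes "integrable M X" shows "ereal_integral M (\<lambda>x. ereal (X x)) = ereal (\<integral>x. X x \<partial>M)"
proof -
  obtain r q where rq: "r \<ge> 0" "q \<ge> 0" "(\<integral>\<^sup>+x. ennreal (X x) \<partial>M) = ennreal r" "(\<integral>\<^sup>+x. ennreal (- X x) \<partial>M) = ennreal q"
    "(\<integral>x. X x \<partial>M) = r - q"
    by (rule integrableE[OF assms]) (rule that, auto)
  have "ereal_integral M (\<lambda>x. ereal (X x)) = ereal r - ereal q"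
    unfolding ereal_integral_def using rq by (simp add: enn2ereal_ennreal e2ennreal_ereal)
  then show ?thesis using rq by simp
qed

lemma ereal_integral_restrict:
  assumes "S \<in> sets lebesgue" "T \<subseteq> S" "T \<in> sets lebesgue"
  shows "ereal_integral (lebesgue_on T) X = ereal_integral (lebesgue_on S) (\<lambda>x. if x \<in> T then X x else 0)"
proof -
  have *: "(\<integral>\<^sup>+x. e2ennreal (Y x) \<partial>lebesgue_on T) = (\<integral>\<^sup>+x. e2ennreal (if x \<in> T then Y x else 0) \<partial>lebesgue_on S)" for Y
  proof -
    have "(\<integral>\<^sup>+x. e2ennreal (Y x) \<partial>lebesgue_on T) = (\<integral>\<^sup>+x. e2ennreal (Y x) * indicator T x \<partial>lebesgue)"
      using assms by (intro nn_integral_restrict_space) auto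
    also have "\<dots> = (\<integral>\<^sup>+x. e2ennreal (if x \<in> T then Y x else 0) * indicator S x \<partial>lebesgue)"
      using assms by (intro nn_integral_cong) (auto simp: indicator_def zero_ennreal.abs_eq[symmetric])
    also have "\<dots> = (\<integral>\<^sup>+x. e2ennreal (if x \<in> T then Y x else 0) \<partial>lebesgue_on S)"
      using assms by (intro nn_integral_restrict_space[symmetric]) auto
    finally show ?thesis .
  qed
  have "(\<lambda>x. e2ennreal (- (if x \<in> T then X x else 0))) = (\<lambda>x. e2ennreal (if x \<in> T then - X x else 0))" by auto
  then show ?thesis unfolding ereal_integral_def using *[of X] *[of "\<lambda>x. - X x"] by simp
qed

text \<open>Fatou's lemma for the nonnegative functions \<open>Y\<^sub>n - X\<^sub>n\<close>.\<close>

lemma reverse_fatou: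
  fixes X Y :: "nat \<Rightarrow> 'a \<Rightarrow> real"
  assumes X: "\<And>n. integrable M (X n)" and Y: "\<And>n. integrable M (Y n)" and D: "integrable M D"
    and le: "\<And>n. AE x in M. X n x \<le> Y n x" and D0: "AE x in M. 0 \<le> D x"
    and lim: "AE x in M. (\<lambda>n. Y n x) \<longlonglongrightarrow> D x" and limI: "(\<lambda>n. \<integral>x. Y n x \<partial>M) \<longlonglongrightarrow> (\<integral>x. D x \<partial>M)"
    and c: "\<And>n. c n \<le> (\<integral>x. X n x \<partial>M)" "c \<longlonglongrightarrow> L"
  shows "ereal L \<le> ereal_integral M (\<lambda>x. limsup (\<lambda>n. ereal (X n x)))"
proof -
  have [measurable]: "X n \<in> borel_measurable M" "Y n \<in> borel_measurable M" "D \<in> borel_measurable M" for n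
    using X Y D by auto
  define W where "W x = limsup (\<lambda>n. ereal (X n x))" for x
  have [measurable]: "W \<in> borel_measurable M" unfolding W_def by measurable
  have intle: "(\<integral>x. X n x \<partial>M) \<le> (\<integral>x. Y n x \<partial>M)" for n by (rule integral_mono_AE[OF X Y le])
  have LD: "L \<le> (\<integral>x. D x \<partial>M)"
    by (rule LIMSEQ_le[OF c(2) limI]) (use c(1) intle order_trans in blast)
  \<comment> \<open>the limit inferior of \<open>Y\<^sub>n - X\<^sub>n\<close>, computed without excluding \<open>W = -\<infinity>\<close>\<close>
  have z: "AE x in M. e2ennreal (ereal (D x) - W x) \<le> liminf (\<lambda>n. ennreal (Y n x - X n x))"
    using lim
  proof eventually_elim
    case (elim x)
    show ?case
      unfolding le_Liminf_iff
    proof (intro allI impI)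
      fix y :: ennreal assume y: "y < e2ennreal (ereal (D x) - W x)"
      then obtain r where r: "y = ennreal r" "r \<ge> 0" by (cases y) auto
      have "ereal r < ereal (D x) - W x"
      proof (rule ccontr)
        assume "\<not> ?thesis"
        then have "e2ennreal (ereal (D x) - W x) \<le> e2ennreal (ereal r)" by (intro e2ennreal_mono) simp
        then show False using y r by (simp add: e2ennreal_ereal)
      qed
      then have "W x < ereal (D x - r)" by (cases "W x") auto
      then obtain \<beta> where \<beta>: "W x < ereal \<beta>" "\<beta> < D x - r" using ereal_dense2 by fastforce
      have "\<forall>\<^sub>F n in sequentially. ereal (X n x) < ereal \<beta>" using \<beta>(1) unfolding W_def by (rule Limsup_lessD)
      moreover have "\<forall>\<^sub>F n in sequentially. r + \<beta> < Y n x" using \<beta>(2) by (intro order_tendstoD(1)[OF elim]) simp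
      ultimately show "\<forall>\<^sub>F n in sequentially. y < ennreal (Y n x - X n x)"
        by eventually_elim (use r in \<open>simp add: ennreal_less_iff\<close>)
    qed
  qed
  have "(\<integral>\<^sup>+x. e2ennreal (ereal (D x) - W x) \<partial>M) \<le> (\<integral>\<^sup>+x. liminf (\<lambda>n. ennreal (Y n x - X n x)) \<partial>M)"
    by (rule nn_integral_mono_AE[OF z])
  also have "\<dots> \<le> liminf (\<lambda>n. \<integral>\<^sup>+x. ennreal (Y n x - X n x) \<partial>M)" by (rule nn_integral_liminf) measurable
  also have "\<dots> \<le> liminf (\<lambda>n. ennreal ((\<integral>x. Y n x \<partial>M) - c n))"
  proof (rule Liminf_mono, rule always_eventually, rule allI)
    fix n
    have "(\<integral>\<^sup>+x. ennreal (Y n x - X n x) \<partial>M) = ennreal (\<integral>x. Y n x - X n x \<partial>M)"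
      using X Y le[of n] by (intro nn_integral_eq_integral) auto
    also have "\<dots> \<le> ennreal ((\<integral>x. Y n x \<partial>M) - c n)" using X Y c(1)[of n] by (intro ennreal_leI) simp
    finally show "(\<integral>\<^sup>+x. ennreal (Y n x - X n x) \<partial>M) \<le> ennreal ((\<integral>x. Y n x \<partial>M) - c n)" .
  qed
  also have "\<dots> = ennreal ((\<integral>x. D x \<partial>M) - L)"
    by (rule lim_imp_Liminf) (auto intro!: tendsto_ennrealI tendsto_diff limI c(2))
  finally have main: "(\<integral>\<^sup>+x. e2ennreal (ereal (D x) - W x) \<partial>M) \<le> ennreal ((\<integral>x. D x \<partial>M) - L)" .
  define P where "P = (\<integral>\<^sup>+x. e2ennreal (W x) \<partial>M)"
  define Q where "Q = (\<integral>\<^sup>+x. e2ennreal (- W x) \<partial>M)"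
  have "ennreal (\<integral>x. D x \<partial>M) + Q = (\<integral>\<^sup>+x. ennreal (D x) + e2ennreal (- W x) \<partial>M)"
    unfolding Q_def using nn_integral_eq_integral[OF D D0] by (subst nn_integral_add) auto
  also have "\<dots> \<le> (\<integral>\<^sup>+x. e2ennreal (ereal (D x) - W x) + e2ennreal (W x) \<partial>M)"
  proof (rule nn_integral_mono_AE, use D0 in eventually_elim)
    fix x assume D: "0 \<le> D x"
    show "ennreal (D x) + e2ennreal (- W x) \<le> e2ennreal (ereal (D x) - W x) + e2ennreal (W x)"
    proof (cases "W x")
      case (real w)
      show ?thesis
      proof (cases "w \<ge> 0")
        case True
        have "ennreal (D x) \<le> ennreal (max 0 (D x - w) + w)" by (intro ennreal_leI) simp
        also have "\<dots> = ennreal (D x - w) + ennreal w" using True by (subst ennreal_plus) (auto simp: max_def ennreal_neg)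
        finally show ?thesis using real True by (simp add: e2ennreal_ereal ennreal_neg)
      next
        case False
        then show ?thesis using real D by (simp add: e2ennreal_ereal ennreal_neg flip: ennreal_plus)
      qed
    qed (auto simp: top_ennreal.abs_eq[symmetric])
  qed
  also have "\<dots> \<le> ennreal ((\<integral>x. D x \<partial>M) - L) + P"
    unfolding P_def using main by (subst nn_integral_add) (auto intro: add_right_mono)
  finally have PQ: "ennreal (\<integral>x. D x \<partial>M) + Q \<le> ennreal ((\<integral>x. D x \<partial>M) - L) + P" .
  have D0': "0 \<le> (\<integral>x. D x \<partial>M)" by (rule integral_nonneg_AE[OF D0])
  have "ereal L \<le> enn2ereal P - enn2ereal Q"
  proof (cases P)
    case top then show ?thesis by (cases Q) auto
  next
    case (real p)
    then have "Q \<noteq> top" using PQ by (auto simp: top_unique)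
    then obtain q where q: "Q = ennreal q" "q \<ge> 0" by (cases Q) auto
    have "ennreal ((\<integral>x. D x \<partial>M) + q) \<le> ennreal ((\<integral>x. D x \<partial>M) - L + p)"
      using PQ LD D0' q real by (simp add: ennreal_plus)
    then have "(\<integral>x. D x \<partial>M) + q \<le> (\<integral>x. D x \<partial>M) - L + p" using LD real by (subst (asm) ennreal_le_iff) auto
    then show ?thesis using q real by (simp add: enn2ereal_ennreal)
  qed
  then show ?thesis by (simp add: ereal_integral_def W_def P_def Q_def)
qed

lemma LIMSEQ_subseq: "strict_mono (r :: nat \<Rightarrow> nat) \<Longrightarrow> a \<longlonglongrightarrow> L \<Longrightarrow> (\<lambda>n. a (r n)) \<longlonglongrightarrow> L"
  using LIMSEQ_subseq_LIMSEQ[of a L r] by (simp add: o_def)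

context orlicz_sobolev
begin

text \<open>An upper bound by \<open>A \<Phi>(v\<^sub>n)\<close> is turned into the convergent
  majorant required by the reverse Fatou lemma through
  \<open>\<Phi>(v\<^sub>n) \<le> 2\<^sup>m (\<Phi>(v\<^sub>n - w) + \<Phi>(w))\<close>.\<close>

lemma reverse_fatou_\<rho>:
  assumes [measurable]: "\<And>n. v n \<in> borel_measurable M" "w \<in> borel_measurable M"
    and fin: "\<And>n. \<rho> (\<lambda>x. v n x - w x) < \<infinity>" "\<rho> w < \<infinity>"
    and ae: "AE x in M. (\<lambda>n. v n x) \<longlonglongrightarrow> w x"
    and conv: "\<And>e. e > 0 \<Longrightarrow> \<exists>K. \<forall>n\<ge>K. \<rho> (\<lambda>x. v n x - w x) \<le> ennreal e"
    and X: "\<And>n. integrable M (X n)" and A: "A \<ge> 0" and B: "integrable M B" "AE x in M. B x \<ge> 0"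
    and le: "\<And>n. AE x in M. X n x \<le> A * \<Phi> (v n x) + B x"
    and \<gamma>: "\<And>n. \<gamma> n \<le> (\<integral>x. X n x \<partial>M)" "\<gamma> \<longlonglongrightarrow> L"
  shows "ereal L \<le> ereal_integral M (\<lambda>x. limsup (\<lambda>n. ereal (X n x)))"
proof -
  define D where "D x = A * 2 powr m * \<Phi> (w x) + B x" for x
  define Y where "Y n x = A * 2 powr m * \<Phi> (v n x - w x) + D x" for n x
  have iw: "integrable M (\<lambda>x. \<Phi> (w x))" by (intro integrable_Phi fin) measurable
  have id: "integrable M (\<lambda>x. \<Phi> (v n x - w x))" for n by (intro integrable_Phi fin) measurable
  have iD: "integrable M D" unfolding D_def using iw B by simp
  have iY: "integrable M (Y n)" for n unfolding Y_def using id iD by simp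
  have "(\<lambda>n. \<integral>x. \<Phi> (v n x - w x) \<partial>M) \<longlonglongrightarrow> 0"
  proof (rule LIMSEQ_I)
    fix e :: real assume e: "e > 0"
    obtain K where K: "\<forall>n\<ge>K. \<rho> (\<lambda>x. v n x - w x) \<le> ennreal (e/2)" using conv[of "e/2"] e by auto
    have "norm ((\<integral>x. \<Phi> (v n x - w x) \<partial>M) - 0) < e" if "n \<ge> K" for n
    proof -
      have "ennreal (\<integral>x. \<Phi> (v n x - w x) \<partial>M) \<le> ennreal (e/2)"
        using K that by (subst \<rho>_eq_integral[OF _ fin(1), symmetric]) auto
      then have "(\<integral>x. \<Phi> (v n x - w x) \<partial>M) \<le> e/2" using e by (subst (asm) ennreal_le_iff) auto
      moreover have "0 \<le> (\<integral>x. \<Phi> (v n x - w x) \<partial>M)" by (intro integral_nonneg_AE) (auto simp: Phi_nonneg)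
      ultimately show ?thesis using e by simp
    qed
    then show "\<exists>K. \<forall>n\<ge>K. norm ((\<integral>x. \<Phi> (v n x - w x) \<partial>M) - 0) < e" by blast
  qed
  from tendsto_add[OF tendsto_mult[OF tendsto_const[of "A * 2 powr m"] this] tendsto_const[of "\<integral>x. D x \<partial>M"]]
  have limI: "(\<lambda>n. \<integral>x. Y n x \<partial>M) \<longlonglongrightarrow> (\<integral>x. D x \<partial>M)" unfolding Y_def using id iD by simp
  show ?thesis
  proof (rule reverse_fatou[OF X iY iD _ _ _ limI \<gamma>])
    show "AE x in M. X n x \<le> Y n x" for n
      using le[of n]
    proof eventually_elim
      case (elim x)
      have "A * \<Phi> (v n x) \<le> A * (2 powr m * (\<Phi> (v n x - w x) + \<Phi> (w x)))"
        using A Phi_add[of "v n x - w x" "w x"] by (intro mult_left_mono) auto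
      then show ?case using elim by (simp add: Y_def D_def algebra_simps)
    qed
    show "AE x in M. 0 \<le> D x" using B(2) by eventually_elim (simp add: D_def A Phi_nonneg)
    show "AE x in M. (\<lambda>n. Y n x) \<longlonglongrightarrow> D x"
      using ae
    proof eventually_elim
      case (elim x)
      have "(\<lambda>n. v n x - w x) \<longlonglongrightarrow> 0" using tendsto_diff[OF elim tendsto_const[of "w x"]] by simp
      then have "(\<lambda>n. \<Phi> (v n x - w x)) \<longlonglongrightarrow> \<Phi> 0" by (intro continuous_on_tendsto_compose[OF Phi_cont]) auto
      from tendsto_add[OF tendsto_mult[OF tendsto_const[of "A * 2 powr m"] this] tendsto_const[of "D x"]]
      show ?case by (simp add: Y_def)
    qed
  qed
qed

lemma W0_\<rho>_integral: "W0 u g \<Longrightarrow> \<rho> u = ennreal (\<integral>x. \<Phi> (u x) \<partial>M)"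
  "W0 u g \<Longrightarrow> \<rho> (\<lambda>x. norm (g x)) = ennreal (\<integral>x. \<Phi> (norm (g x)) \<partial>M)"
  using \<rho>_eq_integral[of "\<lambda>x. norm (g x)"] \<rho>_eq_integral[of u] W0_measurable W0_finite by auto

text \<open>Compactness along a subsequence for which also the energies of the gradients
  converge.\<close>

lemma W0_extract:
  assumes W: "\<And>n::nat. W0 (u n) (g n)" and D: "\<And>n. (\<integral>x. \<Phi> (norm (g n x)) \<partial>M) \<le> D"
  obtains r v h L where "strict_mono (r :: nat \<Rightarrow> nat)" "W0 v h"
    "AE x in M. (\<lambda>n. u (r n) x) \<longlonglongrightarrow> v x"
    "\<And>e. e > 0 \<Longrightarrow> \<exists>K. \<forall>n\<ge>K. \<rho> (\<lambda>x. u (r n) x - v x) \<le> ennreal e"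
    "(\<lambda>n. \<integral>x. \<Phi> (norm (g (r n) x)) \<partial>M) \<longlonglongrightarrow> L" "(\<integral>x. \<Phi> (norm (h x)) \<partial>M) \<le> L"
proof -
  define a where "a n = (\<integral>x. \<Phi> (norm (g n x)) \<partial>M)" for n
  have a: "0 \<le> a n" "a n \<le> D" "\<rho> (\<lambda>x. norm (g n x)) = ennreal (a n)" for n
    using D W0_\<rho>_integral(2)[OF W] by (auto simp: a_def intro!: integral_nonneg_AE Phi_nonneg)
  have D0: "D \<ge> 0" using a(1)[of 0] a(2)[of 0] by simp
  have "\<exists>L\<in>{0..D}. \<exists>s. strict_mono s \<and> (a \<circ> s) \<longlonglongrightarrow> L"
    using compact_Icc[of 0 D, unfolded compact_def, rule_format, of a] a by simp
  then obtain L s where s: "strict_mono (s :: nat \<Rightarrow> nat)" and L: "(a \<circ> s) \<longlonglongrightarrow> L" by blast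
  have L': "(\<lambda>n. a (s n)) \<longlonglongrightarrow> L" using L by (simp add: o_def)
  have Ws: "W0 (u (s n)) (g (s n))" for n by (rule W)
  have Ds: "\<rho> (\<lambda>x. norm (g (s n) x)) \<le> ennreal D" for n unfolding a(3) using a by (intro ennreal_leI)
  show ?thesis
  proof (rule W0_compact[where u="\<lambda>n. u (s n)" and g="\<lambda>n. g (s n)", OF Ws Ds D0])
    fix r v h
    assume r: "strict_mono (r :: nat \<Rightarrow> nat)" and Wv: "W0 v h"
      and ae: "AE x in M. (\<lambda>n. u (s (r n)) x) \<longlonglongrightarrow> v x"
      and conv: "\<And>e. e > 0 \<Longrightarrow> \<exists>K. \<forall>n\<ge>K. \<rho> (\<lambda>x. u (s (r n)) x - v x) \<le> ennreal e"
      and lsc: "\<And>E K. (\<And>n. n \<ge> K \<Longrightarrow> \<rho> (\<lambda>x. norm (g (s (r n)) x)) \<le> E) \<Longrightarrow> \<rho> (\<lambda>x. norm (h x)) \<le> E"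
    have Lr: "(\<lambda>n. a (s (r n))) \<longlonglongrightarrow> L" by (rule LIMSEQ_subseq[OF r L'])
    show thesis
    proof (rule that[of "\<lambda>n. s (r n)", OF _ Wv ae conv])
      show "strict_mono (\<lambda>n. s (r n))" using strict_mono_o[OF s r] by (simp add: o_def)
      show "(\<lambda>n. \<integral>x. \<Phi> (norm (g (s (r n)) x)) \<partial>M) \<longlonglongrightarrow> L" using Lr by (simp add: a_def)
      show "(\<integral>x. \<Phi> (norm (h x)) \<partial>M) \<le> L"
      proof (rule field_le_epsilon)
        fix e :: real assume e: "e > 0"
        have L0: "L \<ge> 0" by (rule LIMSEQ_le_const[OF Lr]) (use a in auto)
        have "\<forall>\<^sub>F n in sequentially. a (s (r n)) < L + e" using e by (intro order_tendstoD(2)[OF Lr]) simp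
        then obtain K where K: "\<And>n. n \<ge> K \<Longrightarrow> a (s (r n)) < L + e" by (auto simp: eventually_sequentially)
        have "\<rho> (\<lambda>x. norm (h x)) \<le> ennreal (L + e)"
          by (rule lsc[of K]) (unfold a(3), rule ennreal_leI, rule less_imp_le, rule K)
        then show "(\<integral>x. \<Phi> (norm (h x)) \<partial>M) \<le> L + e"
          unfolding W0_\<rho>_integral(2)[OF Wv] using L0 e by (subst (asm) ennreal_le_iff) auto
      qed
    qed
  qed
qed

text \<open>By the intermediate value theorem for \<open>t \<mapsto> \<rho> (t u)\<close> on
  \<open>[0, 1]\<close>.\<close>

lemma W0_normalise:
  assumes W: "W0 u g" and big: "1 \<le> (\<integral>x. \<Phi> (u x) \<partial>M)"
  obtains r where "1 \<le> r" "(\<integral>x. \<Phi> (u x / r) \<partial>M) = 1" "(\<integral>x. \<Phi> (u x) \<partial>M) \<le> r powr m"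
proof -
  note [measurable] = W0_measurable(1)[OF W]
  define I where "I t = (\<integral>x. \<Phi> (t * u x) \<partial>M)" for t
  have "continuous_on {0..1} I"
  proof (rule continuous_on_sequentiallyI)
    fix s t assume s: "\<forall>n. s n \<in> {0..1::real}" and st: "s \<longlonglongrightarrow> t" "t \<in> {0..1}"
    show "(\<lambda>n. I (s n)) \<longlonglongrightarrow> I t"
      unfolding I_def
    proof (rule integral_dominated_convergence)
      show "integrable M (\<lambda>x. \<Phi> (u x))" by (rule W0_Phi_integrable(1)[OF W])
      show "AE x in M. (\<lambda>n. \<Phi> (s n * u x)) \<longlonglongrightarrow> \<Phi> (t * u x)"
        using st by (intro AE_I2 continuous_on_tendsto_compose[OF Phi_cont] tendsto_mult) auto
      show "AE x in M. norm (\<Phi> (s n * u x)) \<le> \<Phi> (u x)" for n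
        using s by (intro AE_I2) (auto simp: Phi_nonneg abs_mult intro!: Phi_mono_abs mult_left_le_one_le)
    qed measurable
  qed
  moreover have "I 0 \<le> 1" "1 \<le> I 1" using big by (auto simp: I_def)
  ultimately obtain t where t: "0 \<le> t" "t \<le> 1" "I t = 1" using IVT'[of I 0 1 1] by auto
  have "t \<noteq> 0" using t(3) by (auto simp: I_def)
  then have t0: "t > 0" using t by simp
  show ?thesis
  proof (rule that[of "1 / t"])
    show "1 \<le> 1 / t" using t t0 by simp
    show "(\<integral>x. \<Phi> (u x / (1 / t)) \<partial>M) = 1" using t(3) by (simp add: I_def mult.commute)
    have "(\<integral>x. \<Phi> (u x) \<partial>M) \<le> (\<integral>x. (1 / t) powr m * \<Phi> (t * u x) \<partial>M)"
    proof (rule integral_mono)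
      show "integrable M (\<lambda>x. \<Phi> (u x))" by (rule W0_Phi_integrable(1)[OF W])
      have "W0 (\<lambda>x. t * u x) (\<lambda>x. t *\<^sub>R g x)" using W0_linear[OF W W, of t 0] by simp
      from W0_Phi_integrable(1)[OF this]
      show "integrable M (\<lambda>x. (1 / t) powr m * \<Phi> (t * u x))" by simp
      show "\<Phi> (u x) \<le> (1 / t) powr m * \<Phi> (t * u x)" for x
        using Phi_scale(2)[of "1 / t" "t * u x"] t t0 by simp
    qed
    also have "\<dots> = (1 / t) powr m" using t(3) by (simp add: I_def)
    finally show "(\<integral>x. \<Phi> (u x) \<partial>M) \<le> (1 / t) powr m" .
  qed
qed

end

context nonlinear_problem
begin

definition potential :: "real^'n \<Rightarrow> real \<Rightarrow> real" where
  "potential x s = F x s + h x * s"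

lemma potential_integrable: "W0 u g \<Longrightarrow> integrable M (\<lambda>x. potential x (u x))"
  unfolding potential_def using F_integrable h_integrable by simp

lemma energy_alt: "W0 u g \<Longrightarrow> energy u g = (\<integral>x. \<Phi> (norm (g x)) \<partial>M) - (\<integral>x. potential x (u x) \<partial>M)"
  unfolding potential_def energy_def using F_integrable h_integrable by simp

text \<open>One bound for all scalings \<open>r \<ge> 1\<close>; the linear term
  \<open>h x * s\<close> is absorbed because \<open>r \<le> r\<^sup>l\<close>. It serves as
  the majorant in both applications of the reverse Fatou lemma.\<close>

lemma potential_bound:
  obtains A' B' where "A' \<ge> 0" "integrable M B'" "AE x in M. B' x \<ge> 0"
    "\<And>x r s. good x \<Longrightarrow> 1 \<le> r \<Longrightarrow> potential x (r * s) \<le> r powr l * (A' * \<Phi> s + B' x)"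
proof -
  obtain H q where q: "q \<ge> 0" and H: "integrable M H" "\<And>x. H x \<ge> 0" and hp: "\<And>x s. \<bar>h x * s\<bar> \<le> H x + q * \<Phi> s"
    by (rule h_pairing) (rule that)
  have P1: "\<Phi> 1 > 0" by (rule Phi_pos) simp
  define A' where "A' = A / \<Phi> 1 + q"
  define B' where "B' x = A + B x + H x" for x
  show ?thesis
  proof (rule that[of A' B'])
    show "A' \<ge> 0" using A_nonneg q P1 by (simp add: A'_def)
    show "integrable M B'" unfolding B'_def using B_int H finite_measure.integrable_const[OF finite_M] by (intro Bochner_Integration.integrable_add) auto
    show "AE x in M. B' x \<ge> 0" using B_nonneg by eventually_elim (use A_nonneg H in \<open>auto simp: B'_def\<close>)
    fix x and r s :: real assume g: "good x" and r: "1 \<le> r"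
    have rl: "1 \<le> r powr l" "r \<le> r powr l"
    proof -
      show "1 \<le> r powr l" using r exponents by (intro ge_one_powr_ge_zero) auto
      have "r powr 1 \<le> r powr l" using r exponents by (intro powr_mono) auto
      then show "r \<le> r powr l" using r by simp
    qed
    have sl: "\<bar>s\<bar> powr l \<le> 1 + \<Phi> s / \<Phi> 1"
    proof (cases "\<bar>s\<bar> \<ge> 1")
      case True
      have "\<bar>s\<bar> powr l * \<Phi> 1 \<le> \<Phi> s" using Phi_ge_powr[OF True] by (simp add: Phi_even)
      then have "\<bar>s\<bar> powr l \<le> \<Phi> s / \<Phi> 1" using P1 by (simp add: field_simps)
      then show ?thesis by simp
    next
      case False
      then have "\<bar>s\<bar> powr l \<le> 1" using exponents by (intro powr_le1) auto
      moreover have "0 \<le> \<Phi> s / \<Phi> 1" using P1 Phi_nonneg[of s] by simp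
      ultimately show ?thesis by simp
    qed
    have "F x (r * s) \<le> A * \<bar>r * s\<bar> powr l + B x" using g by (simp add: good_def)
    also have "\<dots> = r powr l * (A * \<bar>s\<bar> powr l) + B x" using r by (simp add: abs_mult powr_mult)
    also have "\<dots> \<le> r powr l * (A * (1 + \<Phi> s / \<Phi> 1)) + r powr l * B x"
    proof (rule add_mono)
      show "r powr l * (A * \<bar>s\<bar> powr l) \<le> r powr l * (A * (1 + \<Phi> s / \<Phi> 1))"
        using A_nonneg sl by (intro mult_left_mono) auto
      show "B x \<le> r powr l * B x" using g rl mult_right_mono[of 1 "r powr l" "B x"] by (simp add: good_def)
    qed
    finally have 1: "F x (r * s) \<le> r powr l * (A * (1 + \<Phi> s / \<Phi> 1)) + r powr l * B x" .
    have "h x * (r * s) \<le> r * \<bar>h x * s\<bar>" using r abs_ge_self[of "h x * s"] by (simp add: mult.left_commute)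
    also have "\<dots> \<le> r powr l * (H x + q * \<Phi> s)" using rl r hp by (intro mult_mono) auto
    finally have "h x * (r * s) \<le> r powr l * (H x + q * \<Phi> s)" .
    with 1 have "potential x (r * s) \<le> r powr l * (A * (1 + \<Phi> s / \<Phi> 1)) + r powr l * B x + r powr l * (H x + q * \<Phi> s)"
      unfolding potential_def by linarith
    also have "\<dots> = r powr l * (A' * \<Phi> s + B' x)" by (simp add: A'_def B'_def field_simps)
    finally show "potential x (r * s) \<le> r powr l * (A' * \<Phi> s + B' x)" .
  qed
qed

lemma potential_cont: "good x \<Longrightarrow> continuous_on UNIV (potential x)"
  unfolding potential_def by (intro continuous_intros F_cont)

text \<open>Where \<open>w \<noteq> 0\<close> the arguments \<open>r\<^sub>n v\<^sub>n\<close>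
  tend to infinity and the definition of the upper limit applies; where \<open>w = 0\<close>
  they may stay bounded, and the upper bound on \<open>F\<close> takes its place. The contribution
  of \<open>h\<close> is of lower order since \<open>l > 1\<close>.\<close>

lemma scaled_potential_limsup:
  assumes g: "good x" and r: "filterlim r at_top sequentially" "\<And>n. 1 \<le> r n" and v: "v \<longlonglongrightarrow> w"
  shows "limsup (\<lambda>n. ereal (potential x (r n * v n) / r n powr l))
    \<le> (if w \<noteq> 0 then Limsup at_infinity (\<lambda>s. ereal (F x s / \<bar>s\<bar> powr l)) * ereal (\<bar>w\<bar> powr l) else 0)"
proof -
  have l1: "l > 1" using exponents by simp
  have rpos: "r n > 0" for n using r(2)[of n] by linarith
  have rl: "(\<lambda>n. r n powr - l) \<longlonglongrightarrow> 0" "(\<lambda>n. r n powr (1 - l)) \<longlonglongrightarrow> 0"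
    using l1 by (auto intro!: tendsto_neg_powr[OF _ r(1)] tendsto_neg_powr[of "1 - l", OF _ r(1)])
  have hl: "(\<lambda>n. r n powr (1 - l) * (h x * v n)) \<longlonglongrightarrow> 0"
    using tendsto_mult[OF rl(2) tendsto_mult[OF tendsto_const[of "h x"] v]] by simp
  have vl: "(\<lambda>n. \<bar>v n\<bar> powr l) \<longlonglongrightarrow> \<bar>w\<bar> powr l"
    using l1 by (intro tendsto_powr2[OF tendsto_rabs[OF v] tendsto_const]) (auto intro!: always_eventually)
  have split: "potential x (r n * v n) / r n powr l = F x (r n * v n) * r n powr - l + r n powr (1 - l) * (h x * v n)" for n
    using rpos[of n] by (simp add: potential_def powr_diff powr_minus field_simps)
  show ?thesis
  proof (cases "w = 0")
    case True
    have lim: "(\<lambda>n. A * \<bar>v n\<bar> powr l + B x * r n powr - l + r n powr (1 - l) * (h x * v n)) \<longlonglongrightarrow> A * \<bar>w\<bar> powr l + B x * 0 + 0"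
      by (intro tendsto_add tendsto_mult tendsto_const vl rl hl)
    have le: "potential x (r n * v n) / r n powr l \<le> A * \<bar>v n\<bar> powr l + B x * r n powr - l + r n powr (1 - l) * (h x * v n)" for n
    proof -
      have "F x (r n * v n) \<le> A * \<bar>r n * v n\<bar> powr l + B x" using g by (simp add: good_def)
      then have "F x (r n * v n) * r n powr - l \<le> (A * \<bar>r n * v n\<bar> powr l + B x) * r n powr - l"
        by (rule mult_right_mono) simp
      also have "\<dots> = A * \<bar>v n\<bar> powr l + B x * r n powr - l"
        using rpos[of n] by (simp add: abs_mult powr_mult powr_minus field_simps)
      finally show ?thesis unfolding split by simp
    qed
    have "limsup (\<lambda>n. ereal (potential x (r n * v n) / r n powr l))
      \<le> limsup (\<lambda>n. ereal (A * \<bar>v n\<bar> powr l + B x * r n powr - l + r n powr (1 - l) * (h x * v n)))"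
      by (intro Limsup_mono always_eventually allI) (use le in simp)
    also have "\<dots> = ereal (A * \<bar>w\<bar> powr l + B x * 0 + 0)"
      by (rule lim_imp_Limsup[OF _ tendsto_ereal[OF lim]]) simp
    finally show ?thesis using True by (simp add: zero_ereal_def)
  next
    case False
    define \<Lambda> where "\<Lambda> = Limsup at_infinity (\<lambda>s. ereal (F x s / \<bar>s\<bar> powr l))"
    have wl: "\<bar>w\<bar> powr l > 0" using False by simp
    have "limsup (\<lambda>n. ereal (potential x (r n * v n) / r n powr l)) \<le> \<Lambda> * ereal (\<bar>w\<bar> powr l)"
      unfolding Limsup_le_iff
    proof (intro allI impI)
      fix y assume y: "\<Lambda> * ereal (\<bar>w\<bar> powr l) < y"
      obtain y' where y': "\<Lambda> * ereal (\<bar>w\<bar> powr l) < ereal y'" "ereal y' < y" using ereal_dense2[OF y] by blast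
      have "\<Lambda> < ereal (y' / \<bar>w\<bar> powr l)"
        using y'(1) wl by (cases \<Lambda>) (auto simp: field_simps)
      then obtain \<alpha> where \<alpha>: "\<Lambda> < ereal \<alpha>" "ereal \<alpha> < ereal (y' / \<bar>w\<bar> powr l)" using ereal_dense2 by blast
      have \<alpha>y: "\<alpha> * \<bar>w\<bar> powr l < y'" using \<alpha>(2) wl by (simp add: field_simps)
      have inf: "filterlim (\<lambda>n. r n * v n) at_infinity sequentially"
        using tendsto_mult_filterlim_at_infinity[OF v False filterlim_at_top_imp_at_infinity[OF r(1)]]
        by (simp only: mult.commute)
      have "\<forall>\<^sub>F s in at_infinity. ereal (F x s / \<bar>s\<bar> powr l) < ereal \<alpha>"
        using \<alpha>(1) unfolding \<Lambda>_def by (rule Limsup_lessD)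
      from eventually_compose_filterlim[OF this inf]
      have 1: "\<forall>\<^sub>F n in sequentially. F x (r n * v n) / \<bar>r n * v n\<bar> powr l < \<alpha>" by simp
      have 2: "\<forall>\<^sub>F n in sequentially. v n \<noteq> 0" by (rule tendsto_imp_eventually_ne[OF v False])
      have "(\<lambda>n. \<alpha> * \<bar>v n\<bar> powr l + r n powr (1 - l) * (h x * v n)) \<longlonglongrightarrow> \<alpha> * \<bar>w\<bar> powr l + 0"
        by (intro tendsto_add tendsto_mult tendsto_const vl hl)
      then have 3: "\<forall>\<^sub>F n in sequentially. \<alpha> * \<bar>v n\<bar> powr l + r n powr (1 - l) * (h x * v n) < y'"
        by (rule order_tendstoD(2)) (use \<alpha>y in simp)
      from 1 2 3 have "\<forall>\<^sub>F n in sequentially. potential x (r n * v n) / r n powr l < y'"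
      proof eventually_elim
        case (elim n)
        have "F x (r n * v n) * r n powr - l = F x (r n * v n) / \<bar>r n * v n\<bar> powr l * \<bar>v n\<bar> powr l"
          using elim(2) rpos[of n] by (simp add: abs_mult powr_mult powr_minus field_simps)
        also have "\<dots> \<le> \<alpha> * \<bar>v n\<bar> powr l" using elim(1) by (intro mult_right_mono) auto
        finally show ?case unfolding split using elim(3) by simp
      qed
      then show "\<forall>\<^sub>F n in sequentially. ereal (potential x (r n * v n) / r n powr l) < y"
        by eventually_elim (rule less_trans[OF _ y'(2)], simp)
    qed
    then show ?thesis using False by (simp add: \<Lambda>_def)
  qed
qed

definition nonresonant :: bool where
  "nonresonant \<longleftrightarrow> (INF v\<in>{v \<in> sobolev_orlicz0 \<Omega> \<Phi>. luxemburg_norm \<Omega> \<Phi> v = 1}.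
     enn2ereal (\<integral>\<^sup>+x. ennreal (\<Phi> (norm (weak_grad \<Omega> v x))) \<partial>M)
     - ereal_integral (lebesgue_on {x \<in> \<Omega>. v x \<noteq> 0})
        (\<lambda>x. Limsup at_infinity (\<lambda>s. ereal (F x s / \<bar>s\<bar> powr l)) * ereal (\<bar>v x\<bar> powr l))) > 0"

lemma nonresonantD:
  assumes nr: nonresonant and W: "W0 v g" and 1: "(\<integral>x. \<Phi> (v x) \<partial>M) = 1"
  shows "ereal_integral M (\<lambda>x. if v x \<noteq> 0 then Limsup at_infinity (\<lambda>s. ereal (F x s / \<bar>s\<bar> powr l)) * ereal (\<bar>v x\<bar> powr l) else 0)
    < ereal (\<integral>x. \<Phi> (norm (g x)) \<partial>M)"
proof -
  let ?w = "\<lambda>x. Limsup at_infinity (\<lambda>s. ereal (F x s / \<bar>s\<bar> powr l)) * ereal (\<bar>v x\<bar> powr l)"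
  let ?E = "ereal_integral (lebesgue_on {x \<in> \<Omega>. v x \<noteq> 0}) ?w"
  note [measurable] = W0_measurable[OF W]
  have "\<rho> v = 1" using W0_\<rho>_integral(1)[OF W] 1 by simp
  then have "luxemburg_norm \<Omega> \<Phi> v = 1" by (rule luxemburg_eq_1[rotated]) measurable
  then have "v \<in> {v \<in> sobolev_orlicz0 \<Omega> \<Phi>. luxemburg_norm \<Omega> \<Phi> v = 1}" using W0_imp_sobolev_orlicz0[OF W] by simp
  with nr have pos: "0 < enn2ereal (\<integral>\<^sup>+x. ennreal (\<Phi> (norm (weak_grad \<Omega> v x))) \<partial>M) - ?E"
    unfolding nonresonant_def by (rule less_le_trans[OF _ INF_lower])
  have "(\<integral>\<^sup>+x. ennreal (\<Phi> (norm (weak_grad \<Omega> v x))) \<partial>M) = \<rho> (\<lambda>x. norm (g x))"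
    unfolding \<rho>_def by (rule nn_integral_cong_AE) (use W0_weak_grad[OF W] in \<open>eventually_elim, simp\<close>)
  also have "enn2ereal \<dots> = ereal (\<integral>x. \<Phi> (norm (g x)) \<partial>M)"
    unfolding W0_\<rho>_integral(2)[OF W] by (intro enn2ereal_ennreal integral_nonneg_AE) (auto simp: Phi_nonneg)
  finally have "?E < ereal (\<integral>x. \<Phi> (norm (g x)) \<partial>M)" using pos by (cases ?E) auto
  moreover have "?E = ereal_integral M (\<lambda>x. if v x \<noteq> 0 then ?w x else 0)"
  proof -
    have "{x \<in> space M. v x \<noteq> 0} \<in> sets M" by measurable
    then have "{x \<in> \<Omega>. v x \<noteq> 0} \<in> sets lebesgue" using sets_restrict_space_iff[of \<Omega> lebesgue] \<Omega>_sets by simp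
    then have "?E = ereal_integral M (\<lambda>x. if x \<in> {x \<in> \<Omega>. v x \<noteq> 0} then ?w x else 0)"
      by (intro ereal_integral_restrict \<Omega>_sets) auto
    also have "\<dots> = ereal_integral M (\<lambda>x. if v x \<noteq> 0 then ?w x else 0)"
      by (intro ereal_integral_cong_AE AE_I2) simp
    finally show ?thesis .
  qed
  ultimately show ?thesis by simp
qed

text \<open>The limit \<open>w\<close> of the normalised sequence has modular \<open>1\<close>,
  and the scaled energy inequality passes to the limit as
  \<open>\<integral> \<Phi>(|\<nabla>w|) \<le> \<integral> A\<^sub>\<infinity> |w|\<^sup>l\<close>,
  against nonresonance.\<close>

lemma blow_up_contradiction:
  assumes nr: nonresonant
    and W: "\<And>n::nat. W0 (v n) (g n)" and one: "\<And>n. (\<integral>x. \<Phi> (v n x) \<partial>M) = 1"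
    and r: "filterlim r at_top sequentially" "\<And>n. 1 \<le> r n"
    and le: "\<And>n. (\<integral>x. \<Phi> (norm (g n x)) \<partial>M) \<le> r n powr - l * C + (\<integral>x. potential x (r n * v n x) / r n powr l \<partial>M)"
    and C: "C \<ge> 0"
  shows False
proof -
  obtain A' B' where A': "A' \<ge> 0" and B': "integrable M B'" "AE x in M. B' x \<ge> 0"
    and bd: "\<And>x r s. good x \<Longrightarrow> 1 \<le> r \<Longrightarrow> potential x (r * s) \<le> r powr l * (A' * \<Phi> s + B' x)"
    by (rule potential_bound) (rule that)
  define X where "X n x = potential x (r n * v n x) / r n powr l" for n x
  have rpos: "r n > 0" for n using r(2)[of n] by linarith
  have X_le: "AE x in M. X n x \<le> A' * \<Phi> (v n x) + B' x" for n
    using good_AE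
  proof eventually_elim
    case (elim x)
    show ?case using bd[OF elim r(2), of n "v n x"] rpos[of n] by (simp add: X_def field_simps)
  qed
  have Wr: "W0 (\<lambda>x. r n * v n x) (\<lambda>x. r n *\<^sub>R g n x)" for n using W0_linear[OF W W, of "r n" n 0 n] by simp
  have iX: "integrable M (X n)" for n unfolding X_def using potential_integrable[OF Wr] by simp
  have iv: "integrable M (\<lambda>x. \<Phi> (v n x))" for n by (rule W0_Phi_integrable(1)[OF W])
  have rl1: "r n powr - l \<le> 1" for n using r(2)[of n] rpos[of n] exponents powr_mono[of "- l" 0 "r n"] by simp
  have "(\<integral>x. \<Phi> (norm (g n x)) \<partial>M) \<le> C + (A' + (\<integral>x. B' x \<partial>M))" for n
  proof -
    have "(\<integral>x. X n x \<partial>M) \<le> (\<integral>x. A' * \<Phi> (v n x) + B' x \<partial>M)" using iX iv B' X_le by (intro integral_mono_AE) auto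
    also have "\<dots> = A' + (\<integral>x. B' x \<partial>M)" using iv B' one by simp
    finally show ?thesis using le[of n] mult_right_mono[OF rl1[of n] C] by (simp add: X_def)
  qed
  then obtain s w k L where s: "strict_mono (s :: nat \<Rightarrow> nat)" and Ww: "W0 w k"
    and ae: "AE x in M. (\<lambda>n. v (s n) x) \<longlonglongrightarrow> w x"
    and conv: "\<And>e. e > 0 \<Longrightarrow> \<exists>K. \<forall>n\<ge>K. \<rho> (\<lambda>x. v (s n) x - w x) \<le> ennreal e"
    and L: "(\<lambda>n. \<integral>x. \<Phi> (norm (g (s n) x)) \<partial>M) \<longlonglongrightarrow> L" and kL: "(\<integral>x. \<Phi> (norm (k x)) \<partial>M) \<le> L"
    by (rule W0_extract[OF W]) (rule that)
  note [measurable] = W0_measurable(1)[OF W] W0_measurable(1)[OF Ww]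
  have rs: "filterlim (\<lambda>n. r (s n)) at_top sequentially"
    by (rule filterlim_compose[OF r(1) filterlim_subseq[OF s]])
  have fin: "\<rho> (\<lambda>x. v (s n) x - w x) < \<infinity>" for n by (rule W0_finite(1)[OF W0_diff[OF W Ww]])
  have lower: "ereal \<gamma>' \<le> ereal_integral M (\<lambda>x. limsup (\<lambda>n. ereal (Y n x)))"
    if "\<And>n. integrable M (Y n)" "\<alpha> \<ge> 0" "integrable M \<beta>" "AE x in M. \<beta> x \<ge> 0" "\<And>n. AE x in M. Y n x \<le> \<alpha> * \<Phi> (v (s n) x) + \<beta> x"
      "\<And>n. \<gamma> n \<le> (\<integral>x. Y n x \<partial>M)" "\<gamma> \<longlonglongrightarrow> \<gamma>'" for Y \<alpha> \<beta> \<gamma> \<gamma>'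
    by (rule reverse_fatou_\<rho>[OF _ _ fin W0_finite(1)[OF Ww] ae conv that]) auto
  \<comment> \<open>Fatou's lemma gives at most \<open>1\<close>, the reverse Fatou lemma at least \<open>1\<close>.\<close>
  have w1: "(\<integral>x. \<Phi> (w x) \<partial>M) = 1"
  proof (rule antisym)
    have "ereal 1 \<le> ereal_integral M (\<lambda>x. limsup (\<lambda>n. ereal (\<Phi> (v (s n) x))))"
      by (rule lower[of _ 1 "\<lambda>_. 0" "\<lambda>_. 1"]) (use iv one in auto)
    also have "\<dots> = ereal_integral M (\<lambda>x. ereal (\<Phi> (w x)))"
    proof (rule ereal_integral_cong_AE, use ae in eventually_elim)
      fix x assume "(\<lambda>n. v (s n) x) \<longlonglongrightarrow> w x"
      then have "(\<lambda>n. \<Phi> (v (s n) x)) \<longlonglongrightarrow> \<Phi> (w x)" by (intro continuous_on_tendsto_compose[OF Phi_cont]) auto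
      then show "limsup (\<lambda>n. ereal (\<Phi> (v (s n) x))) = ereal (\<Phi> (w x))" by (intro lim_imp_Limsup tendsto_ereal) auto
    qed
    also have "\<dots> = ereal (\<integral>x. \<Phi> (w x) \<partial>M)" by (rule ereal_integral_real[OF W0_Phi_integrable(1)[OF Ww]])
    finally show "1 \<le> (\<integral>x. \<Phi> (w x) \<partial>M)" by simp
    have "\<rho> (\<lambda>x. norm (w x)) \<le> ennreal 1"
      by (rule \<rho>_liminf[where K=0, OF _ _ ae]) (auto simp: \<rho>_abs W0_\<rho>_integral(1)[OF W] one)
    then show "(\<integral>x. \<Phi> (w x) \<partial>M) \<le> 1"
      using W0_\<rho>_integral(1)[OF Ww] by (simp add: \<rho>_abs flip: ennreal_1)
  qed
  \<comment> \<open>lower bounds, converging to \<open>L\<close>, for the integrals of the scaled potential\<close>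
  define \<gamma> where "\<gamma> n = (\<integral>x. \<Phi> (norm (g (s n) x)) \<partial>M) - r (s n) powr - l * C" for n
  have "(\<lambda>n. r (s n) powr - l) \<longlonglongrightarrow> 0" using exponents by (intro tendsto_neg_powr[OF _ rs]) auto
  from tendsto_diff[OF L tendsto_mult[OF this tendsto_const[of C]]]
  have \<gamma>: "\<gamma> \<longlonglongrightarrow> L" unfolding \<gamma>_def by simp
  have "ereal L \<le> ereal_integral M (\<lambda>x. limsup (\<lambda>n. ereal (X (s n) x)))"
    by (rule lower[OF iX A' B' X_le _ \<gamma>]) (use le in \<open>auto simp: \<gamma>_def X_def algebra_simps\<close>)
  also have "\<dots> \<le> ereal_integral M (\<lambda>x. if w x \<noteq> 0 then Limsup at_infinity (\<lambda>s. ereal (F x s / \<bar>s\<bar> powr l)) * ereal (\<bar>w x\<bar> powr l) else 0)"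
    unfolding X_def
  proof (rule ereal_integral_mono_AE, use ae good_AE in eventually_elim)
    fix x assume x: "(\<lambda>n. v (s n) x) \<longlonglongrightarrow> w x" "good x"
    show "limsup (\<lambda>n. ereal (potential x (r (s n) * v (s n) x) / r (s n) powr l))
      \<le> (if w x \<noteq> 0 then Limsup at_infinity (\<lambda>s. ereal (F x s / \<bar>s\<bar> powr l)) * ereal (\<bar>w x\<bar> powr l) else 0)"
      by (rule scaled_potential_limsup[OF x(2) rs r(2) x(1)])
  qed
  also have "\<dots> < ereal (\<integral>x. \<Phi> (norm (k x)) \<partial>M)" by (rule nonresonantD[OF nr Ww w1])
  also have "\<dots> \<le> ereal L" using kL by simp
  finally show False by simp
qed

lemma coercive:
  assumes nr: nonresonant
  obtains R where "R \<ge> 0" "\<And>u g. W0 u g \<Longrightarrow> energy u g \<le> C \<Longrightarrow> (\<integral>x. \<Phi> (u x) \<partial>M) \<le> R"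
proof (rule ccontr)
  assume "\<not> thesis"
  then have "\<not> (\<exists>R\<ge>0. \<forall>u g. W0 u g \<longrightarrow> energy u g \<le> C \<longrightarrow> (\<integral>x. \<Phi> (u x) \<partial>M) \<le> R)" using that by blast
  then have no: "\<exists>u g. W0 u g \<and> energy u g \<le> C \<and> R < (\<integral>x. \<Phi> (u x) \<partial>M)" if "R \<ge> 0" for R
    using that by (meson not_le)
  have "\<exists>u v g r. W0 u (\<lambda>x. r *\<^sub>R g x) \<and> energy u (\<lambda>x. r *\<^sub>R g x) \<le> C \<and> W0 v g \<and> (\<integral>x. \<Phi> (v x) \<partial>M) = 1 \<and> 1 \<le> r
    \<and> real n powr (1 / m) \<le> r \<and> u = (\<lambda>x. r * v x)" for n :: nat
  proof -
    obtain u g where u: "W0 u g" "energy u g \<le> C" "real n + 1 < (\<integral>x. \<Phi> (u x) \<partial>M)" using no[of "real n + 1"] by auto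
    obtain r where r: "1 \<le> r" "(\<integral>x. \<Phi> (u x / r) \<partial>M) = 1" "(\<integral>x. \<Phi> (u x) \<partial>M) \<le> r powr m"
      by (rule W0_normalise[OF u(1)]) (use u(3) in simp, rule that)
    have "W0 (\<lambda>x. u x / r) (\<lambda>x. (1 / r) *\<^sub>R g x)" using W0_linear[OF u(1) u(1), of "1 / r" 0] by simp
    moreover have "(\<lambda>x. r *\<^sub>R ((1 / r) *\<^sub>R g x)) = g" "(\<lambda>x. r * (u x / r)) = u" using r by (auto simp: fun_eq_iff)
    moreover have "real n powr (1 / m) \<le> r"
    proof -
      have "real n powr (1 / m) \<le> (r powr m) powr (1 / m)" using u(3) r(3) exponents by (intro powr_mono2) auto
      also have "\<dots> = r" using r exponents by (simp add: powr_powr)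
      finally show ?thesis .
    qed
    ultimately show ?thesis using u r
      by (intro exI[of _ u] exI[of _ "\<lambda>x. u x / r"] exI[of _ "\<lambda>x. (1 / r) *\<^sub>R g x"] exI[of _ r]) simp
  qed
  then have "\<forall>n. \<exists>q. W0 (\<lambda>x. fst q * fst (snd q) x) (\<lambda>x. fst q *\<^sub>R snd (snd q) x) \<and> energy (\<lambda>x. fst q * fst (snd q) x) (\<lambda>x. fst q *\<^sub>R snd (snd q) x) \<le> C
    \<and> W0 (fst (snd q)) (snd (snd q)) \<and> (\<integral>x. \<Phi> (fst (snd q) x) \<partial>M) = 1 \<and> 1 \<le> fst q \<and> real n powr (1 / m) \<le> fst q"
    by (metis fst_conv snd_conv)
  from choice[OF this] obtain z where z: "\<And>n. W0 (\<lambda>x. fst (z n) * fst (snd (z n)) x) (\<lambda>x. fst (z n) *\<^sub>R snd (snd (z n)) x)"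
    "\<And>n. energy (\<lambda>x. fst (z n) * fst (snd (z n)) x) (\<lambda>x. fst (z n) *\<^sub>R snd (snd (z n)) x) \<le> C"
    "\<And>n. W0 (fst (snd (z n))) (snd (snd (z n)))" "\<And>n. (\<integral>x. \<Phi> (fst (snd (z n)) x) \<partial>M) = 1" "\<And>n. 1 \<le> fst (z n)" "\<And>n::nat. real n powr (1 / m) \<le> fst (z n)"
    by blast
  define r where "r n = fst (z n)" for n
  define v where "v n = fst (snd (z n))" for n
  define g where "g n = snd (snd (z n))" for n
  note Wu = z(1)[folded r_def v_def g_def] and en = z(2)[folded r_def v_def g_def] and Wv = z(3)[folded v_def g_def]
    and one = z(4)[folded v_def] and r1 = z(5)[folded r_def] and rn = z(6)[folded r_def]
  have rpos: "r n > 0" for n using r1[of n] by linarith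
  have "filterlim (\<lambda>n. real n powr (1 / m)) at_top sequentially"
    unfolding filterlim_at_top
  proof
    fix Z :: real
    have "\<forall>\<^sub>F n in sequentially. max 0 Z powr m \<le> real n"
      using filterlim_real_sequentially by (simp add: filterlim_at_top)
    then show "\<forall>\<^sub>F n in sequentially. Z \<le> real n powr (1 / m)"
    proof eventually_elim
      case (elim n)
      have "max 0 Z = (max 0 Z powr m) powr (1 / m)" using exponents by (simp add: powr_powr)
      also have "\<dots> \<le> real n powr (1 / m)" using elim exponents by (intro powr_mono2) auto
      finally show ?case by simp
    qed
  qed
  then have r: "filterlim r at_top sequentially" by (rule filterlim_at_top_mono) (use rn in auto)
  show False
  proof (rule blow_up_contradiction[OF nr Wv one r r1])
    fix n
    have iF: "integrable M (\<lambda>x. potential x (r n * v n x))" by (rule potential_integrable[OF Wu])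
    have rl: "r n powr l * r n powr - l = 1" using rpos[of n] by (simp add: powr_minus)
    have "(\<integral>x. \<Phi> (norm (g n x)) \<partial>M) \<le> (\<integral>x. r n powr - l * \<Phi> (norm (r n *\<^sub>R g n x)) \<partial>M)"
    proof (rule integral_mono[OF W0_Phi_integrable(2)[OF Wv]])
      show "integrable M (\<lambda>x. r n powr - l * \<Phi> (norm (r n *\<^sub>R g n x)))" using W0_Phi_integrable(2)[OF Wu[of n]] by simp
      fix x
      have "r n powr l * \<Phi> (norm (g n x)) \<le> \<Phi> (norm (r n *\<^sub>R g n x))" using Phi_scale(1)[OF r1[of n], of "norm (g n x)"] rpos[of n] by simp
      from mult_left_mono[OF this, of "r n powr - l"] rl
      show "\<Phi> (norm (g n x)) \<le> r n powr - l * \<Phi> (norm (r n *\<^sub>R g n x))" by (simp add: mult.assoc[symmetric] mult.commute)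
    qed
    also have "\<dots> = r n powr - l * (\<integral>x. \<Phi> (norm (r n *\<^sub>R g n x)) \<partial>M)" by simp
    also have "\<dots> \<le> r n powr - l * (\<bar>C\<bar> + (\<integral>x. potential x (r n * v n x) \<partial>M))"
      using en[of n] energy_alt[OF Wu[of n]] by (intro mult_left_mono) auto
    also have "\<dots> = r n powr - l * \<bar>C\<bar> + (\<integral>x. potential x (r n * v n x) / r n powr l \<partial>M)"
      by (simp add: powr_minus add_divide_distrib divide_inverse_commute distrib_left)
    finally show "(\<integral>x. \<Phi> (norm (g n x)) \<partial>M) \<le> r n powr - l * \<bar>C\<bar> + (\<integral>x. potential x (r n * v n x) / r n powr l \<partial>M)" .
  qed simp
qed

text \<open>The direct method. Coercivity bounds \<open>\<rho> u\<close>, and then the energy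
  itself bounds the gradients along a minimising sequence.\<close>

theorem minimiser_exists:
  assumes nr: nonresonant
  obtains u g where "W0 u g" "\<And>v k. W0 v k \<Longrightarrow> energy u g \<le> energy v k"
proof -
  obtain A' B' where A': "A' \<ge> 0" and B': "integrable M B'" "AE x in M. B' x \<ge> 0"
    and bd: "\<And>x r s. good x \<Longrightarrow> 1 \<le> r \<Longrightarrow> potential x (r * s) \<le> r powr l * (A' * \<Phi> s + B' x)"
    by (rule potential_bound) (rule that)
  have F_le: "AE x in M. potential x (s x) \<le> A' * \<Phi> (s x) + B' x" for s
    using good_AE by eventually_elim (use bd[of _ 1] in auto)
  have IF: "(\<integral>x. potential x (u x) \<partial>M) \<le> A' * (\<integral>x. \<Phi> (u x) \<partial>M) + (\<integral>x. B' x \<partial>M)" if W: "W0 u g" for u g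
  proof -
    have "(\<integral>x. potential x (u x) \<partial>M) \<le> (\<integral>x. A' * \<Phi> (u x) + B' x \<partial>M)"
      using potential_integrable[OF W] W0_Phi_integrable(1)[OF W] B' F_le by (intro integral_mono_AE) auto
    then show ?thesis using W0_Phi_integrable(1)[OF W] B' by simp
  qed
  have bound: "\<exists>D. \<forall>u g. W0 u g \<longrightarrow> energy u g \<le> C \<longrightarrow> (\<integral>x. \<Phi> (norm (g x)) \<partial>M) - energy u g \<le> D" for C
  proof -
    obtain R where R: "R \<ge> 0" "\<And>u g. W0 u g \<Longrightarrow> energy u g \<le> C \<Longrightarrow> (\<integral>x. \<Phi> (u x) \<partial>M) \<le> R"
      by (rule coercive[OF nr, of C]) (rule that)
    have "(\<integral>x. \<Phi> (norm (g x)) \<partial>M) - energy u g \<le> A' * R + (\<integral>x. B' x \<partial>M)" if W: "W0 u g" and le: "energy u g \<le> C" for u g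
      using IF[OF W] energy_alt[OF W] mult_left_mono[OF R(2)[OF W le] A'] by simp
    then show ?thesis by blast
  qed
  define E where "E = {energy u g | u g. W0 u g}"
  have "E \<noteq> {}" using W0_test[OF zero_test_function] by (auto simp: E_def)
  have P0: "0 \<le> (\<integral>x. \<Phi> (norm (g x)) \<partial>M)" for g :: "real^'n \<Rightarrow> real^'n" by (intro integral_nonneg_AE) (auto simp: Phi_nonneg)
  have "bdd_below E"
  proof -
    obtain D where D: "\<And>u g. W0 u g \<Longrightarrow> energy u g \<le> 0 \<Longrightarrow> (\<integral>x. \<Phi> (norm (g x)) \<partial>M) - energy u g \<le> D" using bound[of 0] by blast
    have "- \<bar>D\<bar> \<le> energy u g" if W: "W0 u g" for u g
    proof (cases "energy u g \<le> 0")
      case True then show ?thesis using D[OF W True] P0[of g] by linarith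
    qed simp
    then show ?thesis by (intro bdd_belowI[of _ "- \<bar>D\<bar>"]) (auto simp: E_def)
  qed
  define I where "I = Inf E"
  have I_le: "I \<le> energy v k" if "W0 v k" for v k
    unfolding I_def using that by (intro cInf_lower \<open>bdd_below E\<close>) (auto simp: E_def)
  have "\<exists>q. W0 (fst q) (snd q) \<and> energy (fst q) (snd q) < I + 1 / real (Suc n)" for n
  proof -
    have "Inf E < I + 1 / real (Suc n)" by (simp add: I_def)
    then obtain y where "y \<in> E" "y < I + 1 / real (Suc n)" using cInf_lessD[OF \<open>E \<noteq> {}\<close>] by blast
    then show ?thesis by (auto simp: E_def)
  qed
  then have "\<forall>n. \<exists>q. W0 (fst q) (snd q) \<and> energy (fst q) (snd q) < I + 1 / real (Suc n)" by simp
  from choice[OF this] obtain z where z: "\<And>n. W0 (fst (z n)) (snd (z n))" "\<And>n. energy (fst (z n)) (snd (z n)) < I + 1 / real (Suc n)" by blast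
  define u where "u n = fst (z n)" for n
  define g where "g n = snd (z n)" for n
  have W: "W0 (u n) (g n)" and en: "energy (u n) (g n) < I + 1 / real (Suc n)" for n using z by (auto simp: u_def g_def)
  have en1: "energy (u n) (g n) \<le> I + 1" for n
  proof -
    have "1 / real (Suc n) \<le> 1" by simp
    then show ?thesis using en[of n] by linarith
  qed
  obtain D where D: "\<And>u g. W0 u g \<Longrightarrow> energy u g \<le> I + 1 \<Longrightarrow> (\<integral>x. \<Phi> (norm (g x)) \<partial>M) - energy u g \<le> D" using bound[of "I + 1"] by blast
  have "(\<integral>x. \<Phi> (norm (g n x)) \<partial>M) \<le> I + 1 + D" for n using D[OF W en1, of n] en1[of n] by linarith
  then obtain s w k L where s: "strict_mono (s :: nat \<Rightarrow> nat)" and Ww: "W0 w k"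
    and ae: "AE x in M. (\<lambda>n. u (s n) x) \<longlonglongrightarrow> w x"
    and conv: "\<And>e. e > 0 \<Longrightarrow> \<exists>K. \<forall>n\<ge>K. \<rho> (\<lambda>x. u (s n) x - w x) \<le> ennreal e"
    and L: "(\<lambda>n. \<integral>x. \<Phi> (norm (g (s n) x)) \<partial>M) \<longlonglongrightarrow> L" and kL: "(\<integral>x. \<Phi> (norm (k x)) \<partial>M) \<le> L"
    by (rule W0_extract[OF W]) (rule that)
  note [measurable] = W0_measurable(1)[OF W] W0_measurable(1)[OF Ww]
  \<comment> \<open>lower bounds for the integrals of the potential that express near-minimality\<close>
  define \<gamma> where "\<gamma> n = (\<integral>x. \<Phi> (norm (g (s n) x)) \<partial>M) - (I + 1 / real (Suc (s n)))" for n
  have "(\<lambda>n. 1 / real (Suc (s n))) \<longlonglongrightarrow> 0" by (rule LIMSEQ_subseq[OF s LIMSEQ_Suc[OF lim_1_over_n]])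
  from tendsto_diff[OF L tendsto_add[OF tendsto_const[of I] this]] have \<gamma>: "\<gamma> \<longlonglongrightarrow> L - I" unfolding \<gamma>_def by simp
  have "ereal (L - I) \<le> ereal_integral M (\<lambda>x. limsup (\<lambda>n. ereal (potential x (u (s n) x))))"
  proof (rule reverse_fatou_\<rho>[OF _ _ _ W0_finite(1)[OF Ww] ae conv potential_integrable[OF W] A' B' F_le _ \<gamma>])
    show "\<rho> (\<lambda>x. u (s n) x - w x) < \<infinity>" for n by (rule W0_finite(1)[OF W0_diff[OF W Ww]])
    show "\<gamma> n \<le> (\<integral>x. potential x (u (s n) x) \<partial>M)" for n using en[of "s n"] energy_alt[OF W, of "s n"] by (simp add: \<gamma>_def)
  qed auto
  also have "\<dots> = ereal_integral M (\<lambda>x. ereal (potential x (w x)))"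
  proof (rule ereal_integral_cong_AE, use ae good_AE in eventually_elim)
    fix x assume x: "(\<lambda>n. u (s n) x) \<longlonglongrightarrow> w x" "good x"
    have "(\<lambda>n. potential x (u (s n) x)) \<longlonglongrightarrow> potential x (w x)" by (rule continuous_on_tendsto_compose[OF potential_cont[OF x(2)] x(1)]) auto
    then show "limsup (\<lambda>n. ereal (potential x (u (s n) x))) = ereal (potential x (w x))" by (intro lim_imp_Limsup tendsto_ereal) auto
  qed
  also have "\<dots> = ereal (\<integral>x. potential x (w x) \<partial>M)" by (rule ereal_integral_real[OF potential_integrable[OF Ww]])
  finally have "energy w k \<le> I" using energy_alt[OF Ww] kL by simp
  then show ?thesis by (intro that[OF Ww] order_trans[OF _ I_le])
qed

end

section \<open>Existence of a weak solution\<close>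

theorem theorem2p2:
  fixes \<Omega> :: "(real^'n::finite) set"
    and \<phi> \<Phi> :: "real \<Rightarrow> real"
    and l m a A :: real
    and f F :: "real^'n \<Rightarrow> real \<Rightarrow> real"
    and A_inf :: "real^'n \<Rightarrow> ereal"
    and b B h :: "real^'n \<Rightarrow> real"
  assumes domain: "bounded_smooth_domain \<Omega>"
    and phi_pos: "\<And>s. s > 0 \<Longrightarrow> \<phi> s > 0"
    and phi_cont: "continuous_on {0<..} \<phi>"
    and phi_lim_0: "((\<lambda>s. s * \<phi> s) \<longlongrightarrow> 0) (at_right 0)"
    and phi_lim_top: "filterlim (\<lambda>s. s * \<phi> s) at_top at_top"
    and phi_mono: "mono_on {0<..} (\<lambda>s. s * \<phi> s)"
    and Phi: "\<And>t. \<Phi> t = (LBINT s=0..\<bar>t\<bar>. s * \<phi> s)"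
    and exponents: "1 < l" "l < real CARD('n)" "1 < m" "m < real CARD('n)"
    and growth: "\<And>t. t > 0 \<Longrightarrow> l \<le> t\<^sup>2 * \<phi> t / \<Phi> t \<and> t\<^sup>2 * \<phi> t / \<Phi> t \<le> m"
    and f: "caratheodory \<Omega> f"
    and F: "\<And>x t. F x t = (LBINT s=0..t. f x s)"
    and A_inf: "\<And>x. A_inf x = Limsup at_infinity (\<lambda>s. ereal (F x s / \<bar>s\<bar> powr l))"
    and hyp_i:
      "a \<ge> 0" "b \<in> orlicz_dual \<Omega> (critical_fun CARD('n) \<Phi>)" "AE x in lebesgue_on \<Omega>. b x \<ge> 0"
      "AE x in lebesgue_on \<Omega>. \<forall>s. \<bar>f x s * s\<bar> \<le> a * critical_fun CARD('n) \<Phi> s + b x * \<bar>s\<bar>"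
    and hyp_ii:
      "A \<ge> 0" "integrable (lebesgue_on \<Omega>) B" "AE x in lebesgue_on \<Omega>. B x \<ge> 0"
      "AE x in lebesgue_on \<Omega>. \<forall>s. F x s \<le> A * \<bar>s\<bar> powr l + B x"
    and hyp_iii:
      "(INF v\<in>{v \<in> sobolev_orlicz0 \<Omega> \<Phi>. luxemburg_norm \<Omega> \<Phi> v = 1}.
          enn2ereal (\<integral>\<^sup>+x. ennreal (\<Phi> (norm (weak_grad \<Omega> v x))) \<partial>lebesgue_on \<Omega>)
          - ereal_integral (lebesgue_on {x \<in> \<Omega>. v x \<noteq> 0}) (\<lambda>x. A_inf x * ereal (\<bar>v x\<bar> powr l))) > 0"
    and h: "h \<in> orlicz_dual \<Omega> \<Phi>"
  shows "\<exists>u. weak_solution \<Omega> \<phi> \<Phi> f h u"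
proof -
  interpret nonlinear_problem \<phi> \<Phi> l m \<Omega> f F a A b B h
  proof unfold_locales
    show "open \<Omega>" "bounded \<Omega>" using domain by (auto simp: bounded_smooth_domain_def)
  qed (use assms in auto)
  have nonresonant
    unfolding nonresonant_def using hyp_iii unfolding A_inf .
  then obtain u g where "W0 u g" "\<And>v k. W0 v k \<Longrightarrow> energy u g \<le> energy v k"
    by (rule minimiser_exists) (rule that)
  then have "weak_solution \<Omega> \<phi> \<Phi> f h u" by (rule minimiser_is_weak_solution)
  then show ?thesis by blast
qed

end
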